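(* Let $f:\mathbb R\to\mathbb R$ be a smooth function which is both $2$-good and $3$-good, with $\lim_{x\to\pm\infty}f(x)=+\infty$. Let $F:B^1\to B^0$, $F(u)(t)=u'(t)+f(u(t))$, and let $\hat\gamma_2:\mathbb R\to\mathbb R^2$, $\hat\gamma_2(x)=(f'(x),f''(x))$. If $0$ is in the interior of the convex hull of the image of $\hat\gamma_2$, then $F$ has cusps (i.e., at least one critical point of $F$ is a cusp). Otherwise, $F$ is a (differentiable) global fold.
   Context: $\mathbb S^1=\mathbb R/\mathbb Z$. The pair $(B^1,B^0)$ is either $(H^1(\mathbb S^1;\mathbb R),L^2(\mathbb S^1;\mathbb R))$ or $(C^1(\mathbb S^1;\mathbb R),C^0(\mathbb S^1;\mathbb R))$; the result is asserted in both cases. $\tilde B^0$ is the space of average-zero functions in $B^0$. A smooth $f:\mathbb R\to\mathbb R$ is *$k$-good* if $\hat\gamma_k(x)=(f'(x),\dots,f^{(k)}(x))\in\mathbb R^k$ never vanishes and the image under $\hat\gamma_k$ of any nonempty open interval is not contained in a hyperplane through the origin of $\mathbb R^k$. The map $\Psi:B^1\to B^0$, $\Psi(u)=F(u)-\int F(u)+\int u$, is a diffeomorphism and $F\circ\Psi^{-1}(\tilde v,\overline u)=(\tilde v,\phi(\tilde v,\overline u))$ on $B^0=\tilde B^0\oplus\mathbb R$, with $\phi:\tilde B^0\times\mathbb R\to\mathbb R$ smooth. A *cusp* (Morin singularity of order 2) of $F$ is a point $u$ such that at $\Psi(u)$: $D_2\phi=D_2^2\phi=0$, $D_2^3\phi\neq0$,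 and the (total) derivative $D(D_2\phi)$ is surjective onto $\mathbb R$; here $D_2$ is the derivative in the real variable $\overline u$. $G:B^1\to B^0$ is a *global fold* if there are diffeomorphisms $\Xi_1:B^1\to\mathbb R\times\tilde B^0$ and $\Xi_0:B^0\to\mathbb R\times\tilde B^0$ with $(\Xi_0\circ G\circ\Xi_1^{-1})(x,\tilde v)=(x^2,\tilde v)$ for all $(x,\tilde v)$. *)

theory Defs
  imports "HOL-Analysis.Analysis"
begin

section \<open>Smooth maps between normed spaces\<close>

definition bounded_multilinear ::
    "nat \<Rightarrow> ('a::real_normed_vector list \<Rightarrow> 'b::real_normed_vector) \<Rightarrow> bool" where
  "bounded_multilinear k T \<longleftrightarrow>
     (\<forall>vs ws. length vs + length ws + 1 = k \<longrightarrow> linear (\<lambda>v. T (vs @ v # ws))) \<and>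
     (\<exists>C. \<forall>vs. length vs = k \<longrightarrow> norm (T vs) \<le> C * prod_list (map norm vs))"

text \<open>
  \<open>D x vs\<close> with \<open>length vs = k\<close> is the \<open>k\<close>-th derivative at \<open>x\<close>, a bounded \<open>k\<close>-linear map,
  applied to \<open>vs\<close>. The last condition says that the \<open>k\<close>-th derivative, as a map into the normed space
  of bounded \<open>k\<close>-linear maps (operator norm), is Frechet differentiable at \<open>x\<close>
  with derivative the \<open>(k+1)\<close>-st one. The lists are needed since the type of the \<open>k\<close>-th derivative
  depends on \<open>k\<close>.
\<close>
definition smooth :: "('a::real_normed_vector \<Rightarrow> 'b::real_normed_vector) \<Rightarrow> bool" where
  "smooth f \<longleftrightarrow> (\<exists>D :: 'a \<Rightarrow> 'a list \<Rightarrow> 'b.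
     (\<forall>x. D x [] = f x) \<and>
     (\<forall>k x. bounded_multilinear k (D x)) \<and>
     (\<forall>k x. \<forall>e>0. \<forall>\<^sub>F h in nhds 0. \<forall>vs. length vs = k \<longrightarrow>
        norm (D (x + h) vs - D x vs - D x (h # vs)) \<le> e * norm h * prod_list (map norm vs)))"

definition diffeomorphism :: "('a::real_normed_vector \<Rightarrow> 'b::real_normed_vector) \<Rightarrow> bool" where
  "diffeomorphism f \<longleftrightarrow> bij f \<and> smooth f \<and> smooth (inv f)"


section \<open>Good functions\<close>

definition hat_gamma :: "(real \<Rightarrow> real) \<Rightarrow> real \<Rightarrow> real ^ 'k::{finite, zero, one, plus}" where
  "hat_gamma f x = vector (map (\<lambda>j. (deriv ^^ j) f x) [1..<Suc CARD('k)])"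

text \<open>The dimension is passed as a type, for example \<open>k_good TYPE(3) f\<close>.\<close>
definition k_good :: "'k::{finite, zero, one, plus} itself \<Rightarrow> (real \<Rightarrow> real) \<Rightarrow> bool" where
  "k_good _ f \<longleftrightarrow>
     (\<forall>x. (hat_gamma f x :: real ^ 'k::{finite, zero, one, plus}) \<noteq> 0) \<and>
     (\<forall>I. open I \<and> is_interval I \<and> I \<noteq> {} \<longrightarrow>
        \<not> (\<exists>a :: real ^ 'k::{finite, zero, one, plus}. a \<noteq> 0 \<and> hat_gamma f ` I \<subseteq> {y. a \<bullet> y = 0}))"

lemma hat_gamma_2: "(hat_gamma f x :: real^2) = vector [deriv f x, (deriv ^^ 2) f x]"
  by (simp add: hat_gamma_def upt_rec eval_nat_numeral)

lemma hat_gamma_3: "(hat_gamma f x :: real^3) = vector [deriv f x, (deriv ^^ 2) f x, (deriv ^^ 3) f x]"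
  by (simp add: hat_gamma_def upt_rec eval_nat_numeral)


section \<open>Spaces of functions on the circle\<close>

class circle_space = real_normed_vector +
  fixes mean :: "'a \<Rightarrow> real"
    and const_fn :: "real \<Rightarrow> 'a"
  assumes mean_add: "mean (u + v) = mean u + mean v"
    and mean_scaleR: "mean (c *\<^sub>R u) = c * mean u"
    and mean_const_fn: "mean (const_fn c) = c"

lemma mean_zero [simp]: "mean (0::'a::circle_space) = 0"
  using mean_scaleR[of 0 "0::'a"] by simp

lemma mean_minus [simp]: "mean (- u) = - mean (u::'a::circle_space)"
  using mean_scaleR[of "-1" u] by simp

lemma mean_diff: "mean (u - v) = mean u - mean (v::'a::circle_space)"
  using mean_add[of u "- v"] by simp

typedef (overloaded) 'a zero_mean = "{v :: 'a::circle_space. mean v = 0}"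
  by (rule exI[of _ 0]) simp

setup_lifting type_definition_zero_mean

instantiation zero_mean :: (circle_space) real_normed_vector
begin

lift_definition zero_zero_mean :: "'a zero_mean" is 0 by simp
lift_definition plus_zero_mean :: "'a zero_mean \<Rightarrow> 'a zero_mean \<Rightarrow> 'a zero_mean" is "(+)"
  by (simp add: mean_add)
lift_definition uminus_zero_mean :: "'a zero_mean \<Rightarrow> 'a zero_mean" is uminus by simp
lift_definition minus_zero_mean :: "'a zero_mean \<Rightarrow> 'a zero_mean \<Rightarrow> 'a zero_mean" is "(-)"
  by (simp add: mean_diff)
lift_definition scaleR_zero_mean :: "real \<Rightarrow> 'a zero_mean \<Rightarrow> 'a zero_mean" is "(*\<^sub>R)"
  by (simp add: mean_scaleR)
lift_definition norm_zero_mean :: "'a zero_mean \<Rightarrow> real" is norm .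
definition dist_zero_mean :: "'a zero_mean \<Rightarrow> 'a zero_mean \<Rightarrow> real"
  where "dist_zero_mean u v = norm (u - v)"
definition sgn_zero_mean :: "'a zero_mean \<Rightarrow> 'a zero_mean"
  where "sgn_zero_mean u = inverse (norm u) *\<^sub>R u"
definition uniformity_zero_mean :: "('a zero_mean \<times> 'a zero_mean) filter"
  where "uniformity_zero_mean = (INF e\<in>{0 <..}. principal {(x, y). dist x y < e})"
definition open_zero_mean :: "'a zero_mean set \<Rightarrow> bool"
  where "open_zero_mean S = (\<forall>x\<in>S. \<forall>\<^sub>F (x', y) in uniformity. x' = x \<longrightarrow> y \<in> S)"

instance
  by standard
    (rule dist_zero_mean_def sgn_zero_mean_def uniformity_zero_mean_def open_zero_mean_def |
     transfer; simp add: algebra_simps norm_triangle_ineq)+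

end


subsection \<open>Continuous and continuously differentiable functions\<close>

text \<open>Functions on the circle \<open>\<real>/\<int>\<close> are represented by 1-periodic functions on the line.\<close>

definition circle :: "real measure" where
  "circle = restrict_space lborel {0..1}"

definition periodic :: "(real \<Rightarrow> real) \<Rightarrow> bool" where
  "periodic u \<longleftrightarrow> (\<forall>t. u (t + 1) = u t)"

lemma periodic_frac:
  assumes "periodic u" shows "u (frac t) = u t"
proof -
  have nat: "u (t + real n) = u t" for t and n :: nat
    using assms by (induction n) (auto simp: periodic_def algebra_simps, metis add.commute add.left_commute)
  show ?thesis
  proof (cases "\<lfloor>t\<rfloor> \<ge> 0")
    case True
    then show ?thesis using nat[of "frac t" "nat \<lfloor>t\<rfloor>"] by (simp add: frac_def)
  next
    case False
    then show ?thesis using nat[of t "nat (- \<lfloor>t\<rfloor>)"] by (simp add: frac_def)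
  qed
qed

lemma periodic_bounded:
  assumes "periodic u" "continuous_on UNIV u" shows "bdd_above (range (\<lambda>t. \<bar>u t\<bar>))"
proof -
  have "compact ((\<lambda>t. \<bar>u t\<bar>) ` {0..1})"
    by (intro compact_continuous_image continuous_intros continuous_on_subset[OF assms(2)]) auto
  then have "bdd_above ((\<lambda>t. \<bar>u t\<bar>) ` {0..1})"
    by (simp add: bounded_imp_bdd_above compact_imp_bounded)
  moreover have "range (\<lambda>t. \<bar>u t\<bar>) \<subseteq> (\<lambda>t. \<bar>u t\<bar>) ` {0..1}"
  proof safe
    fix t :: real
    have "\<bar>u t\<bar> = \<bar>u (frac t)\<bar>" using periodic_frac[OF assms(1)] by simp
    moreover have "frac t \<in> {0..1}" using frac_ge_0[of t] frac_lt_1[of t] by simp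
    ultimately show "\<bar>u t\<bar> \<in> (\<lambda>t. \<bar>u t\<bar>) ` {0..1}" by blast
  qed
  ultimately show ?thesis by (rule bdd_above_mono)
qed

lemma space_circle [simp]: "space circle = {0..1}"
  by (simp add: circle_def space_restrict_space)

lemma continuous_integrable_circle:
  fixes u :: "real \<Rightarrow> real"
  assumes "continuous_on {0..1} u" shows "integrable circle u"
proof -
  have "set_integrable lborel {0..1} u"
    using borel_integrable_compact[of "{0..1::real}" u] assms
    by (simp add: set_integrable_def)
  then show ?thesis
    by (simp add: circle_def integrable_restrict_space set_integrable_def)
qed

lemma measure_circle: "emeasure circle {0..1} = 1" "measure circle {0..1} = 1"
  by (simp_all add: circle_def emeasure_restrict_space measure_restrict_space)

lemma finite_measure_circle: "finite_measure circle"
  by standard (simp add: measure_circle)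

typedef c0 = "{u :: real \<Rightarrow> real. continuous_on UNIV u \<and> periodic u}"
  by (rule exI[of _ "\<lambda>_. 0"]) (simp add: periodic_def)

setup_lifting type_definition_c0

instantiation c0 :: circle_space
begin

lift_definition zero_c0 :: c0 is "\<lambda>_. 0" by (simp add: periodic_def)
lift_definition plus_c0 :: "c0 \<Rightarrow> c0 \<Rightarrow> c0" is "\<lambda>u v t. u t + v t"
  by (auto simp: periodic_def intro: continuous_intros)
lift_definition uminus_c0 :: "c0 \<Rightarrow> c0" is "\<lambda>u t. - u t"
  by (auto simp: periodic_def intro: continuous_intros)
lift_definition minus_c0 :: "c0 \<Rightarrow> c0 \<Rightarrow> c0" is "\<lambda>u v t. u t - v t"
  by (auto simp: periodic_def intro: continuous_intros)
lift_definition scaleR_c0 :: "real \<Rightarrow> c0 \<Rightarrow> c0" is "\<lambda>c u t. c * u t"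
  by (auto simp: periodic_def intro: continuous_intros)
lift_definition norm_c0 :: "c0 \<Rightarrow> real" is "\<lambda>u. SUP t. \<bar>u t\<bar>" .
definition dist_c0 :: "c0 \<Rightarrow> c0 \<Rightarrow> real" where "dist_c0 u v = norm (u - v)"
definition sgn_c0 :: "c0 \<Rightarrow> c0" where "sgn_c0 u = inverse (norm u) *\<^sub>R u"
definition uniformity_c0 :: "(c0 \<times> c0) filter"
  where "uniformity_c0 = (INF e\<in>{0 <..}. principal {(x, y). dist x y < e})"
definition open_c0 :: "c0 set \<Rightarrow> bool"
  where "open_c0 S = (\<forall>x\<in>S. \<forall>\<^sub>F (x', y) in uniformity. x' = x \<longrightarrow> y \<in> S)"
lift_definition mean_c0 :: "c0 \<Rightarrow> real" is "\<lambda>u. LINT t|circle. u t" .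
lift_definition const_fn_c0 :: "real \<Rightarrow> c0" is "\<lambda>c _. c" by (simp add: periodic_def)

instance
proof
  fix u v w :: c0 and a b :: real
  have up: "\<bar>f t\<bar> \<le> (SUP t. \<bar>f t\<bar>)" if "continuous_on UNIV f \<and> periodic f" for f and t :: real
    using that by (intro cSUP_upper periodic_bounded) auto
  show "u + v + w = u + (v + w)" "u + v = v + u" "0 + u = u" "- u + u = 0" "u - v = u + - v"
    "a *\<^sub>R (u + v) = a *\<^sub>R u + a *\<^sub>R v" "(a + b) *\<^sub>R u = a *\<^sub>R u + b *\<^sub>R u"
    "a *\<^sub>R b *\<^sub>R u = (a * b) *\<^sub>R u" "1 *\<^sub>R u = u"
    by (transfer; simp add: algebra_simps)+
  show "dist u v = norm (u - v)" "sgn u = inverse (norm u) *\<^sub>R u"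
    by (simp_all add: dist_c0_def sgn_c0_def)
  show "uniformity = (INF e\<in>{0 <..}. principal {(x::c0, y). dist x y < e})"
    by (rule uniformity_c0_def)
  show "open S = (\<forall>x\<in>S. \<forall>\<^sub>F (x', y) in uniformity. x' = x \<longrightarrow> y \<in> S)" for S :: "c0 set"
    by (rule open_c0_def)
  show "(norm u = 0) = (u = 0)"
  proof (transfer, safe)
    fix u :: "real \<Rightarrow> real" assume u: "continuous_on UNIV u" "periodic u" "(SUP t. \<bar>u t\<bar>) = 0"
    show "u = (\<lambda>_. 0)"
    proof
      fix t show "u t = 0" using up[of u t] u by simp
    qed
  qed auto
  show "norm (u + v) \<le> norm u + norm v"
  proof transfer
    fix u v :: "real \<Rightarrow> real"
    assume uv: "continuous_on UNIV u \<and> periodic u" "continuous_on UNIV v \<and> periodic v"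
    show "(SUP t. \<bar>u t + v t\<bar>) \<le> (SUP t. \<bar>u t\<bar>) + (SUP t. \<bar>v t\<bar>)"
    proof (rule cSUP_least)
      fix t show "\<bar>u t + v t\<bar> \<le> (SUP t. \<bar>u t\<bar>) + (SUP t. \<bar>v t\<bar>)"
        using up[OF uv(1), of t] up[OF uv(2), of t] by linarith
    qed auto
  qed
  show "norm (a *\<^sub>R u) = \<bar>a\<bar> * norm u"
  proof transfer
    fix a :: real and u :: "real \<Rightarrow> real"
    assume u: "continuous_on UNIV u \<and> periodic u"
    have "(SUP t. \<bar>a\<bar> * \<bar>u t\<bar>) = \<bar>a\<bar> * (SUP t. \<bar>u t\<bar>)"
    proof (rule antisym)
      show "(SUP t. \<bar>a\<bar> * \<bar>u t\<bar>) \<le> \<bar>a\<bar> * (SUP t. \<bar>u t\<bar>)"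
        by (rule cSUP_least) (auto intro: mult_left_mono up[OF u])
      have au: "continuous_on UNIV (\<lambda>t. a * u t) \<and> periodic (\<lambda>t. a * u t)"
        using u by (auto simp: periodic_def intro: continuous_intros)
      show "\<bar>a\<bar> * (SUP t. \<bar>u t\<bar>) \<le> (SUP t. \<bar>a\<bar> * \<bar>u t\<bar>)"
      proof (cases "a = 0")
        case False
        have "(SUP t. \<bar>u t\<bar>) \<le> (SUP t. \<bar>a\<bar> * \<bar>u t\<bar>) / \<bar>a\<bar>"
        proof (rule cSUP_least)
          fix t show "\<bar>u t\<bar> \<le> (SUP t. \<bar>a\<bar> * \<bar>u t\<bar>) / \<bar>a\<bar>"
            using up[OF au, of t] False by (simp add: abs_mult field_simps)
        qed auto
        then show ?thesis using False by (simp add: field_simps)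
      qed simp
    qed
    then show "(SUP t. \<bar>a * u t\<bar>) = \<bar>a\<bar> * (SUP t. \<bar>u t\<bar>)" by (simp add: abs_mult)
  qed
  show "mean (u + v) = mean u + mean v"
    by transfer (auto intro!: Bochner_Integration.integral_add continuous_integrable_circle
      intro: continuous_on_subset)
  show "mean (a *\<^sub>R u) = a * mean u" by transfer simp
  show "mean (const_fn a :: c0) = a" by transfer (simp add: measure_circle)
qed

end

typedef c1 = "{u :: real \<Rightarrow> real. (\<forall>t. u differentiable (at t)) \<and> continuous_on UNIV (deriv u) \<and> periodic u}"
  by (rule exI[of _ "\<lambda>_. 0"]) (simp add: periodic_def)

setup_lifting type_definition_c1

lemma differentiable_real_deriv:
  "u differentiable (at t) \<Longrightarrow> (u has_real_derivative deriv u t) (at t)" for u :: "real \<Rightarrow> real"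
  by (metis DERIV_imp_deriv real_differentiableE)

lemma periodic_deriv:
  assumes "periodic u" "\<forall>t. u differentiable (at t)" shows "periodic (deriv u)"
proof -
  have "deriv u (t + 1) = deriv u t" for t
  proof -
    have "(u has_real_derivative deriv u (t + 1)) (at (t + 1))"
      using assms by (simp add: differentiable_real_deriv)
    then have "((\<lambda>s. u (s + 1)) has_real_derivative deriv u (t + 1)) (at t)"
      by (simp add: DERIV_shift)
    then show ?thesis using assms by (simp add: periodic_def DERIV_imp_deriv)
  qed
  then show ?thesis by (simp add: periodic_def)
qed

lift_definition c0_of_c1 :: "c1 \<Rightarrow> c0" is "\<lambda>u. u"
  by (auto intro!: differentiable_imp_continuous_on simp: differentiable_on_def)

lift_definition deriv_c1 :: "c1 \<Rightarrow> c0" is "deriv"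
  by (simp add: periodic_deriv)

instantiation c1 :: circle_space
begin

lift_definition zero_c1 :: c1 is "\<lambda>_. 0" by (simp add: periodic_def)
lift_definition plus_c1 :: "c1 \<Rightarrow> c1 \<Rightarrow> c1" is "\<lambda>u v t. u t + v t"
proof -
  fix u v :: "real \<Rightarrow> real"
  assume u: "(\<forall>t. u differentiable (at t)) \<and> continuous_on UNIV (deriv u) \<and> periodic u"
    and v: "(\<forall>t. v differentiable (at t)) \<and> continuous_on UNIV (deriv v) \<and> periodic v"
  have "deriv (\<lambda>t. u t + v t) = (\<lambda>t. deriv u t + deriv v t)"
    using u v by (intro ext DERIV_imp_deriv DERIV_add) (auto simp: differentiable_real_deriv)
  then show "(\<forall>t. (\<lambda>t. u t + v t) differentiable (at t)) \<and>
    continuous_on UNIV (deriv (\<lambda>t. u t + v t)) \<and> periodic (\<lambda>t. u t + v t)"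
    using u v by (auto simp: periodic_def intro!: continuous_intros)
qed
lift_definition scaleR_c1 :: "real \<Rightarrow> c1 \<Rightarrow> c1" is "\<lambda>c u t. c * u t"
proof -
  fix c :: real and u :: "real \<Rightarrow> real"
  assume u: "(\<forall>t. u differentiable (at t)) \<and> continuous_on UNIV (deriv u) \<and> periodic u"
  have "deriv (\<lambda>t. c * u t) = (\<lambda>t. c * deriv u t)"
    using u by (intro ext DERIV_imp_deriv DERIV_cmult) (auto simp: differentiable_real_deriv)
  then show "(\<forall>t. (\<lambda>t. c * u t) differentiable (at t)) \<and>
    continuous_on UNIV (deriv (\<lambda>t. c * u t)) \<and> periodic (\<lambda>t. c * u t)"
    using u by (auto simp: periodic_def intro!: continuous_intros)
qed
definition uminus_c1 :: "c1 \<Rightarrow> c1" where "uminus_c1 u = (-1) *\<^sub>R u"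
definition minus_c1 :: "c1 \<Rightarrow> c1 \<Rightarrow> c1" where "minus_c1 u v = u + (-1) *\<^sub>R v"
definition norm_c1 :: "c1 \<Rightarrow> real" where "norm_c1 u = norm (c0_of_c1 u) + norm (deriv_c1 u)"
definition dist_c1 :: "c1 \<Rightarrow> c1 \<Rightarrow> real" where "dist_c1 u v = norm (u - v)"
definition sgn_c1 :: "c1 \<Rightarrow> c1" where "sgn_c1 u = inverse (norm u) *\<^sub>R u"
definition uniformity_c1 :: "(c1 \<times> c1) filter"
  where "uniformity_c1 = (INF e\<in>{0 <..}. principal {(x, y). dist x y < e})"
definition open_c1 :: "c1 set \<Rightarrow> bool"
  where "open_c1 S = (\<forall>x\<in>S. \<forall>\<^sub>F (x', y) in uniformity. x' = x \<longrightarrow> y \<in> S)"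
definition mean_c1 :: "c1 \<Rightarrow> real" where "mean_c1 u = mean (c0_of_c1 u)"
lift_definition const_fn_c1 :: "real \<Rightarrow> c1" is "\<lambda>c _. c" by (simp add: periodic_def)

instance
proof
  fix u v w :: c1 and a b :: real
  have c0_lin: "c0_of_c1 (u + v) = c0_of_c1 u + c0_of_c1 v" "c0_of_c1 (a *\<^sub>R u) = a *\<^sub>R c0_of_c1 u"
    for u v a by (transfer; simp)+
  have deriv_lin: "deriv_c1 (u + v) = deriv_c1 u + deriv_c1 v" "deriv_c1 (a *\<^sub>R u) = a *\<^sub>R deriv_c1 u"
    for u v a
    by (transfer; intro ext DERIV_imp_deriv DERIV_add DERIV_cmult; simp add: differentiable_real_deriv)+
  show "u + v + w = u + (v + w)" "u + v = v + u" "0 + u = u"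
    "a *\<^sub>R (u + v) = a *\<^sub>R u + a *\<^sub>R v" "(a + b) *\<^sub>R u = a *\<^sub>R u + b *\<^sub>R u"
    "a *\<^sub>R b *\<^sub>R u = (a * b) *\<^sub>R u" "1 *\<^sub>R u = u"
    by (transfer; simp add: algebra_simps)+
  show "- u + u = 0" "u - v = u + - v"
    unfolding uminus_c1_def minus_c1_def by (transfer; simp)+
  show "dist u v = norm (u - v)" "sgn u = inverse (norm u) *\<^sub>R u"
    by (simp_all add: dist_c1_def sgn_c1_def)
  show "uniformity = (INF e\<in>{0 <..}. principal {(x::c1, y). dist x y < e})"
    by (rule uniformity_c1_def)
  show "open S = (\<forall>x\<in>S. \<forall>\<^sub>F (x', y) in uniformity. x' = x \<longrightarrow> y \<in> S)" for S :: "c1 set"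
    by (rule open_c1_def)
  have "c0_of_c1 u = 0 \<longleftrightarrow> u = 0" by transfer simp
  moreover have "deriv_c1 0 = 0" by transfer (intro ext DERIV_imp_deriv DERIV_const)
  ultimately show "(norm u = 0) = (u = 0)"
    by (auto simp: norm_c1_def add_nonneg_eq_0_iff)
  show "norm (u + v) \<le> norm u + norm v"
    using norm_triangle_ineq[of "c0_of_c1 u" "c0_of_c1 v"] norm_triangle_ineq[of "deriv_c1 u" "deriv_c1 v"]
    by (simp add: norm_c1_def c0_lin deriv_lin)
  show "norm (a *\<^sub>R u) = \<bar>a\<bar> * norm u"
    by (simp add: norm_c1_def c0_lin deriv_lin algebra_simps)
  show "mean (u + v) = mean u + mean v" "mean (a *\<^sub>R u) = a * mean u"
    by (simp_all add: mean_c1_def c0_lin mean_add mean_scaleR)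
  have "c0_of_c1 (const_fn a) = const_fn a" by transfer simp
  then show "mean (const_fn a :: c1) = a" by (simp add: mean_c1_def mean_const_fn)
qed

end


subsection \<open>Square integrable functions\<close>

definition square_int :: "(real \<Rightarrow> real) \<Rightarrow> bool" where
  "square_int f \<longleftrightarrow> f \<in> borel_measurable circle \<and> integrable circle (\<lambda>t. (f t)\<^sup>2)"

lemma square_int_continuous: "continuous_on {0..1} f \<Longrightarrow> square_int f"
  using continuous_integrable_circle[of f] continuous_integrable_circle[of "\<lambda>t. (f t)\<^sup>2"]
  by (auto simp: square_int_def intro: continuous_intros borel_measurable_integrable)

lemma square_int_mult:
  assumes "square_int f" "square_int g" shows "integrable circle (\<lambda>t. f t * g t)"
proof (rule Bochner_Integration.integrable_bound)
  show "integrable circle (\<lambda>t. (f t)\<^sup>2 + (g t)\<^sup>2)"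
    using assms by (simp add: square_int_def)
  show "(\<lambda>t. f t * g t) \<in> borel_measurable circle"
    using assms by (auto simp: square_int_def)
  have "\<bar>x * y\<bar> \<le> x\<^sup>2 + y\<^sup>2" for x y :: real
  proof -
    have "0 \<le> (\<bar>x\<bar> - \<bar>y\<bar>)\<^sup>2" by simp
    then have "2 * \<bar>x * y\<bar> \<le> x\<^sup>2 + y\<^sup>2" by (simp add: power2_diff abs_mult)
    then show ?thesis using abs_ge_zero[of "x * y"] by linarith
  qed
  then show "AE t in circle. norm (f t * g t) \<le> norm ((f t)\<^sup>2 + (g t)\<^sup>2)"
    by (auto intro!: AE_I2)
qed

lemma square_int_const: "square_int (\<lambda>_. c)"
  by (rule square_int_continuous) simp

lemma square_int_add:
  assumes "square_int f" "square_int g" shows "square_int (\<lambda>t. f t + g t)"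
proof -
  have "integrable circle (\<lambda>t. (f t)\<^sup>2 + (g t)\<^sup>2 + 2 * (f t * g t))"
    using assms square_int_mult[OF assms] by (simp add: square_int_def)
  then show ?thesis
    using assms by (auto simp: square_int_def power2_sum mult.assoc)
qed

lemma square_int_cmult: "square_int f \<Longrightarrow> square_int (\<lambda>t. c * f t)"
  by (auto simp: square_int_def power_mult_distrib)

lemma square_int_minus: "square_int f \<Longrightarrow> square_int (\<lambda>t. - f t)"
  using square_int_cmult[of f "-1"] by simp

lemma square_int_diff: "square_int f \<Longrightarrow> square_int g \<Longrightarrow> square_int (\<lambda>t. f t - g t)"
  using square_int_add[of f "\<lambda>t. - g t"] square_int_minus by simp

lemma square_int_integrable: "square_int f \<Longrightarrow> integrable circle f"
  using square_int_mult[OF _ square_int_const[of 1]] by simp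

definition l2_rel :: "(real \<Rightarrow> real) \<Rightarrow> (real \<Rightarrow> real) \<Rightarrow> bool" where
  "l2_rel f g \<longleftrightarrow> square_int f \<and> square_int g \<and> (AE t in circle. f t = g t)"

text \<open>
  The fundamental domain \<open>[0,1]\<close> of the circle carries the measure; its two endpoints, which represent
  the same point, are a null set. Values of representatives outside \<open>[0,1]\<close> are ignored.
\<close>
quotient_type l2 = "real \<Rightarrow> real" / partial: l2_rel
proof (rule part_equivpI)
  show "\<exists>f. l2_rel f f" using square_int_const by (auto simp: l2_rel_def)
  show "symp l2_rel" by (auto simp: symp_def l2_rel_def)
  show "transp l2_rel" unfolding transp_def l2_rel_def
  proof (intro allI impI, elim conjE, intro conjI)
    fix f g h :: "real \<Rightarrow> real"
    assume "AE t in circle. f t = g t" "AE t in circle. g t = h t"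
    then show "AE t in circle. f t = h t" by eventually_elim simp
  qed
qed

instantiation l2 :: real_inner
begin

lift_definition zero_l2 :: l2 is "\<lambda>_. 0" by (simp add: l2_rel_def square_int_const)
lift_definition plus_l2 :: "l2 \<Rightarrow> l2 \<Rightarrow> l2" is "\<lambda>u v t. u t + v t"
  by (auto simp: l2_rel_def square_int_add)
lift_definition uminus_l2 :: "l2 \<Rightarrow> l2" is "\<lambda>u t. - u t"
  by (auto simp: l2_rel_def square_int_minus)
lift_definition minus_l2 :: "l2 \<Rightarrow> l2 \<Rightarrow> l2" is "\<lambda>u v t. u t - v t"
  by (auto simp: l2_rel_def square_int_diff)
lift_definition scaleR_l2 :: "real \<Rightarrow> l2 \<Rightarrow> l2" is "\<lambda>c u t. c * u t"
  by (auto simp: l2_rel_def square_int_cmult)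
lift_definition inner_l2 :: "l2 \<Rightarrow> l2 \<Rightarrow> real" is "\<lambda>u v. LINT t|circle. u t * v t"
  by (rule integral_cong_AE) (auto simp: l2_rel_def square_int_def)
definition norm_l2 :: "l2 \<Rightarrow> real" where "norm_l2 u = sqrt (inner u u)"
definition dist_l2 :: "l2 \<Rightarrow> l2 \<Rightarrow> real" where "dist_l2 u v = norm (u - v)"
definition sgn_l2 :: "l2 \<Rightarrow> l2" where "sgn_l2 u = inverse (norm u) *\<^sub>R u"
definition uniformity_l2 :: "(l2 \<times> l2) filter"
  where "uniformity_l2 = (INF e\<in>{0 <..}. principal {(x, y). dist x y < e})"
definition open_l2 :: "l2 set \<Rightarrow> bool"
  where "open_l2 S = (\<forall>x\<in>S. \<forall>\<^sub>F (x', y) in uniformity. x' = x \<longrightarrow> y \<in> S)"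

instance
proof
  fix u v w :: l2 and a b :: real
  note [simp] = square_int_const square_int_add square_int_cmult square_int_minus square_int_diff
  show "u + v + w = u + (v + w)" "u + v = v + u" "0 + u = u" "- u + u = 0" "u - v = u + - v"
    "a *\<^sub>R (u + v) = a *\<^sub>R u + a *\<^sub>R v" "(a + b) *\<^sub>R u = a *\<^sub>R u + b *\<^sub>R u"
    "a *\<^sub>R b *\<^sub>R u = (a * b) *\<^sub>R u" "1 *\<^sub>R u = u"
    by (transfer; auto simp: l2_rel_def algebra_simps)+
  show "dist u v = norm (u - v)" "sgn u = inverse (norm u) *\<^sub>R u" "norm u = sqrt (inner u u)"
    by (simp_all add: dist_l2_def sgn_l2_def norm_l2_def)
  show "uniformity = (INF e\<in>{0 <..}. principal {(x::l2, y). dist x y < e})"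
    by (rule uniformity_l2_def)
  show "open S = (\<forall>x\<in>S. \<forall>\<^sub>F (x', y) in uniformity. x' = x \<longrightarrow> y \<in> S)" for S :: "l2 set"
    by (rule open_l2_def)
  show "inner u v = inner v u" by transfer (simp add: mult.commute)
  show "inner (u + v) w = inner u w + inner v w"
    by transfer (simp add: l2_rel_def distrib_right square_int_mult)
  show "inner (a *\<^sub>R u) v = a * inner u v"
    by transfer (simp add: mult.assoc)
  show "0 \<le> inner u u" by transfer (simp add: integral_nonneg_AE)
  show "(inner u u = 0) = (u = 0)"
  proof transfer
    fix u assume "l2_rel u u"
    then have u: "square_int u" by (simp add: l2_rel_def)
    then have "(LINT t|circle. u t * u t) = 0 \<longleftrightarrow> (AE t in circle. u t * u t = 0)"
      by (intro integral_nonneg_eq_0_iff_AE square_int_mult) auto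
    then show "((LINT t|circle. u t * u t) = 0) = l2_rel u (\<lambda>_. 0)"
      using u by (simp add: l2_rel_def)
  qed
qed

end

instantiation l2 :: circle_space
begin

lift_definition mean_l2 :: "l2 \<Rightarrow> real" is "\<lambda>u. LINT t|circle. u t"
  by (rule integral_cong_AE) (auto simp: l2_rel_def square_int_def)
lift_definition const_fn_l2 :: "real \<Rightarrow> l2" is "\<lambda>c _. c" by (simp add: l2_rel_def square_int_const)

instance
proof
  fix u v :: l2 and a :: real
  show "mean (u + v) = mean u + mean v"
    by transfer (simp add: l2_rel_def square_int_integrable)
  show "mean (a *\<^sub>R u) = a * mean u" by transfer simp
  show "mean (const_fn a :: l2) = a" by transfer (simp add: measure_circle)
qed

end

lemma abs_l2_eqI: "square_int f \<Longrightarrow> square_int g \<Longrightarrow> (AE t in circle. f t = g t) \<Longrightarrow> abs_l2 f = abs_l2 g"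
  by (rule Quotient_rel_abs[OF Quotient_l2]) (simp add: l2_rel_def)

lemma abs_l2_eqD: "square_int f \<Longrightarrow> square_int g \<Longrightarrow> abs_l2 f = abs_l2 g \<Longrightarrow> (AE t in circle. f t = g t)"
  using Quotient_rel[OF Quotient_l2, of f g] by (simp add: l2_rel_def)


subsection \<open>The Sobolev space of order one\<close>

text \<open>
  An element of \<open>H\<^sup>1\<close> is given by its continuous representative, an absolutely continuous periodic
  function whose derivative is square integrable. The values of \<open>g\<close> outside \<open>[0,1]\<close> are irrelevant.
\<close>

definition is_weak_deriv :: "(real \<Rightarrow> real) \<Rightarrow> (real \<Rightarrow> real) \<Rightarrow> bool" where
  "is_weak_deriv u g \<longleftrightarrow> square_int g \<and> (\<forall>t\<in>{0..1}. u t = u 0 + (LBINT s:{0..t}. g s))"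

lemma is_weak_derivD:
  assumes "is_weak_deriv u g"
  shows "square_int g" and "t \<in> {0..1} \<Longrightarrow> u t = u 0 + (LBINT s:{0..t}. g s)"
  using assms unfolding is_weak_deriv_def by blast+

lemma square_int_set_integrable:
  assumes "square_int g" "t \<le> 1" shows "set_integrable lborel {0..t} g"
proof -
  have "set_integrable lborel {0..1} g"
    using square_int_integrable[OF assms(1)]
    by (simp add: circle_def integrable_restrict_space set_integrable_def)
  then show ?thesis by (rule set_integrable_subset) (use assms in auto)
qed

lemma is_weak_deriv_continuous:
  assumes "is_weak_deriv u g" shows "continuous_on {0..1} u"
proof -
  have g: "square_int g" and u: "\<And>t. t \<in> {0..1} \<Longrightarrow> u t = u 0 + (LBINT s:{0..t}. g s)"
    using is_weak_derivD[OF assms] by blast+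
  have "continuous_on {0..1} (\<lambda>t. u 0 + integral {0..t} g)"
    using set_borel_integral_eq_integral(1)[OF square_int_set_integrable[OF g order_refl]]
    by (intro continuous_intros indefinite_integral_continuous_1)
  moreover have "u t = u 0 + integral {0..t} g" if "t \<in> {0..1}" for t
  unfolding u[OF that]
    using set_borel_integral_eq_integral(2)[OF square_int_set_integrable[OF g, of t]] that by simp
  ultimately show ?thesis by (metis (no_types, lifting) continuous_on_eq)
qed

lemma is_weak_deriv_square_int: "is_weak_deriv u g \<Longrightarrow> square_int u"
  by (rule square_int_continuous[OF is_weak_deriv_continuous])

lemma is_weak_deriv_add:
  assumes "is_weak_deriv u g" "is_weak_deriv v h"
  shows "is_weak_deriv (\<lambda>t. u t + v t) (\<lambda>t. g t + h t)"
  unfolding is_weak_deriv_def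
proof (intro conjI ballI)
  show "square_int (\<lambda>t. g t + h t)" using assms by (intro square_int_add is_weak_derivD(1))
  fix t :: real assume t: "t \<in> {0..1}"
  have "u t = u 0 + (LBINT s:{0..t}. g s)" "v t = v 0 + (LBINT s:{0..t}. h s)"
    using is_weak_derivD(2)[OF assms(1) t] is_weak_derivD(2)[OF assms(2) t] .
  moreover have "(LBINT s:{0..t}. g s + h s) = (LBINT s:{0..t}. g s) + (LBINT s:{0..t}. h s)"
    using t by (intro set_integral_add square_int_set_integrable is_weak_derivD(1)[OF assms(1)]
        is_weak_derivD(1)[OF assms(2)]) auto
  ultimately show "u t + v t = u 0 + v 0 + (LBINT s:{0..t}. g s + h s)" by linarith
qed

lemma is_weak_deriv_cmult:
  assumes "is_weak_deriv u g"
  shows "is_weak_deriv (\<lambda>t. c * u t) (\<lambda>t. c * g t)"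
  unfolding is_weak_deriv_def
proof (intro conjI ballI)
  show "square_int (\<lambda>t. c * g t)" using assms by (intro square_int_cmult is_weak_derivD(1))
  fix t :: real assume t: "t \<in> {0..1}"
  show "c * u t = c * u 0 + (LBINT s:{0..t}. c * g s)"
    by (subst is_weak_derivD(2)[OF assms t]) (simp add: distrib_left)
qed

lemma is_weak_deriv_const: "is_weak_deriv (\<lambda>_. c) (\<lambda>_. 0)"
  by (simp add: is_weak_deriv_def square_int_const)

lemma is_weak_deriv_unique:
  assumes "is_weak_deriv u g" "is_weak_deriv u h"
  shows "AE t in circle. g t = h t"
proof -
  define d where "d s = indicator {0..1} s * (g s - h s)" for s :: real
  have *: "is_weak_deriv (\<lambda>t. u t + (-1) * u t) (\<lambda>t. g t + (-1) * h t)"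
    by (intro is_weak_deriv_add is_weak_deriv_cmult assms)
  have sq: "square_int (\<lambda>t. g t - h t)" and int0: "\<And>t. t \<in> {0..1} \<Longrightarrow> (LBINT s:{0..t}. g s - h s) = 0"
    using is_weak_derivD(1)[OF *] is_weak_derivD(2)[OF *] by simp_all
  have d[measurable]: "integrable lborel d"
    using square_int_set_integrable[OF sq order_refl] by (simp add: d_def[abs_def] set_integrable_def)
  have zero: "(LBINT s:{x<..}. d s) = 0" for x
  proof -
    have le: "(LBINT s:{..y}. d s) = 0" for y
    proof -
      have "(LBINT s:{..y}. d s) = (LBINT s:{0..min y 1}. g s - h s)"
        unfolding set_lebesgue_integral_def d_def
        by (intro Bochner_Integration.integral_cong) (auto simp: indicator_def)
      then show ?thesis
        using int0[of "min y 1"] by (cases "y < 0") (auto simp: set_lebesgue_integral_def)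
    qed
    have "(LBINT s. d s) = (LBINT s:{..1}. d s)"
      unfolding set_lebesgue_integral_def d_def
      by (intro Bochner_Integration.integral_cong) (auto simp: indicator_def)
    then have "(LBINT s. d s) = 0" using le by simp
    moreover have "(LBINT s:{..x} \<union> {x<..}. d s) = (LBINT s:{..x}. d s) + (LBINT s:{x<..}. d s)"
      using integrable_mult_indicator[OF _ d]
      by (intro set_integral_Un) (auto simp: set_integrable_def)
    moreover have "{..x} \<union> {x<..} = UNIV" by auto
    ultimately show ?thesis using le by (simp add: set_lebesgue_integral_def)
  qed
  let ?p = "\<lambda>s. ennreal (max 0 (d s))" and ?n = "\<lambda>s. ennreal (max 0 (- d s))"
  have int: "set_integrable lborel {x<..} (\<lambda>s. max 0 (d s))" "set_integrable lborel {x<..} (\<lambda>s. max 0 (- d s))" for x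
    using integrable_mult_indicator[of "{x<..}" lborel "\<lambda>s. max 0 (d s)"]
      integrable_mult_indicator[of "{x<..}" lborel "\<lambda>s. max 0 (- d s)"] d
    by (auto simp: set_integrable_def)
  have em: "emeasure (density lborel ?p) {x<..} = ennreal (LBINT s:{x<..}. max 0 (d s))"
    "emeasure (density lborel ?n) {x<..} = ennreal (LBINT s:{x<..}. max 0 (- d s))" for x
  proof -
    have ind: "ennreal y * indicator A s = ennreal (indicator A s * y)" for y A and s :: real
      by (simp add: indicator_def)
    show "emeasure (density lborel ?p) {x<..} = ennreal (LBINT s:{x<..}. max 0 (d s))"
      using int(1)[of x] unfolding set_integrable_def set_lebesgue_integral_def
      by (subst nn_integral_eq_integral[symmetric]) (auto simp: emeasure_density ind)
    show "emeasure (density lborel ?n) {x<..} = ennreal (LBINT s:{x<..}. max 0 (- d s))"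
      using int(2)[of x] unfolding set_integrable_def set_lebesgue_integral_def
      by (subst nn_integral_eq_integral[symmetric]) (auto simp: emeasure_density ind)
  qed
  have "density lborel ?p = density lborel ?n"
  proof (rule measure_eqI_lessThan)
    fix x
    have "(LBINT s:{x<..}. max 0 (d s)) - (LBINT s:{x<..}. max 0 (- d s)) = (LBINT s:{x<..}. max 0 (d s) - max 0 (- d s))"
      by (rule set_integral_diff(2)[symmetric]) (rule int)+
    also have "(\<lambda>s. max 0 (d s) - max 0 (- d s)) = d" by (auto simp: max_def)
    finally show "emeasure (density lborel ?p) {x<..} = emeasure (density lborel ?n) {x<..}"
      unfolding em using zero[of x] by simp
    show "emeasure (density lborel ?p) {x<..} < \<infinity>" unfolding em by simp
  qed simp_all
  then have "AE s in lborel. ?p s = ?n s"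
    by (subst (asm) sigma_finite_measure.density_unique_iff[OF sigma_finite_lborel]) auto
  then have "AE s in lborel. d s = 0"
    by eventually_elim (auto simp: max_def ennreal_eq_0_iff split: if_splits)
  then show ?thesis
    unfolding circle_def
    by (subst AE_restrict_space_iff) (auto simp: d_def elim!: eventually_mono)
qed

typedef h1 = "{u :: real \<Rightarrow> real. periodic u \<and> (\<exists>g. is_weak_deriv u g)}"
  using is_weak_deriv_const by (intro exI[of _ "\<lambda>_. 0"]) (auto simp: periodic_def)

setup_lifting type_definition_h1

lift_definition l2_of_h1 :: "h1 \<Rightarrow> l2" is "\<lambda>u. u"
  by (auto simp: l2_rel_def intro: is_weak_deriv_square_int)

definition weak_deriv :: "h1 \<Rightarrow> l2" where
  "weak_deriv u = (THE d. \<exists>g. is_weak_deriv (Rep_h1 u) g \<and> d = abs_l2 g)"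

lemma weak_deriv_eq:
  assumes "is_weak_deriv (Rep_h1 u) g" shows "weak_deriv u = abs_l2 g"
  unfolding weak_deriv_def
proof (rule the_equality)
  fix d assume "\<exists>g. is_weak_deriv (Rep_h1 u) g \<and> d = abs_l2 g"
  then obtain h where "is_weak_deriv (Rep_h1 u) h" "d = abs_l2 h" by blast
  then show "d = abs_l2 g"
    using assms is_weak_deriv_unique is_weak_derivD(1) by (auto intro!: abs_l2_eqI)
qed (use assms in blast)

instantiation h1 :: real_vector
begin

lift_definition zero_h1 :: h1 is "\<lambda>_. 0"
  using is_weak_deriv_const by (auto simp: periodic_def)
lift_definition plus_h1 :: "h1 \<Rightarrow> h1 \<Rightarrow> h1" is "\<lambda>u v t. u t + v t"
  using is_weak_deriv_add by (auto simp: periodic_def) blast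
lift_definition scaleR_h1 :: "real \<Rightarrow> h1 \<Rightarrow> h1" is "\<lambda>c u t. c * u t"
  using is_weak_deriv_cmult by (auto simp: periodic_def)
definition uminus_h1 :: "h1 \<Rightarrow> h1" where "uminus_h1 u = (-1) *\<^sub>R u"
definition minus_h1 :: "h1 \<Rightarrow> h1 \<Rightarrow> h1" where "minus_h1 u v = u + (-1) *\<^sub>R v"

instance
proof
  fix u v w :: h1 and a b :: real
  show "u + v + w = u + (v + w)" "u + v = v + u" "0 + u = u"
    "a *\<^sub>R (u + v) = a *\<^sub>R u + a *\<^sub>R v" "(a + b) *\<^sub>R u = a *\<^sub>R u + b *\<^sub>R u"
    "a *\<^sub>R b *\<^sub>R u = (a * b) *\<^sub>R u" "1 *\<^sub>R u = u"
    by (transfer; simp add: algebra_simps)+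
  show "- u + u = 0" "u - v = u + - v"
    unfolding uminus_h1_def minus_h1_def by (transfer; simp)+
qed

end

lemma weak_deriv_ex: "\<exists>g. is_weak_deriv (Rep_h1 u) g"
  using Rep_h1[of u] by auto

lemma square_int_h1: "square_int (Rep_h1 u)"
  using weak_deriv_ex is_weak_deriv_square_int by blast

lemma l2_of_h1_eq: "l2_of_h1 u = abs_l2 (Rep_h1 u)"
  by (simp add: l2_of_h1_def)

lemma l2_of_h1_add: "l2_of_h1 (u + v) = l2_of_h1 u + l2_of_h1 v"
  by (simp add: l2_of_h1_eq plus_h1.rep_eq plus_l2.abs_eq l2_rel_def square_int_h1)

lemma l2_of_h1_scaleR: "l2_of_h1 (a *\<^sub>R u) = a *\<^sub>R l2_of_h1 u"
  by (simp add: l2_of_h1_eq scaleR_h1.rep_eq scaleR_l2.abs_eq l2_rel_def square_int_h1)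

lemma weak_deriv_add: "weak_deriv (u + v) = weak_deriv u + weak_deriv v"
proof -
  obtain g h where gh: "is_weak_deriv (Rep_h1 u) g" "is_weak_deriv (Rep_h1 v) h"
    using weak_deriv_ex by blast
  then have "is_weak_deriv (Rep_h1 (u + v)) (\<lambda>t. g t + h t)"
    by (simp add: plus_h1.rep_eq is_weak_deriv_add)
  moreover have "abs_l2 g + abs_l2 h = abs_l2 (\<lambda>t. g t + h t)"
    using gh by (intro plus_l2.abs_eq) (auto simp: l2_rel_def dest: is_weak_derivD(1))
  ultimately show ?thesis using gh by (simp add: weak_deriv_eq)
qed

lemma weak_deriv_scaleR: "weak_deriv (a *\<^sub>R u) = a *\<^sub>R weak_deriv u"
proof -
  obtain g where g: "is_weak_deriv (Rep_h1 u) g" using weak_deriv_ex by blast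
  then have "is_weak_deriv (Rep_h1 (a *\<^sub>R u)) (\<lambda>t. a * g t)"
    by (simp add: scaleR_h1.rep_eq is_weak_deriv_cmult)
  moreover have "a *\<^sub>R abs_l2 g = abs_l2 (\<lambda>t. a * g t)"
    using g by (intro scaleR_l2.abs_eq) (auto simp: l2_rel_def dest: is_weak_derivD(1))
  ultimately show ?thesis using g by (simp add: weak_deriv_eq)
qed

instantiation h1 :: real_inner
begin

definition inner_h1 :: "h1 \<Rightarrow> h1 \<Rightarrow> real"
  where "inner_h1 u v = inner (l2_of_h1 u) (l2_of_h1 v) + inner (weak_deriv u) (weak_deriv v)"
definition norm_h1 :: "h1 \<Rightarrow> real" where "norm_h1 u = sqrt (inner u u)"
definition dist_h1 :: "h1 \<Rightarrow> h1 \<Rightarrow> real" where "dist_h1 u v = norm (u - v)"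
definition sgn_h1 :: "h1 \<Rightarrow> h1" where "sgn_h1 u = inverse (norm u) *\<^sub>R u"
definition uniformity_h1 :: "(h1 \<times> h1) filter"
  where "uniformity_h1 = (INF e\<in>{0 <..}. principal {(x, y). dist x y < e})"
definition open_h1 :: "h1 set \<Rightarrow> bool"
  where "open_h1 S = (\<forall>x\<in>S. \<forall>\<^sub>F (x', y) in uniformity. x' = x \<longrightarrow> y \<in> S)"

instance
proof
  fix u v w :: h1 and a b :: real
  note lin = l2_of_h1_add l2_of_h1_scaleR weak_deriv_add weak_deriv_scaleR
  show "dist u v = norm (u - v)" "sgn u = inverse (norm u) *\<^sub>R u" "norm u = sqrt (inner u u)"
    by (simp_all add: dist_h1_def sgn_h1_def norm_h1_def)
  show "uniformity = (INF e\<in>{0 <..}. principal {(x::h1, y). dist x y < e})"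
    by (rule uniformity_h1_def)
  show "open S = (\<forall>x\<in>S. \<forall>\<^sub>F (x', y) in uniformity. x' = x \<longrightarrow> y \<in> S)" for S :: "h1 set"
    by (rule open_h1_def)
  show "inner u v = inner v u" by (simp add: inner_h1_def inner_commute)
  show "inner (u + v) w = inner u w + inner v w" by (simp add: inner_h1_def lin inner_add_left)
  show "inner (a *\<^sub>R u) v = a * inner u v" by (simp add: inner_h1_def lin distrib_left)
  show "0 \<le> inner u u" by (simp add: inner_h1_def)
  show "(inner u u = 0) = (u = 0)"
  proof
    assume "inner u u = 0"
    then have 0: "l2_of_h1 u = 0" "weak_deriv u = 0"
      by (simp_all add: inner_h1_def add_nonneg_eq_0_iff)
    obtain g where g: "is_weak_deriv (Rep_h1 u) g" using weak_deriv_ex by blast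
    then have "abs_l2 g = abs_l2 (\<lambda>_. 0)" using 0 by (simp add: weak_deriv_eq zero_l2.abs_eq)
    then have "AE t in circle. g t = 0"
      using is_weak_derivD(1)[OF g] by (intro abs_l2_eqD square_int_const)
    then have ae: "AE t in lborel. t \<in> {0..1} \<longrightarrow> g t = 0"
      unfolding circle_def by (subst (asm) AE_restrict_space_iff) auto
    have const: "Rep_h1 u t = Rep_h1 u 0" if "t \<in> {0..1}" for t
    proof -
      have "(LBINT s:{0..t}. g s) = 0" unfolding set_lebesgue_integral_def
        by (rule integral_eq_zero_AE) (use ae that in \<open>auto simp: indicator_def elim!: eventually_mono\<close>)
      then show ?thesis using is_weak_derivD(2)[OF g that] by simp
    qed
    have "abs_l2 (Rep_h1 u) = abs_l2 (\<lambda>_. 0)"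
      using 0 by (simp add: zero_l2.abs_eq l2_of_h1_eq)
    then have "AE t in circle. Rep_h1 u t = 0"
      by (intro abs_l2_eqD square_int_h1 square_int_const)
    then have "AE t in circle. Rep_h1 u 0 = 0"
      using AE_space by eventually_elim (metis const space_circle)
    moreover have "\<not> (AE t in circle. False)"
    proof
      assume "AE t in circle. False"
      then have "space circle \<in> null_sets circle"
        by (subst (asm) AE_iff_null) (auto simp del: space_circle)
      then show False using measure_circle by (simp add: null_sets_def)
    qed
    ultimately have "Rep_h1 u 0 = 0" by (cases "Rep_h1 u 0 = 0") auto
    then have z: "Rep_h1 u t = 0" if "t \<in> {0..1}" for t using const[OF that] by simp
    have "Rep_h1 u t = 0" for t
    proof -
      have "frac t \<in> {0..1}" using frac_ge_0[of t] frac_lt_1[of t] by simp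
      then show ?thesis using z periodic_frac[of "Rep_h1 u" t] Rep_h1[of u] by auto
    qed
    then show "u = 0" by transfer auto
  next
    assume "u = 0"
    then have "u = 0 *\<^sub>R u" by transfer simp
    then have "l2_of_h1 u = 0" "weak_deriv u = 0"
      using l2_of_h1_scaleR[of 0 u] weak_deriv_scaleR[of 0 u] by simp_all
    then show "inner u u = 0" by (simp add: inner_h1_def)
  qed
qed

end

instantiation h1 :: circle_space
begin

definition mean_h1 :: "h1 \<Rightarrow> real" where "mean_h1 u = mean (l2_of_h1 u)"
lift_definition const_fn_h1 :: "real \<Rightarrow> h1" is "\<lambda>c _. c"
  using is_weak_deriv_const by (auto simp: periodic_def)

instance
proof
  fix u v :: h1 and a :: real
  show "mean (u + v) = mean u + mean v" "mean (a *\<^sub>R u) = a * mean u"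
    by (simp_all add: mean_h1_def l2_of_h1_add l2_of_h1_scaleR mean_add mean_scaleR)
  have "l2_of_h1 (const_fn a) = const_fn a"
    by (simp add: l2_of_h1_eq const_fn_h1.rep_eq const_fn_l2.abs_eq)
  then show "mean (const_fn a :: h1) = a" by (simp add: mean_h1_def mean_const_fn)
qed

end


section \<open>The differential operator\<close>

definition op_C :: "(real \<Rightarrow> real) \<Rightarrow> c1 \<Rightarrow> c0" where
  "op_C f u = Abs_c0 (\<lambda>t. deriv (Rep_c1 u) t + f (Rep_c1 u t))"

definition op_H :: "(real \<Rightarrow> real) \<Rightarrow> h1 \<Rightarrow> l2" where
  "op_H f u = weak_deriv u + abs_l2 (\<lambda>t. f (Rep_h1 u t))"


section \<open>Cusps and global folds\<close>

definition Psi :: "('b1::circle_space \<Rightarrow> 'b0::circle_space) \<Rightarrow> 'b1 \<Rightarrow> 'b0" where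
  "Psi F u = F u - const_fn (mean (F u)) + const_fn (mean u)"

text \<open>The second component of \<open>F \<circ> (Psi F)\<inverse>\<close>; the first one is the identity. The inverse is
  meaningful only where \<open>Psi F\<close> is bijective, as it is for the operators \<open>op_C f\<close> and \<open>op_H f\<close>.\<close>
definition phi :: "('b1::circle_space \<Rightarrow> 'b0::circle_space) \<Rightarrow> 'b0 zero_mean \<Rightarrow> real \<Rightarrow> real" where
  "phi F v x = mean (F (inv (Psi F) (Rep_zero_mean v + const_fn x)))"

text \<open>The components of \<open>w\<close> in the direct sum of \<open>'b zero_mean\<close> and the constants are
  \<open>zero_mean_part w\<close> and \<open>mean w\<close>.\<close>
definition zero_mean_part :: "'b::circle_space \<Rightarrow> 'b zero_mean" where
  "zero_mean_part w = Abs_zero_mean (w - const_fn (mean w))"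

text \<open>
  A Morin singularity of order two. The partial derivatives in the real variable are iterated
  one-variable derivatives; the last clause is about the total derivative.
\<close>
definition is_cusp :: "('b1::circle_space \<Rightarrow> 'b0::circle_space) \<Rightarrow> 'b1 \<Rightarrow> bool" where
  "is_cusp F u \<longleftrightarrow>
     (let v = zero_mean_part (Psi F u); x = mean (Psi F u) in
        deriv (phi F v) x = 0 \<and> (deriv ^^ 2) (phi F v) x = 0 \<and> (deriv ^^ 3) (phi F v) x \<noteq> 0 \<and>
        (\<exists>L. ((\<lambda>(w, s). deriv (phi F w) s) has_derivative L) (at (v, x)) \<and> surj L))"

definition global_fold :: "('b1::circle_space \<Rightarrow> 'b0::circle_space) \<Rightarrow> bool" where
  "global_fold G \<longleftrightarrow>
     (\<exists>(\<Xi>1 :: 'b1 \<Rightarrow> real \<times> 'b0 zero_mean) (\<Xi>0 :: 'b0 \<Rightarrow> real \<times> 'b0 zero_mean).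
        diffeomorphism \<Xi>1 \<and> diffeomorphism \<Xi>0 \<and>
        (\<forall>x v. (\<Xi>0 \<circ> G \<circ> inv \<Xi>1) (x, v) = (x\<^sup>2, v)))"

end

theory Submission
  imports Defs
begin

text \<open>
  In both cases the inverse of \<open>Psi F\<close> factors through \<open>C\<^sup>0\<close>. If \<open>prim q\<close> is the mean free primitive of
  \<open>q\<close> minus its mean, then \<open>Psi F u = b\<close> becomes \<open>q + prim (f \<circ> q) = p\<close> for the continuous functions
  \<open>q = u\<close> and \<open>p = prim b + mean b\<close>. An a priori bound (at a down-crossing of zero of \<open>q - p\<close>) together
  with the continuation method solves this equation by a smooth \<open>q = M p\<close>, and the height function
  is \<open>p \<mapsto> mean (f \<circ> M p)\<close>.

  At a critical point of a fiber, with \<open>u\<close> the solution and \<open>w > 0\<close>, \<open>w' = - f'(u) w\<close>, the second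
  derivative of the height is a positive multiple of \<open>\<integral> f''(u) w\<close>; if it vanishes, the third one is a
  positive multiple of \<open>\<integral> f'''(u) w\<^sup>2\<close>.

  If zero is interior to the hull, some positive density \<open>\<rho>\<close> on a large loop annihilates \<open>f'(g)\<close> and \<open>f''(g)\<close>
  but not \<open>f'''(g)\<close>. Reparametrizing the circle by \<open>\<rho>\<close> and going around it very often makes \<open>w\<close> nearly
  constant, and a small correction of \<open>\<rho>\<close> yields an exact cusp. Otherwise
  \<open>f'' + c f' \<ge> 0\<close> for some \<open>c\<close>. Since \<open>\<integral> f'(u) w = 0\<close>, all critical points of the fibers are
  nondegenerate minima, and Taylor's formula straightens each fiber to \<open>x\<^sup>2\<close>.
\<close>

section \<open>Smooth maps through iterated directional derivatives\<close>

text \<open>Both pairs of spaces enter only through bounded linear maps to and from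
  \<open>C^0\<close>: in the sup norm, composition with a smooth \<open>f\<close> is smooth, so all
  nonlinear analysis is done once, in a Banach algebra. No inverse function theorem is used for the
  solution operators. Existence and uniqueness are global, and the directional derivative of a
  solution is again given by a solution operator, so each order of regularity yields the next. This
  dictates a scale of smoothness built on directional derivatives.

  For the cusp the obstacle is exactness: after finitely many turns \<open>w\<close> is not
  constant, and the integral of \<open>f''(u) w\<close> is only close to zero. The correction of
  \<rho> is orthogonal to \<open>f' \<circ> g\<close>, so \<open>w\<close> closes up along the whole
  family and one scalar equation is left for the intermediate value theorem. Transversality then
  costs nothing more, since the variation \<open>f''(u)\<close> of the solution tests it with the
  integral of a square.

  For the fold the obstacle is a square root that is smooth at the bottom of each fiber; the
  integral remainder provides a positive smooth factor under it.\<close>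

abbreviation line_deriv ::
    "('a::real_normed_vector \<Rightarrow> 'b::real_normed_vector) \<Rightarrow> 'a \<Rightarrow> 'a \<Rightarrow> 'b \<Rightarrow> bool" where
  "line_deriv f x v d \<equiv> ((\<lambda>s::real. f (x + s *\<^sub>R v)) has_vector_derivative d) (at 0)"

abbreviation nprod :: "'a::real_normed_vector list \<Rightarrow> real" where
  "nprod vs \<equiv> prod_list (map norm vs)"

lemma nprod_nonneg: "0 \<le> nprod vs"
  by (induction vs) auto

lemma has_vector_derivative_at_0_iff:
  fixes g :: "real \<Rightarrow> 'a::real_normed_vector"
  shows "(g has_vector_derivative d) (at 0) \<longleftrightarrow> ((\<lambda>s. (g s - g 0) /\<^sub>R s) \<longlongrightarrow> d) (at 0)"
proof -
  have "(g has_vector_derivative d) (at 0) \<longleftrightarrow>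
      ((\<lambda>s. norm (g s - g 0 - s *\<^sub>R d) / norm s) \<longlongrightarrow> 0) (at 0)"
    by (simp add: has_vector_derivative_def has_derivative_iff_norm bounded_linear_scaleR_left)
  also have "\<dots> \<longleftrightarrow> ((\<lambda>s. norm ((g s - g 0) /\<^sub>R s - d)) \<longlongrightarrow> 0) (at 0)"
  proof (rule filterlim_cong[OF refl refl], rule eventually_at_filter[THEN iffD2], intro always_eventually allI impI)
    fix s :: real assume "s \<noteq> 0"
    then have "(g s - g 0) /\<^sub>R s - d = (g s - g 0 - s *\<^sub>R d) /\<^sub>R s"
      by (simp add: scaleR_diff_right)
    then show "norm (g s - g 0 - s *\<^sub>R d) / norm s = norm ((g s - g 0) /\<^sub>R s - d)"
      by (simp add: divide_inverse mult.commute)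
  qed
  also have "\<dots> \<longleftrightarrow> ((\<lambda>s. (g s - g 0) /\<^sub>R s) \<longlongrightarrow> d) (at 0)"
    by (simp add: tendsto_norm_zero_iff LIM_zero_iff)
  finally show ?thesis .
qed

lemma line_deriv_at:
  assumes "\<And>r. line_deriv f (x + r *\<^sub>R v) v (d r)"
  shows "((\<lambda>s. f (x + s *\<^sub>R v)) has_vector_derivative d s) (at s within S)"
proof -
  have "((\<lambda>r. f ((x + s *\<^sub>R v) + r *\<^sub>R v)) has_vector_derivative d s) (at (s - s))"
    using assms[of s] by simp
  moreover have "((\<lambda>r. r - s) has_vector_derivative 1) (at s)"
    by (auto intro!: derivative_eq_intros)
  ultimately have "((\<lambda>r. f ((x + s *\<^sub>R v) + r *\<^sub>R v)) \<circ> (\<lambda>r. r - s) has_vector_derivative 1 *\<^sub>R d s) (at s)"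
    by (rule vector_diff_chain_at[rotated])
  moreover have "(\<lambda>r. f ((x + s *\<^sub>R v) + r *\<^sub>R v)) \<circ> (\<lambda>r. r - s) = (\<lambda>s. f (x + s *\<^sub>R v))"
    by (simp add: fun_eq_iff algebra_simps)
  ultimately show ?thesis
    by (simp add: has_vector_derivative_at_within)
qed

lemma vector_derivative_bound:
  fixes g :: "real \<Rightarrow> 'a::real_normed_vector"
  assumes "\<And>s. s \<in> {0..1} \<Longrightarrow> (g has_vector_derivative g' s) (at s within {0..1})"
    and "\<And>s. s \<in> {0..1} \<Longrightarrow> norm (g' s) \<le> B"
  shows "norm (g 1 - g 0) \<le> B"
proof -
  have "norm (g 1 - g 0) \<le> B * norm (1 - 0 :: real)"
  proof (rule differentiable_bound[where S = "{0..1}" and f' = "\<lambda>s h. h *\<^sub>R g' s"])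
    fix s :: real assume s: "s \<in> {0..1}"
    show "(g has_derivative (\<lambda>h. h *\<^sub>R g' s)) (at s within {0..1})"
      using assms(1)[OF s] by (simp add: has_vector_derivative_def)
    show "onorm (\<lambda>h. h *\<^sub>R g' s) \<le> B"
      by (rule onorm_le) (use assms(2)[OF s] in \<open>simp add: mult.commute[of B] mult_left_mono\<close>)
  qed auto
  then show ?thesis by simp
qed

lemma line_deriv_lipschitz:
  assumes "convex S" "x \<in> S" "y \<in> S"
    and "\<And>z v. line_deriv f z v (D z v)"
    and "\<And>z v. z \<in> S \<Longrightarrow> norm (D z v) \<le> C * norm v"
  shows "norm (f y - f x) \<le> C * norm (y - x)"
proof -
  have "norm (f (x + 1 *\<^sub>R (y - x)) - f (x + 0 *\<^sub>R (y - x))) \<le> C * norm (y - x)"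
  proof (rule vector_derivative_bound[where g = "\<lambda>s. f (x + s *\<^sub>R (y - x))"])
    fix s :: real assume s: "s \<in> {0..1}"
    show "((\<lambda>s. f (x + s *\<^sub>R (y - x))) has_vector_derivative D (x + s *\<^sub>R (y - x)) (y - x)) (at s within {0..1})"
      by (rule line_deriv_at) (rule assms(4))
    have "x + s *\<^sub>R (y - x) = (1 - s) *\<^sub>R x + s *\<^sub>R y" by (simp add: algebra_simps)
    then have "x + s *\<^sub>R (y - x) \<in> S"
      using assms(1-3) s by (simp add: convex_alt)
    then show "norm (D (x + s *\<^sub>R (y - x)) (y - x)) \<le> C * norm (y - x)" by (rule assms(5))
  qed
  then show ?thesis by simp
qed

text \<open>Local Lipschitz continuity turns the directional derivative into a derivative along curves.\<close>

lemma line_deriv_curve: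
  assumes lip: "\<And>a b. a \<in> ball (y 0) \<delta> \<Longrightarrow> b \<in> ball (y 0) \<delta> \<Longrightarrow> norm (f a - f b) \<le> C * norm (a - b)"
    and "\<delta> > 0" "line_deriv f (y 0) y' d" and y: "(y has_vector_derivative y') (at 0)"
  shows "((\<lambda>s. f (y s)) has_vector_derivative d) (at 0)"
proof -
  have y_lim: "((\<lambda>s. (y s - y 0) /\<^sub>R s) \<longlongrightarrow> y') (at 0)"
    using y by (simp add: has_vector_derivative_at_0_iff)
  have c1: "(y \<longlongrightarrow> y 0) (at 0)"
    using has_vector_derivative_continuous[OF y] by (simp add: continuous_at)
  have c2: "((\<lambda>s. y 0 + s *\<^sub>R y') \<longlongrightarrow> y 0) (at 0)"
    by (auto intro!: tendsto_eq_intros)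
  have "((\<lambda>s. (f (y s) - f (y 0 + s *\<^sub>R y')) /\<^sub>R s) \<longlongrightarrow> 0) (at 0)"
  proof (rule Lim_null_comparison)
    have "((\<lambda>s. C * norm ((y s - y 0) /\<^sub>R s - y')) \<longlongrightarrow> C * norm (y' - y')) (at 0)"
      by (intro tendsto_intros y_lim)
    then show "((\<lambda>s. C * norm ((y s - y 0) /\<^sub>R s - y')) \<longlongrightarrow> 0) (at 0)" by simp
    have e1: "\<forall>\<^sub>F s in at 0. y s \<in> ball (y 0) \<delta>" "\<forall>\<^sub>F s in at 0. y 0 + s *\<^sub>R y' \<in> ball (y 0) \<delta>"
      using c1 c2 \<open>\<delta> > 0\<close> by (auto dest!: tendstoD simp: dist_commute)
    show "\<forall>\<^sub>F s in at 0. norm ((f (y s) - f (y 0 + s *\<^sub>R y')) /\<^sub>R s) \<le> C * norm ((y s - y 0) /\<^sub>R s - y')"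
      using e1 eventually_neq_at_within[of 0 0 UNIV]
    proof eventually_elim
      case (elim s)
      have "norm ((f (y s) - f (y 0 + s *\<^sub>R y')) /\<^sub>R s) \<le> (C * norm (y s - (y 0 + s *\<^sub>R y'))) / \<bar>s\<bar>"
        using lip[OF elim(1,2)] by (simp add: divide_inverse mult.commute mult_left_mono)
      also have "\<dots> = C * norm ((y s - (y 0 + s *\<^sub>R y')) /\<^sub>R s)"
        by (simp add: divide_inverse mult.commute mult.left_commute)
      also have "(y s - (y 0 + s *\<^sub>R y')) /\<^sub>R s = (y s - y 0) /\<^sub>R s - y'"
        using elim(3) by (simp add: algebra_simps)
      finally show ?case .
    qed
  qed
  moreover have "((\<lambda>s. (f (y 0 + s *\<^sub>R y') - f (y 0)) /\<^sub>R s) \<longlongrightarrow> d) (at 0)"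
    using assms(3) by (simp add: has_vector_derivative_at_0_iff)
  ultimately have "((\<lambda>s. (f (y s) - f (y 0 + s *\<^sub>R y')) /\<^sub>R s + (f (y 0 + s *\<^sub>R y') - f (y 0)) /\<^sub>R s) \<longlongrightarrow> 0 + d) (at 0)"
    by (rule tendsto_add)
  moreover have "(\<lambda>s. (f (y s) - f (y 0 + s *\<^sub>R y')) /\<^sub>R s + (f (y 0 + s *\<^sub>R y') - f (y 0)) /\<^sub>R s)
      = (\<lambda>s. (f (y s) - f (y 0)) /\<^sub>R s)"
    by (rule ext) (simp add: scaleR_diff_right)
  ultimately have "((\<lambda>s. (f (y s) - f (y 0)) /\<^sub>R s) \<longlongrightarrow> d) (at 0)"
    by (simp only: add_0_left)
  then show ?thesis
    by (rule iffD2[OF has_vector_derivative_at_0_iff])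
qed

fun dd :: "('a::real_normed_vector \<Rightarrow> 'b::real_normed_vector) \<Rightarrow> 'a \<Rightarrow> 'a list \<Rightarrow> 'b" where
  "dd f x [] = f x"
| "dd f x (v # vs) = vector_derivative (\<lambda>s. dd f (x + s *\<^sub>R v) vs) (at 0)"

text \<open>The derivative of order \<open>n\<close> itself is only required to be locally bounded; so this is
  \<open>C\<^sup>n\<^sup>-\<^sup>1\<close> with locally Lipschitz top derivative, a scale that is stable under composition.\<close>

definition Cn :: "nat \<Rightarrow> ('a::real_normed_vector \<Rightarrow> 'b::real_normed_vector) \<Rightarrow> bool" where
  "Cn n f \<longleftrightarrow> continuous_on UNIV f \<and>
     (\<forall>x v vs. length vs < n \<longrightarrow> (\<lambda>s. dd f (x + s *\<^sub>R v) vs) differentiable (at 0)) \<and>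
     (\<forall>x. \<exists>\<delta>>0. \<exists>C. \<forall>y\<in>ball x \<delta>. \<forall>vs. length vs \<le> n \<longrightarrow> norm (dd f y vs) \<le> C * nprod vs)"

lemma Cn_continuous: "Cn n f \<Longrightarrow> continuous_on UNIV f"
  by (simp add: Cn_def)

lemma Cn_bound:
  assumes "Cn n f"
  obtains \<delta> C where "\<delta> > 0" "C \<ge> 1"
    "\<And>y vs. y \<in> ball x \<delta> \<Longrightarrow> length vs \<le> n \<Longrightarrow> norm (dd f y vs) \<le> C * nprod vs"
proof -
  obtain \<delta> C where "\<delta> > 0" and C: "\<And>y vs. y \<in> ball x \<delta> \<Longrightarrow> length vs \<le> n \<Longrightarrow> norm (dd f y vs) \<le> C * nprod vs"
    using assms unfolding Cn_def by blast
  moreover have "norm (dd f y vs) \<le> max C 1 * nprod vs" if "y \<in> ball x \<delta>" "length vs \<le> n" for y vs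
    using C[OF that] mult_right_mono[OF max.cobounded1[of C 1] nprod_nonneg[of vs]] by linarith
  ultimately show ?thesis by (intro that[of \<delta> "max C 1"]) auto
qed

lemma dd_line:
  assumes "Cn n f" "length vs < n"
  shows "line_deriv (\<lambda>y. dd f y vs) x v (dd f x (v # vs))"
  using assms by (simp add: Cn_def vector_derivative_works[symmetric])

text \<open>The bound on the derivative of the next order is a Lipschitz constant, by the mean value
  inequality on the convex ball.\<close>

lemma dd_lipschitz:
  assumes f: "Cn n f" and vs: "length vs < n" and y: "y \<in> ball x \<delta>" "z \<in> ball x \<delta>"
    and C: "\<And>y vs. y \<in> ball x \<delta> \<Longrightarrow> length vs \<le> n \<Longrightarrow> norm (dd f y vs) \<le> C * nprod vs"
  shows "norm (dd f y vs - dd f z vs) \<le> C * nprod vs * norm (y - z)"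
proof (rule line_deriv_lipschitz[where S = "ball x \<delta>" and D = "\<lambda>z v. dd f z (v # vs)"])
  show "norm (dd f w (v # vs)) \<le> C * nprod vs * norm v" if "w \<in> ball x \<delta>" for w v
    using C[OF that, of "v # vs"] vs by (simp add: mult_ac)
qed (use y dd_line[OF f vs] in auto)

lemma dd_continuous:
  assumes f: "Cn n f" and vs: "length vs < n"
  shows "continuous_on UNIV (\<lambda>x. dd f x vs)"
proof (rule continuous_at_imp_continuous_on, intro ballI)
  fix x
  obtain \<delta> C where *: "\<delta> > 0" "C \<ge> 1"
    and C: "\<And>y vs. y \<in> ball x \<delta> \<Longrightarrow> length vs \<le> n \<Longrightarrow> norm (dd f y vs) \<le> C * nprod vs"
    using Cn_bound[OF f] by metis
  have "((\<lambda>y. dd f y vs - dd f x vs) \<longlongrightarrow> 0) (at x)"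
  proof (rule Lim_null_comparison)
    show "\<forall>\<^sub>F y in at x. norm (dd f y vs - dd f x vs) \<le> C * nprod vs * norm (y - x)"
      unfolding eventually_at
    proof (intro exI[of _ \<delta>] conjI ballI impI)
      fix y assume "y \<noteq> x \<and> dist y x < \<delta>"
      then show "norm (dd f y vs - dd f x vs) \<le> C * nprod vs * norm (y - x)"
        using * by (intro dd_lipschitz[OF f vs, where x = x and \<delta> = \<delta>] C) (auto simp: dist_commute)
    qed (use * in auto)
    have "((\<lambda>y. C * nprod vs * norm (y - x)) \<longlongrightarrow> C * nprod vs * norm (x - x)) (at x)"
      by (intro tendsto_intros)
    then show "((\<lambda>y. C * nprod vs * norm (y - x)) \<longlongrightarrow> 0) (at x)" by simp
  qed
  then show "isCont (\<lambda>x. dd f x vs) x" by (simp add: continuous_at LIM_zero_iff)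
qed

text \<open>Along the segment, the derivative of the remainder is a difference of values of the next
  derivative, hence linearly small by its Lipschitz bound. So a quadratic remainder follows from
  directional derivatives and bounds alone, at the price of two orders.\<close>

lemma dd_frechet:
  assumes f: "Cn n f" and vs: "Suc (length vs) < n" and y: "y \<in> ball x \<delta>" "z \<in> ball x \<delta>"
    and C: "\<And>y vs. y \<in> ball x \<delta> \<Longrightarrow> length vs \<le> n \<Longrightarrow> norm (dd f y vs) \<le> C * nprod vs"
  shows "norm (dd f y vs - dd f z vs - dd f z ((y - z) # vs)) \<le> C * nprod vs * (norm (y - z))\<^sup>2"
proof -
  define h where "h = y - z"
  define g where "g s = dd f (z + s *\<^sub>R h) vs - s *\<^sub>R dd f z (h # vs)" for s
  have C0: "C * nprod vs * (norm h)\<^sup>2 \<ge> 0"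
  proof -
    have "0 \<le> C * nprod vs"
      using order_trans[OF norm_ge_zero C[OF y(1)]] vs by (meson Suc_lessD less_imp_le)
    then show ?thesis by (intro mult_nonneg_nonneg[of "C * nprod vs"]) simp_all
  qed
  have "norm (g 1 - g 0) \<le> C * nprod vs * (norm h)\<^sup>2"
  proof (rule vector_derivative_bound[where g' = "\<lambda>s. dd f (z + s *\<^sub>R h) (h # vs) - dd f z (h # vs)"])
    fix s :: real assume s: "s \<in> {0..1}"
    have "((\<lambda>s. dd f (z + s *\<^sub>R h) vs) has_vector_derivative dd f (z + s *\<^sub>R h) (h # vs)) (at s within {0..1})"
      by (rule line_deriv_at) (use dd_line[OF f] vs in simp)
    moreover have "((\<lambda>s. s *\<^sub>R dd f z (h # vs)) has_vector_derivative dd f z (h # vs)) (at s within {0..1})"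
      by (auto intro!: derivative_eq_intros simp del: dd.simps)
    ultimately show "(g has_vector_derivative dd f (z + s *\<^sub>R h) (h # vs) - dd f z (h # vs)) (at s within {0..1})"
      unfolding g_def by (rule has_vector_derivative_diff)
    have "z + s *\<^sub>R h = (1 - s) *\<^sub>R z + s *\<^sub>R y" by (simp add: h_def algebra_simps)
    then have "z + s *\<^sub>R h \<in> ball x \<delta>"
      using convexD_alt[OF convex_ball y(2,1)] s by simp
    then have "norm (dd f (z + s *\<^sub>R h) (h # vs) - dd f z (h # vs)) \<le> C * nprod (h # vs) * norm (z + s *\<^sub>R h - z)"
      using vs by (intro dd_lipschitz[OF f _ _ y(2) C]) auto
    also have "\<dots> = s * (C * nprod vs * (norm h)\<^sup>2)"
      using s by (simp add: power2_eq_square mult_ac)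
    also have "\<dots> \<le> C * nprod vs * (norm h)\<^sup>2"
      using s C0 by (simp add: mult_left_le_one_le)
    finally show "norm (dd f (z + s *\<^sub>R h) (h # vs) - dd f z (h # vs)) \<le> C * nprod vs * (norm h)\<^sup>2" .
  qed
  moreover have "g 1 - g 0 = dd f y vs - dd f z vs - dd f z ((y - z) # vs)"
    by (simp add: g_def h_def del: dd.simps(2))
  ultimately show ?thesis by (simp add: h_def)
qed

text \<open>Homogeneity of the outermost derivative comes from rescaling the line; differentiating
  this identity carries it to any later slot.\<close>

lemma dd_scale:
  assumes f: "Cn n f" and "length us + length ws < n"
  shows "dd f x (us @ (c *\<^sub>R v) # ws) = c *\<^sub>R dd f x (us @ v # ws)"
  using assms(2)
proof (induction us arbitrary: x)
  case Nil
  have "((\<lambda>r. r * c) has_vector_derivative c) (at 0)"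
    by (auto intro!: derivative_eq_intros simp: has_real_derivative_iff_has_vector_derivative[symmetric])
  moreover have "line_deriv (\<lambda>y. dd f y ws) x v (dd f x (v # ws))"
    by (rule dd_line[OF f]) (use Nil in simp)
  ultimately have "((\<lambda>s. dd f (x + s *\<^sub>R v) ws) \<circ> (\<lambda>r. r * c) has_vector_derivative c *\<^sub>R dd f x (v # ws)) (at 0)"
    by (intro vector_diff_chain_at) simp_all
  then have "line_deriv (\<lambda>y. dd f y ws) x (c *\<^sub>R v) (c *\<^sub>R dd f x (v # ws))"
    by (simp add: o_def)
  moreover have "line_deriv (\<lambda>y. dd f y ws) x (c *\<^sub>R v) (dd f x ((c *\<^sub>R v) # ws))"
    by (rule dd_line[OF f]) (use Nil in simp)
  ultimately show ?case
    using vector_derivative_unique_at by (simp del: dd.simps) blast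
next
  case (Cons u us)
  then have IH: "dd f y (us @ (c *\<^sub>R v) # ws) = c *\<^sub>R dd f y (us @ v # ws)" for y by simp
  have "line_deriv (\<lambda>y. dd f y (us @ v # ws)) x u (dd f x (u # us @ v # ws))"
    by (rule dd_line[OF f]) (use Cons in simp)
  then have "line_deriv (\<lambda>y. dd f y (us @ (c *\<^sub>R v) # ws)) x u (c *\<^sub>R dd f x (u # us @ v # ws))"
    unfolding IH by (auto intro!: derivative_eq_intros simp del: dd.simps)
  then show ?case by (simp add: vector_derivative_at)
qed

text \<open>The increment to \<open>x + s *\<^sub>R (u + v)\<close> is computed directly and via
  \<open>x + s *\<^sub>R u\<close>. All errors are quadratic in \<open>s\<close>, whereas the defect
  \<open>E\<close> of additivity enters with the factor \<open>s\<close>; so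
  \<open>norm E \<le> s * K\<close> for all small \<open>s > 0\<close>.\<close>

lemma dd_add_first:
  assumes f: "Cn n f" and vs: "Suc (length vs) < n"
  shows "dd f x ((u + v) # vs) = dd f x (u # vs) + dd f x (v # vs)"
proof -
  obtain \<delta> C where \<delta>: "\<delta> > 0" "C \<ge> 1"
    and C: "\<And>y vs. y \<in> ball x \<delta> \<Longrightarrow> length vs \<le> n \<Longrightarrow> norm (dd f y vs) \<le> C * nprod vs"
    using Cn_bound[OF f] by metis
  define K where "K = C * nprod vs * ((norm (u + v))\<^sup>2 + (norm u)\<^sup>2 + (norm v)\<^sup>2 + norm u * norm v)"
  define E where "E = dd f x ((u + v) # vs) - dd f x (u # vs) - dd f x (v # vs)"
  have sc: "dd f y ((s *\<^sub>R w) # vs) = s *\<^sub>R dd f y (w # vs)" for s y w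
    using dd_scale[OF f, of "[]" vs] vs by simp
  have ev: "\<forall>\<^sub>F s in at_right 0. norm E \<le> s * K"
  proof -
    have "((\<lambda>s. x + s *\<^sub>R (u + v)) \<longlongrightarrow> x) (at_right 0)" "((\<lambda>s. x + s *\<^sub>R u) \<longlongrightarrow> x) (at_right (0::real))"
      by (auto intro!: tendsto_eq_intros)
    then have "\<forall>\<^sub>F s in at_right 0. x + s *\<^sub>R (u + v) \<in> ball x \<delta>" "\<forall>\<^sub>F s in at_right 0. x + s *\<^sub>R u \<in> ball x \<delta>"
      using \<delta> by (auto dest!: tendstoD simp: dist_commute)
    then show ?thesis using eventually_at_right_less[of 0]
    proof eventually_elim
      case (elim s)
      let ?F = "\<lambda>y. dd f y vs" and ?T = "\<lambda>y w. dd f y (w # vs)"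
      let ?a = "x + s *\<^sub>R (u + v)" and ?b = "x + s *\<^sub>R u"
      have x: "x \<in> ball x \<delta>" using \<delta> by simp
      note fr = dd_frechet[OF f vs _ _ C]
      have 1: "norm (?F ?a - ?F x - s *\<^sub>R ?T x (u + v)) \<le> C * nprod vs * (s\<^sup>2 * (norm (u + v))\<^sup>2)"
        using fr[OF elim(1) x] elim(3) by (simp only: add_diff_cancel_left' sc norm_scaleR power_mult_distrib power2_abs)
      have 2: "norm (?F ?b - ?F x - s *\<^sub>R ?T x u) \<le> C * nprod vs * (s\<^sup>2 * (norm u)\<^sup>2)"
        using fr[OF elim(2) x] elim(3) by (simp only: add_diff_cancel_left' sc norm_scaleR power_mult_distrib power2_abs)
      have "?a - ?b = s *\<^sub>R v" by (simp add: algebra_simps)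
      then have 3: "norm (?F ?a - ?F ?b - s *\<^sub>R ?T ?b v) \<le> C * nprod vs * (s\<^sup>2 * (norm v)\<^sup>2)"
        using fr[OF elim(1,2)] elim(3) by (simp only: sc norm_scaleR power_mult_distrib power2_abs)
      have "norm (?T ?b v - ?T x v) \<le> C * nprod (v # vs) * norm (?b - x)"
        by (rule dd_lipschitz[OF f _ elim(2) x C]) (use vs in auto)
      then have "norm (?T ?b v - ?T x v) \<le> C * (norm v * nprod vs) * (s * norm u)"
        using elim(3) by (simp only: list.map prod_list.Cons add_diff_cancel_left' norm_scaleR abs_of_pos)
      from mult_left_mono[OF this, of s] have 4: "norm (s *\<^sub>R (?T ?b v - ?T x v)) \<le> s * (C * (norm v * nprod vs) * (s * norm u))"
        using elim(3) by (simp only: norm_scaleR abs_of_pos)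
      have scaled: "C * nprod vs * (s\<^sup>2 * (norm (u + v))\<^sup>2) + C * nprod vs * (s\<^sup>2 * (norm u)\<^sup>2)
          + C * nprod vs * (s\<^sup>2 * (norm v)\<^sup>2) + s * (C * (norm v * nprod vs) * (s * norm u)) = s * (s * K)"
      proof -
        have "C * P * (s\<^sup>2 * a\<^sup>2) + C * P * (s\<^sup>2 * b\<^sup>2) + C * P * (s\<^sup>2 * c\<^sup>2) + s * (C * (c * P) * (s * b))
            = s * (s * (C * P * (a\<^sup>2 + b\<^sup>2 + c\<^sup>2 + b * c)))" for a b c P :: real
          by (simp add: algebra_simps power2_eq_square)
        then show ?thesis unfolding K_def .
      qed
      have tri: "norm (- a + b + c + d) \<le> norm a + norm b + norm c + norm d" for a b c d :: 'b
        using norm_triangle_ineq[of "- a + b + c" d] norm_triangle_ineq[of "- a + b" c]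
          norm_triangle_ineq[of "- a" b] by simp
      have E_eq: "s *\<^sub>R E = - (?F ?a - ?F x - s *\<^sub>R ?T x (u + v)) + (?F ?b - ?F x - s *\<^sub>R ?T x u)
          + (?F ?a - ?F ?b - s *\<^sub>R ?T ?b v) + s *\<^sub>R (?T ?b v - ?T x v)"
        by (simp add: E_def scaleR_diff_right del: dd.simps)
      have "norm (s *\<^sub>R E) \<le> norm (?F ?a - ?F x - s *\<^sub>R ?T x (u + v)) + norm (?F ?b - ?F x - s *\<^sub>R ?T x u)
          + norm (?F ?a - ?F ?b - s *\<^sub>R ?T ?b v) + norm (s *\<^sub>R (?T ?b v - ?T x v))"
        unfolding E_eq by (rule tri)
      then have "norm (s *\<^sub>R E) \<le> s * (s * K)"
        using 1 2 3 4 scaled by linarith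
      then have "s * norm E \<le> s * (s * K)" using elim(3) by simp
      then show "norm E \<le> s * K" using elim(3) by simp
    qed
  qed
  have "((\<lambda>s. s * K) \<longlongrightarrow> 0 * K) (at_right 0)" by (intro tendsto_intros)
  then have "norm E \<le> 0 * K"
    by (rule tendsto_lowerbound[OF _ ev]) simp
  then show ?thesis by (simp add: E_def algebra_simps del: dd.simps)
qed

lemma dd_add:
  assumes f: "Cn n f" and "Suc (length us + length ws) < n"
  shows "dd f x (us @ (u + v) # ws) = dd f x (us @ u # ws) + dd f x (us @ v # ws)"
  using assms(2)
proof (induction us arbitrary: x)
  case Nil
  then show ?case using dd_add_first[OF f, of ws] by (simp del: dd.simps)
next
  case (Cons a us)
  then have IH: "dd f y (us @ (u + v) # ws) = dd f y (us @ u # ws) + dd f y (us @ v # ws)" for y by simp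
  have "line_deriv (\<lambda>y. dd f y (us @ u # ws)) x a (dd f x (a # us @ u # ws))"
       "line_deriv (\<lambda>y. dd f y (us @ v # ws)) x a (dd f x (a # us @ v # ws))"
    by (rule dd_line[OF f]; use Cons in simp)+
  then have "line_deriv (\<lambda>y. dd f y (us @ (u + v) # ws)) x a (dd f x (a # us @ u # ws) + dd f x (a # us @ v # ws))"
    unfolding IH by (rule has_vector_derivative_add)
  then show ?case by (simp add: vector_derivative_at)
qed

lemma Cn_has_derivative:
  assumes "Cn 2 f"
  shows "(f has_derivative (\<lambda>h. dd f x [h])) (at x)"
  unfolding has_derivative_iff_norm
proof
  obtain \<delta> C where \<delta>: "\<delta> > 0" "C \<ge> 1"
    and C: "\<And>y vs. y \<in> ball x \<delta> \<Longrightarrow> length vs \<le> 2 \<Longrightarrow> norm (dd f y vs) \<le> C * nprod vs"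
    using Cn_bound[OF assms] by metis
  show "bounded_linear (\<lambda>h. dd f x [h])"
  proof (rule bounded_linear_intro)
    show "dd f x [u + v] = dd f x [u] + dd f x [v]" for u v
      using dd_add[OF assms, of "[]" "[]"] by simp
    show "dd f x [c *\<^sub>R v] = c *\<^sub>R dd f x [v]" for c v
      using dd_scale[OF assms, of "[]" "[]"] by simp
    show "norm (dd f x [v]) \<le> norm v * C" for v
      using C[of x "[v]"] \<delta> by (simp add: mult.commute del: dd.simps)
  qed
  show "((\<lambda>y. norm (f y - f x - dd f x [y - x]) / norm (y - x)) \<longlongrightarrow> 0) (at x)"
  proof (rule Lim_null_comparison)
    have "norm (f y - f x - dd f x [y - x]) \<le> C * (norm (y - x))\<^sup>2" if "y \<in> ball x \<delta>" for y
      using dd_frechet[OF assms _ that _ C, where vs = "[]" and z = x] \<delta> by (simp del: dd.simps(2))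
    then show "\<forall>\<^sub>F y in at x. norm (norm (f y - f x - dd f x [y - x]) / norm (y - x)) \<le> C * norm (y - x)"
      unfolding eventually_at
    proof (intro exI[of _ \<delta>] conjI ballI impI)
      fix y assume *: "\<And>y. y \<in> ball x \<delta> \<Longrightarrow> norm (f y - f x - dd f x [y - x]) \<le> C * (norm (y - x))\<^sup>2"
        and y: "y \<noteq> x \<and> dist y x < \<delta>"
      from y have "norm (y - x) > 0" by simp
      then show "norm (norm (f y - f x - dd f x [y - x]) / norm (y - x)) \<le> C * norm (y - x)"
        using *[of y] y by (simp add: dist_commute pos_divide_le_eq power2_eq_square mult.assoc del: dd.simps)
    qed (use \<delta> in simp)
    have "((\<lambda>y. C * norm (y - x)) \<longlongrightarrow> C * norm (x - x)) (at x)" by (intro tendsto_intros)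
    then show "((\<lambda>y. C * norm (y - x)) \<longlongrightarrow> 0) (at x)" by simp
  qed
qed

text \<open>Prescribed candidates \<open>D\<close> avoid computing with the iterated
  \<open>vector_derivative\<close>. Bounds may be given for each length separately, since finitely
  many are merged on a smaller ball. Continuity is asked for at \<open>n = 0\<close> only, as
  otherwise the first-order bound makes \<open>f\<close> locally Lipschitz.\<close>

lemma CnI:
  assumes D0: "\<And>x. D x [] = f x"
    and D: "\<And>x v vs. length vs < n \<Longrightarrow> line_deriv (\<lambda>y. D y vs) x v (D x (v # vs))"
    and bd: "\<And>x k. k \<le> n \<Longrightarrow> \<exists>\<delta>>0. \<exists>C. \<forall>y\<in>ball x \<delta>. \<forall>vs. length vs = k \<longrightarrow> norm (D y vs) \<le> C * nprod vs"
    and cont: "n = 0 \<Longrightarrow> continuous_on UNIV f"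
  shows "Cn n f" and "length vs \<le> n \<Longrightarrow> dd f x vs = D x vs"
proof -
  have dd_eq: "dd f x vs = D x vs" if "length vs \<le> n" for x vs
    using that
  proof (induction vs arbitrary: x)
    case (Cons v vs)
    then have "(\<lambda>s. dd f (x + s *\<^sub>R v) vs) = (\<lambda>s. D (x + s *\<^sub>R v) vs)" by simp
    then show ?case using D[of vs x v] Cons.prems by (simp add: vector_derivative_at)
  qed (simp add: D0)
  have bd': "\<exists>\<delta>>0. \<exists>C. \<forall>y\<in>ball x \<delta>. \<forall>vs. length vs \<le> n \<longrightarrow> norm (D y vs) \<le> C * nprod vs" for x
  proof -
    have "\<exists>\<delta>>0. \<exists>C. \<forall>y\<in>ball x \<delta>. \<forall>vs. length vs \<le> m \<longrightarrow> norm (D y vs) \<le> C * nprod vs" if "m \<le> n" for m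
      using that
    proof (induction m)
      case 0
      then show ?case using bd[of 0 x] by simp
    next
      case (Suc m)
      then obtain \<delta> C where 1: "\<delta> > 0" "\<forall>y\<in>ball x \<delta>. \<forall>vs. length vs \<le> m \<longrightarrow> norm (D y vs) \<le> C * nprod vs"
        by auto
      obtain \<delta>' C' where 2: "\<delta>' > 0" "\<forall>y\<in>ball x \<delta>'. \<forall>vs. length vs = Suc m \<longrightarrow> norm (D y vs) \<le> C' * nprod vs"
        using bd[OF Suc.prems, of x] by auto
      have "norm (D y vs) \<le> max C C' * nprod vs" if "y \<in> ball x (min \<delta> \<delta>')" "length vs \<le> Suc m" for y vs
      proof (cases "length vs = Suc m")
        case True
        then have "norm (D y vs) \<le> C' * nprod vs" using 2 that by simp
        then show ?thesis using mult_right_mono[OF max.cobounded2[of C' C] nprod_nonneg[of vs]] by linarith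
      next
        case False
        then have "norm (D y vs) \<le> C * nprod vs" using 1 that by simp
        then show ?thesis using mult_right_mono[OF max.cobounded1[of C C'] nprod_nonneg[of vs]] by linarith
      qed
      then show ?case using 1(1) 2(1)
        by (intro exI[of _ "min \<delta> \<delta>'"] conjI exI[of _ "max C C'"]) auto
    qed
    then show ?thesis by simp
  qed
  have diff: "(\<lambda>s. dd f (x + s *\<^sub>R v) vs) differentiable (at 0)" if "length vs < n" for x v vs
  proof -
    have "(\<lambda>s. dd f (x + s *\<^sub>R v) vs) = (\<lambda>s. D (x + s *\<^sub>R v) vs)" using dd_eq that by simp
    then show ?thesis using D[OF that, of x v] by (simp add: differentiableI_vector)
  qed
  have "continuous_on UNIV f"
  proof (cases "n = 0")
    case False
    show ?thesis
    proof (rule continuous_at_imp_continuous_on, intro ballI)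
      fix x
      obtain \<delta> C where \<delta>: "\<delta> > 0" and C: "\<forall>y\<in>ball x \<delta>. \<forall>vs. length vs \<le> n \<longrightarrow> norm (D y vs) \<le> C * nprod vs"
        using bd'[of x] by auto
      have lip: "norm (f y - f x) \<le> C * norm (y - x)" if "y \<in> ball x \<delta>" for y
      proof (rule line_deriv_lipschitz[where S = "ball x \<delta>" and D = "\<lambda>z v. D z [v]"])
        show "line_deriv f z v (D z [v])" for z v using D[of "[]" z v] False by (simp add: D0)
        show "norm (D z [v]) \<le> C * norm v" if "z \<in> ball x \<delta>" for z v
          using C that False by (auto dest!: bspec[of _ _ z] spec[of _ "[v]"])
      qed (use that \<delta> in auto)
      have "((\<lambda>y. f y - f x) \<longlongrightarrow> 0) (at x)"
      proof (rule Lim_null_comparison)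
        show "\<forall>\<^sub>F y in at x. norm (f y - f x) \<le> C * norm (y - x)"
          unfolding eventually_at using lip \<delta> by (intro exI[of _ \<delta>]) (auto simp: dist_commute)
        have "((\<lambda>y. C * norm (y - x)) \<longlongrightarrow> C * norm (x - x)) (at x)" by (intro tendsto_intros)
        then show "((\<lambda>y. C * norm (y - x)) \<longlongrightarrow> 0) (at x)" by simp
      qed
      then show "isCont f x" by (simp add: continuous_at LIM_zero_iff)
    qed
  qed (rule cont)
  then show "Cn n f" unfolding Cn_def using diff bd' dd_eq by simp
  show "length vs \<le> n \<Longrightarrow> dd f x vs = D x vs" by (rule dd_eq)
qed

text \<open>The defining condition of \<open>smooth\<close>, read on a line, gives the directional
  derivatives because \<open>D\<close> is homogeneous in its first entry. Conversely, order
  \<open>k + 2\<close> of the scale bounds the remainder of the \<open>k\<close>-th derivative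
  quadratically and uniformly in the other entries, which is the operator norm condition.\<close>

lemma smooth_iff_Cn: "smooth f \<longleftrightarrow> (\<forall>n. Cn n f)"
proof
  assume "smooth f"
  then obtain D where D0: "\<And>x. D x [] = f x" and ml: "\<And>k x. bounded_multilinear k (D x)"
    and fr: "\<And>k x e. e > 0 \<Longrightarrow> \<forall>\<^sub>F h in nhds 0. \<forall>vs. length vs = k \<longrightarrow>
        norm (D (x + h) vs - D x vs - D x (h # vs)) \<le> e * norm h * nprod vs"
    unfolding smooth_def by blast
  have sc: "D x ((s *\<^sub>R v) # vs) = s *\<^sub>R D x (v # vs)" for x s v vs
  proof -
    have "\<forall>us ws. length us + length ws + 1 = Suc (length vs) \<longrightarrow> linear (\<lambda>v. D x (us @ v # ws))"
      using ml[of "Suc (length vs)" x] unfolding bounded_multilinear_def by blast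
    from this[rule_format, of "[]" vs] have "linear (\<lambda>v. D x ([] @ v # vs))" by simp
    from linear_cmul[OF this, of s v] show ?thesis by (simp only: append_Nil)
  qed
  show "\<forall>n. Cn n f"
  proof
    fix n
    show "Cn n f"
    proof (rule CnI(1)[of D])
      fix x v vs
      have "((\<lambda>s. (D (x + s *\<^sub>R v) vs - D x vs) /\<^sub>R s - D x (v # vs)) \<longlongrightarrow> 0) (at 0)"
      proof (rule tendstoI)
        fix e :: real assume e: "e > 0"
        define N where "N = norm v * nprod vs + 1"
        define e' where "e' = e / (2 * N)"
        have pos: "N > 0" using nprod_nonneg[of vs] by (simp add: N_def add_nonneg_pos)
        then have e': "e' > 0" using e by (simp add: e'_def)
        have lim: "((\<lambda>s. s *\<^sub>R v) \<longlongrightarrow> 0) (at (0::real))" by (auto intro!: tendsto_eq_intros)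
        have "\<forall>\<^sub>F s in at 0. \<forall>us. length us = length vs \<longrightarrow>
            norm (D (x + s *\<^sub>R v) us - D x us - D x ((s *\<^sub>R v) # us)) \<le> e' * norm (s *\<^sub>R v) * nprod us"
          by (rule eventually_compose_filterlim[OF fr[OF e'] lim])
        then show "\<forall>\<^sub>F s in at 0. dist ((D (x + s *\<^sub>R v) vs - D x vs) /\<^sub>R s - D x (v # vs)) 0 < e"
          using eventually_neq_at_within[of 0 0 UNIV]
        proof eventually_elim
          case (elim s)
          have "(D (x + s *\<^sub>R v) vs - D x vs) /\<^sub>R s - D x (v # vs)
              = (D (x + s *\<^sub>R v) vs - D x vs - D x ((s *\<^sub>R v) # vs)) /\<^sub>R s"
            using elim(2) by (simp add: sc scaleR_diff_right)
          also have "norm \<dots> = norm (D (x + s *\<^sub>R v) vs - D x vs - D x ((s *\<^sub>R v) # vs)) / \<bar>s\<bar>"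
            by (simp add: divide_inverse mult.commute)
          also have "\<dots> \<le> (e' * norm (s *\<^sub>R v) * nprod vs) / \<bar>s\<bar>"
            using elim(1) by (intro divide_right_mono) auto
          also have "\<dots> = e' * (norm v * nprod vs)" using elim(2) by simp
          also have "\<dots> \<le> e' * N" using e' by (simp add: N_def)
          also have "\<dots> = e / 2" using pos by (simp add: e'_def)
          finally show ?case using e by (simp add: dist_norm)
        qed
      qed
      then show "line_deriv (\<lambda>y. D y vs) x v (D x (v # vs))"
        by (simp add: has_vector_derivative_at_0_iff LIM_zero_iff)
    next
      fix x and k :: nat
      obtain C1 where C1: "\<And>vs. length vs = k \<Longrightarrow> norm (D x vs) \<le> C1 * nprod vs"
        using ml[of k x] unfolding bounded_multilinear_def by blast
      obtain C2 where C2: "\<And>vs. length vs = Suc k \<Longrightarrow> norm (D x vs) \<le> C2 * nprod vs"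
        using ml[of "Suc k" x] unfolding bounded_multilinear_def by blast
      obtain \<delta> where \<delta>: "\<delta> > 0" "\<And>h vs. norm h < \<delta> \<Longrightarrow> length vs = k \<Longrightarrow>
          norm (D (x + h) vs - D x vs - D x (h # vs)) \<le> 1 * norm h * nprod vs"
        using fr[of 1 k x] by (auto simp: eventually_nhds_metric)
      have "norm (D y vs) \<le> (C1 + (\<bar>C2\<bar> + 1) * \<delta>) * nprod vs" if y: "y \<in> ball x \<delta>" and k: "length vs = k" for y vs
      proof -
        define h where "h = y - x"
        have h: "norm h < \<delta>" "y = x + h" using y by (auto simp: h_def dist_norm norm_minus_commute)
        have "norm (D y vs) \<le> norm (D y vs - D x vs - D x (h # vs)) + norm (D x vs) + norm (D x (h # vs))"
          using norm_triangle_ineq[of "D y vs - D x vs - D x (h # vs)" "D x vs + D x (h # vs)"]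
            norm_triangle_ineq[of "D x vs" "D x (h # vs)"] by (simp add: algebra_simps)
        moreover have "norm (D y vs - D x vs - D x (h # vs)) \<le> \<delta> * nprod vs"
          using \<delta>(2)[OF h(1) k] mult_right_mono[OF less_imp_le[OF h(1)] nprod_nonneg[of vs]] h(2) by simp
        moreover have "norm (D x (h # vs)) \<le> (\<bar>C2\<bar> * \<delta>) * nprod vs"
        proof -
          have "norm (D x (h # vs)) \<le> C2 * (norm h * nprod vs)" using C2[of "h # vs"] k by simp
          also have "\<dots> \<le> \<bar>C2\<bar> * (\<delta> * nprod vs)"
            using h(1) by (intro mult_mono mult_right_mono) (auto intro!: mult_nonneg_nonneg nprod_nonneg)
          finally show ?thesis by (simp add: mult_ac)
        qed
        moreover note C1[OF k]
        ultimately show ?thesis by (simp add: algebra_simps)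
      qed
      then show "\<exists>\<delta>>0. \<exists>C. \<forall>y\<in>ball x \<delta>. \<forall>vs. length vs = k \<longrightarrow> norm (D y vs) \<le> C * nprod vs"
        using \<delta>(1) by blast
    next
      show "continuous_on UNIV f"
      proof (rule continuous_at_imp_continuous_on, intro ballI)
        fix x
        obtain C2 where C2: "\<And>vs. length vs = 1 \<Longrightarrow> norm (D x vs) \<le> C2 * nprod vs"
          using ml[of 1 x] unfolding bounded_multilinear_def by blast
        have "((\<lambda>h. f (x + h) - f x) \<longlongrightarrow> 0) (at 0)"
        proof (rule Lim_null_comparison)
          have "\<forall>\<^sub>F h in at 0. norm (D (x + h) [] - D x [] - D x [h]) \<le> 1 * norm h"
            using fr[of 1 0 x] by (auto simp: eventually_at_filter elim!: eventually_mono)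
          then show "\<forall>\<^sub>F h in at 0. norm (f (x + h) - f x) \<le> (C2 + 1) * norm h"
          proof eventually_elim
            case (elim h)
            have "norm (D x [h]) \<le> C2 * norm h" using C2[of "[h]"] by simp
            then show ?case using elim norm_triangle_sub[of "f (x + h) - f x" "D x [h]"]
              by (simp add: D0 algebra_simps)
          qed
          show "((\<lambda>h. (C2 + 1) * norm h) \<longlongrightarrow> 0) (at (0::'a))"
            by (rule tendsto_mult_right_zero[OF tendsto_norm_zero[OF tendsto_ident_at]])
        qed
        then show "isCont f x" by (simp add: isCont_iff LIM_zero_iff)
      qed
    qed (rule D0)
  qed
next
  assume *: "\<forall>n. Cn n f"
  show "smooth f"
    unfolding smooth_def
  proof (intro exI[of _ "dd f"] conjI allI impI)
    fix k x
    show "bounded_multilinear k (dd f x)"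
      unfolding bounded_multilinear_def
    proof (intro conjI allI impI)
      fix vs ws :: "'a list" assume len: "length vs + length ws + 1 = k"
      have f: "Cn (Suc k) f" using * by blast
      show "linear (\<lambda>v. dd f x (vs @ v # ws))"
        by (rule linearI) (use dd_add[OF f] dd_scale[OF f] len in simp)+
    next
      obtain \<delta> C where \<delta>: "\<delta> > 0" and C: "\<And>y vs. y \<in> ball x \<delta> \<Longrightarrow> length vs \<le> k \<Longrightarrow> norm (dd f y vs) \<le> C * nprod vs"
        using Cn_bound[of k f x] * by metis
      show "\<exists>C. \<forall>vs. length vs = k \<longrightarrow> norm (dd f x vs) \<le> C * nprod vs"
        using C[of x] \<delta> by (auto intro!: exI[of _ C])
    qed
  next
    fix k x and e :: real assume e: "e > 0"
    have f: "Cn (k + 2) f" using * by blast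
    obtain \<delta> C where \<delta>: "\<delta> > 0" "C \<ge> 1"
      and C: "\<And>y vs. y \<in> ball x \<delta> \<Longrightarrow> length vs \<le> k + 2 \<Longrightarrow> norm (dd f y vs) \<le> C * nprod vs"
      using Cn_bound[OF f] by metis
    have "norm (dd f (x + h) vs - dd f x vs - dd f x (h # vs)) \<le> e * norm h * nprod vs"
      if h: "norm h < min \<delta> (e / C)" and len: "length vs = k" for h vs
    proof -
      have x: "x \<in> ball x \<delta>" and xh: "x + h \<in> ball x \<delta>"
        using h \<delta> by (auto simp: dist_norm)
      have "norm (dd f (x + h) vs - dd f x vs - dd f x (h # vs)) \<le> C * nprod vs * (norm h)\<^sup>2"
        using dd_frechet[OF f _ xh x C] len by (simp only: add_diff_cancel_left')
      also have "\<dots> = (C * norm h) * (norm h * nprod vs)" by (simp add: power2_eq_square mult_ac)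
      also have "\<dots> \<le> e * (norm h * nprod vs)"
        using h \<delta> by (intro mult_right_mono mult_nonneg_nonneg nprod_nonneg) (auto simp: field_simps)
      finally show ?thesis by (simp add: mult_ac)
    qed
    then show "\<forall>\<^sub>F h in nhds 0. \<forall>vs. length vs = k \<longrightarrow>
        norm (dd f (x + h) vs - dd f x vs - dd f x (h # vs)) \<le> e * norm h * nprod vs"
      unfolding eventually_nhds_metric using e \<delta>
      by (intro exI[of _ "min \<delta> (e / C)"]) (simp add: dist_norm del: dd.simps)
  qed simp
qed

declare dd.simps(2) [simp del]

subsection \<open>Composition\<close>

lemma dd_0: "Cn n f \<Longrightarrow> length us + length ws < n \<Longrightarrow> dd f x (us @ 0 # ws) = 0"
  using dd_scale[of n f us ws x 0 0] by simp

lemma tendsto_nprod: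
  assumes "list_all2 (\<lambda>w w0. (w \<longlongrightarrow> w0) F) ws ws0"
  shows "((\<lambda>s. nprod (map (\<lambda>w. w s) ws)) \<longlongrightarrow> nprod ws0) F"
  using assms
proof (induction rule: list_all2_induct)
  case (Cons w ws w0 ws0)
  have "((\<lambda>s. norm (w s) * nprod (map (\<lambda>w. w s) ws)) \<longlongrightarrow> norm w0 * nprod ws0) F"
    by (intro tendsto_mult tendsto_norm Cons)
  then show ?case by simp
qed simp

text \<open>Joint continuity in the point and the entries. The moving entries \<open>ws\<close> are
  replaced one after another by their limits and join the fixed entries \<open>cs\<close>; each
  replacement costs a term that the local bound sends to zero.\<close>

lemma dd_tendsto:
  assumes f: "Cn n f" and y: "(y \<longlongrightarrow> y0) F"
    and ws: "list_all2 (\<lambda>w w0. (w \<longlongrightarrow> w0) F) ws ws0" and "length cs + length ws < n"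
  shows "((\<lambda>s. dd f (y s) (cs @ map (\<lambda>w. w s) ws)) \<longlongrightarrow> dd f y0 (cs @ ws0)) F"
  using ws assms(4)
proof (induction arbitrary: cs rule: list_all2_induct)
  case Nil
  then have "continuous_on UNIV (\<lambda>x. dd f x cs)" by (intro dd_continuous[OF f]) simp
  from continuous_on_tendsto_compose[OF this y] show ?case by simp
next
  case (Cons w ws w0 ws0)
  obtain \<delta> C where \<delta>: "\<delta> > 0" "C \<ge> 1"
    and C: "\<And>y vs. y \<in> ball y0 \<delta> \<Longrightarrow> length vs \<le> n \<Longrightarrow> norm (dd f y vs) \<le> C * nprod vs"
    using Cn_bound[OF f] by metis
  define R where "R s = dd f (y s) (cs @ (w s - w0) # map (\<lambda>w. w s) ws)" for s
  have "((\<lambda>s. dd f (y s) ((cs @ [w0]) @ map (\<lambda>w. w s) ws)) \<longlongrightarrow> dd f y0 ((cs @ [w0]) @ ws0)) F"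
    by (rule Cons.IH) (use Cons.prems in simp)
  moreover have "(R \<longlongrightarrow> 0) F"
  proof (rule Lim_null_comparison)
    have "((\<lambda>s. norm (w s - w0)) \<longlongrightarrow> 0) F"
      by (rule tendsto_norm_zero) (use Cons.hyps(1) LIM_zero in blast)
    then have "((\<lambda>s. (C * nprod cs) * (norm (w s - w0) * nprod (map (\<lambda>w. w s) ws))) \<longlongrightarrow> (C * nprod cs) * (0 * nprod ws0)) F"
      by (intro tendsto_mult tendsto_const tendsto_nprod Cons.hyps(2))
    then show "((\<lambda>s. (C * nprod cs) * (norm (w s - w0) * nprod (map (\<lambda>w. w s) ws))) \<longlongrightarrow> 0) F" by simp
    have "\<forall>\<^sub>F s in F. y s \<in> ball y0 \<delta>"
      using tendstoD[OF y \<delta>(1)] by (simp add: dist_commute)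
    then show "\<forall>\<^sub>F s in F. norm (R s) \<le> (C * nprod cs) * (norm (w s - w0) * nprod (map (\<lambda>w. w s) ws))"
    proof eventually_elim
      case (elim s)
      show ?case
        using C[OF elim, of "cs @ (w s - w0) # map (\<lambda>w. w s) ws"] Cons.prems list_all2_lengthD[OF Cons.hyps(2)]
        unfolding R_def by (simp add: mult.assoc)
    qed
  qed
  ultimately have "((\<lambda>s. dd f (y s) ((cs @ [w0]) @ map (\<lambda>w. w s) ws) + R s) \<longlongrightarrow> dd f y0 ((cs @ [w0]) @ ws0) + 0) F"
    by (rule tendsto_add)
  moreover have "dd f (y s) (cs @ w s # map (\<lambda>w. w s) ws) = dd f (y s) ((cs @ [w0]) @ map (\<lambda>w. w s) ws) + R s" for s
    using dd_add[OF f, of cs "map (\<lambda>w. w s) ws" "y s" w0 "w s - w0"] Cons.prems by (simp add: R_def)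
  ultimately show ?case by simp
qed

text \<open>All lists that arise from the first argument by replacing one entry by the corresponding entry
  of the second one, as in the product rule for a multilinear map.\<close>

fun slots :: "'a list \<Rightarrow> 'a list \<Rightarrow> 'a list list" where
  "slots (w # ws) (w' # ws') = (w' # ws) # map ((#) w) (slots ws ws')"
| "slots _ _ = []"

text \<open>Moving entries are frozen one at a time at their values in 0. The leftover
  \<open>R\<close>, with \<open>w s - w 0\<close> in one slot, vanishes at 0; its difference
  quotient has \<open>(w s - w 0) /\<^sub>R s\<close> in that slot and converges by
  \<open>dd_tendsto\<close>.\<close>

lemma dd_curve:
  assumes f: "Cn n f" and y: "(y has_vector_derivative y') (at 0)"
    and ws: "list_all2 (\<lambda>w w'. (w has_vector_derivative w') (at (0::real))) ws ws'"
    and "length cs + length ws < n"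
  shows "((\<lambda>s. dd f (y s) (cs @ map (\<lambda>w. w s) ws)) has_vector_derivative
    (dd f (y 0) (y' # cs @ map (\<lambda>w. w 0) ws) +
     (\<Sum>l\<leftarrow>slots (map (\<lambda>w. w 0) ws) ws'. dd f (y 0) (cs @ l)))) (at 0)"
  using ws assms(4)
proof (induction arbitrary: cs rule: list_all2_induct)
  case Nil
  obtain \<delta> C where \<delta>: "\<delta> > 0" "C \<ge> 1"
    and C: "\<And>z vs. z \<in> ball (y 0) \<delta> \<Longrightarrow> length vs \<le> n \<Longrightarrow> norm (dd f z vs) \<le> C * nprod vs"
    using Cn_bound[OF f] by metis
  have "((\<lambda>s. dd f (y s) cs) has_vector_derivative dd f (y 0) (y' # cs)) (at 0)"
  proof (rule line_deriv_curve[OF _ \<delta>(1) _ y])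
    show "norm (dd f a cs - dd f b cs) \<le> (C * nprod cs) * norm (a - b)"
      if "a \<in> ball (y 0) \<delta>" "b \<in> ball (y 0) \<delta>" for a b
      by (rule dd_lipschitz[OF f _ that C]) (use Nil in simp_all)
    show "line_deriv (\<lambda>x. dd f x cs) (y 0) y' (dd f (y 0) (y' # cs))"
      by (rule dd_line[OF f]) (use Nil in simp)
  qed
  then show ?case by simp
next
  case (Cons w ws w' ws')
  define R where "R s = dd f (y s) (cs @ (w s - w 0) # map (\<lambda>w. w s) ws)" for s
  have len: "length ws = length ws'" using Cons.hyps(2) by (rule list_all2_lengthD)
  have 1: "((\<lambda>s. dd f (y s) ((cs @ [w 0]) @ map (\<lambda>w. w s) ws)) has_vector_derivative
      (dd f (y 0) (y' # (cs @ [w 0]) @ map (\<lambda>w. w 0) ws) +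
       (\<Sum>l\<leftarrow>slots (map (\<lambda>w. w 0) ws) ws'. dd f (y 0) ((cs @ [w 0]) @ l)))) (at 0)"
    by (rule Cons.IH) (use Cons.prems in simp)
  have quot: "((\<lambda>s. (w s - w 0) /\<^sub>R s) \<longlongrightarrow> w') (at 0)"
    using Cons.hyps(1) by (rule has_vector_derivative_at_0_iff[THEN iffD1])
  have ws_lim: "list_all2 (\<lambda>w w0. (w \<longlongrightarrow> w0) (at 0)) ws (map (\<lambda>w. w 0) ws)"
    unfolding list_all2_map2
  proof (rule list_all2_all_nthI)
    fix i assume "i < length ws"
    then have "((ws ! i) has_vector_derivative (ws' ! i)) (at 0)"
      using Cons.hyps(2) by (simp add: list_all2_conv_all_nth)
    from has_vector_derivative_continuous[OF this]
    show "((ws ! i) \<longlongrightarrow> (ws ! i) 0) (at 0)" by (simp add: continuous_at)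
  qed simp
  have y_lim: "(y \<longlongrightarrow> y 0) (at 0)"
    using has_vector_derivative_continuous[OF y] by (simp add: continuous_at)
  have R0: "R 0 = 0" unfolding R_def using dd_0[OF f] Cons.prems by simp
  have "((\<lambda>s. dd f (y s) (cs @ map (\<lambda>w. w s) ((\<lambda>s. (w s - w 0) /\<^sub>R s) # ws))) \<longlongrightarrow>
      dd f (y 0) (cs @ w' # map (\<lambda>w. w 0) ws)) (at 0)"
    by (rule dd_tendsto[OF f y_lim]) (use quot ws_lim Cons.prems in simp_all)
  moreover have "dd f (y s) (cs @ map (\<lambda>w. w s) ((\<lambda>s. (w s - w 0) /\<^sub>R s) # ws)) = (R s - R 0) /\<^sub>R s" for s
    using dd_scale[OF f, of cs "map (\<lambda>w. w s) ws" "y s" "inverse s" "w s - w 0"] Cons.prems R0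
    by (simp add: R_def)
  ultimately have "((\<lambda>s. (R s - R 0) /\<^sub>R s) \<longlongrightarrow> dd f (y 0) (cs @ w' # map (\<lambda>w. w 0) ws)) (at 0)" by simp
  then have 2: "(R has_vector_derivative dd f (y 0) (cs @ w' # map (\<lambda>w. w 0) ws)) (at 0)"
    by (rule has_vector_derivative_at_0_iff[THEN iffD2])
  have "dd f (y s) (cs @ w s # map (\<lambda>w. w s) ws) = dd f (y s) ((cs @ [w 0]) @ map (\<lambda>w. w s) ws) + R s" for s
    using dd_add[OF f, of cs "map (\<lambda>w. w s) ws" "y s" "w 0" "w s - w 0"] Cons.prems by (simp add: R_def)
  then have "(\<lambda>s. dd f (y s) (cs @ map (\<lambda>w. w s) (w # ws))) =
      (\<lambda>s. dd f (y s) ((cs @ [w 0]) @ map (\<lambda>w. w s) ws) + R s)" by simp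
  moreover have "(dd f (y 0) (y' # (cs @ [w 0]) @ map (\<lambda>w. w 0) ws) +
       (\<Sum>l\<leftarrow>slots (map (\<lambda>w. w 0) ws) ws'. dd f (y 0) ((cs @ [w 0]) @ l))) +
      dd f (y 0) (cs @ w' # map (\<lambda>w. w 0) ws) =
    dd f (y 0) (y' # cs @ map (\<lambda>w. w 0) (w # ws)) +
      (\<Sum>l\<leftarrow>slots (map (\<lambda>w. w 0) (w # ws)) (w' # ws'). dd f (y 0) (cs @ l))"
    by (simp add: o_def)
  ultimately show ?case
    using has_vector_derivative_add[OF 1 2] by (simp only:)
qed

text \<open>\<open>parts vs\<close> enumerates the partitions of \<open>vs\<close> into nonempty blocks, the index set of
  Faa di Bruno's formula.\<close>

fun bump :: "'a \<Rightarrow> 'a list list \<Rightarrow> 'a list list list" where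
  "bump v [] = []"
| "bump v (B # P) = ((v # B) # P) # map ((#) B) (bump v P)"

fun parts :: "'a list \<Rightarrow> 'a list list list" where
  "parts [] = [[]]"
| "parts (v # vs) = concat (map (\<lambda>P. ([v] # P) # bump v P) (parts vs))"

text \<open>The product rule over the blocks of a partition in combinatorial form: the derivative
  hits one block, and \<open>bump\<close> adds the new direction to that block.\<close>

lemma slots_map: "slots (map h P) (map (\<lambda>B. h (v # B)) P) = map (map h) (bump v P)"
  by (induction P) (simp_all add: o_def)

lemma length_bump: "length (bump v P) = length P"
  by (induction P) simp_all

lemma bump_props:
  assumes "Q \<in> set (bump v P)" "\<forall>B\<in>set P. length B \<le> m"
  shows "length Q = length P" "\<forall>B\<in>set Q. length B \<le> Suc m"
    "prod_list (map nprod Q) = norm v * prod_list (map nprod P)"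
  using assms by (induction P arbitrary: Q) (auto, force+)

lemma parts_props:
  assumes "P \<in> set (parts vs)"
  shows "length P \<le> length vs" "\<forall>B\<in>set P. length B \<le> length vs"
    "prod_list (map nprod P) = nprod vs"
proof -
  have "length P \<le> length vs \<and> (\<forall>B\<in>set P. length B \<le> length vs) \<and> prod_list (map nprod P) = nprod vs"
    using assms
  proof (induction vs arbitrary: P)
    case (Cons v vs)
    then obtain P' where P': "P' \<in> set (parts vs)" "P = [v] # P' \<or> P \<in> set (bump v P')" by auto
    note IH = Cons.IH[OF P'(1)]
    from P'(2) show ?case
    proof
      assume "P = [v] # P'" then show ?thesis using IH by auto
    next
      assume "P \<in> set (bump v P')"
      from bump_props[OF this, of "length vs"] show ?thesis using IH by auto
    qed
  qed simp
  then show "length P \<le> length vs" "\<forall>B\<in>set P. length B \<le> length vs"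
    "prod_list (map nprod P) = nprod vs" by blast+
qed

text \<open>A crude bound for the Bell numbers: a partition of a list of length \<open>m\<close> has
  at most \<open>m\<close> blocks, so it extends in at most \<open>m + 1\<close> ways.\<close>

lemma length_parts: "length (parts vs) \<le> fact (length vs)" for vs :: "'a::real_normed_vector list"
proof (induction vs)
  case (Cons v vs)
  have "length (parts (v # vs)) = (\<Sum>P\<leftarrow>parts vs. Suc (length P))"
    by (simp add: length_concat o_def length_bump)
  also have "\<dots> \<le> (\<Sum>P\<leftarrow>parts vs. Suc (length vs))"
    by (rule sum_list_mono) (simp add: parts_props(1))
  also have "\<dots> = Suc (length vs) * length (parts vs)" by (simp add: sum_list_triv)
  also have "\<dots> \<le> Suc (length vs) * fact (length vs)" using Cons by (intro mult_le_mono) auto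
  finally show ?case by simp
qed simp

lemma sum_list_concat_map: "sum_list (map t (concat (map h xs))) = (\<Sum>x\<leftarrow>xs. sum_list (map t (h x)))"
  for t :: "'a \<Rightarrow> 'b::monoid_add"
  by (induction xs) simp_all

lemma has_vector_derivative_sum_list:
  assumes "\<And>P. P \<in> set Ps \<Longrightarrow> (F P has_vector_derivative F' P) net"
  shows "((\<lambda>s. \<Sum>P\<leftarrow>Ps. F P s) has_vector_derivative (\<Sum>P\<leftarrow>Ps. F' P)) net"
  using assms by (induction Ps) (auto intro!: has_vector_derivative_add)

lemma norm_sum_list_le:
  assumes "\<And>P. P \<in> set Ps \<Longrightarrow> norm (t P) \<le> b"
  shows "norm (\<Sum>P\<leftarrow>Ps. t P) \<le> real (length Ps) * b"
  using assms
proof (induction Ps)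
  case (Cons P Ps)
  then have "norm (\<Sum>P\<leftarrow>Ps. t P) \<le> real (length Ps) * b" "norm (t P) \<le> b" by simp_all
  then show ?case using norm_triangle_ineq[of "t P" "\<Sum>P\<leftarrow>Ps. t P"] by (simp add: algebra_simps)
qed simp

lemma prod_list_norm_le:
  assumes "\<And>B. B \<in> set P \<Longrightarrow> norm (h B) \<le> C * nprod B" "C \<ge> 0"
  shows "nprod (map h P) \<le> C ^ length P * prod_list (map nprod P)"
  using assms(1)
proof (induction P)
  case (Cons B P)
  have "norm (h B) * nprod (map h P) \<le> (C * nprod B) * (C ^ length P * prod_list (map nprod P))"
    by (rule mult_mono[OF _ _ _ nprod_nonneg])
      (use Cons assms(2) nprod_nonneg[of B] in \<open>simp_all del: map_map\<close>)
  then show ?case by (simp add: mult_ac del: map_map)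
qed simp

text \<open>Faa di Bruno's formula serves as the candidate. Differentiating the point
  \<open>f x\<close> in a summand opens the new block \<open>[v]\<close>; differentiating an entry
  enlarges an old block. Together these are the partitions of \<open>v # vs\<close>.\<close>

lemma Cn_compose:
  assumes g: "Cn n g" and f: "Cn n f"
  shows "Cn n (\<lambda>x. g (f x))"
proof (rule CnI(1)[of "\<lambda>x vs. \<Sum>P\<leftarrow>parts vs. dd g (f x) (map (dd f x) P)"])
  fix x v and vs :: "'c list" assume vs: "length vs < n"
  have "((\<lambda>s. \<Sum>P\<leftarrow>parts vs. dd g (f (x + s *\<^sub>R v)) (map (dd f (x + s *\<^sub>R v)) P)) has_vector_derivative
     (\<Sum>P\<leftarrow>parts vs. dd g (f x) (dd f x [v] # map (dd f x) P) +
        (\<Sum>Q\<leftarrow>bump v P. dd g (f x) (map (dd f x) Q)))) (at 0)"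
  proof (rule has_vector_derivative_sum_list)
    fix P assume P: "P \<in> set (parts vs)"
    have lf: "line_deriv f x v (dd f x [v])" using dd_line[OF f, of "[]"] vs by simp
    have ld: "list_all2 (\<lambda>w w'. (w has_vector_derivative w') (at (0::real)))
        (map (\<lambda>B s. dd f (x + s *\<^sub>R v) B) P) (map (\<lambda>B. dd f x (v # B)) P)"
      unfolding list_all2_map1 list_all2_map2 list.rel_refl_strong
      by (rule list.rel_refl_strong) (use dd_line[OF f] parts_props(2)[OF P] vs in force)
    have "((\<lambda>s. dd g (f (x + s *\<^sub>R v)) ([] @ map (\<lambda>w. w s) (map (\<lambda>B s. dd f (x + s *\<^sub>R v) B) P)))
        has_vector_derivative (dd g (f (x + 0 *\<^sub>R v)) (dd f x [v] # [] @ map (\<lambda>w. w 0) (map (\<lambda>B s. dd f (x + s *\<^sub>R v) B) P)) +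
        (\<Sum>l\<leftarrow>slots (map (\<lambda>w. w 0) (map (\<lambda>B s. dd f (x + s *\<^sub>R v) B) P)) (map (\<lambda>B. dd f x (v # B)) P).
            dd g (f (x + 0 *\<^sub>R v)) ([] @ l)))) (at 0)"
      by (rule dd_curve[OF g lf ld]) (use parts_props(1)[OF P] vs in simp)
    then show "((\<lambda>s. dd g (f (x + s *\<^sub>R v)) (map (dd f (x + s *\<^sub>R v)) P)) has_vector_derivative
       (dd g (f x) (dd f x [v] # map (dd f x) P) +
        (\<Sum>Q\<leftarrow>bump v P. dd g (f x) (map (dd f x) Q)))) (at 0)"
      by (simp add: o_def slots_map)
  qed
  then show "line_deriv (\<lambda>x. \<Sum>P\<leftarrow>parts vs. dd g (f x) (map (dd f x) P)) x v
      (\<Sum>P\<leftarrow>parts (v # vs). dd g (f x) (map (dd f x) P))"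
    by (simp only: parts.simps sum_list_concat_map list.map sum_list.Cons)
next
  fix x and k :: nat assume k: "k \<le> n"
  obtain \<delta>f Cf where \<delta>f: "\<delta>f > 0" "Cf \<ge> 1"
    and Cf: "\<And>y vs. y \<in> ball x \<delta>f \<Longrightarrow> length vs \<le> n \<Longrightarrow> norm (dd f y vs) \<le> Cf * nprod vs"
    using Cn_bound[OF f] by metis
  obtain \<delta>g Cg where \<delta>g: "\<delta>g > 0" "Cg \<ge> 1"
    and Cg: "\<And>y vs. y \<in> ball (f x) \<delta>g \<Longrightarrow> length vs \<le> n \<Longrightarrow> norm (dd g y vs) \<le> Cg * nprod vs"
    using Cn_bound[OF g] by metis
  have "isCont f x" using Cn_continuous[OF f] by (simp add: continuous_on_eq_continuous_at)
  then obtain \<delta> where \<delta>: "\<delta> > 0" "\<And>y. dist y x < \<delta> \<Longrightarrow> dist (f y) (f x) < \<delta>g"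
    using \<delta>g(1) unfolding continuous_at_eps_delta by blast
  define M where "M = Cg * Cf ^ n"
  have M: "M \<ge> 0" using \<delta>f \<delta>g by (simp add: M_def)
  have "norm (\<Sum>P\<leftarrow>parts vs. dd g (f y) (map (dd f y) P)) \<le> (fact k * M) * nprod vs"
    if y: "y \<in> ball x (min \<delta> \<delta>f)" and len: "length vs = k" for y vs
  proof -
    have "norm (\<Sum>P\<leftarrow>parts vs. dd g (f y) (map (dd f y) P)) \<le> real (length (parts vs)) * (M * nprod vs)"
    proof (rule norm_sum_list_le)
      fix P assume P: "P \<in> set (parts vs)"
      note pp = parts_props[OF P]
      have fy: "f y \<in> ball (f x) \<delta>g" using \<delta>(2)[of y] y by (simp add: dist_commute)
      have "nprod (map (dd f y) P) \<le> Cf ^ length P * prod_list (map nprod P)"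
        by (rule prod_list_norm_le, rule Cf) (use y pp len k \<delta>f in force)+
      also have "\<dots> \<le> Cf ^ n * nprod vs"
        unfolding pp(3) using pp(1) len k \<delta>f by (intro mult_right_mono power_increasing nprod_nonneg) auto
      finally have 1: "nprod (map (dd f y) P) \<le> Cf ^ n * nprod vs" .
      have "norm (dd g (f y) (map (dd f y) P)) \<le> Cg * nprod (map (dd f y) P)"
        by (rule Cg[OF fy]) (use pp len k in simp)
      also have "\<dots> \<le> Cg * (Cf ^ n * nprod vs)"
        using 1 \<delta>g by (intro mult_left_mono) auto
      finally show "norm (dd g (f y) (map (dd f y) P)) \<le> M * nprod vs"
        by (simp add: M_def mult.assoc)
    qed
    also have "\<dots> \<le> fact k * (M * nprod vs)"
    proof (rule mult_right_mono)
      show "real (length (parts vs)) \<le> fact k" using length_parts[of vs] len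
        by (metis of_nat_fact of_nat_le_iff)
    qed (intro mult_nonneg_nonneg M nprod_nonneg)
    finally show ?thesis by (simp add: mult.assoc)
  qed
  then show "\<exists>\<delta>>0. \<exists>C. \<forall>y\<in>ball x \<delta>. \<forall>vs. length vs = k \<longrightarrow>
      norm (\<Sum>P\<leftarrow>parts vs. dd g (f y) (map (dd f y) P)) \<le> C * nprod vs"
    using \<delta>(1) \<delta>f(1) by (intro exI[of _ "min \<delta> \<delta>f"] conjI exI[of _ "fact k * M"]) auto
next
  show "continuous_on UNIV (\<lambda>x. g (f x))"
    using continuous_on_compose2[OF Cn_continuous[OF g] Cn_continuous[OF f]] by simp
qed simp

subsection \<open>Closure properties\<close>

lemma Cn_const: "Cn n (\<lambda>x. c)"
proof (rule CnI(1)[of "\<lambda>x vs. if vs = [] then c else 0"])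
  fix x :: 'a and k :: nat
  have "norm (if vs = [] then c else 0) \<le> norm c * nprod vs" for vs :: "'a list"
    by (auto simp: nprod_nonneg)
  then show "\<exists>\<delta>>0. \<exists>C. \<forall>y\<in>ball x \<delta>. \<forall>vs::'a list. length vs = k \<longrightarrow>
      norm (if vs = [] then c else 0) \<le> C * nprod vs"
    by (intro exI[of _ 1] conjI exI[of _ "norm c"]) auto
qed auto

lemma Cn_bounded_linear:
  assumes f: "bounded_linear f"
  shows "Cn n f"
proof -
  interpret f: bounded_linear f by fact
  define D where "D x vs = (case vs of [] \<Rightarrow> f x | [v] \<Rightarrow> f v | _ \<Rightarrow> 0)" for x vs
  obtain K where K: "\<And>x. norm (f x) \<le> norm x * K" "K > 0" using f.pos_bounded by blast
  show ?thesis
  proof (rule CnI(1)[of D])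
    fix x v and vs :: "'a list"
    show "line_deriv (\<lambda>y. D y vs) x v (D x (v # vs))"
    proof (cases vs)
      case Nil
      have "((\<lambda>s. f x + s *\<^sub>R f v) has_vector_derivative f v) (at 0)"
        by (auto intro!: derivative_eq_intros)
      then show ?thesis by (simp add: Nil D_def f.add f.scaleR)
    next
      case (Cons w ws)
      then show ?thesis by (cases ws) (simp_all add: D_def)
    qed
  next
    fix x and k :: nat
    have "norm (D y vs) \<le> (K * (norm x + 2)) * nprod vs" if "y \<in> ball x 1" for y vs
    proof (cases vs)
      case Nil
      have "norm y \<le> norm x + 1"
        using that norm_triangle_ineq2[of y x] by (simp add: dist_norm norm_minus_commute)
      then have "norm y * K \<le> (norm x + 2) * K" using K(2) by (intro mult_right_mono) auto
      then show ?thesis using K(1)[of y] by (simp add: Nil D_def mult.commute)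
    next
      case (Cons w ws)
      show ?thesis
      proof (cases ws)
        case Nil
        have "norm w * K * 1 \<le> norm w * K * (norm x + 2)"
          using K(2) by (intro mult_left_mono) auto
        then show ?thesis using K(1)[of w] Cons Nil by (simp add: D_def mult_ac)
      next
        case (Cons a as)
        then show ?thesis using \<open>vs = w # ws\<close> K(2) nprod_nonneg[of as]
          by (simp add: D_def add_nonneg_nonneg)
      qed
    qed
    then show "\<exists>\<delta>>0. \<exists>C. \<forall>y\<in>ball x \<delta>. \<forall>vs. length vs = k \<longrightarrow> norm (D y vs) \<le> C * nprod vs"
      by (intro exI[of _ 1] conjI exI[of _ "K * (norm x + 2)"]) auto
  qed (auto simp: D_def intro: f.continuous_on)
qed

lemma Cn_Pair:
  assumes f: "Cn n f" and g: "Cn n g"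
  shows "Cn n (\<lambda>x. (f x, g x))"
proof (rule CnI(1)[of "\<lambda>x vs. (dd f x vs, dd g x vs)"])
  show "line_deriv (\<lambda>y. (dd f y vs, dd g y vs)) x v (dd f x (v # vs), dd g x (v # vs))"
    if "length vs < n" for x v vs
    by (intro has_vector_derivative_Pair dd_line[OF f that] dd_line[OF g that])
next
  fix x and k :: nat assume k: "k \<le> n"
  obtain \<delta>f Cf where f': "\<delta>f > 0" "\<And>y vs. y \<in> ball x \<delta>f \<Longrightarrow> length vs \<le> n \<Longrightarrow> norm (dd f y vs) \<le> Cf * nprod vs"
    using Cn_bound[OF f] by metis
  obtain \<delta>g Cg where g': "\<delta>g > 0" "\<And>y vs. y \<in> ball x \<delta>g \<Longrightarrow> length vs \<le> n \<Longrightarrow> norm (dd g y vs) \<le> Cg * nprod vs"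
    using Cn_bound[OF g] by metis
  have "norm (dd f y vs, dd g y vs) \<le> (Cf + Cg) * nprod vs"
    if "y \<in> ball x (min \<delta>f \<delta>g)" "length vs = k" for y vs
    using norm_Pair_le[of "dd f y vs" "dd g y vs"] f'(2)[of y vs] g'(2)[of y vs] that k
    by (simp add: distrib_right)
  then show "\<exists>\<delta>>0. \<exists>C. \<forall>y\<in>ball x \<delta>. \<forall>vs. length vs = k \<longrightarrow> norm (dd f y vs, dd g y vs) \<le> C * nprod vs"
    using f'(1) g'(1) by (intro exI[of _ "min \<delta>f \<delta>g"] conjI exI[of _ "Cf + Cg"]) auto
qed (auto intro!: continuous_on_Pair Cn_continuous[OF f] Cn_continuous[OF g])

lemma Cn_linear_compose: "bounded_linear L \<Longrightarrow> Cn n f \<Longrightarrow> Cn n (\<lambda>x. L (f x))"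
  by (rule Cn_compose[OF Cn_bounded_linear])

lemma Cn_id: "Cn n (\<lambda>x. x)"
  by (rule Cn_bounded_linear) (rule bounded_linear_ident)

lemma Cn_fst: "Cn n f \<Longrightarrow> Cn n (\<lambda>x. fst (f x))"
  by (rule Cn_linear_compose[OF bounded_linear_fst])

lemma Cn_snd: "Cn n f \<Longrightarrow> Cn n (\<lambda>x. snd (f x))"
  by (rule Cn_linear_compose[OF bounded_linear_snd])

lemma Cn_add: "Cn n f \<Longrightarrow> Cn n g \<Longrightarrow> Cn n (\<lambda>x. f x + g x)"
  using Cn_linear_compose[OF bounded_linear_add[OF bounded_linear_fst bounded_linear_snd] Cn_Pair] by auto

lemma Cn_uminus: "Cn n f \<Longrightarrow> Cn n (\<lambda>x. - f x)"
  by (rule Cn_linear_compose[OF bounded_linear_minus[OF bounded_linear_ident]])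

lemma Cn_diff: "Cn n f \<Longrightarrow> Cn n g \<Longrightarrow> Cn n (\<lambda>x. f x - g x)"
  using Cn_add[OF _ Cn_uminus] by fastforce

text \<open>A map is as smooth as its directional derivative, as a function of point and direction, plus one.
  Since both sides live on the same kind of space, smoothness of solutions of equations can be bootstrapped.\<close>

lemma Cn_Suc:
  fixes f :: "'a::real_normed_vector \<Rightarrow> 'b::real_normed_vector"
  assumes line: "\<And>x v. line_deriv f x v (F (x, v))" and F: "Cn n F"
  shows "Cn (Suc n) f"
proof -
  \<comment> \<open>The last entry belongs to the innermost derivative and is the direction in
    \<open>F (x, v)\<close>; every other entry differentiates \<open>F\<close> in the point only,
    hence the second component 0.\<close>
  define D where "D x vs = (if vs = [] then f x else dd F (x, last vs) (map (\<lambda>w. (w, 0)) (butlast vs)))" for x vs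
  have homog0: "F (x, c *\<^sub>R v) = c *\<^sub>R F (x, v)" for x c v
  proof -
    have "((\<lambda>r. r * c) has_vector_derivative c) (at 0)"
      by (auto intro!: derivative_eq_intros simp: has_real_derivative_iff_has_vector_derivative[symmetric])
    moreover have "line_deriv f x v (F (x, v))" by (rule line)
    ultimately have "((\<lambda>s. f (x + s *\<^sub>R v)) \<circ> (\<lambda>r. r * c) has_vector_derivative c *\<^sub>R F (x, v)) (at 0)"
      by (intro vector_diff_chain_at) simp_all
    then have "line_deriv f x (c *\<^sub>R v) (c *\<^sub>R F (x, v))" by (simp add: o_def)
    from vector_derivative_unique_at[OF line this] show ?thesis .
  qed
  have homog: "dd F (x, c *\<^sub>R v) (map (\<lambda>w. (w, 0)) us) = c *\<^sub>R dd F (x, v) (map (\<lambda>w. (w, 0)) us)"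
    if "length us \<le> n" for x c v us
    using that
  proof (induction us arbitrary: x)
    case (Cons u us)
    have "line_deriv (\<lambda>y. dd F y (map (\<lambda>w. (w, 0)) us)) (x, v) (u, 0) (dd F (x, v) ((u, 0) # map (\<lambda>w. (w, 0)) us))"
      by (rule dd_line[OF F]) (use Cons in simp)
    then have "((\<lambda>s. c *\<^sub>R dd F (x + s *\<^sub>R u, v) (map (\<lambda>w. (w, 0)) us)) has_vector_derivative
        c *\<^sub>R dd F (x, v) ((u, 0) # map (\<lambda>w. (w, 0)) us)) (at 0)"
      by (intro bounded_linear.has_vector_derivative[OF bounded_linear_scaleR_right]) simp
    then have "((\<lambda>s. dd F (x + s *\<^sub>R u, c *\<^sub>R v) (map (\<lambda>w. (w, 0)) us)) has_vector_derivative
        c *\<^sub>R dd F (x, v) ((u, 0) # map (\<lambda>w. (w, 0)) us)) (at 0)"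
      using Cons by simp
    from vector_derivative_at[OF this] show ?case by (simp add: dd.simps(2))
  qed (simp add: homog0)
  \<comment> \<open>\<open>Cn\<close> bounds \<open>F\<close> only near \<open>(x, 0)\<close>;
    homogeneity in the direction extends the estimate to all \<open>v\<close> and produces the
    factor \<open>norm v\<close>.\<close>
  have bound: "\<exists>\<delta>>0. \<exists>C\<ge>0. \<forall>y\<in>ball x \<delta>. \<forall>us v. length us \<le> n \<longrightarrow>
      norm (dd F (y, v) (map (\<lambda>w. (w, 0)) us)) \<le> C * (norm v * nprod us)" for x
  proof -
    obtain \<delta> C where \<delta>: "\<delta> > 0" "C \<ge> 1"
      and C: "\<And>z vs. z \<in> ball (x, 0) \<delta> \<Longrightarrow> length vs \<le> n \<Longrightarrow> norm (dd F z vs) \<le> C * nprod vs"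
      using Cn_bound[OF F] by metis
    have "norm (dd F (y, v) (map (\<lambda>w. (w, 0)) us)) \<le> (C * (4 / \<delta>)) * (norm v * nprod us)"
      if y: "y \<in> ball x (\<delta> / 2)" and us: "length us \<le> n" for y us v
    proof (cases "v = 0")
      case True
      then show ?thesis using homog[OF us, of y 0 v] by simp
    next
      case False
      \<comment> \<open>Scales \<open>v\<close> to length \<delta> / 4, so that the pair stays in
        the ball around \<open>(x, 0)\<close>.\<close>
      define c where "c = \<delta> / (4 * norm v)"
      have c: "c > 0" using False \<delta> by (simp add: c_def)
      have "norm (c *\<^sub>R v) = \<delta> / 4" using False \<delta> by (simp add: c_def)
      moreover have "norm (x - y) < \<delta> / 2" using y by (simp add: dist_norm)
      ultimately have "norm (x - y, - (c *\<^sub>R v)) < \<delta>"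
        using norm_Pair_le[of "x - y" "- (c *\<^sub>R v)"] \<delta> by simp
      then have "(y, c *\<^sub>R v) \<in> ball (x, 0) \<delta>" by (simp add: dist_norm)
      then have "norm (dd F (y, c *\<^sub>R v) (map (\<lambda>w. (w, 0)) us)) \<le> C * nprod (map (\<lambda>w. (w, 0 :: 'a)) us)"
        by (rule C) (use us in simp)
      also have "nprod (map (\<lambda>w. (w, 0 :: 'a)) us) = nprod us" by (simp add: o_def)
      finally have "c * norm (dd F (y, v) (map (\<lambda>w. (w, 0)) us)) \<le> C * nprod us"
        using homog[OF us, of y c v] c by simp
      then have "norm (dd F (y, v) (map (\<lambda>w. (w, 0)) us)) \<le> C * nprod us / c"
        using c by (simp add: pos_le_divide_eq mult.commute)
      also have "\<dots> = (C * (4 / \<delta>)) * (norm v * nprod us)"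
        using False \<delta> by (simp add: c_def)
      finally show ?thesis .
    qed
    then show ?thesis using \<delta>
      by (intro exI[of _ "\<delta> / 2"] conjI exI[of _ "C * (4 / \<delta>)"]) auto
  qed
  show ?thesis
  proof (rule CnI(1)[of D])
    fix x v and vs :: "'a list" assume len: "length vs < Suc n"
    show "line_deriv (\<lambda>y. D y vs) x v (D x (v # vs))"
    proof (cases vs rule: rev_cases)
      case Nil
      then show ?thesis using line by (simp add: D_def)
    next
      case (snoc us u)
      have "line_deriv (\<lambda>y. dd F y (map (\<lambda>w. (w, 0)) us)) (x, u) (v, 0)
          (dd F (x, u) ((v, 0) # map (\<lambda>w. (w, 0)) us))"
        by (rule dd_line[OF F]) (use len snoc in simp)
      then show ?thesis by (simp add: D_def snoc)
    qed
  next
    fix x and k :: nat assume k: "k \<le> Suc n"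
    obtain \<delta> C where \<delta>: "\<delta> > 0" "C \<ge> 0" and C: "\<And>y us v. y \<in> ball x \<delta> \<Longrightarrow> length us \<le> n \<Longrightarrow>
      norm (dd F (y, v) (map (\<lambda>w. (w, 0)) us)) \<le> C * (norm v * nprod us)"
      using bound[of x] by blast
    show "\<exists>\<delta>>0. \<exists>C. \<forall>y\<in>ball x \<delta>. \<forall>vs. length vs = k \<longrightarrow> norm (D y vs) \<le> C * nprod vs"
    proof (cases k)
      case 0
      have "norm (f y) \<le> norm (f x) + C * \<delta>" if y: "y \<in> ball x \<delta>" for y
      proof -
        have "norm (f y - f x) \<le> C * norm (y - x)"
        proof (rule line_deriv_lipschitz[where S = "ball x \<delta>" and D = "\<lambda>z v. F (z, v)"])
          show "norm (F (z, v)) \<le> C * norm v" if "z \<in> ball x \<delta>" for z v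
            using C[OF that, of "[]" v] by simp
        qed (use y \<delta> line in auto)
        also have "\<dots> \<le> C * \<delta>" using y \<delta> by (intro mult_left_mono) (auto simp: dist_norm norm_minus_commute)
        finally show ?thesis using norm_triangle_ineq2[of "f y" "f x"] by linarith
      qed
      then show ?thesis using \<delta>(1) 0
        by (intro exI[of _ \<delta>] conjI exI[of _ "norm (f x) + C * \<delta>"]) (auto simp: D_def)
    next
      case (Suc m)
      have "norm (D y vs) \<le> C * nprod vs" if y: "y \<in> ball x \<delta>" and vs: "length vs = k" for y vs
      proof (cases vs rule: rev_cases)
        case (snoc us u)
        have "norm (dd F (y, u) (map (\<lambda>w. (w, 0)) us)) \<le> C * (norm u * nprod us)"
          by (rule C[OF y]) (use vs snoc k in simp)
        then show ?thesis by (simp add: D_def snoc mult_ac)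
      qed (use vs Suc in simp)
      then show ?thesis using \<delta>(1) by blast
    qed
  qed (simp_all add: D_def)
qed

lemma Cn_0:
  assumes "continuous_on UNIV f" shows "Cn 0 f"
proof (rule CnI(1)[of "\<lambda>x vs. f x"])
  fix x and k :: nat
  have "isCont f x" using assms by (simp add: continuous_on_eq_continuous_at)
  then obtain \<delta> where "\<delta> > 0" and \<delta>: "\<And>y. dist y x < \<delta> \<Longrightarrow> dist (f y) (f x) < 1"
    unfolding continuous_at_eps_delta by (metis zero_less_one)
  moreover have "norm (f y) \<le> norm (f x) + 1" if "dist y x < \<delta>" for y
    using \<delta>[OF that] norm_triangle_ineq2[of "f y" "f x"] by (simp add: dist_norm)
  ultimately show "\<exists>\<delta>>0. \<exists>C. \<forall>y\<in>ball x \<delta>. \<forall>vs::'a list. length vs = k \<longrightarrow> norm (f y) \<le> C * nprod vs"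
    if "k \<le> 0" using that
    by (intro exI[of _ \<delta>] conjI exI[of _ "norm (f x) + 1"]) (auto simp: dist_commute)
qed (use assms in auto)

text \<open>The derivative of a product is a sum of products of the same kind, so induction on the
  order goes through \<open>Cn_Suc\<close>.\<close>

lemma (in bounded_bilinear) Cn_prod:
  assumes f: "Cn n f" and g: "Cn n g"
  shows "Cn n (\<lambda>x. prod (f x) (g x))"
proof -
  have "Cn n (\<lambda>p. prod (fst p) (snd p))"
  proof (induction n)
    case 0
    show ?case
      by (rule Cn_0) (intro continuous_on continuous_on_fst continuous_on_snd continuous_on_id)
  next
    case (Suc n)
    show ?case
    proof (rule Cn_Suc)
      fix x v :: "'a \<times> 'b"
      have "line_deriv (\<lambda>p. prod (fst p) (snd p)) x v (prod (fst x) (snd v) + prod (fst v) (snd x))"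
      proof -
        have "((\<lambda>s. fst x + s *\<^sub>R fst v) has_vector_derivative fst v) (at 0)"
             "((\<lambda>s. snd x + s *\<^sub>R snd v) has_vector_derivative snd v) (at 0)"
          by (auto intro!: derivative_eq_intros)
        from has_vector_derivative[OF this] show ?thesis by simp
      qed
      then show "line_deriv (\<lambda>p. prod (fst p) (snd p)) x v
          ((\<lambda>(x, v). prod (fst x) (snd v) + prod (fst v) (snd x)) (x, v))" by simp
      have 1: "Cn n (\<lambda>p. (fst (fst p), snd (snd p)) :: 'a \<times> 'b)" and 2: "Cn n (\<lambda>p. (fst (snd p), snd (fst p)) :: 'a \<times> 'b)"
        by (intro Cn_Pair Cn_fst Cn_snd Cn_id)+
      show "Cn n (\<lambda>(x, v). prod (fst x) (snd v) + prod (fst v) (snd x))"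
        using Cn_add[OF Cn_compose[OF Suc 1] Cn_compose[OF Suc 2]] by (simp add: case_prod_beta')
    qed
  qed
  from Cn_compose[OF this Cn_Pair[OF f g]] show ?thesis by simp
qed

lemmas Cn_mult = bounded_bilinear.Cn_prod[OF bounded_bilinear_mult]
lemmas Cn_scaleR = bounded_bilinear.Cn_prod[OF bounded_bilinear_scaleR]

text \<open>The entries of \<open>dirs ws\<close> are the argument lists that appear when the direction in
  \<open>dd f x [v]\<close> is differentiated together with the point.\<close>

fun dirs :: "('a \<times> 'a) list \<Rightarrow> 'a list list" where
  "dirs [] = []"
| "dirs (w # ws) = (map fst ws @ [snd w]) # map ((#) (fst w)) (dirs ws)"

lemma nprod_fst_le: "nprod (map fst ws) \<le> nprod ws"
proof (induction ws)
  case (Cons w ws)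
  have "norm (fst w) * nprod (map fst ws) \<le> norm w * nprod ws"
    using norm_fst_le[of "fst w" "snd w"] by (intro mult_mono Cons nprod_nonneg) simp_all
  then show ?case by simp
qed simp

lemma dirs_props:
  assumes "l \<in> set (dirs ws)"
  shows "length l = length ws" "nprod l \<le> nprod ws"
proof -
  have "length l = length ws \<and> nprod l \<le> nprod ws"
    using assms
  proof (induction ws arbitrary: l)
    case (Cons w ws)
    have w: "norm (fst w) \<le> norm w" "norm (snd w) \<le> norm w"
      using norm_fst_le[of "fst w" "snd w"] norm_snd_le[of "snd w" "fst w"] by simp_all
    from Cons.prems consider "l = map fst ws @ [snd w]" | l' where "l' \<in> set (dirs ws)" "l = fst w # l'" by auto
    then show ?case
    proof cases
      case 1
      have "nprod (map fst ws) * norm (snd w) \<le> nprod ws * norm w"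
        by (intro mult_mono nprod_fst_le w nprod_nonneg norm_ge_zero)
      then show ?thesis using 1 by (simp add: mult.commute)
    next
      case 2
      have "norm (fst w) * nprod l' \<le> norm w * nprod ws"
        by (intro mult_mono w nprod_nonneg norm_ge_zero) (use Cons.IH[OF 2(1)] in simp)
      then show ?thesis using 2 Cons.IH[OF 2(1)] by simp
    qed
  qed simp
  then show "length l = length ws" "nprod l \<le> nprod ws" by blast+
qed

lemma length_dirs: "length (dirs ws) = length ws"
  by (induction ws) simp_all

text \<open>With this, formulas that contain derivatives of \<open>f\<close> can be differentiated
  again, as the bootstrap through \<open>Cn_Suc\<close> requires. Since the map is linear in
  \<open>snd p\<close>, that slot can be differentiated at most once: \<open>D\<close> has one term
  in which it survives and one for each entry that replaces it.\<close>

lemma smooth_dd: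
  fixes f :: "'a::real_normed_vector \<Rightarrow> 'b::real_normed_vector"
  assumes "smooth f"
  shows "smooth (\<lambda>p. dd f (fst p) [snd p])"
proof -
  have f: "Cn n f" for n using assms by (simp add: smooth_iff_Cn)
  show ?thesis
    unfolding smooth_iff_Cn
  proof
    fix n
    define D where "D p ws = dd f (fst p) (map fst ws @ [snd p]) + (\<Sum>l\<leftarrow>dirs ws. dd f (fst p) l)" for p ws
    show "Cn n (\<lambda>p. dd f (fst p) [snd p])"
    proof (rule CnI(1)[of D])
      fix p w :: "'a \<times> 'a" and ws :: "('a \<times> 'a) list"
      obtain x v where p: "p = (x, v)" by force
      obtain h k where w: "w = (h, k)" by force
      let ?cs = "map fst ws"
      have "((\<lambda>s. x + s *\<^sub>R h) has_vector_derivative h) (at 0)"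
        "((\<lambda>s. v + s *\<^sub>R k) has_vector_derivative k) (at 0)"
        by (auto intro!: derivative_eq_intros)
      then have "((\<lambda>s. dd f (x + s *\<^sub>R h) (?cs @ map (\<lambda>w. w s) [\<lambda>s. v + s *\<^sub>R k])) has_vector_derivative
        (dd f (x + 0 *\<^sub>R h) (h # ?cs @ map (\<lambda>w. w 0) [\<lambda>s. v + s *\<^sub>R k]) +
         (\<Sum>l\<leftarrow>slots (map (\<lambda>w. w 0) [\<lambda>s. v + s *\<^sub>R k]) [k]. dd f (x + 0 *\<^sub>R h) (?cs @ l)))) (at 0)"
        by (intro dd_curve[OF f[of "length ws + 2"]]) simp_all
      moreover have "((\<lambda>s. \<Sum>l\<leftarrow>dirs ws. dd f (x + s *\<^sub>R h) l) has_vector_derivative (\<Sum>l\<leftarrow>dirs ws. dd f x (h # l))) (at 0)"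
        by (rule has_vector_derivative_sum_list) (rule dd_line[OF f[of "length ws + 2"]], simp add: dirs_props)
      ultimately show "line_deriv (\<lambda>p. D p ws) p w (D p (w # ws))"
        unfolding D_def p w
        by (auto simp: o_def add.assoc intro: has_vector_derivative_add has_vector_derivative_eq_rhs)
    next
      fix p :: "'a \<times> 'a" and k :: nat
      obtain \<delta> C where \<delta>: "\<delta> > 0" "C \<ge> 1"
        and C: "\<And>y vs. y \<in> ball (fst p) \<delta> \<Longrightarrow> length vs \<le> k + 1 \<Longrightarrow> norm (dd f y vs) \<le> C * nprod vs"
        using Cn_bound[OF f] by metis
      have "norm (D q ws) \<le> (C * (norm (snd p) + 1 + real k)) * nprod ws"
        if q: "q \<in> ball p (min \<delta> 1)" and ws: "length ws = k" for q ws
      proof -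
        have "dist (fst p) (fst q) < \<delta>" "dist (snd p) (snd q) < 1"
          using q dist_fst_le[of p q] dist_snd_le[of p q] by auto
        then have q': "fst q \<in> ball (fst p) \<delta>" "norm (snd q) \<le> norm (snd p) + 1"
          using norm_triangle_ineq2[of "snd q" "snd p"] by (auto simp: dist_norm norm_minus_commute)
        have "norm (dd f (fst q) (map fst ws @ [snd q])) \<le> C * nprod (map fst ws @ [snd q])"
          by (rule C[OF q'(1)]) (use ws in simp)
        also have "nprod (map fst ws @ [snd q]) = nprod (map fst ws) * norm (snd q)" by simp
        also have "\<dots> \<le> nprod ws * (norm (snd p) + 1)"
          by (intro mult_mono nprod_fst_le q' nprod_nonneg norm_ge_zero)
        finally have 1: "norm (dd f (fst q) (map fst ws @ [snd q])) \<le> C * (nprod ws * (norm (snd p) + 1))"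
          using \<delta> by simp
        have "norm (\<Sum>l\<leftarrow>dirs ws. dd f (fst q) l) \<le> real (length (dirs ws)) * (C * nprod ws)"
        proof (rule norm_sum_list_le)
          fix l assume l: "l \<in> set (dirs ws)"
          have "norm (dd f (fst q) l) \<le> C * nprod l" by (rule C[OF q'(1)]) (use ws dirs_props[OF l] in simp)
          also have "\<dots> \<le> C * nprod ws" using dirs_props[OF l] \<delta> by simp
          finally show "norm (dd f (fst q) l) \<le> C * nprod ws" .
        qed
        then have 2: "norm (\<Sum>l\<leftarrow>dirs ws. dd f (fst q) l) \<le> real k * (C * nprod ws)"
          by (simp add: length_dirs ws)
        show ?thesis
          unfolding D_def using norm_triangle_mono[OF 1 2] by (simp add: algebra_simps)
      qed
      then show "\<exists>\<delta>>0. \<exists>C. \<forall>y\<in>ball p \<delta>. \<forall>vs. length vs = k \<longrightarrow> norm (D y vs) \<le> C * nprod vs"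
        using \<delta> by (intro exI[of _ "min \<delta> 1"] conjI exI[of _ "C * (norm (snd p) + 1 + real k)"]) auto
    next
      have 2: "list_all2 (\<lambda>w w0. (w \<longlongrightarrow> w0) (at p)) [snd] [snd p]" for p :: "'a \<times> 'a"
        by (simp add: tendsto_snd)
      have "((\<lambda>q. dd f (fst q) ([] @ map (\<lambda>w. w q) [snd])) \<longlongrightarrow> dd f (fst p) ([] @ [snd p])) (at p)" for p :: "'a \<times> 'a"
        by (rule dd_tendsto[OF f[of 2] tendsto_fst[OF tendsto_ident_at] 2]) simp
      then show "continuous_on UNIV (\<lambda>p. dd f (fst p) [snd p])"
        by (simp add: continuous_on_def)
    qed (simp add: D_def)
  qed
qed

section \<open>Calculus of smooth maps\<close>

lemma smoothD: "smooth f \<Longrightarrow> Cn n f"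
  by (simp add: smooth_iff_Cn)

lemma smoothI: "(\<And>n. Cn n f) \<Longrightarrow> smooth f"
  by (simp add: smooth_iff_Cn)

lemma smooth_compose: "smooth g \<Longrightarrow> smooth f \<Longrightarrow> smooth (\<lambda>x. g (f x))"
  by (rule smoothI) (rule Cn_compose[OF smoothD smoothD])

lemma smooth_bounded_linear: "bounded_linear f \<Longrightarrow> smooth f"
  by (rule smoothI) (rule Cn_bounded_linear)

lemma smooth_linear_compose: "bounded_linear L \<Longrightarrow> smooth f \<Longrightarrow> smooth (\<lambda>x. L (f x))"
  by (rule smoothI) (rule Cn_linear_compose[OF _ smoothD])

lemma smooth_continuous: "smooth f \<Longrightarrow> continuous_on UNIV f"
  by (rule Cn_continuous[OF smoothD[of f 0]])

lemma smooth_line: "smooth f \<Longrightarrow> line_deriv f x v (dd f x [v])"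
  using dd_line[OF smoothD[of f 1], of "[]"] by simp

lemma smooth_curve:
  assumes "smooth f" "(y has_vector_derivative y') (at 0)"
  shows "((\<lambda>s. f (y s)) has_vector_derivative dd f (y 0) [y']) (at 0)"
  using dd_curve[OF smoothD[OF assms(1), of 1] assms(2), of "[]" "[]" "[]"] by simp

lemma smooth_has_derivative: "smooth f \<Longrightarrow> (f has_derivative (\<lambda>h. dd f x [h])) (at x)"
  by (rule Cn_has_derivative[OF smoothD])

lemma Cn_dd_compose:
  assumes "smooth f" "Cn n a" "Cn n b"
  shows "Cn n (\<lambda>x. dd f (a x) [b x])"
  using Cn_compose[OF smoothD[OF smooth_dd[OF assms(1)]] Cn_Pair[OF assms(2,3)]] by simp

lemma smooth_dd_const: "smooth f \<Longrightarrow> smooth (\<lambda>x. dd f x [v])"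
  by (rule smoothI) (rule Cn_dd_compose[OF _ Cn_id Cn_const])

text \<open>The derivative is a polynomial in \<open>inverse (q x)\<close> and the derivative of
  \<open>q\<close>, so each order of regularity yields the next.\<close>

lemma smooth_inverse:
  fixes q :: "'a::real_normed_vector \<Rightarrow> real"
  assumes q: "smooth q" and nz: "\<And>x. q x \<noteq> 0"
  shows "smooth (\<lambda>x. inverse (q x))"
proof (rule smoothI)
  fix n
  show "Cn n (\<lambda>x. inverse (q x))"
  proof (induction n)
    case 0
    show ?case by (rule Cn_0) (intro continuous_on_inverse smooth_continuous q ballI nz)
  next
    case (Suc n)
    show ?case
    proof (rule Cn_Suc[where F = "\<lambda>p. - (inverse (q (fst p)) * (inverse (q (fst p)) * dd q (fst p) [snd p]))"])
      fix x v
      have "((\<lambda>s. q (x + s *\<^sub>R v)) has_real_derivative dd q x [v]) (at 0)"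
        using smooth_line[OF q] by (simp add: has_real_derivative_iff_has_vector_derivative)
      then have "((\<lambda>s. inverse (q (x + s *\<^sub>R v))) has_real_derivative
          - (inverse (q (x + 0 *\<^sub>R v)) * dd q x [v] * inverse (q (x + 0 *\<^sub>R v)))) (at 0)"
        by (rule DERIV_inverse') (rule nz)
      then show "line_deriv (\<lambda>x. inverse (q x)) x v
          (- (inverse (q (fst (x, v))) * (inverse (q (fst (x, v))) * dd q (fst (x, v)) [snd (x, v)])))"
        by (simp add: has_real_derivative_iff_has_vector_derivative mult_ac)
    qed (intro Cn_uminus Cn_mult Cn_dd_compose[OF q] Cn_fst Cn_snd Cn_id
        Cn_compose[OF Suc Cn_fst[OF Cn_id]])
  qed
qed

lemma smooth_sqrt:
  fixes q :: "'a::real_normed_vector \<Rightarrow> real"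
  assumes q: "smooth q" and pos: "\<And>x. q x > 0"
  shows "smooth (\<lambda>x. sqrt (q x))"
proof (rule smoothI)
  fix n
  have inv: "Cn n (\<lambda>x. inverse (q x))" for n
    using pos by (intro smoothD smooth_inverse q) (metis less_irrefl)
  show "Cn n (\<lambda>x. sqrt (q x))"
  proof (induction n)
    case 0
    show ?case by (rule Cn_0) (intro continuous_on_real_sqrt smooth_continuous q)
  next
    case (Suc n)
    show ?case
    \<comment> \<open>\<open>1 / sqrt q\<close> is written as \<open>sqrt q * inverse q\<close>, so
      that the induction hypothesis covers it.\<close>
    proof (rule Cn_Suc[where F = "\<lambda>p. (sqrt (q (fst p)) * inverse (q (fst p))) * (dd q (fst p) [snd p] * (1 / 2))"])
      fix x v
      have "((\<lambda>s. q (x + s *\<^sub>R v)) has_real_derivative dd q x [v]) (at 0)"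
        using smooth_line[OF q] by (simp add: has_real_derivative_iff_has_vector_derivative)
      moreover have "(sqrt has_real_derivative inverse (sqrt (q (x + 0 *\<^sub>R v))) / 2) (at (q (x + 0 *\<^sub>R v)))"
        by (rule DERIV_real_sqrt) (rule pos)
      ultimately have "((\<lambda>s. sqrt (q (x + s *\<^sub>R v))) has_real_derivative
          inverse (sqrt (q (x + 0 *\<^sub>R v))) / 2 * dd q x [v]) (at 0)"
        by (rule DERIV_chain2[rotated])
      moreover have "inverse (sqrt (q x)) = sqrt (q x) * inverse (q x)"
        using pos[of x] real_sqrt_mult_self[of "q x"] by (simp add: field_simps)
      ultimately show "line_deriv (\<lambda>x. sqrt (q x)) x v ((sqrt (q (fst (x, v))) * inverse (q (fst (x, v)))) *
          (dd q (fst (x, v)) [snd (x, v)] * (1 / 2)))"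
        by (simp add: has_real_derivative_iff_has_vector_derivative)
    qed (intro Cn_mult Cn_dd_compose[OF q] Cn_fst Cn_snd Cn_id Cn_const
        Cn_compose[OF Suc Cn_fst[OF Cn_id]] Cn_compose[OF inv Cn_fst[OF Cn_id]])
  qed
qed

text \<open>Differentiation under the integral sign at every order. The local bound has to be
  uniform in \<open>t\<close>; this comes from a finite cover of \<open>{x} \<times> {0..1}\<close>
  and a Lebesgue number of it.\<close>

lemma smooth_integral:
  fixes K :: "'a::real_normed_vector \<times> real \<Rightarrow> real"
  assumes "smooth K"
  shows "smooth (\<lambda>x. integral {0..1} (\<lambda>t. K (x, t)))"
proof (rule smoothI)
  fix n
  have K: "Cn m K" for m using assms by (rule smoothD)
  define emb where "emb = map (\<lambda>v :: 'a. (v, 0 :: real))"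
  define D where "D x vs = integral {0..1} (\<lambda>t. dd K (x, t) (emb vs))" for x and vs :: "'a list"
  have cont: "continuous_on UNIV (\<lambda>z. dd K z (emb vs))" for vs :: "'a list"
    by (rule dd_continuous[OF K[of "Suc (length vs)"]]) (simp add: emb_def)
  show "Cn n (\<lambda>x. integral {0..1} (\<lambda>t. K (x, t)))"
  proof (rule CnI(1)[of D])
    fix x v and vs :: "'a list"
    have "((\<lambda>s. integral (cbox 0 1) (\<lambda>t. dd K (x + s *\<^sub>R v, t) (emb vs))) has_vector_derivative
        integral (cbox 0 1) (\<lambda>t. dd K (x + 0 *\<^sub>R v, t) (emb (v # vs)))) (at 0 within UNIV)"
    proof (rule leibniz_rule_vector_derivative)
      fix s t :: real
      have "((\<lambda>s. dd K ((x, t) + s *\<^sub>R (v, 0)) (emb vs)) has_vector_derivative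
          dd K ((x, t) + s *\<^sub>R (v, 0)) ((v, 0) # emb vs)) (at s within UNIV)"
        by (rule line_deriv_at) (rule dd_line[OF K[of "Suc (length vs)"]], simp add: emb_def)
      then show "((\<lambda>s. dd K (x + s *\<^sub>R v, t) (emb vs)) has_vector_derivative
          dd K (x + s *\<^sub>R v, t) (emb (v # vs))) (at s within UNIV)" by (simp add: emb_def)
    next
      fix s :: real
      show "(\<lambda>t. dd K (x + s *\<^sub>R v, t) (emb vs)) integrable_on cbox 0 1"
        by (rule integrable_continuous, rule continuous_on_compose2[OF cont])
          (auto intro!: continuous_intros)
    next
      show "continuous_on (UNIV \<times> cbox 0 1) (\<lambda>(s, t). dd K (x + s *\<^sub>R v, t) (emb (v # vs)))"
        unfolding case_prod_beta' by (rule continuous_on_compose2[OF cont]) (auto intro!: continuous_intros)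
    qed auto
    then show "line_deriv (\<lambda>y. D y vs) x v (D x (v # vs))" by (simp add: D_def)
  next
    fix x and k :: nat
    have "\<exists>\<delta> C. \<delta> > 0 \<and> (\<forall>z vs. z \<in> ball (x, t) \<delta> \<longrightarrow> length vs \<le> k \<longrightarrow> norm (dd K z vs) \<le> C * nprod vs)" for t
      using Cn_bound[OF K[of k], of "(x, t)"] by metis
    then obtain \<delta> C where \<delta>: "\<And>t. \<delta> t > 0" and
      C: "\<And>t z vs. z \<in> ball (x, t) (\<delta> t) \<Longrightarrow> length vs \<le> k \<Longrightarrow> norm (dd K z vs) \<le> C t * nprod vs"
      by metis
    have comp: "compact ({x} \<times> {0..1::real})" by (intro compact_Times) auto
    have cover: "{x} \<times> {0..1} \<subseteq> (\<Union>t\<in>{0..1}. ball (x, t) (\<delta> t))" using \<delta> by force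
    have "\<exists>T\<subseteq>{0..1}. finite T \<and> {x} \<times> {0..1} \<subseteq> (\<Union>t\<in>T. ball (x, t) (\<delta> t))"
      by (rule compactE_image[OF comp, where C = "{0..1}" and f = "\<lambda>t. ball (x, t) (\<delta> t)", OF open_ball cover]) blast
    then obtain T where T: "finite T" "{x} \<times> {0..1} \<subseteq> (\<Union>t\<in>T. ball (x, t) (\<delta> t))" by blast
    have "\<exists>\<epsilon>>0. \<forall>z\<in>{x} \<times> {0..1}. \<exists>G\<in>(\<lambda>t. ball (x, t) (\<delta> t)) ` T. ball z \<epsilon> \<subseteq> G"
      by (rule Heine_Borel_lemma[OF comp T(2)]) auto
    then obtain \<epsilon> where \<epsilon>: "\<epsilon> > 0" "\<And>z. z \<in> {x} \<times> {0..1} \<Longrightarrow> \<exists>t\<in>T. ball z \<epsilon> \<subseteq> ball (x, t) (\<delta> t)"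
      by (metis (no_types, lifting) imageE)
    define M where "M = (\<Sum>t\<in>T. \<bar>C t\<bar>)"
    have "norm (D y vs) \<le> M * nprod vs" if y: "y \<in> ball x \<epsilon>" and vs: "length vs = k" for y vs
    proof -
      have "norm (dd K (y, t) (emb vs)) \<le> M * nprod vs" if t: "t \<in> {0..1}" for t
      proof -
        obtain r where r: "r \<in> T" "ball (x, t) \<epsilon> \<subseteq> ball (x, r) (\<delta> r)" using \<epsilon>(2)[of "(x, t)"] t by auto
        have "dist (x, t) (y, t) < \<epsilon>" using y by (simp add: dist_Pair_Pair)
        then have "(y, t) \<in> ball (x, r) (\<delta> r)" using r by auto
        then have "norm (dd K (y, t) (emb vs)) \<le> C r * nprod (emb vs)" by (rule C) (simp add: vs emb_def)
        moreover have "nprod (emb vs) = nprod vs" by (simp add: emb_def o_def)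
        moreover have "C r \<le> M" unfolding M_def using member_le_sum[OF r(1), of "\<lambda>t. \<bar>C t\<bar>"] T(1) by auto
        ultimately show ?thesis using mult_right_mono[of "C r" M "nprod vs"] nprod_nonneg[of vs] by simp
      qed
      then have "norm (integral {0..1} (\<lambda>t. dd K (y, t) (emb vs))) \<le> M * nprod vs * (1 - 0)"
        by (intro integral_bound continuous_on_compose2[OF cont]) (auto intro!: continuous_intros)
      then show ?thesis by (simp add: D_def)
    qed
    then show "\<exists>\<delta>>0. \<exists>C. \<forall>y\<in>ball x \<delta>. \<forall>vs. length vs = k \<longrightarrow> norm (D y vs) \<le> C * nprod vs"
      using \<epsilon>(1) by blast
  next
    show "continuous_on UNIV (\<lambda>x. integral {0..1} (\<lambda>t. K (x, t)))"
    proof -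
      have "continuous_on UNIV (\<lambda>x. integral (cbox 0 1) (\<lambda>t. K (x, t)))"
        by (rule integral_continuous_on_param)
          (use continuous_on_subset[OF smooth_continuous[OF assms]] in \<open>simp add: case_prod_beta'\<close>)
      then show ?thesis by simp
    qed
  qed (simp add: D_def emb_def)
qed

text \<open>An implicit function theorem for a real unknown and a parameter in any normed space.
  Since the solution \<open>g\<close> is given and continuous, only its differentiation is left: the
  mean value theorem in the real variable yields the difference quotient.\<close>

lemma smooth_implicit_real:
  fixes E :: "'a::real_normed_vector \<times> real \<Rightarrow> real"
  assumes E: "smooth E" and g: "continuous_on UNIV g"
    and zero: "\<And>a. E (a, g a) = 0" and nz: "\<And>a. dd E (a, g a) [(0, 1)] \<noteq> 0"
  shows "smooth g"
proof -
  define Es where "Es z = dd E z [(0, 1)]" for z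
  have Es: "smooth Es" unfolding Es_def using E by (rule smooth_dd_const)
  define r where "r a = inverse (Es (a, g a))" for a
  define G where "G p = - dd E (fst p, g (fst p)) [(snd p, 0)] * r (fst p)" for p
  define R where "R p = - (r (fst p) * (r (fst p) * dd Es (fst p, g (fst p)) [(snd p, G p)]))" for p
  have nz': "Es (a, g a) \<noteq> 0" for a using nz by (simp add: Es_def)
  have E_real: "((\<lambda>\<tau>. E (b, \<tau>)) has_real_derivative Es (b, \<tau>)) (at \<tau>)" for b \<tau>
  proof -
    have "((\<lambda>\<tau>. E ((b, 0) + \<tau> *\<^sub>R (0, 1))) has_vector_derivative dd E ((b, 0) + \<tau> *\<^sub>R (0, 1)) [(0, 1)]) (at \<tau> within UNIV)"
      by (rule line_deriv_at) (rule smooth_line[OF E])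
    then show ?thesis by (simp add: Es_def has_real_derivative_iff_has_vector_derivative)
  qed
  have mvt: "\<exists>\<xi>. \<bar>\<xi> - \<alpha>\<bar> \<le> \<bar>\<beta> - \<alpha>\<bar> \<and> E (b, \<beta>) - E (b, \<alpha>) = (\<beta> - \<alpha>) * Es (b, \<xi>)" for b \<alpha> \<beta>
  proof -
    consider "\<alpha> < \<beta>" | "\<beta> < \<alpha>" | "\<alpha> = \<beta>" by linarith
    then show ?thesis
    proof cases
      case 1
      then obtain z where "\<alpha> < z" "z < \<beta>" "E (b, \<beta>) - E (b, \<alpha>) = (\<beta> - \<alpha>) * Es (b, z)"
        using MVT2[of \<alpha> \<beta> "\<lambda>\<tau>. E (b, \<tau>)" "\<lambda>\<tau>. Es (b, \<tau>)"] E_real by blast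
      then show ?thesis by (intro exI[of _ z]) auto
    next
      case 2
      then obtain z where "\<beta> < z" "z < \<alpha>" "E (b, \<alpha>) - E (b, \<beta>) = (\<alpha> - \<beta>) * Es (b, z)"
        using MVT2[of \<beta> \<alpha> "\<lambda>\<tau>. E (b, \<tau>)" "\<lambda>\<tau>. Es (b, \<tau>)"] E_real by blast
      then show ?thesis by (intro exI[of _ z]) (auto simp: algebra_simps)
    qed auto
  qed
  have g_line: "line_deriv g a h (G (a, h))" for a h
  proof -
    define \<gamma> where "\<gamma> s = g (a + s *\<^sub>R h)" for s
    have "\<forall>s. \<exists>\<xi>. \<bar>\<xi> - \<gamma> 0\<bar> \<le> \<bar>\<gamma> s - \<gamma> 0\<bar> \<and>
        E (a + s *\<^sub>R h, \<gamma> s) - E (a + s *\<^sub>R h, \<gamma> 0) = (\<gamma> s - \<gamma> 0) * Es (a + s *\<^sub>R h, \<xi>)"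
      using mvt by blast
    then obtain \<xi> where \<xi>: "\<And>s. \<bar>\<xi> s - \<gamma> 0\<bar> \<le> \<bar>\<gamma> s - \<gamma> 0\<bar>"
      "\<And>s. E (a + s *\<^sub>R h, \<gamma> s) - E (a + s *\<^sub>R h, \<gamma> 0) = (\<gamma> s - \<gamma> 0) * Es (a + s *\<^sub>R h, \<xi> s)"
      by metis
    have a_lim: "((\<lambda>s. a + s *\<^sub>R h) \<longlongrightarrow> a) (at 0)" by (auto intro!: tendsto_eq_intros)
    have "(\<gamma> \<longlongrightarrow> \<gamma> 0) (at 0)"
      using continuous_on_tendsto_compose[OF g a_lim] by (simp add: \<gamma>_def[abs_def])
    then have "((\<lambda>s. \<bar>\<gamma> s - \<gamma> 0\<bar>) \<longlongrightarrow> 0) (at 0)" by (intro tendsto_rabs_zero) (rule LIM_zero)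
    then have "((\<lambda>s. \<xi> s - \<gamma> 0) \<longlongrightarrow> 0) (at 0)"
      by (rule Lim_null_comparison[rotated]) (use \<xi>(1) in auto)
    then have "(\<xi> \<longlongrightarrow> \<gamma> 0) (at 0)" by (rule LIM_zero_cancel)
    then have "((\<lambda>s. (a + s *\<^sub>R h, \<xi> s)) \<longlongrightarrow> (a, \<gamma> 0)) (at 0)" by (intro tendsto_Pair a_lim)
    from continuous_on_tendsto_compose[OF smooth_continuous[OF Es] this]
    have Es_lim: "((\<lambda>s. Es (a + s *\<^sub>R h, \<xi> s)) \<longlongrightarrow> Es (a, g a)) (at 0)" by (simp add: \<gamma>_def)
    have "((\<lambda>s. E ((a, \<gamma> 0) + s *\<^sub>R (h, 0))) has_vector_derivative dd E (a, \<gamma> 0) [(h, 0)]) (at 0)"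
      by (rule smooth_line[OF E])
    then have "((\<lambda>s. (E (a + s *\<^sub>R h, \<gamma> 0) - E (a, \<gamma> 0)) /\<^sub>R s) \<longlongrightarrow> dd E (a, \<gamma> 0) [(h, 0)]) (at 0)"
      by (simp add: has_vector_derivative_at_0_iff)
    then have "((\<lambda>s. - ((E (a + s *\<^sub>R h, \<gamma> 0) - E (a, \<gamma> 0)) /\<^sub>R s) * inverse (Es (a + s *\<^sub>R h, \<xi> s)))
        \<longlongrightarrow> - dd E (a, \<gamma> 0) [(h, 0)] * inverse (Es (a, g a))) (at 0)"
      by (intro tendsto_mult tendsto_minus tendsto_inverse Es_lim nz')
    moreover have "\<forall>\<^sub>F s in at 0. - ((E (a + s *\<^sub>R h, \<gamma> 0) - E (a, \<gamma> 0)) /\<^sub>R s) * inverse (Es (a + s *\<^sub>R h, \<xi> s))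
        = (\<gamma> s - \<gamma> 0) /\<^sub>R s"
      using tendsto_imp_eventually_ne[OF Es_lim nz'[of a]]
    proof eventually_elim
      case (elim s)
      have "E (a + s *\<^sub>R h, \<gamma> s) = 0" "E (a, \<gamma> 0) = 0" using zero by (simp_all add: \<gamma>_def)
      then have "- (E (a + s *\<^sub>R h, \<gamma> 0) - E (a, \<gamma> 0)) = (\<gamma> s - \<gamma> 0) * Es (a + s *\<^sub>R h, \<xi> s)"
        using \<xi>(2)[of s] by simp
      then have "- ((E (a + s *\<^sub>R h, \<gamma> 0) - E (a, \<gamma> 0)) /\<^sub>R s) = inverse s * ((\<gamma> s - \<gamma> 0) * Es (a + s *\<^sub>R h, \<xi> s))"
        by (metis mult_minus_right real_scaleR_def)
      then show ?case using elim by simp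
    qed
    ultimately have "((\<lambda>s. (\<gamma> s - \<gamma> 0) /\<^sub>R s) \<longlongrightarrow> - dd E (a, \<gamma> 0) [(h, 0)] * inverse (Es (a, g a))) (at 0)"
      by (rule Lim_transform_eventually)
    then have "(\<gamma> has_vector_derivative - dd E (a, \<gamma> 0) [(h, 0)] * inverse (Es (a, g a))) (at 0)"
      by (rule has_vector_derivative_at_0_iff[THEN iffD2])
    then show ?thesis by (simp add: \<gamma>_def[abs_def] G_def r_def)
  qed
  have r_line: "line_deriv r a h (R (a, h))" for a h
  proof -
    have "((\<lambda>s. (a + s *\<^sub>R h, g (a + s *\<^sub>R h))) has_vector_derivative (h, G (a, h))) (at 0)"
      by (intro has_vector_derivative_Pair g_line) (auto intro!: derivative_eq_intros)
    from smooth_curve[OF Es this]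
    have "((\<lambda>s. Es (a + s *\<^sub>R h, g (a + s *\<^sub>R h))) has_real_derivative dd Es (a, g a) [(h, G (a, h))]) (at 0)"
      by (simp add: has_real_derivative_iff_has_vector_derivative)
    then have "((\<lambda>s. inverse (Es (a + s *\<^sub>R h, g (a + s *\<^sub>R h)))) has_real_derivative
        - (inverse (Es (a + 0 *\<^sub>R h, g (a + 0 *\<^sub>R h))) * dd Es (a, g a) [(h, G (a, h))] *
           inverse (Es (a + 0 *\<^sub>R h, g (a + 0 *\<^sub>R h))))) (at 0)"
      by (rule DERIV_inverse') (rule nz')
    then show ?thesis by (simp add: has_real_derivative_iff_has_vector_derivative r_def R_def mult_ac)
  qed
  \<comment> \<open>The derivatives of \<open>g\<close> and of the reciprocal \<open>r\<close> of
    the partial derivative involve both functions, so their regularity is raised together.\<close>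
  have "Cn n g \<and> Cn n r" for n
  proof (induction n)
    case 0
    have "continuous_on UNIV r"
      unfolding r_def
      by (intro continuous_on_inverse ballI nz' continuous_on_compose2[OF smooth_continuous[OF Es]]
          continuous_on_Pair continuous_on_id g subset_UNIV)
    then show ?case by (intro conjI Cn_0 g)
  next
    case (Suc n)
    then have gf: "Cn n (\<lambda>p :: 'a \<times> 'a. g (fst p))" and rf: "Cn n (\<lambda>p :: 'a \<times> 'a. r (fst p))"
      by (auto intro: Cn_compose[of n g fst] Cn_compose[of n r fst] Cn_fst[OF Cn_id])
    have G: "Cn n G" unfolding G_def
      by (intro Cn_mult Cn_uminus Cn_dd_compose[OF E] Cn_Pair Cn_fst Cn_snd Cn_id Cn_const gf rf)
    have R: "Cn n R" unfolding R_def
      by (intro Cn_mult Cn_uminus Cn_dd_compose[OF Es] Cn_Pair Cn_fst Cn_snd Cn_id gf rf G)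
    show ?case using Cn_Suc[OF g_line G] Cn_Suc[OF r_line R] by blast
  qed
  then show ?thesis by (intro smoothI) blast
qed

lemma smooth_real:
  fixes f :: "real \<Rightarrow> real"
  assumes "smooth f"
  shows "(f has_real_derivative deriv f x) (at x)" and "smooth (deriv f)"
proof -
  have *: "(f has_real_derivative dd f x [1]) (at x)" for x
  proof -
    have "((\<lambda>s. f (0 + s *\<^sub>R 1)) has_vector_derivative dd f (0 + x *\<^sub>R 1) [1]) (at x within UNIV)"
      by (rule line_deriv_at) (rule smooth_line[OF assms])
    then show ?thesis by (simp add: has_real_derivative_iff_has_vector_derivative)
  qed
  then have "deriv f = (\<lambda>x. dd f x [1])" by (intro ext DERIV_imp_deriv)
  then show "(f has_real_derivative deriv f x) (at x)" "smooth (deriv f)"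
    using * smooth_dd_const[OF assms] by simp_all
qed

section \<open>The Banach algebra of continuous periodic functions\<close>

instantiation c0 :: comm_ring_1
begin

lift_definition one_c0 :: c0 is "\<lambda>_. 1" by (simp add: periodic_def)
lift_definition times_c0 :: "c0 \<Rightarrow> c0 \<Rightarrow> c0" is "\<lambda>u v t. u t * v t"
  by (auto simp: periodic_def intro: continuous_intros)

instance
proof
  fix a b c :: c0
  show "a * b * c = a * (b * c)" "a * b = b * a" "1 * a = a" "(a + b) * c = a * c + b * c"
    by (transfer; simp add: algebra_simps)+
  show "(0::c0) \<noteq> 1" by transfer (simp add: fun_eq_iff)
qed

end

lemma c0_eqI: "(\<And>t. Rep_c0 u t = Rep_c0 v t) \<Longrightarrow> u = v"
  by (metis Rep_c0_inject ext)

lemma c0_continuous: "continuous_on S (Rep_c0 u)"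
  using Rep_c0[of u] continuous_on_subset by auto

lemma c0_periodic: "Rep_c0 u (t + 1) = Rep_c0 u t"
  using Rep_c0[of u] by (simp add: periodic_def)

lemma Rep_Abs_c0: "continuous_on UNIV u \<Longrightarrow> (\<And>t. u (t + 1) = u t) \<Longrightarrow> Rep_c0 (Abs_c0 u) = u"
  by (simp add: Abs_c0_inverse periodic_def)

lemmas c0_rep = zero_c0.rep_eq plus_c0.rep_eq uminus_c0.rep_eq minus_c0.rep_eq scaleR_c0.rep_eq
  one_c0.rep_eq times_c0.rep_eq const_fn_c0.rep_eq

lemma c0_abs_le_norm: "\<bar>Rep_c0 u t\<bar> \<le> norm u"
proof -
  have "bdd_above (range (\<lambda>t. \<bar>Rep_c0 u t\<bar>))"
    using Rep_c0[of u] by (intro periodic_bounded) auto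
  then show ?thesis unfolding norm_c0.rep_eq by (rule cSUP_upper[rotated]) simp
qed

lemma c0_norm_le: "(\<And>t. \<bar>Rep_c0 u t\<bar> \<le> B) \<Longrightarrow> norm u \<le> B"
  unfolding norm_c0.rep_eq by (rule cSUP_least) auto

instance c0 :: real_normed_algebra_1
proof
  fix a b :: c0 and r :: real
  show "r *\<^sub>R a * b = r *\<^sub>R (a * b)" "a * r *\<^sub>R b = r *\<^sub>R (a * b)"
    by (rule c0_eqI, simp add: c0_rep)+
  show "norm (a * b) \<le> norm a * norm b"
    by (rule c0_norm_le) (auto simp: c0_rep abs_mult intro!: mult_mono c0_abs_le_norm)
  have "norm (1::c0) \<le> 1" by (rule c0_norm_le) (simp add: c0_rep)
  moreover have "1 \<le> norm (1::c0)" using c0_abs_le_norm[of 1 0] by (simp add: c0_rep)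
  ultimately show "norm (1::c0) = 1" by simp
qed

instance c0 :: banach
proof
  fix X :: "nat \<Rightarrow> c0" assume X: "Cauchy X"
  have "uniformly_Cauchy_on UNIV (\<lambda>n. Rep_c0 (X n))"
    unfolding uniformly_Cauchy_on_def
  proof (intro allI impI)
    fix e :: real assume "e > 0"
    then obtain M where M: "\<And>m n. m \<ge> M \<Longrightarrow> n \<ge> M \<Longrightarrow> norm (X m - X n) < e"
      using X unfolding Cauchy_iff by blast
    have "dist (Rep_c0 (X m) t) (Rep_c0 (X n) t) < e" if "m \<ge> M" "n \<ge> M" for m n t
      using c0_abs_le_norm[of "X m - X n" t] M[OF that] by (simp add: c0_rep dist_real_def)
    then show "\<exists>M. \<forall>t\<in>UNIV. \<forall>m\<ge>M. \<forall>n\<ge>M. dist (Rep_c0 (X m) t) (Rep_c0 (X n) t) < e" by blast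
  qed
  then obtain l where l: "uniform_limit UNIV (\<lambda>n. Rep_c0 (X n)) l sequentially"
    using Cauchy_uniformly_convergent by (auto simp: uniformly_convergent_on_def)
  have "continuous_on UNIV l"
    by (rule uniform_limit_theorem[OF _ l]) (auto simp: c0_continuous)
  moreover have lim: "(\<lambda>n. Rep_c0 (X n) t) \<longlonglongrightarrow> l t" for t
    using tendsto_uniform_limitI[OF l] by simp
  have "l (t + 1) = l t" for t
    using LIMSEQ_unique[OF lim[of "t + 1"]] lim[of t] by (simp add: c0_periodic)
  ultimately have L: "Rep_c0 (Abs_c0 l) = l" by (rule Rep_Abs_c0)
  have "X \<longlonglongrightarrow> Abs_c0 l"
  proof (rule LIMSEQ_I)
    fix e :: real assume e: "e > 0"
    then obtain N where N: "\<And>n t. n \<ge> N \<Longrightarrow> dist (Rep_c0 (X n) t) (l t) < e / 2"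
      using uniform_limitD[OF l, of "e / 2"] by (auto simp: eventually_sequentially)
    have "norm (X n - Abs_c0 l) < e" if "n \<ge> N" for n
    proof -
      have "norm (X n - Abs_c0 l) \<le> e / 2"
        by (rule c0_norm_le) (use N[OF that] in \<open>simp add: c0_rep L dist_real_def less_imp_le\<close>)
      then show ?thesis using e by simp
    qed
    then show "\<exists>N. \<forall>n\<ge>N. norm (X n - Abs_c0 l) < e" by blast
  qed
  then show "convergent X" by (auto simp: convergent_def)
qed

section \<open>Means, zeros and primitives of periodic functions\<close>

lemma const_fn_c0_eq: "const_fn c = c *\<^sub>R (1 :: c0)"
  by (rule c0_eqI) (simp add: c0_rep)

lemma mean_c0_integral: "mean u = integral {0..1} (Rep_c0 u)"
proof -
  have "set_integrable lborel {0..1} (Rep_c0 u)"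
    using borel_integrable_compact[of "{0..1::real}" "Rep_c0 u"] c0_continuous
    by (simp add: set_integrable_def)
  then have "(LINT t:{0..1}|lborel. Rep_c0 u t) = integral {0..1} (Rep_c0 u)"
    by (rule set_borel_integral_eq_integral(2))
  then show ?thesis
    by (simp add: mean_c0.rep_eq circle_def integral_restrict_space set_lebesgue_integral_def)
qed

lemma mean_c0_mono:
  assumes "\<And>t. Rep_c0 u t \<le> Rep_c0 v t" shows "mean u \<le> mean v"
  unfolding mean_c0_integral
  by (intro integral_le integrable_continuous_real c0_continuous assms)

lemma mean_c0_1 [simp]: "mean (1 :: c0) = 1"
  using mean_const_fn[of 1, where 'a = c0] by (simp add: const_fn_c0_eq)

lemma abs_mean_c0_le: "\<bar>mean (u :: c0)\<bar> \<le> norm u"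
proof -
  have u: "Rep_c0 u t \<le> norm u" "- norm u \<le> Rep_c0 u t" for t
    using c0_abs_le_norm[of u t] by linarith+
  have "mean u \<le> mean (norm u *\<^sub>R 1 :: c0)"
    by (rule mean_c0_mono) (simp add: c0_rep u)
  moreover have "mean (- norm u *\<^sub>R 1 :: c0) \<le> mean u"
    by (rule mean_c0_mono) (simp add: c0_rep u)
  ultimately show ?thesis by (simp add: mean_scaleR)
qed

lemma bounded_linear_mean_c0: "bounded_linear (mean :: c0 \<Rightarrow> real)"
  by (rule bounded_linear_intro[where K = 1]) (simp_all add: mean_add mean_scaleR abs_mean_c0_le)

lemma mean_c0_eq_0_iff:
  assumes "\<And>t. 0 \<le> Rep_c0 u t" shows "mean u = 0 \<longleftrightarrow> u = 0"
proof
  assume "mean u = 0"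
  then have z: "\<And>t. t \<in> {0..1} \<Longrightarrow> Rep_c0 u t = 0"
    using integral_eq_0_iff[of 0 1 "Rep_c0 u"] c0_continuous assms by (simp add: mean_c0_integral)
  show "u = 0"
  proof (rule c0_eqI)
    fix t :: real
    have "frac t \<in> {0..1}" using frac_ge_0[of t] frac_lt_1[of t] by simp
    then show "Rep_c0 u t = Rep_c0 0 t"
      using z[of "frac t"] periodic_frac[of "Rep_c0 u" t] Rep_c0[of u] by (simp add: c0_rep)
  qed
qed simp

lemma mean_c0_pos:
  assumes "\<And>t. 0 \<le> Rep_c0 u t" "u \<noteq> 0" shows "0 < mean u"
  using mean_c0_mono[of 0 u] mean_c0_eq_0_iff[of u] assms by (simp add: c0_rep)

lemma mean_c0_diff:
  assumes Y: "\<And>t. (Y has_real_derivative Rep_c0 q t) (at t)"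
  shows "Y (s + 1) - Y s = mean q"
proof -
  have "(Rep_c0 q has_integral (Y 1 - Y 0)) {0..1}"
    using Y by (intro fundamental_theorem_of_calculus)
      (auto simp: has_real_derivative_iff_has_vector_derivative intro: has_vector_derivative_at_within)
  then have "mean q = Y 1 - Y 0" by (simp add: mean_c0_integral integral_unique)
  moreover have "((\<lambda>s. Y (s + 1) - Y s) has_real_derivative 0) (at s)" for s
  proof -
    have "((\<lambda>s. Y (s + 1)) has_real_derivative Rep_c0 q (s + 1)) (at s)"
      using Y[of "s + 1"] by (simp add: DERIV_shift)
    from DERIV_diff[OF this Y] show ?thesis by (simp add: c0_periodic)
  qed
  then have "Y (s + 1) - Y s = Y (0 + 1) - Y 0" using DERIV_isconst_all by blast
  ultimately show ?thesis by simp
qed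

lemma continuous_primitive:
  fixes g :: "real \<Rightarrow> real"
  assumes "continuous_on UNIV g"
  shows "\<exists>G. \<forall>t. (G has_real_derivative g t) (at t)"
proof (intro exI allI)
  fix t :: real
  define b where "b = \<bar>t\<bar> + 1"
  have "((\<lambda>u. LBINT y=(0::real)..u. g y) has_vector_derivative g t) (at t within {-b..b})"
    by (rule interval_integral_FTC2) (use continuous_on_subset[OF assms] in \<open>auto simp: b_def\<close>)
  moreover have "at t within {-b..b} = at t"
    by (rule at_within_Icc_at) (auto simp: b_def)
  ultimately show "((\<lambda>u. LBINT y=(0::real)..u. g y) has_real_derivative g t) (at t)"
    by (simp add: has_real_derivative_iff_has_vector_derivative)
qed

lemma c0_primitive: "\<exists>G. \<forall>t. (G has_real_derivative Rep_c0 q t) (at t)"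
  by (rule continuous_primitive[OF c0_continuous])

text \<open>Rolle's theorem for a primitive, which is periodic as the mean vanishes.\<close>

lemma c0_zero:
  assumes "mean y = 0"
  obtains t where "s < t" "t < s + 1" "Rep_c0 y t = 0"
proof -
  obtain Y where Y: "\<And>t. (Y has_real_derivative Rep_c0 y t) (at t)" using c0_primitive[of y] by blast
  obtain z where "s < z" "z < s + 1" "Y (s + 1) - Y s = (s + 1 - s) * Rep_c0 y z"
    using MVT2[of s "s + 1" Y "Rep_c0 y"] Y by auto
  then show ?thesis using that mean_c0_diff[OF Y, of s] assms by simp
qed

subsection \<open>The mean free primitive\<close>

definition prim :: "c0 \<Rightarrow> c0" where
  "prim q = (THE y. mean y = 0 \<and> (\<forall>t. (Rep_c0 y has_real_derivative (Rep_c0 q t - mean q)) (at t)))"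

lemma prim_unique_aux:
  assumes "mean y = 0" "mean z = 0"
    and "\<And>t. (Rep_c0 y has_real_derivative d t) (at t)" "\<And>t. (Rep_c0 z has_real_derivative d t) (at t)"
  shows "y = z"
proof -
  have "((\<lambda>t. Rep_c0 y t - Rep_c0 z t) has_real_derivative 0) (at t)" for t
    using DERIV_diff[OF assms(3,4)] by simp
  then have "Rep_c0 y t - Rep_c0 z t = Rep_c0 y 0 - Rep_c0 z 0" for t using DERIV_isconst_all by blast
  then have "y - z = const_fn (Rep_c0 y 0 - Rep_c0 z 0)" by (intro c0_eqI) (simp add: c0_rep)
  moreover from this have "mean (y - z) = Rep_c0 y 0 - Rep_c0 z 0" by (simp only: mean_const_fn)
  then have "Rep_c0 y 0 - Rep_c0 z 0 = 0" using assms(1,2) by (simp add: mean_diff)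
  ultimately show ?thesis by (simp add: const_fn_c0_eq)
qed

lemma prim_props: "mean (prim q) = 0" "(Rep_c0 (prim q) has_real_derivative (Rep_c0 q t - mean q)) (at t)"
proof -
  obtain G where G: "\<And>t. (G has_real_derivative Rep_c0 (q - const_fn (mean q)) t) (at t)"
    using c0_primitive[of "q - const_fn (mean q)"] by blast
  have per: "G (t + 1) = G t" for t
    using mean_c0_diff[OF G, of t] by (simp add: mean_diff mean_const_fn)
  have "continuous_on UNIV G"
    using G by (intro continuous_at_imp_continuous_on) (blast intro: DERIV_isCont)
  then have Rep: "Rep_c0 (Abs_c0 G) = G" using per by (rule Rep_Abs_c0)
  define y where "y = Abs_c0 G - const_fn (mean (Abs_c0 G))"
  have y: "mean y = 0 \<and> (\<forall>t. (Rep_c0 y has_real_derivative (Rep_c0 q t - mean q)) (at t))"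
  proof
    show "mean y = 0" by (simp add: y_def mean_diff mean_const_fn)
    have "Rep_c0 y = (\<lambda>t. G t - mean (Abs_c0 G))" by (simp add: y_def c0_rep Rep fun_eq_iff)
    then show "\<forall>t. (Rep_c0 y has_real_derivative (Rep_c0 q t - mean q)) (at t)"
      using G by (auto intro!: derivative_eq_intros simp: c0_rep)
  qed
  then have "mean (prim q) = 0 \<and> (\<forall>t. (Rep_c0 (prim q) has_real_derivative (Rep_c0 q t - mean q)) (at t))"
    unfolding prim_def
  proof (rule theI)
    fix x assume "mean x = 0 \<and> (\<forall>t. (Rep_c0 x has_real_derivative (Rep_c0 q t - mean q)) (at t))"
    then show "x = y" using y by (intro prim_unique_aux[of x y "\<lambda>t. Rep_c0 q t - mean q"]) auto
  qed
  then show "mean (prim q) = 0" "(Rep_c0 (prim q) has_real_derivative (Rep_c0 q t - mean q)) (at t)"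
    by auto
qed

lemma prim_eqI:
  assumes "mean y = 0" "\<And>t. (Rep_c0 y has_real_derivative (Rep_c0 q t - mean q)) (at t)"
  shows "prim q = y"
  by (rule prim_unique_aux[OF prim_props(1) assms(1) prim_props(2) assms(2)])

lemma prim_of_deriv:
  assumes "\<And>t. (Rep_c0 y has_real_derivative Rep_c0 q t) (at t)"
  shows "mean q = 0" "prim q = y - const_fn (mean y)"
proof -
  show q: "mean q = 0" using mean_c0_diff[OF assms, of 0] by (simp add: c0_periodic[of y 0, simplified])
  have "Rep_c0 (y - const_fn (mean y)) = (\<lambda>t. Rep_c0 y t - mean y)" by (simp add: c0_rep fun_eq_iff)
  then show "prim q = y - const_fn (mean y)"
    using assms by (intro prim_eqI) (auto simp: mean_diff mean_const_fn q intro!: derivative_eq_intros)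
qed

text \<open>A mean free function has a zero within distance one, and the slope
  \<open>q - mean q\<close> is at most \<open>2 * norm q\<close>.\<close>

lemma norm_prim_le: "norm (prim q) \<le> 2 * norm q"
proof (rule c0_norm_le)
  fix t :: real
  obtain z where z: "t < z" "z < t + 1" "Rep_c0 (prim q) z = 0" using c0_zero[OF prim_props(1)] .
  obtain w where "Rep_c0 (prim q) z - Rep_c0 (prim q) t = (z - t) * (Rep_c0 q w - mean q)"
    using MVT2[OF z(1), of "Rep_c0 (prim q)" "\<lambda>w. Rep_c0 q w - mean q", OF prim_props(2)] by blast
  then have "\<bar>Rep_c0 (prim q) t\<bar> = \<bar>(z - t) * (Rep_c0 q w - mean q)\<bar>"
    using z(3) by (metis abs_minus_cancel diff_0)
  also have "\<dots> = (z - t) * \<bar>Rep_c0 q w - mean q\<bar>"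
    using z(1) by (simp add: abs_mult)
  also have "\<dots> \<le> 1 * \<bar>Rep_c0 q w - mean q\<bar>" using z by (intro mult_right_mono) auto
  also have "\<dots> \<le> 2 * norm q" using c0_abs_le_norm[of q w] abs_mean_c0_le[of q] by simp
  finally show "\<bar>Rep_c0 (prim q) t\<bar> \<le> 2 * norm q" .
qed

lemma bounded_linear_prim: "bounded_linear prim"
proof (rule bounded_linear_intro[where K = 2])
  show "prim (a + b) = prim a + prim b" for a b
  proof (rule prim_eqI)
    have "Rep_c0 (prim a + prim b) = (\<lambda>t. Rep_c0 (prim a) t + Rep_c0 (prim b) t)"
      by (simp add: c0_rep fun_eq_iff)
    then show "(Rep_c0 (prim a + prim b) has_real_derivative Rep_c0 (a + b) t - mean (a + b)) (at t)" for t
      using DERIV_add[OF prim_props(2)[of a t] prim_props(2)[of b t]] by (simp add: c0_rep mean_add algebra_simps)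
  qed (simp add: mean_add prim_props)
  show "prim (c *\<^sub>R a) = c *\<^sub>R prim a" for c a
  proof (rule prim_eqI)
    have "Rep_c0 (c *\<^sub>R prim a) = (\<lambda>t. c * Rep_c0 (prim a) t)"
      by (simp add: c0_rep fun_eq_iff)
    then show "(Rep_c0 (c *\<^sub>R prim a) has_real_derivative Rep_c0 (c *\<^sub>R a) t - mean (c *\<^sub>R a)) (at t)" for t
      using DERIV_cmult[OF prim_props(2)[of a t], of c] by (simp add: c0_rep mean_scaleR algebra_simps)
  qed (simp add: mean_scaleR prim_props)
qed (use norm_prim_le in \<open>simp add: mult.commute\<close>)

lemmas prim_linear = bounded_linear.linear[OF bounded_linear_prim]
lemmas prim_add = linear_add[OF prim_linear]
  and prim_diff = linear_diff[OF prim_linear]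
  and prim_scaleR = linear_cmul[OF prim_linear]
  and prim_minus = linear_neg[OF prim_linear]

subsection \<open>The linearized equation\<close>

text \<open>\<open>exp L\<close> bounds the variation of the integrating factor over one period, and
  \<open>2 * L\<close> accounts for the inhomogeneity and the unknown mean, which is of the same
  size.\<close>

definition lin_bound :: "real \<Rightarrow> real" where "lin_bound L = 1 + 2 * L * exp L"

lemma lin_bound_mono: "0 \<le> L \<Longrightarrow> L \<le> L' \<Longrightarrow> lin_bound L \<le> lin_bound L'"
  unfolding lin_bound_def by (intro add_left_mono mult_mono) auto

text \<open>With \<open>z = prim (a * h)\<close> the equation is the linear ODE
  \<open>z' = a g - a z - l\<close> with an unknown constant \<open>l\<close>. The integrating
  factor \<open>exp A\<close> removes \<open>a z\<close>, and zeros of \<open>z\<close> replace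
  initial values. The bound involves the size of \<open>a\<close> but neither its sign nor its mean,
  so it is uniform along the continuation.\<close>

lemma prim_linear_bound:
  assumes eq: "h + prim (a * h) = g" and a: "norm a \<le> L"
  shows "norm h \<le> lin_bound L * norm g"
proof -
  define z where "z = prim (a * h)"
  define l where "l = mean (a * h)"
  define b where "b = a * g"
  have L: "L \<ge> 0" using a norm_ge_zero[of a] by linarith
  have b: "\<bar>Rep_c0 b t\<bar> \<le> L * norm g" for t
    using c0_abs_le_norm[of b t] norm_mult_ineq[of a g] mult_right_mono[OF a norm_ge_zero[of g]]
    by (simp add: b_def)
  have h: "h = g - z" using eq by (simp add: z_def eq_diff_eq)
  have z': "(Rep_c0 z has_real_derivative Rep_c0 b t - Rep_c0 a t * Rep_c0 z t - l) (at t)" for t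
    using prim_props(2)[of "a * h" t] unfolding z_def[symmetric] l_def[symmetric]
    by (simp add: h b_def c0_rep algebra_simps)
  obtain A where A: "\<And>t. (A has_real_derivative Rep_c0 a t) (at t)" using c0_primitive[of a] by blast
  have A_diff: "A s - A t \<le> L" if "\<bar>s - t\<bar> \<le> 1" for s t
  proof -
    have "norm (A s - A t) \<le> L * norm (s - t)"
    proof (rule differentiable_bound[where S = UNIV and f' = "\<lambda>t h. Rep_c0 a t * h"])
      show "(A has_derivative (*) (Rep_c0 a t)) (at t)" for t
        using A by (simp add: has_field_derivative_def)
      show "onorm ((*) (Rep_c0 a t)) \<le> L" for t
        using c0_abs_le_norm[of a t] a by (intro onorm_le) (simp add: abs_mult mult_right_mono)
    qed auto
    also have "\<dots> \<le> L" using that L by (simp add: mult_left_le)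
    finally show ?thesis by simp
  qed
  define H where "H t = exp (A t) * Rep_c0 z t" for t
  have H': "(H has_real_derivative exp (A t) * (Rep_c0 b t - l)) (at t)" for t
    unfolding H_def[abs_def] using A z'
    by (auto intro!: derivative_eq_intros simp: algebra_simps)
  have mz: "mean z = 0" by (simp add: z_def prim_props)
  obtain t0 where t0: "Rep_c0 z t0 = 0" using c0_zero[OF mz] by blast
  \<comment> \<open>\<open>H\<close> vanishes at both ends of this period, so Rolle's theorem finds
    a point where \<open>b = l\<close>; this bounds \<open>l\<close> by the data.\<close>
  obtain w where "H (t0 + 1) - H t0 = (t0 + 1 - t0) * (exp (A w) * (Rep_c0 b w - l))"
    using MVT2[of t0 "t0 + 1" H "\<lambda>t. exp (A t) * (Rep_c0 b t - l)"] H' by auto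
  then have "Rep_c0 b w = l" using t0 by (simp add: H_def c0_periodic)
  then have l: "\<bar>l\<bar> \<le> L * norm g" using b[of w] by simp
  have "\<bar>Rep_c0 z t\<bar> \<le> 2 * L * exp L * norm g" for t
  proof -
    obtain s where s: "t < s" "s < t + 1" "Rep_c0 z s = 0" using c0_zero[OF mz] .
    obtain w where w: "t < w" "w < s" "H s - H t = (s - t) * (exp (A w) * (Rep_c0 b w - l))"
      using MVT2[OF s(1), of H "\<lambda>t. exp (A t) * (Rep_c0 b t - l)"] H' by auto
    have "exp (A t) * \<bar>Rep_c0 z t\<bar> = \<bar>H s - H t\<bar>" using s by (simp add: H_def abs_mult)
    also have "\<dots> = (s - t) * (exp (A w) * \<bar>Rep_c0 b w - l\<bar>)"
      unfolding w(3) using s by (simp add: abs_mult)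
    also have "\<dots> \<le> 1 * (exp (A w) * (2 * (L * norm g)))"
      using s b[of w] l by (intro mult_mono mult_left_mono) auto
    also have "\<dots> \<le> exp (A t + L) * (2 * (L * norm g))"
      using A_diff[of w t] w s L by (simp add: mult_right_mono)
    finally have "exp (A t) * \<bar>Rep_c0 z t\<bar> \<le> exp (A t) * (exp L * (2 * (L * norm g)))"
      by (simp add: exp_add mult_ac)
    then show ?thesis by (simp add: mult_ac)
  qed
  then have "norm z \<le> 2 * L * exp L * norm g" by (rule c0_norm_le)
  then show ?thesis
    using norm_triangle_ineq4[of g z] by (simp add: h lin_bound_def algebra_simps)
qed

text \<open>The step size of the continuation in \<open>\<tau>\<close> is uniform because the
  bound on the inverse is.\<close>

lemma prim_perturbation_surj:
  assumes N: "\<And>q1 q2. \<exists>a. norm a \<le> L \<and> N q1 - N q2 = a * (q1 - q2)"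
  shows "\<exists>q. q + prim (N q) = p"
proof -
  have L: "L \<ge> 0" using N[of 0 0] by (meson norm_ge_zero order_trans)
  define K where "K = lin_bound L"
  have K: "K \<ge> 0" using L by (simp add: K_def lin_bound_def)
  define T where "T \<tau> q = q + \<tau> *\<^sub>R prim (N q)" for \<tau> q
  have expand: "norm (q1 - q2) \<le> K * norm (T \<tau> q1 - T \<tau> q2)" if \<tau>: "0 \<le> \<tau>" "\<tau> \<le> 1" for \<tau> q1 q2
  proof -
    obtain a where a: "norm a \<le> L" "N q1 - N q2 = a * (q1 - q2)" using N by blast
    have "T \<tau> q1 - T \<tau> q2 = (q1 - q2) + \<tau> *\<^sub>R prim (N q1 - N q2)"
      by (simp add: T_def prim_diff algebra_simps)
    then have "(q1 - q2) + prim ((\<tau> *\<^sub>R a) * (q1 - q2)) = T \<tau> q1 - T \<tau> q2"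
      by (simp add: a(2) prim_scaleR)
    moreover have "norm (\<tau> *\<^sub>R a) \<le> L"
      using \<tau> a(1) mult_mono[of \<tau> 1 "norm a" L] by simp
    ultimately show ?thesis unfolding K_def by (rule prim_linear_bound)
  qed
  \<comment> \<open>A step of length \<open>1 / m\<close> changes the equation by a map with
    Lipschitz constant \<open>2 * L / m\<close>, and the inverse at the previous stage has constant
    \<open>K\<close>; this \<open>m\<close> makes their composition a contraction.\<close>
  obtain m :: nat where m': "2 * K * L + 1 < real m" using reals_Archimedean2 by blast
  have "0 \<le> K * L" using K L by simp
  then have m: "real m > 2 * K * L" "m > 0" using m' by (auto intro!: Nat.gr0I)
  have "\<exists>q. T (real j / real m) q = p" if "j \<le> m" for j p
    using that
  proof (induction j arbitrary: p)
    case 0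
    then show ?case by (simp add: T_def)
  next
    case (Suc j)
    define \<tau> where "\<tau> = real j / real m"
    have \<tau>: "0 \<le> \<tau>" "\<tau> \<le> 1" using Suc.prems by (simp_all add: \<tau>_def)
    obtain S where S: "\<And>p. T \<tau> (S p) = p" using Suc by (auto simp: \<tau>_def) metis
    have S_lip: "norm (S p1 - S p2) \<le> K * norm (p1 - p2)" for p1 p2
      using expand[OF \<tau>, of "S p1" "S p2"] by (simp add: S)
    define c where "c = 2 * K * L / real m"
    define \<Phi> where "\<Phi> q = S (p - (1 / real m) *\<^sub>R prim (N q))" for q
    have "\<exists>!q. \<Phi> q = q"
    proof (rule banach_fix_type[where c = c], goal_cases)
      case 1 show ?case using K L by (simp add: c_def)
    next
      case 2 show ?case using m by (simp add: c_def)
    next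
      case 3 show ?case
    proof (intro allI)
      fix q1 q2
      obtain a where a: "norm a \<le> L" "N q1 - N q2 = a * (q1 - q2)" using N by blast
      have "norm (N q1 - N q2) \<le> L * norm (q1 - q2)"
        unfolding a(2) using norm_mult_ineq[of a "q1 - q2"] mult_right_mono[OF a(1) norm_ge_zero[of "q1 - q2"]] by simp
      then have 1: "norm (prim (N q1) - prim (N q2)) \<le> 2 * (L * norm (q1 - q2))"
        using norm_prim_le[of "N q1 - N q2"] by (simp add: prim_diff)
      have "norm (\<Phi> q1 - \<Phi> q2) \<le> K * norm ((p - (1 / real m) *\<^sub>R prim (N q1)) - (p - (1 / real m) *\<^sub>R prim (N q2)))"
        unfolding \<Phi>_def by (rule S_lip)
      also have "(p - (1 / real m) *\<^sub>R prim (N q1)) - (p - (1 / real m) *\<^sub>R prim (N q2)) =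
          - ((1 / real m) *\<^sub>R (prim (N q1) - prim (N q2)))" by (simp add: algebra_simps)
      also have "K * norm \<dots> = (K / real m) * norm (prim (N q1) - prim (N q2))" by simp
      also have "\<dots> \<le> (K / real m) * (2 * (L * norm (q1 - q2)))"
        using 1 K by (intro mult_left_mono) auto
      finally show "dist (\<Phi> q1) (\<Phi> q2) \<le> c * dist q1 q2" by (simp add: dist_norm c_def mult_ac)
    qed
    qed
    then obtain q where "\<Phi> q = q" by auto
    then have "T \<tau> q = p - (1 / real m) *\<^sub>R prim (N q)" using S unfolding \<Phi>_def by metis
    then have "T (real (Suc j) / real m) q = p"
      by (simp add: T_def \<tau>_def add_divide_distrib algebra_simps)
    then show ?case by blast
  qed
  from this[of m p] m(2) show ?thesis by (auto simp: T_def)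
qed

section \<open>The solution operator of the linearized equation\<close>

definition lin_sol :: "c0 \<Rightarrow> c0 \<Rightarrow> c0" where
  "lin_sol a g = (THE h. h + prim (a * h) = g)"

lemma lin_sol_unique:
  assumes "h + prim (a * h) = g" "h' + prim (a * h') = g" shows "h = h'"
proof -
  have "(h - h') + prim (a * (h - h')) = 0"
    using assms by (simp add: prim_diff algebra_simps)
  from prim_linear_bound[OF this order_refl] show ?thesis by simp
qed

lemma lin_sol: "lin_sol a g + prim (a * lin_sol a g) = g"
proof -
  have "\<exists>h. h + prim (a * h) = g"
    by (rule prim_perturbation_surj[where L = "norm a" and N = "(*) a"]) (auto simp: right_diff_distrib)
  then show ?thesis unfolding lin_sol_def by (rule theI'[OF ex_ex1I]) (rule lin_sol_unique)
qed

lemma lin_solI: "h + prim (a * h) = g \<Longrightarrow> lin_sol a g = h"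
  by (rule lin_sol_unique[OF lin_sol])

lemma lin_sol_scaleR: "lin_sol a (c *\<^sub>R g) = c *\<^sub>R lin_sol a g"
proof (rule lin_solI)
  have "c *\<^sub>R lin_sol a g + prim (a * (c *\<^sub>R lin_sol a g)) = c *\<^sub>R (lin_sol a g + prim (a * lin_sol a g))"
    by (simp only: mult_scaleR_right prim_scaleR scaleR_add_right)
  then show "c *\<^sub>R lin_sol a g + prim (a * (c *\<^sub>R lin_sol a g)) = c *\<^sub>R g"
    by (simp only: lin_sol)
qed

lemma norm_lin_sol_le: "norm (lin_sol a g) \<le> lin_bound (norm a) * norm g"
  by (rule prim_linear_bound[OF lin_sol order_refl])

text \<open>A resolvent identity. It expresses increments of the solution by the solution operator
  itself, from which continuity and the derivative follow.\<close>

lemma lin_sol_diff: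
  "lin_sol a g - lin_sol b h = lin_sol a (g - h - prim ((a - b) * lin_sol b h))"
proof (rule lin_solI[symmetric])
  have "x - y + prim (a * (x - y)) = (x + prim (a * x)) - (y + prim (b * y)) - prim ((a - b) * y)" for x y
    by (simp add: prim_diff left_diff_distrib right_diff_distrib)
  from this[of "lin_sol a g" "lin_sol b h"]
  show "lin_sol a g - lin_sol b h + prim (a * (lin_sol a g - lin_sol b h)) =
      g - h - prim ((a - b) * lin_sol b h)"
    by (simp only: lin_sol)
qed

lemma lin_sol_continuous: "continuous_on UNIV (\<lambda>p. lin_sol (fst p) (snd p))"
proof (rule continuous_at_imp_continuous_on, intro ballI)
  fix p0 :: "c0 \<times> c0"
  obtain b h where p0: "p0 = (b, h)" by force
  define K where "K = lin_bound (norm b + 1)"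
  have "((\<lambda>p. lin_sol (fst p) (snd p) - lin_sol b h) \<longlongrightarrow> 0) (at p0)"
  proof (rule Lim_null_comparison)
    have "\<forall>\<^sub>F p in at p0. dist p p0 < 1" by (rule tendstoD[OF tendsto_ident_at]) simp
    then show "\<forall>\<^sub>F p in at p0. norm (lin_sol (fst p) (snd p) - lin_sol b h) \<le>
        K * (norm (snd p - h) + 2 * (norm (fst p - b) * norm (lin_sol b h)))"
    proof eventually_elim
      case (elim p)
      obtain a g where p: "p = (a, g)" by force
      have "norm (a - b) < 1" using elim dist_fst_le[of p p0] by (simp add: p p0 dist_norm)
      then have "lin_bound (norm a) \<le> K" unfolding K_def
        using norm_triangle_ineq2[of a b] by (intro lin_bound_mono) auto
      moreover have "norm (g - h - prim ((a - b) * lin_sol b h)) \<le> norm (g - h) + 2 * (norm (a - b) * norm (lin_sol b h))"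
        using norm_triangle_ineq4[of "g - h" "prim ((a - b) * lin_sol b h)"]
          norm_prim_le[of "(a - b) * lin_sol b h"] norm_mult_ineq[of "a - b" "lin_sol b h"] by linarith
      ultimately have "lin_bound (norm a) * norm (g - h - prim ((a - b) * lin_sol b h)) \<le>
          K * (norm (g - h) + 2 * (norm (a - b) * norm (lin_sol b h)))"
        by (intro mult_mono) (auto simp: K_def lin_bound_def)
      then show ?case
        using norm_lin_sol_le[of a "g - h - prim ((a - b) * lin_sol b h)"] by (simp add: p lin_sol_diff)
    qed
    have "((\<lambda>p. K * (norm (snd p - h) + 2 * (norm (fst p - b) * norm (lin_sol b h)))) \<longlongrightarrow>
        K * (norm (snd p0 - h) + 2 * (norm (fst p0 - b) * norm (lin_sol b h)))) (at p0)"
      by (intro tendsto_intros)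
    then show "((\<lambda>p. K * (norm (snd p - h) + 2 * (norm (fst p - b) * norm (lin_sol b h)))) \<longlongrightarrow> 0) (at p0)"
      by (simp add: p0)
  qed
  then show "isCont (\<lambda>p. lin_sol (fst p) (snd p)) p0" by (simp add: continuous_at LIM_zero_iff p0)
qed

text \<open>By the resolvent identity the difference quotient is \<open>lin_sol\<close> at a nearby
  coefficient with a fixed right-hand side, so that continuity gives the limit.\<close>

lemma lin_sol_line:
  "line_deriv (\<lambda>p. lin_sol (fst p) (snd p)) p v
    (lin_sol (fst p) (snd v - prim (fst v * lin_sol (fst p) (snd p))))"
proof (rule has_vector_derivative_at_0_iff[THEN iffD2])
  obtain a g where p: "p = (a, g)" by force
  obtain \<alpha> \<gamma> where v: "v = (\<alpha>, \<gamma>)" by force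
  have "((\<lambda>s. a + s *\<^sub>R \<alpha>) \<longlongrightarrow> a) (at 0)" by (auto intro!: tendsto_eq_intros)
  then have "((\<lambda>s. (a + s *\<^sub>R \<alpha>, \<gamma> - prim (\<alpha> * lin_sol a g))) \<longlongrightarrow> (a, \<gamma> - prim (\<alpha> * lin_sol a g))) (at 0)"
    by (intro tendsto_Pair tendsto_const)
  from continuous_on_tendsto_compose[OF lin_sol_continuous this]
  have "((\<lambda>s. lin_sol (a + s *\<^sub>R \<alpha>) (\<gamma> - prim (\<alpha> * lin_sol a g))) \<longlongrightarrow> lin_sol a (\<gamma> - prim (\<alpha> * lin_sol a g))) (at 0)"
    by simp
  moreover have "\<forall>\<^sub>F s in at 0. lin_sol (a + s *\<^sub>R \<alpha>) (\<gamma> - prim (\<alpha> * lin_sol a g)) =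
      (lin_sol (a + s *\<^sub>R \<alpha>) (g + s *\<^sub>R \<gamma>) - lin_sol a g) /\<^sub>R s"
    using eventually_neq_at_within[of 0 0 UNIV]
  proof eventually_elim
    case (elim s)
    have "g + s *\<^sub>R \<gamma> - g - prim ((a + s *\<^sub>R \<alpha> - a) * lin_sol a g) = s *\<^sub>R (\<gamma> - prim (\<alpha> * lin_sol a g))"
      by (simp add: prim_scaleR scaleR_diff_right)
    then show ?case using elim by (simp add: lin_sol_diff lin_sol_scaleR)
  qed
  ultimately have "((\<lambda>s. (lin_sol (a + s *\<^sub>R \<alpha>) (g + s *\<^sub>R \<gamma>) - lin_sol a g) /\<^sub>R s) \<longlongrightarrow>
      lin_sol a (\<gamma> - prim (\<alpha> * lin_sol a g))) (at 0)"
    by (rule Lim_transform_eventually)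
  then show "((\<lambda>s. (lin_sol (fst (p + s *\<^sub>R v)) (snd (p + s *\<^sub>R v)) -
      lin_sol (fst (p + 0 *\<^sub>R v)) (snd (p + 0 *\<^sub>R v))) /\<^sub>R s) \<longlongrightarrow>
      lin_sol (fst p) (snd v - prim (fst v * lin_sol (fst p) (snd p)))) (at 0)"
    by (simp add: p v)
qed

lemma smooth_lin_sol: "smooth (\<lambda>p. lin_sol (fst p) (snd p))"
proof (rule smoothI)
  fix n
  show "Cn n (\<lambda>p. lin_sol (fst p) (snd p))"
  proof (induction n)
    case 0
    show ?case by (rule Cn_0) (rule lin_sol_continuous)
  next
    case (Suc n)
    have c: "Cn n (\<lambda>x. lin_sol (A x) (G x))" if "Cn n A" "Cn n G" for A G :: "(c0 \<times> c0) \<times> (c0 \<times> c0) \<Rightarrow> c0"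
      using Cn_compose[OF Suc Cn_Pair[OF that]] by simp
    show ?case
    proof (rule Cn_Suc[where F = "\<lambda>(p, v). lin_sol (fst p) (snd v - prim (fst v * lin_sol (fst p) (snd p)))"])
      show "Cn n (\<lambda>(p, v). lin_sol (fst p) (snd v - prim (fst v * lin_sol (fst p) (snd p))))"
        unfolding case_prod_beta'
        by (intro c Cn_diff Cn_linear_compose[OF bounded_linear_prim] Cn_mult Cn_fst Cn_snd Cn_id)
    qed (use lin_sol_line in simp)
  qed
qed

subsection \<open>Composition operators\<close>

text \<open>The superposition (Nemytskii) operator.\<close>

definition nem :: "(real \<Rightarrow> real) \<Rightarrow> c0 \<Rightarrow> c0" where
  "nem f u = Abs_c0 (\<lambda>t. f (Rep_c0 u t))"

lemma Rep_nem: "continuous_on UNIV f \<Longrightarrow> Rep_c0 (nem f u) = (\<lambda>t. f (Rep_c0 u t))"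
  unfolding nem_def
  by (rule Rep_Abs_c0) (simp_all add: continuous_on_compose2[OF _ c0_continuous] c0_periodic)

lemma dd_1: "line_deriv f x v d \<Longrightarrow> dd f x [v] = d"
  by (simp add: dd.simps(2) vector_derivative_at)

lemma bounded_on_interval:
  fixes g :: "real \<Rightarrow> real"
  assumes "continuous_on UNIV g"
  shows "\<exists>B\<ge>0. \<forall>x. \<bar>x\<bar> \<le> M \<longrightarrow> \<bar>g x\<bar> \<le> B"
proof -
  have "compact (g ` {-M..M})"
    by (intro compact_continuous_image continuous_on_subset[OF assms]) auto
  then obtain B where B: "\<forall>y\<in>g ` {-M..M}. \<bar>y\<bar> \<le> B"
    using compact_imp_bounded bounded_real by blast
  show ?thesis
  proof (intro exI[of _ "max B 0"] conjI allI impI)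
    fix x assume "\<bar>x\<bar> \<le> M"
    then have "x \<in> {-M..M}" by auto
    then show "\<bar>g x\<bar> \<le> max B 0" using B by (simp add: max.coboundedI1)
  qed simp
qed

lemma real_lipschitz:
  assumes "\<And>z. z \<in> closed_segment x y \<Longrightarrow> (g has_real_derivative g' z) (at z)"
    and "\<And>z. z \<in> closed_segment x y \<Longrightarrow> \<bar>g' z\<bar> \<le> B"
  shows "\<bar>g y - g x\<bar> \<le> B * \<bar>y - x\<bar>"
proof -
  have "norm (g y - g x) \<le> B * norm (y - x)"
    by (rule field_differentiable_bound[where S = "closed_segment x y" and f' = g'])
      (use assms in \<open>auto intro: has_field_derivative_at_within\<close>)
  then show ?thesis by simp
qed

lemma segment_abs_le:
  fixes x y z :: real
  assumes "z \<in> closed_segment x y" "\<bar>x\<bar> \<le> M" "\<bar>y\<bar> \<le> M" shows "\<bar>z\<bar> \<le> M"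
  using assms by (auto simp: closed_segment_eq_real_ivl split: if_splits)

lemma segment_diff_le:
  fixes x y z :: real
  assumes "z \<in> closed_segment x y" shows "\<bar>z - x\<bar> \<le> \<bar>y - x\<bar>" "\<bar>z - y\<bar> \<le> \<bar>x - y\<bar>"
  using assms by (auto simp: closed_segment_eq_real_ivl split: if_splits)

lemma real_taylor:
  assumes f: "\<And>z. (f has_real_derivative f' z) (at z)" and f': "\<And>z. (f' has_real_derivative f'' z) (at z)"
    and B: "\<And>z. \<bar>z\<bar> \<le> M \<Longrightarrow> \<bar>f'' z\<bar> \<le> B" "B \<ge> 0" and xy: "\<bar>x\<bar> \<le> M" "\<bar>y\<bar> \<le> M"
  shows "\<bar>f y - f x - f' x * (y - x)\<bar> \<le> B * (y - x)\<^sup>2"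
proof -
  have 1: "\<bar>f' z - f' x\<bar> \<le> B * \<bar>y - x\<bar>" if z: "z \<in> closed_segment x y" for z
  proof -
    have "\<bar>z\<bar> \<le> M" by (rule segment_abs_le[OF z xy])
    then have "\<bar>f' z - f' x\<bar> \<le> B * \<bar>z - x\<bar>"
      by (intro real_lipschitz[where g' = f''] f' B(1)) (rule segment_abs_le[OF _ xy(1)])
    also have "\<dots> \<le> B * \<bar>y - x\<bar>" using segment_diff_le(1)[OF z] B(2) by (rule mult_left_mono)
    finally show ?thesis .
  qed
  have "\<bar>(f y - f' x * y) - (f x - f' x * x)\<bar> \<le> (B * \<bar>y - x\<bar>) * \<bar>y - x\<bar>"
    by (rule real_lipschitz[where g = "\<lambda>z. f z - f' x * z" and g' = "\<lambda>z. f' z - f' x"])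
      (auto intro!: derivative_eq_intros f 1)
  then show ?thesis by (simp add: power2_eq_square algebra_simps)
qed

text \<open>In the sup norm all values of \<open>u\<close> and \<open>v\<close> stay in one compact
  interval, so the pointwise Taylor bound is uniform.\<close>

lemma nem_taylor:
  assumes "smooth f"
  shows "\<exists>B\<ge>0. \<forall>u v. norm u \<le> M \<longrightarrow> norm v \<le> M \<longrightarrow>
    norm (nem f v - nem f u - nem (deriv f) u * (v - u)) \<le> B * (norm (v - u))\<^sup>2"
proof -
  note f' = smooth_real(2)[OF assms]
  obtain B where B: "B \<ge> 0" "\<And>z. \<bar>z\<bar> \<le> M \<Longrightarrow> \<bar>deriv (deriv f) z\<bar> \<le> B"
    using bounded_on_interval[OF smooth_continuous[OF smooth_real(2)[OF f']], of M] by blast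
  have "norm (nem f v - nem f u - nem (deriv f) u * (v - u)) \<le> B * (norm (v - u))\<^sup>2"
    if uv: "norm u \<le> M" "norm v \<le> M" for u v
  proof (rule c0_norm_le)
    fix t
    have "\<bar>f (Rep_c0 v t) - f (Rep_c0 u t) - deriv f (Rep_c0 u t) * (Rep_c0 v t - Rep_c0 u t)\<bar>
        \<le> B * (Rep_c0 v t - Rep_c0 u t)\<^sup>2"
      by (rule real_taylor[OF smooth_real(1)[OF assms] smooth_real(1)[OF f'] B(2) B(1)])
        (use c0_abs_le_norm order_trans uv in blast)+
    also have "(Rep_c0 v t - Rep_c0 u t)\<^sup>2 \<le> (norm (v - u))\<^sup>2"
      using c0_abs_le_norm[of "v - u" t] by (simp add: c0_rep abs_le_square_iff[symmetric])
    finally show "\<bar>Rep_c0 (nem f v - nem f u - nem (deriv f) u * (v - u)) t\<bar> \<le> B * (norm (v - u))\<^sup>2"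
      using B(1) by (simp add: c0_rep Rep_nem smooth_continuous assms f' mult_left_mono)
  qed
  then show ?thesis using B(1) by blast
qed

lemma nem_line:
  assumes "smooth f"
  shows "line_deriv (nem f) u h (nem (deriv f) u * h)"
proof (rule has_vector_derivative_at_0_iff[THEN iffD2])
  obtain B where B: "B \<ge> 0" and *: "\<And>u' v. norm u' \<le> norm u + norm h \<Longrightarrow> norm v \<le> norm u + norm h \<Longrightarrow>
    norm (nem f v - nem f u' - nem (deriv f) u' * (v - u')) \<le> B * (norm (v - u'))\<^sup>2"
    using nem_taylor[OF assms, of "norm u + norm h"] by blast
  have "((\<lambda>s. (nem f (u + s *\<^sub>R h) - nem f u) /\<^sub>R s - nem (deriv f) u * h) \<longlongrightarrow> 0) (at 0)"
  proof (rule Lim_null_comparison)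
    have "\<forall>\<^sub>F s in at (0::real). dist s 0 < 1" by (rule tendstoD[OF tendsto_ident_at]) simp
    then show "\<forall>\<^sub>F s in at 0. norm ((nem f (u + s *\<^sub>R h) - nem f u) /\<^sub>R s - nem (deriv f) u * h) \<le> B * (\<bar>s\<bar> * (norm h)\<^sup>2)"
      using eventually_neq_at_within[of 0 0 UNIV]
    proof eventually_elim
      case (elim s)
      have "norm (u + s *\<^sub>R h) \<le> norm u + norm h"
        using elim norm_triangle_ineq[of u "s *\<^sub>R h"] mult_right_mono[of "\<bar>s\<bar>" 1 "norm h"] by simp
      from *[OF _ this, of u]
      have "norm (nem f (u + s *\<^sub>R h) - nem f u - s *\<^sub>R (nem (deriv f) u * h)) \<le> B * (s\<^sup>2 * (norm h)\<^sup>2)"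
        by (simp add: power_mult_distrib)
      then have 1: "norm (nem f (u + s *\<^sub>R h) - nem f u - s *\<^sub>R (nem (deriv f) u * h)) \<le> \<bar>s\<bar> * (B * (\<bar>s\<bar> * (norm h)\<^sup>2))"
        by (simp add: power2_eq_square mult_ac abs_mult[symmetric])
      have "(nem f (u + s *\<^sub>R h) - nem f u) /\<^sub>R s - nem (deriv f) u * h =
          (nem f (u + s *\<^sub>R h) - nem f u - s *\<^sub>R (nem (deriv f) u * h)) /\<^sub>R s"
        using elim(2) by (simp add: scaleR_diff_right)
      then have "norm ((nem f (u + s *\<^sub>R h) - nem f u) /\<^sub>R s - nem (deriv f) u * h) =
          norm (nem f (u + s *\<^sub>R h) - nem f u - s *\<^sub>R (nem (deriv f) u * h)) / \<bar>s\<bar>"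
        by (simp add: divide_inverse mult.commute)
      also have "\<dots> \<le> B * (\<bar>s\<bar> * (norm h)\<^sup>2)"
        using 1 elim(2) by (simp add: pos_divide_le_eq mult.commute)
      finally show ?case .
    qed
    show "((\<lambda>s. B * (\<bar>s\<bar> * (norm h)\<^sup>2)) \<longlongrightarrow> 0) (at 0)"
      by (intro tendsto_mult_right_zero tendsto_mult_left_zero tendsto_rabs_zero tendsto_ident_at)
  qed
  then show "((\<lambda>s. (nem f (u + s *\<^sub>R h) - nem f (u + 0 *\<^sub>R h)) /\<^sub>R s) \<longlongrightarrow> nem (deriv f) u * h) (at 0)"
    by (simp add: LIM_zero_iff)
qed

lemma nem_continuous:
  assumes "smooth f" shows "continuous_on UNIV (nem f)"
proof (rule continuous_at_imp_continuous_on, intro ballI)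
  fix u :: c0
  obtain B where B: "B \<ge> 0" and *: "\<And>u' v. norm u' \<le> norm u + 1 \<Longrightarrow> norm v \<le> norm u + 1 \<Longrightarrow>
    norm (nem f v - nem f u' - nem (deriv f) u' * (v - u')) \<le> B * (norm (v - u'))\<^sup>2"
    using nem_taylor[OF assms, of "norm u + 1"] by blast
  define D where "D = norm (nem (deriv f) u)"
  have "((\<lambda>v. nem f v - nem f u) \<longlongrightarrow> 0) (at u)"
  proof (rule Lim_null_comparison)
    have "\<forall>\<^sub>F v in at u. dist v u < 1" by (rule tendstoD[OF tendsto_ident_at]) simp
    then show "\<forall>\<^sub>F v in at u. norm (nem f v - nem f u) \<le> B * (norm (v - u))\<^sup>2 + D * norm (v - u)"
    proof eventually_elim
      case (elim v)
      have "norm v \<le> norm u + 1" using elim norm_triangle_ineq2[of v u] by (simp add: dist_norm)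
      from *[OF _ this, of u] have "norm (nem f v - nem f u - nem (deriv f) u * (v - u)) \<le> B * (norm (v - u))\<^sup>2"
        by simp
      moreover have "norm (nem (deriv f) u * (v - u)) \<le> D * norm (v - u)"
        unfolding D_def by (rule norm_mult_ineq)
      ultimately show ?case
        using norm_triangle_sub[of "nem f v - nem f u" "nem (deriv f) u * (v - u)"] by linarith
    qed
    have "((\<lambda>v. B * (norm (v - u))\<^sup>2 + D * norm (v - u)) \<longlongrightarrow> B * (norm (u - u))\<^sup>2 + D * norm (u - u)) (at u)"
      by (intro tendsto_intros)
    then show "((\<lambda>v. B * (norm (v - u))\<^sup>2 + D * norm (v - u)) \<longlongrightarrow> 0) (at u)" by simp
  qed
  then show "isCont (nem f) u" by (simp add: continuous_at LIM_zero_iff)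
qed

lemma smooth_nem:
  assumes "smooth f" shows "smooth (nem f)"
proof (rule smoothI)
  fix n
  show "Cn n (nem f)"
    using assms
  proof (induction n arbitrary: f)
    case 0
    then show ?case by (intro Cn_0 nem_continuous)
  next
    case (Suc n)
    have 1: "Cn n (\<lambda>p. nem (deriv f) (fst p))"
      by (rule Cn_compose[OF Suc.IH[OF smooth_real(2)[OF Suc.prems]] Cn_fst[OF Cn_id]])
    show ?case
      by (rule Cn_Suc[where F = "\<lambda>p. nem (deriv f) (fst p) * snd p"])
        (simp add: nem_line Suc.prems, intro Cn_mult 1 Cn_snd Cn_id)
  qed
qed

subsection \<open>Difference quotients\<close>

text \<open>Hadamard's integral form of the difference quotient of a primitive of \<open>f'\<close>.
  Without a division it is continuous across the diagonal, so that \<open>cslope\<close> is again an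
  element of \<open>C^0\<close>.\<close>

definition slope :: "(real \<Rightarrow> real) \<Rightarrow> real \<Rightarrow> real \<Rightarrow> real" where
  "slope f' x y = integral {0..1} (\<lambda>s. f' (y + s * (x - y)))"

lemma slope_point_in_segment: "s \<in> {0..1} \<Longrightarrow> y + s * (x - y) \<in> closed_segment x y" for x y :: real
  unfolding closed_segment_def
  by (auto intro!: exI[of _ "1 - s"] simp: algebra_simps)

lemma slope_eq:
  assumes "\<And>z. (f has_real_derivative f' z) (at z)"
  shows "f x - f y = slope f' x y * (x - y)"
proof -
  have "((\<lambda>s. f' (y + s * (x - y)) * (x - y)) has_integral (f (y + 1 * (x - y)) - f (y + 0 * (x - y)))) {0..1}"
  proof (rule fundamental_theorem_of_calculus)
    fix s :: real
    have "((\<lambda>s. y + s * (x - y)) has_real_derivative (x - y)) (at s)"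
      by (auto intro!: derivative_eq_intros)
    from DERIV_chain2[OF assms this]
    show "((\<lambda>s. f (y + s * (x - y))) has_vector_derivative f' (y + s * (x - y)) * (x - y)) (at s within {0..1})"
      by (simp add: has_real_derivative_iff_has_vector_derivative has_vector_derivative_at_within)
  qed simp
  from integral_unique[OF this] show ?thesis by (simp add: slope_def)
qed

lemma slope_integrand_continuous:
  "continuous_on UNIV f' \<Longrightarrow> continuous_on {0..1} (\<lambda>s::real. f' (y + s * (x - y)))" for y x :: real
  by (rule continuous_on_compose2) (auto intro!: continuous_intros)

lemma slope_bound:
  assumes "continuous_on UNIV f'" "\<And>z. z \<in> closed_segment x y \<Longrightarrow> \<bar>f' z - c\<bar> \<le> B"
  shows "\<bar>slope f' x y - c\<bar> \<le> B"
proof -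
  note cont = slope_integrand_continuous[OF assms(1), of y x]
  have "slope f' x y - c = integral {0..1} (\<lambda>s. f' (y + s * (x - y)) - c)"
    unfolding slope_def by (subst integral_diff) (auto intro!: integrable_continuous_real cont)
  also have "norm \<dots> \<le> B * (1 - 0)"
    by (rule integral_bound) (use assms(2) slope_point_in_segment in \<open>auto intro!: continuous_on_diff cont\<close>)
  finally show ?thesis by simp
qed

lemma slope_continuous:
  assumes "continuous_on UNIV f'"
  shows "continuous_on UNIV (\<lambda>p. slope f' (fst p) (snd p))"
proof -
  have "continuous_on UNIV (\<lambda>p. integral (cbox 0 1) (\<lambda>s::real. f' (snd p + s * (fst p - snd p))))"
    by (rule integral_continuous_on_param)
      (auto simp: case_prod_beta' intro!: continuous_on_compose2[OF assms] continuous_intros)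
  then show ?thesis by (simp add: slope_def)
qed

definition cslope :: "(real \<Rightarrow> real) \<Rightarrow> c0 \<Rightarrow> c0 \<Rightarrow> c0" where
  "cslope f' u v = Abs_c0 (\<lambda>t. slope f' (Rep_c0 u t) (Rep_c0 v t))"

lemma Rep_cslope:
  assumes "continuous_on UNIV f'"
  shows "Rep_c0 (cslope f' u v) t = slope f' (Rep_c0 u t) (Rep_c0 v t)"
proof -
  have "continuous_on UNIV (\<lambda>t. slope f' (fst (Rep_c0 u t, Rep_c0 v t)) (snd (Rep_c0 u t, Rep_c0 v t)))"
    by (rule continuous_on_compose2[OF slope_continuous[OF assms]])
      (auto intro!: continuous_on_Pair c0_continuous)
  then show ?thesis unfolding cslope_def by (subst Rep_Abs_c0) (auto simp: c0_periodic)
qed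

lemma nem_diff:
  assumes f: "\<And>z. (f has_real_derivative f' z) (at z)" and f': "continuous_on UNIV f'"
  shows "nem f u - nem f v = cslope f' u v * (u - v)"
proof (rule c0_eqI)
  have "continuous_on UNIV f"
    using f by (intro continuous_at_imp_continuous_on) (blast intro: DERIV_isCont)
  then show "Rep_c0 (nem f u - nem f v) t = Rep_c0 (cslope f' u v * (u - v)) t" for t
    using slope_eq[OF f] by (simp add: c0_rep Rep_nem Rep_cslope[OF f'])
qed

lemma norm_cslope_le:
  assumes "continuous_on UNIV f'" "\<And>z. \<bar>z\<bar> \<le> M \<Longrightarrow> \<bar>f' z\<bar> \<le> B" "norm u \<le> M" "norm v \<le> M"
  shows "norm (cslope f' u v) \<le> B"
proof (rule c0_norm_le)
  fix t
  have "\<bar>slope f' (Rep_c0 u t) (Rep_c0 v t) - 0\<bar> \<le> B"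
  proof (rule slope_bound[OF assms(1)])
    fix z assume "z \<in> closed_segment (Rep_c0 u t) (Rep_c0 v t)"
    from segment_abs_le[OF this order_trans[OF c0_abs_le_norm assms(3)] order_trans[OF c0_abs_le_norm assms(4)]]
    show "\<bar>f' z - 0\<bar> \<le> B" using assms(2) by simp
  qed
  then show "\<bar>Rep_c0 (cslope f' u v) t\<bar> \<le> B" by (simp add: Rep_cslope[OF assms(1)])
qed

lemma cslope_near:
  assumes "smooth f'" "norm u \<le> M" "norm v \<le> M" "\<And>z. \<bar>z\<bar> \<le> M \<Longrightarrow> \<bar>deriv f' z\<bar> \<le> B" "B \<ge> 0"
  shows "norm (cslope f' u v - nem f' v) \<le> B * norm (u - v)"
proof (rule c0_norm_le)
  fix t
  note cont = smooth_continuous[OF assms(1)]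
  let ?x = "Rep_c0 u t" and ?y = "Rep_c0 v t"
  have b: "\<bar>?x\<bar> \<le> M" "\<bar>?y\<bar> \<le> M" using c0_abs_le_norm order_trans assms(2,3) by blast+
  have "\<bar>slope f' ?x ?y - f' ?y\<bar> \<le> B * \<bar>?x - ?y\<bar>"
  proof (rule slope_bound[OF cont])
    fix z assume z: "z \<in> closed_segment ?x ?y"
    have "\<bar>f' z - f' ?y\<bar> \<le> B * \<bar>z - ?y\<bar>"
      by (intro real_lipschitz[where g' = "deriv f'"] smooth_real(1) assms)
        (rule segment_abs_le[OF _ b(2) segment_abs_le[OF z b]])
    also have "\<dots> \<le> B * \<bar>?x - ?y\<bar>" using segment_diff_le(2)[OF z] assms(5) by (rule mult_left_mono)
    finally show "\<bar>f' z - f' ?y\<bar> \<le> B * \<bar>?x - ?y\<bar>" .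
  qed
  also have "\<dots> \<le> B * norm (u - v)"
    using c0_abs_le_norm[of "u - v" t] assms(5) by (intro mult_left_mono) (auto simp: c0_rep)
  finally show "\<bar>Rep_c0 (cslope f' u v - nem f' v) t\<bar> \<le> B * norm (u - v)"
    by (simp add: c0_rep Rep_cslope[OF cont] Rep_nem[OF cont])
qed

subsection \<open>A priori bounds\<close>

text \<open>The first zero after \<open>a\<close> would be reached from positive values, against the
  positive slope there.\<close>

lemma stays_positive:
  fixes \<sigma> :: "real \<Rightarrow> real"
  assumes d: "\<And>t. (\<sigma> has_real_derivative d t) (at t)" and pos: "\<And>t. \<sigma> t = 0 \<Longrightarrow> d t > 0"
    and ab: "a < b" "\<sigma> a > 0"
  shows "\<sigma> b > 0"
proof (rule ccontr)
  assume b: "\<not> \<sigma> b > 0"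
  have cont: "continuous_on UNIV \<sigma>"
    using d by (intro continuous_at_imp_continuous_on) (blast intro: DERIV_isCont)
  define Z where "Z = {a..b} \<inter> \<sigma> -` {..0}"
  have "closed Z" unfolding Z_def by (intro closed_Int closed_vimage cont) auto
  then have "compact Z" by (auto simp: Z_def compact_eq_bounded_closed intro: bounded_subset[of "{a..b}"])
  moreover have "b \<in> Z" using ab b by (simp add: Z_def)
  ultimately obtain t1 where t1: "t1 \<in> Z" "\<And>t. t \<in> Z \<Longrightarrow> t1 \<le> t"
    using compact_attains_inf[of Z] by blast
  have "t1 \<noteq> a" using t1(1) ab by (auto simp: Z_def)
  then have t1a: "a < t1" "t1 \<le> b" using t1(1) by (auto simp: Z_def)
  have \<sigma>_pos: "\<sigma> t > 0" if "a \<le> t" "t < t1" for t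
    using t1(2)[of t] that t1a by (force simp: Z_def)
  have "\<sigma> t1 = 0"
  proof (rule ccontr)
    assume "\<sigma> t1 \<noteq> 0"
    then have neg: "\<sigma> t1 < 0" using t1(1) by (auto simp: Z_def)
    then obtain t where "a \<le> t" "t \<le> t1" "\<sigma> t = 0"
      using IVT2'[of \<sigma> t1 0 a] ab t1a continuous_on_subset[OF cont] by auto
    then show False using \<sigma>_pos[of t] neg by (cases "t = t1") auto
  qed
  from DERIV_pos_inc_left[OF d pos[OF this]]
  obtain e where e: "e > 0" "\<And>h. 0 < h \<Longrightarrow> h < e \<Longrightarrow> \<sigma> (t1 - h) < \<sigma> t1" by blast
  define h where "h = min e (t1 - a) / 2"
  have "0 < h" "h < e" "a \<le> t1 - h" using e(1) t1a by (auto simp: h_def min_def field_simps)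
  with e(2)[of h] \<sigma>_pos[of "t1 - h"] \<open>\<sigma> t1 = 0\<close> show False by simp
qed

text \<open>If all zeros were crossed upwards, the function would stay positive after leaving a zero
  and could not return to it one period later.\<close>

lemma c0_downcrossing:
  assumes "mean y = 0" and d: "\<And>t. (Rep_c0 y has_real_derivative d t) (at t)"
  shows "\<exists>t. Rep_c0 y t = 0 \<and> d t \<le> 0"
proof (rule ccontr)
  assume "\<not> ?thesis"
  then have pos: "d t > 0" if "Rep_c0 y t = 0" for t using that not_le by blast
  obtain t where t: "Rep_c0 y t = 0" using c0_zero[OF assms(1)] by blast
  obtain e where e: "e > 0" "\<And>h. 0 < h \<Longrightarrow> h < e \<Longrightarrow> Rep_c0 y t < Rep_c0 y (t + h)"
    using DERIV_pos_inc_right[OF d pos[OF t]] by blast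
  define a where "a = t + min e 1 / 2"
  have "a < t + 1" "Rep_c0 y a > 0"
    using e(1) e(2)[of "min e 1 / 2"] t by (auto simp: a_def min_def split: if_splits)
  from stays_positive[OF d pos this] show False by (simp add: c0_periodic t)
qed

text \<open>Zeros lie within distance one on both sides of any point. The upper bound on the slope,
  applied from the zero on the left and up to the zero on the right, controls the function from
  above and from below.\<close>

lemma c0_osc_bound:
  assumes "mean y = 0" and d: "\<And>t. (Rep_c0 y has_real_derivative d t) (at t)" "\<And>t. d t \<le> r"
  shows "\<bar>Rep_c0 y t\<bar> \<le> r" "0 \<le> r"
proof -
  have up: "Rep_c0 y b - Rep_c0 y a \<le> (b - a) * r" if ab: "a < b" for a b
  proof -
    obtain z where "Rep_c0 y b - Rep_c0 y a = (b - a) * d z"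
      using MVT2[OF ab, of "Rep_c0 y" d] d(1) by blast
    then show ?thesis using d(2)[of z] ab by simp
  qed
  have "0 \<le> r" using up[of 0 1] c0_periodic[of y 0] by simp
  then show "0 \<le> r" .
  obtain a where a: "t - 1 < a" "a < t - 1 + 1" "Rep_c0 y a = 0" using c0_zero[OF assms(1)] .
  obtain b where b: "t < b" "b < t + 1" "Rep_c0 y b = 0" using c0_zero[OF assms(1)] .
  have "Rep_c0 y t \<le> (t - a) * r" using up[of a t] a by simp
  moreover have "(t - a) * r \<le> 1 * r" using a \<open>0 \<le> r\<close> by (intro mult_right_mono) auto
  moreover have "- Rep_c0 y t \<le> (b - t) * r" using up[of t b] b by simp
  moreover have "(b - t) * r \<le> 1 * r" using b \<open>0 \<le> r\<close> by (intro mult_right_mono) auto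
  ultimately show "\<bar>Rep_c0 y t\<bar> \<le> r" by simp
qed

text \<open>The difference \<open>y = q - p\<close> has slope \<open>mean (nem F q) - F q\<close>.
  Where \<open>y\<close> crosses zero downwards, \<open>q\<close> equals \<open>p\<close>, so the
  mean is at most a value of \<open>F\<close> on the range of \<open>p\<close>. The lower bound
  \<open>m\<close> of \<open>F\<close> then bounds the slope from above, and with it
  \<open>y\<close> on both sides.\<close>

lemma apriori_bound:
  assumes F: "continuous_on UNIV F" and m: "\<And>x. m \<le> F x"
    and eq: "q + prim (nem F q) = p" and S: "\<And>x. \<bar>x\<bar> \<le> norm p \<Longrightarrow> F x \<le> S"
  shows "mean (nem F q) \<le> S" "\<bar>Rep_c0 q t - Rep_c0 p t\<bar> \<le> mean (nem F q) - m" "norm q \<le> norm p + (S - m)"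
proof -
  define y where "y = - prim (nem F q)"
  define c where "c = mean (nem F q)"
  have q: "q = p + y" using eq by (simp add: y_def algebra_simps)
  have y0: "mean y = 0" by (simp add: y_def prim_props)
  have d: "(Rep_c0 y has_real_derivative (c - F (Rep_c0 q t))) (at t)" for t
  proof -
    have "Rep_c0 y = (\<lambda>t. - Rep_c0 (prim (nem F q)) t)" by (simp add: y_def c0_rep fun_eq_iff)
    then show ?thesis using DERIV_minus[OF prim_props(2)[of "nem F q" t]] by (simp add: c_def Rep_nem[OF F])
  qed
  obtain t0 where t0: "Rep_c0 y t0 = 0" "c - F (Rep_c0 q t0) \<le> 0"
    using c0_downcrossing[OF y0 d] by blast
  have "F (Rep_c0 q t0) \<le> S" using t0(1) by (intro S) (simp add: q c0_rep c0_abs_le_norm)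
  then show cS: "mean (nem F q) \<le> S" using t0(2) by (simp add: c_def)
  have osc: "\<bar>Rep_c0 y t\<bar> \<le> c - m" for t
    by (rule c0_osc_bound(1)[OF y0 d]) (simp add: m)
  then show "\<bar>Rep_c0 q t - Rep_c0 p t\<bar> \<le> mean (nem F q) - m" by (simp add: q c0_rep c_def)
  have "norm y \<le> c - m" using osc by (rule c0_norm_le)
  then show "norm q \<le> norm p + (S - m)" using norm_triangle_ineq[of p y] cS by (simp add: q c_def)
qed

section \<open>Chain rules along curves, positive solutions and the adjoint equation\<close>

lemma lin_sol_curve:
  assumes "(a has_vector_derivative a') (at 0)" "(g has_vector_derivative g') (at (0::real))"
  shows "((\<lambda>s. lin_sol (a s) (g s)) has_vector_derivative
    lin_sol (a 0) (g' - prim (a' * lin_sol (a 0) (g 0)))) (at 0)"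
  using smooth_curve[OF smooth_lin_sol has_vector_derivative_Pair[OF assms]]
    dd_1[OF lin_sol_line, of "(a 0, g 0)" "(a', g')"] by simp

lemma nem_curve:
  assumes "smooth f" "(u has_vector_derivative u') (at (0::real))"
  shows "((\<lambda>s. nem f (u s)) has_vector_derivative nem (deriv f) (u 0) * u') (at 0)"
  using smooth_curve[OF smooth_nem[OF assms(1)] assms(2)] dd_1[OF nem_line[OF assms(1)]] by simp

lemma mean_curve:
  assumes "(u has_vector_derivative u') (at (0::real))"
  shows "((\<lambda>s. mean (u s) :: real) has_vector_derivative mean (u' :: c0)) (at 0)"
  by (rule bounded_linear.has_vector_derivative[OF bounded_linear_mean_c0 assms])

lemma prim_curve:
  assumes "(u has_vector_derivative u') (at (0::real))"
  shows "((\<lambda>s. prim (u s)) has_vector_derivative prim u') (at 0)"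
  by (rule bounded_linear.has_vector_derivative[OF bounded_linear_prim assms])

lemma smooth_mean: "smooth f \<Longrightarrow> smooth (\<lambda>x. mean (f x :: c0))"
  by (rule smooth_linear_compose[OF bounded_linear_mean_c0])

lemma smooth_c0_mult: "smooth f \<Longrightarrow> smooth g \<Longrightarrow> smooth (\<lambda>x. f x * g x :: c0)"
  by (rule smoothI) (rule Cn_mult[OF smoothD smoothD])

lemma smooth_lin_sol_compose: "smooth a \<Longrightarrow> smooth g \<Longrightarrow> smooth (\<lambda>x. lin_sol (a x) (g x))"
  using smooth_compose[OF smooth_lin_sol smoothI[OF Cn_Pair[OF smoothD smoothD]]] by simp

text \<open>\<open>w * exp A\<close> is constant for a primitive \<open>A\<close> of
  \<open>a\<close>, so \<open>w\<close> has the sign of its mean.\<close>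

lemma decay_pos:
  assumes w: "\<And>t. (Rep_c0 w has_real_derivative - (Rep_c0 a t * Rep_c0 w t)) (at t)" and "mean w > 0"
  shows "Rep_c0 w t > 0"
proof -
  obtain A where A: "\<And>t. (A has_real_derivative Rep_c0 a t) (at t)" using c0_primitive[of a] by blast
  have "((\<lambda>t. Rep_c0 w t * exp (A t)) has_real_derivative 0) (at t)" for t
    using w A by (auto intro!: derivative_eq_intros simp: algebra_simps)
  then have const: "Rep_c0 w t * exp (A t) = Rep_c0 w 0 * exp (A 0)" for t
    by (intro DERIV_isconst_all) simp
  have "Rep_c0 w 0 * exp (A 0) > 0"
  proof (rule ccontr)
    assume "\<not> ?thesis"
    then have "Rep_c0 w t * exp (A t) \<le> 0" for t using const[of t] by simp
    then have "Rep_c0 w t \<le> Rep_c0 0 t" for t by (simp add: mult_le_0_iff c0_rep)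
    from mean_c0_mono[OF this] show False using assms(2) by simp
  qed
  then have "Rep_c0 w t * exp (A t) > 0" using const[of t] by simp
  then show ?thesis by (simp add: zero_less_mult_iff)
qed

definition recip :: "c0 \<Rightarrow> c0" where "recip w = Abs_c0 (\<lambda>t. inverse (Rep_c0 w t))"

lemma Rep_recip:
  assumes "\<And>t. Rep_c0 w t > 0" shows "Rep_c0 (recip w) t = inverse (Rep_c0 w t)"
proof -
  have "continuous_on UNIV (\<lambda>t. inverse (Rep_c0 w t))"
    by (intro continuous_on_inverse c0_continuous ballI) (metis assms less_irrefl)
  then show ?thesis unfolding recip_def by (subst Rep_Abs_c0) (simp_all add: c0_periodic)
qed

lemma mult_recip: "(\<And>t. Rep_c0 w t > 0) \<Longrightarrow> w * recip w = 1"
  by (rule c0_eqI) (simp add: c0_rep Rep_recip less_imp_neq[symmetric])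

lemma mean_recip_pos:
  assumes "\<And>t. Rep_c0 w t > 0" shows "mean (recip w) > 0"
proof (rule mean_c0_pos)
  show "0 \<le> Rep_c0 (recip w) t" for t using assms[of t] by (simp add: Rep_recip[OF assms])
  show "recip w \<noteq> 0" using mult_recip[OF assms] by auto
qed

text \<open>Variation of constants: \<open>1 / w\<close> solves the adjoint of the linearized equation.\<close>

lemma adjoint_identity:
  assumes pos: "\<And>t. Rep_c0 w t > 0"
    and w: "\<And>t. (Rep_c0 w has_real_derivative - (Rep_c0 a t * Rep_c0 w t)) (at t)"
    and h: "h = lin_sol a (- prim k)"
  shows "((\<lambda>t. Rep_c0 h t / Rep_c0 w t) has_real_derivative
      (mean (k + a * h) - Rep_c0 k t) / Rep_c0 w t) (at t)" (is ?D)
    and "mean (k + a * h) * mean (recip w) = mean (k * recip w)"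
proof -
  define \<mu> where "\<mu> = mean (k + a * h)"
  have "h + prim (a * h) = - prim k" unfolding h by (rule lin_sol)
  then have "h = - prim k - prim (a * h)" by (simp only: eq_diff_eq)
  then have "h = - prim (k + a * h)" by (simp add: prim_add)
  then have "Rep_c0 h = (\<lambda>t. - Rep_c0 (prim (k + a * h)) t)" by (metis uminus_c0.rep_eq)
  then have h': "(Rep_c0 h has_real_derivative - (Rep_c0 k t + Rep_c0 a t * Rep_c0 h t - \<mu>)) (at t)" for t
    using DERIV_minus[OF prim_props(2)[of "k + a * h" t]] by (simp add: c0_rep \<mu>_def)
  have nz: "Rep_c0 w t \<noteq> 0" for t using pos[of t] by simp
  have D: "((\<lambda>t. Rep_c0 h t / Rep_c0 w t) has_real_derivative (\<mu> - Rep_c0 k t) / Rep_c0 w t) (at t)" for t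
  proof -
    have "(- (Rep_c0 k t + Rep_c0 a t * Rep_c0 h t - \<mu>) * Rep_c0 w t - Rep_c0 h t * - (Rep_c0 a t * Rep_c0 w t))
        / (Rep_c0 w t * Rep_c0 w t) = (\<mu> - Rep_c0 k t) / Rep_c0 w t"
      using nz[of t] by (simp add: divide_simps) (simp add: algebra_simps)
    then show ?thesis using DERIV_divide[OF h' w nz, of t] by simp
  qed
  then show ?D by (simp add: \<mu>_def)
  \<comment> \<open>The quotient \<open>h / w\<close> is periodic, so its derivative has mean zero,
    which determines \<mu>.\<close>
  have "((\<lambda>t. Rep_c0 h t / Rep_c0 w t) has_real_derivative Rep_c0 ((const_fn \<mu> - k) * recip w) t) (at t)" for t
    using D[of t] by (simp add: c0_rep Rep_recip[OF pos] divide_inverse)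
  from mean_c0_diff[OF this, of 0] have "mean ((const_fn \<mu> - k) * recip w) = 0"
    using c0_periodic[of h 0] c0_periodic[of w 0] by simp
  then show "mean (k + a * h) * mean (recip w) = mean (k * recip w)"
    by (simp add: left_diff_distrib mean_diff const_fn_c0_eq mean_scaleR \<mu>_def)
qed

section \<open>The nonlinear problem on continuous functions\<close>

locale coercive =
  fixes f :: "real \<Rightarrow> real"
  assumes f: "smooth f" and f_top: "filterlim f at_top at_top" and f_bot: "filterlim f at_top at_bot"
begin

definition "f1 = deriv f"
definition "f2 = deriv f1"
definition "f3 = deriv f2"

lemma smooth_f: "smooth f1" "smooth f2" "smooth f3"
  by (simp_all add: f1_def f2_def f3_def smooth_real(2) f)

lemma f_cont: "continuous_on UNIV f" "continuous_on UNIV f1" "continuous_on UNIV f2" "continuous_on UNIV f3"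
  by (intro smooth_continuous smooth_f f)+

lemma f_deriv: "(f has_real_derivative f1 x) (at x)" "(f1 has_real_derivative f2 x) (at x)"
  "(f2 has_real_derivative f3 x) (at x)"
  unfolding f1_def f2_def f3_def by (intro smooth_real smooth_f[unfolded f1_def f2_def f3_def] f)+

lemma f_large: "\<exists>b. \<forall>x. \<bar>x\<bar> \<ge> b \<longrightarrow> f x \<ge> K"
proof -
  obtain b where b: "\<And>x. x \<ge> b \<Longrightarrow> f x \<ge> K"
    using f_top unfolding filterlim_at_top eventually_at_top_linorder by blast
  obtain a where a: "\<And>x. x \<le> a \<Longrightarrow> f x \<ge> K"
    using f_bot unfolding filterlim_at_top eventually_at_bot_linorder by blast
  have "f x \<ge> K" if "max \<bar>a\<bar> \<bar>b\<bar> \<le> \<bar>x\<bar>" for x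
    using that a[of x] b[of x] by (cases "x \<ge> 0") auto
  then show ?thesis by blast
qed

lemma f_lower: "\<exists>m. \<forall>x. m \<le> f x"
proof -
  obtain b where b: "\<And>x. \<bar>x\<bar> \<ge> b \<Longrightarrow> f x \<ge> 0" using f_large[of 0] by blast
  obtain B where B: "B \<ge> 0" "\<And>x. \<bar>x\<bar> \<le> b \<Longrightarrow> \<bar>f x\<bar> \<le> B" using bounded_on_interval[OF f_cont(1), of b] by blast
  have "- B \<le> f x" for x using b[of x] B(1) B(2)[of x] by (cases "\<bar>x\<bar> \<le> b") auto
  then show ?thesis by blast
qed

text \<open>A far point where \<open>f\<close> exceeds \<open>f R\<close> by one forces the sign of
  the slope somewhere in between.\<close>

lemma f1_signs: "\<exists>b\<ge>R. f1 b > 0" "\<exists>a\<le>R. f1 a < 0"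
proof -
  obtain K where K: "\<And>x. \<bar>x\<bar> \<ge> K \<Longrightarrow> f x \<ge> f R + 1" using f_large[of "f R + 1"] by blast
  define b a where "b = \<bar>R\<bar> + \<bar>K\<bar> + 1" and "a = - \<bar>R\<bar> - \<bar>K\<bar> - 1"
  have ab: "a < R" "R < b" unfolding a_def b_def by linarith+
  have "f R + 1 \<le> f b" "f R + 1 \<le> f a" by (rule K, simp add: a_def b_def)+
  moreover obtain z where "z > R" "f b - f R = (b - R) * f1 z"
    using MVT2[OF ab(2), of f f1] f_deriv(1) by blast
  moreover obtain y where "y < R" "f R - f a = (R - a) * f1 y"
    using MVT2[OF ab(1), of f f1] f_deriv(1) by blast
  ultimately have z: "z > R" "(b - R) * f1 z > 0" and y: "y < R" "(R - a) * f1 y < 0" by linarith+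
  have "f1 z > 0" using z(2) by (rule zero_less_mult_pos) (use ab in simp)
  then show "\<exists>b\<ge>R. f1 b > 0" using z(1) by (intro exI[of _ z]) simp
  have "f1 y < 0"
  proof (rule ccontr)
    assume "\<not> f1 y < 0"
    then have "(R - a) * f1 y \<ge> 0" using ab by (intro mult_nonneg_nonneg) auto
    then show False using y(2) by simp
  qed
  then show "\<exists>a\<le>R. f1 a < 0" using y(1) by (intro exI[of _ y]) simp
qed

text \<open>Outside an interval that contains the a priori range of the solution, \<open>f\<close> is replaced by its
  tangents at the end points; the slopes there have the signs that keep the lower bound.\<close>

lemma nonlinear_surj: "\<exists>q. q + prim (nem f q) = p"
proof -
  obtain m where m: "\<And>x. m \<le> f x" using f_lower by blast
  obtain S where S: "\<And>x. \<bar>x\<bar> \<le> norm p \<Longrightarrow> \<bar>f x\<bar> \<le> S" using bounded_on_interval[OF f_cont(1), of "norm p"] by blast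
  define R where "R = norm p + (S - m)"
  have "\<bar>f 0\<bar> \<le> S" by (rule S) simp
  then have R: "norm p \<le> R" "0 \<le> R" using m[of 0] norm_ge_zero[of p] unfolding R_def by linarith+
  obtain b where b: "b \<ge> R" "f1 b \<ge> 0" using f1_signs(1)[of R] less_imp_le by blast
  obtain a where a: "a \<le> - R" "f1 a \<le> 0" using f1_signs(2)[of "- R"] less_imp_le by blast
  \<comment> \<open>\<open>g\<close> freezes \<open>f1\<close> outside \<open>{a..b}\<close>; its
    primitive \<open>F\<close> through \<open>f 0\<close> has bounded slope, so that
    \<open>prim_perturbation_surj\<close> applies to it.\<close>
  define g where "g x = f1 (max a (min b x))" for x
  have g_cont: "continuous_on UNIV g"
    unfolding g_def by (intro continuous_on_compose2[OF f_cont(2)] continuous_intros) auto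
  obtain G where G: "\<And>x. (G has_real_derivative g x) (at x)" using continuous_primitive[OF g_cont] by blast
  define F where "F x = G x - G 0 + f 0" for x
  have F: "(F has_real_derivative g x) (at x)" for x
    unfolding F_def[abs_def] using G by (auto intro!: derivative_eq_intros)
  have F_cont: "continuous_on UNIV F"
    using F by (intro continuous_at_imp_continuous_on) (blast intro: DERIV_isCont)
  have F_eq: "F x = f x" if x: "a \<le> x" "x \<le> b" for x
  proof -
    have "\<bar>(F x - f x) - (F 0 - f 0)\<bar> \<le> 0 * \<bar>x - 0\<bar>"
    proof (rule real_lipschitz[where g = "\<lambda>x. F x - f x" and g' = "\<lambda>z. g z - f1 z"])
      fix z assume "z \<in> closed_segment 0 x"
      then have "a \<le> z" "z \<le> b" using x a b R
        by (auto simp: closed_segment_eq_real_ivl split: if_splits)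
      then show "\<bar>g z - f1 z\<bar> \<le> 0" by (simp add: g_def)
    qed (intro DERIV_diff F f_deriv)
    then show ?thesis by (simp add: F_def)
  qed
  have Fm: "m \<le> F x" for x
  proof -
    consider "x < a" | "a \<le> x" "x \<le> b" | "b < x" by linarith
    then show ?thesis
    proof cases
      case 1
      obtain z where z: "x < z" "z < a" "F a - F x = (a - x) * g z" using MVT2[OF 1, of F g] F by blast
      then have "g z = f1 a" using a b R by (simp add: g_def)
      then have "(a - x) * g z \<le> 0" using 1 a by (intro mult_nonneg_nonpos) auto
      then show ?thesis using z(3) m[of a] F_eq[of a] a b R by simp
    next
      case 3
      obtain z where z: "b < z" "z < x" "F x - F b = (x - b) * g z" using MVT2[OF 3, of F g] F by blast
      then have "g z = f1 b" using a b R by (simp add: g_def)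
      then have "(x - b) * g z \<ge> 0" using 3 b by (intro mult_nonneg_nonneg) auto
      then show ?thesis using z(3) m[of b] F_eq[of b] a b R by simp
    qed (use F_eq m in simp)
  qed
  obtain L where L: "\<And>x. \<bar>x\<bar> \<le> max \<bar>a\<bar> \<bar>b\<bar> \<Longrightarrow> \<bar>f1 x\<bar> \<le> L"
    using bounded_on_interval[OF f_cont(2), of "max \<bar>a\<bar> \<bar>b\<bar>"] by blast
  have gL: "\<bar>g z\<bar> \<le> L" for z unfolding g_def using a b R by (intro L) (auto simp: max_def min_def)
  have "\<exists>q. q + prim (nem F q) = p"
  proof (rule prim_perturbation_surj[where L = L])
    fix u v
    have "norm (cslope g u v) \<le> L"
      by (rule norm_cslope_le[OF g_cont, of "max (norm u) (norm v)"]) (auto simp: gL)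
    then show "\<exists>a. norm a \<le> L \<and> nem F u - nem F v = a * (u - v)"
      using nem_diff[OF F g_cont, of u v] by blast
  qed
  then obtain q where q: "q + prim (nem F q) = p" ..
  \<comment> \<open>\<open>F\<close> agrees with \<open>f\<close> on the range of \<open>p\<close>,
    so the a priori bound holds with the constants of \<open>f\<close> and confines \<open>q\<close>
    to the interval where the two functions coincide.\<close>
  have "norm q \<le> norm p + (S - m)"
  proof (rule apriori_bound(3)[OF F_cont Fm q])
    fix x assume x: "\<bar>x\<bar> \<le> norm p"
    then have "a \<le> x" "x \<le> b" using a b R by (auto simp: abs_le_iff)
    then show "F x \<le> S" using F_eq[of x] S[OF x] by simp
  qed
  then have "\<bar>Rep_c0 q t\<bar> \<le> R" for t using c0_abs_le_norm[of q t] by (simp add: R_def)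
  then have "F (Rep_c0 q t) = f (Rep_c0 q t)" for t
    using a b by (intro F_eq) (meson abs_le_iff order_trans minus_le_iff)+
  then have "nem F q = nem f q" by (intro c0_eqI) (simp add: Rep_nem F_cont f_cont)
  then show ?thesis using q by auto
qed

text \<open>Two solutions differ by a solution of a linear equation whose coefficient is bounded on
  bounded sets. Uniqueness, local Lipschitz continuity and the derivative of the solution operator
  all come from this.\<close>

lemma nonlinear_diff:
  assumes "q1 + prim (nem f q1) = p1" "q2 + prim (nem f q2) = p2"
  shows "(q1 - q2) + prim (cslope f1 q1 q2 * (q1 - q2)) = p1 - p2"
proof -
  have "(q1 - q2) + prim (nem f q1 - nem f q2) = p1 - p2"
    using assms by (simp add: prim_diff algebra_simps)
  then show ?thesis by (simp only: nem_diff[OF f_deriv(1) f_cont(2)])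
qed

section \<open>The nonlinear solution operator\<close>

definition M :: "c0 \<Rightarrow> c0" where "M p = (THE q. q + prim (nem f q) = p)"

lemma nonlinear_unique:
  assumes "q1 + prim (nem f q1) = p" "q2 + prim (nem f q2) = p" shows "q1 = q2"
  using prim_linear_bound[OF nonlinear_diff[OF assms] order_refl] by simp

lemma M: "M p + prim (nem f (M p)) = p"
  unfolding M_def by (rule theI'[OF ex_ex1I[OF nonlinear_surj]]) (rule nonlinear_unique)

lemma M_I: "q + prim (nem f q) = p \<Longrightarrow> M p = q"
  by (rule nonlinear_unique[OF M])

lemma M_bound: "\<exists>B. \<forall>p. norm p \<le> r \<longrightarrow> norm (M p) \<le> B"
proof -
  obtain m where m: "\<And>x. m \<le> f x" using f_lower by blast
  obtain S where S: "\<And>x. \<bar>x\<bar> \<le> r \<Longrightarrow> \<bar>f x\<bar> \<le> S" using bounded_on_interval[OF f_cont(1), of r] by blast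
  have "norm (M p) \<le> r + (S - m)" if p: "norm p \<le> r" for p
  proof -
    have "norm (M p) \<le> norm p + (S - m)"
    proof (rule apriori_bound(3)[OF f_cont(1) m M])
      fix x assume "\<bar>x\<bar> \<le> norm p"
      then have "\<bar>x\<bar> \<le> r" using p by simp
      from S[OF this] show "f x \<le> S" by simp
    qed
    then show ?thesis using p by simp
  qed
  then show ?thesis by blast
qed

lemma M_local:
  "\<exists>B K C. 0 \<le> C \<and> (\<forall>z. \<bar>z\<bar> \<le> B \<longrightarrow> \<bar>f2 z\<bar> \<le> C) \<and>
    (\<forall>p. norm p \<le> r \<longrightarrow> norm (M p) \<le> B) \<and> (\<forall>p p'. norm p \<le> r \<longrightarrow> norm p' \<le> r \<longrightarrow> norm (M p - M p') \<le> K * norm (p - p'))"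
proof -
  obtain B where B: "\<And>p. norm p \<le> r \<Longrightarrow> norm (M p) \<le> B" using M_bound[of r] by blast
  obtain L where L: "\<And>x. \<bar>x\<bar> \<le> B \<Longrightarrow> \<bar>f1 x\<bar> \<le> L" using bounded_on_interval[OF f_cont(2), of B] by blast
  obtain C where C: "0 \<le> C" "\<And>x. \<bar>x\<bar> \<le> B \<Longrightarrow> \<bar>f2 x\<bar> \<le> C" using bounded_on_interval[OF f_cont(3), of B] by blast
  have "norm (M p - M p') \<le> lin_bound L * norm (p - p')" if "norm p \<le> r" "norm p' \<le> r" for p p'
    by (rule prim_linear_bound[OF nonlinear_diff[OF M M]])
      (rule norm_cslope_le[OF f_cont(2) L B[OF that(1)] B[OF that(2)]])
  then show ?thesis using B C by blast
qed

lemma M_continuous: "continuous_on UNIV M"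
proof (rule continuous_at_imp_continuous_on, intro ballI)
  fix p :: c0
  obtain K where K: "\<And>p1 p2. norm p1 \<le> norm p + 1 \<Longrightarrow> norm p2 \<le> norm p + 1 \<Longrightarrow> norm (M p1 - M p2) \<le> K * norm (p1 - p2)"
    using M_local[of "norm p + 1"] by blast
  have "((\<lambda>p'. M p' - M p) \<longlongrightarrow> 0) (at p)"
  proof (rule Lim_null_comparison)
    have "\<forall>\<^sub>F p' in at p. dist p' p < 1" by (rule tendstoD[OF tendsto_ident_at]) simp
    then show "\<forall>\<^sub>F p' in at p. norm (M p' - M p) \<le> K * norm (p' - p)"
    proof eventually_elim
      case (elim p')
      then show ?case using norm_triangle_ineq2[of p' p] by (intro K) (auto simp: dist_norm)
    qed
    have "((\<lambda>p'. K * norm (p' - p)) \<longlongrightarrow> K * norm (p - p)) (at p)" by (intro tendsto_intros)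
    then show "((\<lambda>p'. K * norm (p' - p)) \<longlongrightarrow> 0) (at p)" by simp
  qed
  then show "isCont M p" by (simp add: continuous_at LIM_zero_iff)
qed

text \<open>The difference quotient solves the linear equation with coefficient
  \<open>cslope f1\<close>, which tends to \<open>nem f1 (M p)\<close>; continuity of
  \<open>lin_sol\<close> gives the limit.\<close>

lemma M_line: "line_deriv M p h (lin_sol (nem f1 (M p)) h)"
proof (rule has_vector_derivative_at_0_iff[THEN iffD2])
  obtain B C where C: "0 \<le> C" "\<And>z. \<bar>z\<bar> \<le> B \<Longrightarrow> \<bar>f2 z\<bar> \<le> C"
    and B: "\<And>p'. norm p' \<le> norm p + 1 \<Longrightarrow> norm (M p') \<le> B" using M_local[of "norm p + 1"] by blast
  have p_lim: "((\<lambda>s. p + s *\<^sub>R h) \<longlongrightarrow> p) (at 0)" by (auto intro!: tendsto_eq_intros)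
  have M_lim: "((\<lambda>s. M (p + s *\<^sub>R h)) \<longlongrightarrow> M p) (at 0)"
    by (rule continuous_on_tendsto_compose[OF M_continuous p_lim]) auto
  define a where "a s = cslope f1 (M (p + s *\<^sub>R h)) (M p)" for s
  have "((\<lambda>s. a s - nem f1 (M p)) \<longlongrightarrow> 0) (at 0)"
  proof (rule Lim_null_comparison)
    have "\<forall>\<^sub>F s in at 0. dist (p + s *\<^sub>R h) p < 1" by (rule tendstoD[OF p_lim]) simp
    then show "\<forall>\<^sub>F s in at 0. norm (a s - nem f1 (M p)) \<le> C * norm (M (p + s *\<^sub>R h) - M p)"
    proof eventually_elim
      case (elim s)
      have "norm (p + s *\<^sub>R h) \<le> norm p + 1" using elim norm_triangle_ineq2[of "p + s *\<^sub>R h" p] by (simp add: dist_norm)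
      then show ?case unfolding a_def
        by (intro cslope_near[OF smooth_f(1) B B]) (auto simp: C f2_def[symmetric])
    qed
    have "((\<lambda>s. C * norm (M (p + s *\<^sub>R h) - M p)) \<longlongrightarrow> C * norm (M p - M p)) (at 0)"
      by (intro tendsto_intros M_lim)
    then show "((\<lambda>s. C * norm (M (p + s *\<^sub>R h) - M p)) \<longlongrightarrow> 0) (at 0)" by simp
  qed
  then have "(a \<longlongrightarrow> nem f1 (M p)) (at 0)" by (rule LIM_zero_cancel)
  then have "((\<lambda>s. (a s, h)) \<longlongrightarrow> (nem f1 (M p), h)) (at 0)" by (intro tendsto_Pair tendsto_const)
  from continuous_on_tendsto_compose[OF lin_sol_continuous this]
  have "((\<lambda>s. lin_sol (a s) h) \<longlongrightarrow> lin_sol (nem f1 (M p)) h) (at 0)" by simp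
  moreover have "\<forall>\<^sub>F s in at 0. lin_sol (a s) h = (M (p + s *\<^sub>R h) - M p) /\<^sub>R s"
    using eventually_neq_at_within[of 0 0 UNIV]
  proof eventually_elim
    case (elim s)
    have "(M (p + s *\<^sub>R h) - M p) + prim (a s * (M (p + s *\<^sub>R h) - M p)) = s *\<^sub>R h"
      unfolding a_def using nonlinear_diff[OF M M, of "p + s *\<^sub>R h" p] by simp
    from lin_solI[OF this] have "s *\<^sub>R lin_sol (a s) h = M (p + s *\<^sub>R h) - M p"
      by (simp only: lin_sol_scaleR)
    from this[symmetric] show ?case using elim by simp
  qed
  ultimately have "((\<lambda>s. (M (p + s *\<^sub>R h) - M p) /\<^sub>R s) \<longlongrightarrow> lin_sol (nem f1 (M p)) h) (at 0)"
    by (rule Lim_transform_eventually)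
  then show "((\<lambda>s. (M (p + s *\<^sub>R h) - M (p + 0 *\<^sub>R h)) /\<^sub>R s) \<longlongrightarrow> lin_sol (nem f1 (M p)) h) (at 0)" by simp
qed

text \<open>The derivative formula contains \<open>M\<close> itself, composed with smooth maps, so
  each order of regularity yields the next.\<close>

lemma smooth_M: "smooth M"
proof (rule smoothI)
  fix n
  show "Cn n M"
  proof (induction n)
    case 0
    show ?case by (rule Cn_0) (rule M_continuous)
  next
    case (Suc n)
    have 1: "Cn n (\<lambda>x :: c0 \<times> c0. nem f1 (M (fst x)))"
      by (rule Cn_compose[OF smoothD[OF smooth_nem[OF smooth_f(1)]] Cn_compose[OF Suc Cn_fst[OF Cn_id]]])
    have "Cn n (\<lambda>x. lin_sol (fst (nem f1 (M (fst x)), snd x)) (snd (nem f1 (M (fst x)), snd x)))"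
      by (rule Cn_compose[OF smoothD[OF smooth_lin_sol] Cn_Pair[OF 1 Cn_snd[OF Cn_id]]])
    then show ?case
      by (intro Cn_Suc[where F = "\<lambda>x. lin_sol (nem f1 (M (fst x))) (snd x)"]) (simp_all add: M_line)
  qed
qed

lemma M_curve:
  assumes "(y has_vector_derivative y') (at 0)"
  shows "((\<lambda>s. M (y s)) has_vector_derivative lin_sol (nem f1 (M (y 0))) y') (at 0)"
  using smooth_curve[OF smooth_M assms] dd_1[OF M_line] by simp

subsection \<open>Derivatives along the fibers\<close>

text \<open>In the fiber coordinate, \<open>val\<close> is the height function, \<open>val1\<close>, \<open>val2\<close>, \<open>val3\<close> its derivatives
  and \<open>W\<close>, \<open>Z\<close> the first two derivatives of the solution.\<close>

definition "A p = nem f1 (M p)"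
definition "W p = lin_sol (A p) 1"
text \<open>\<open>K2 p g\<close> is \<open>f''(u)\<close> times the derivatives of the solution in
  the directions \<open>g\<close> and 1, the source term of the mixed second derivative of the
  solution; \<open>K3\<close> is the source term at third order.\<close>

definition "K2 p g = nem f2 (M p) * lin_sol (A p) g * W p"
definition "Z p = lin_sol (A p) (- prim (K2 p 1))"
definition "K3 p = nem f3 (M p) * W p * W p * W p + 3 * (nem f2 (M p) * W p * Z p)"
definition val :: "c0 \<Rightarrow> real" where "val p = mean (nem f (M p))"
definition val1 :: "c0 \<Rightarrow> real" where "val1 p = mean (A p * W p)"
definition dval1 :: "c0 \<Rightarrow> c0 \<Rightarrow> real" where
  "dval1 p g = mean (K2 p g + A p * lin_sol (A p) (- prim (K2 p g)))"
definition val2 :: "c0 \<Rightarrow> real" where "val2 p = mean (K2 p 1 + A p * Z p)"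
definition val3 :: "c0 \<Rightarrow> real" where "val3 p = mean (K3 p + A p * lin_sol (A p) (- prim (K3 p)))"

lemma W: "W p + prim (A p * W p) = 1"
  unfolding W_def by (rule lin_sol)

lemma mean_W: "mean (W p) = 1"
  using arg_cong[OF W[of p], of mean] by (simp add: mean_add prim_props)

lemma smooth_A: "smooth A"
  unfolding A_def[abs_def] by (rule smooth_compose[OF smooth_nem[OF smooth_f(1)] smooth_M])

lemma smooth_const: "smooth (\<lambda>x. c)"
  by (rule smoothI) (rule Cn_const)

lemma smooth_W: "smooth W"
  unfolding W_def[abs_def] by (rule smooth_lin_sol_compose[OF smooth_A smooth_const])

lemma smooth_val: "smooth val"
  unfolding val_def[abs_def] by (rule smooth_mean[OF smooth_compose[OF smooth_nem[OF f] smooth_M]])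

lemma smooth_val1: "smooth val1"
  unfolding val1_def[abs_def] by (rule smooth_mean[OF smooth_c0_mult[OF smooth_A smooth_W]])

lemma line_curve: "((\<lambda>s. p + s *\<^sub>R g) has_vector_derivative g) (at 0)"
  by (auto intro!: derivative_eq_intros)

lemma val_line: "line_deriv val p 1 (val1 p)"
  using mean_curve[OF nem_curve[OF f M_curve[OF line_curve[of p 1]]]]
  by (simp add: val_def val1_def A_def W_def f1_def)

lemma A_line: "line_deriv A p g (nem f2 (M p) * lin_sol (A p) g)"
  using nem_curve[OF smooth_f(1) M_curve[OF line_curve[of p g]]]
  by (simp add: A_def f2_def)

lemma W_line: "line_deriv W p g (lin_sol (A p) (- prim (K2 p g)))"
  using lin_sol_curve[OF A_line[of p g] has_vector_derivative_const[of 1]]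
  by (simp add: W_def K2_def)

lemma val1_line: "line_deriv val1 p g (dval1 p g)"
proof -
  have "((\<lambda>s. A (p + s *\<^sub>R g) * W (p + s *\<^sub>R g)) has_vector_derivative
      A (p + 0 *\<^sub>R g) * lin_sol (A p) (- prim (K2 p g)) + (nem f2 (M p) * lin_sol (A p) g) * W (p + 0 *\<^sub>R g)) (at 0)"
    by (rule bounded_bilinear.has_vector_derivative[OF bounded_bilinear_mult A_line W_line])
  from mean_curve[OF this] show ?thesis
    by (simp add: val1_def dval1_def K2_def add.commute)
qed

lemma dval1_1: "dval1 p 1 = val2 p"
  by (simp add: dval1_def val2_def Z_def)

lemma val2_line: "line_deriv val2 p 1 (val3 p)"
proof -
  let ?q = "M p" and ?w = "W p" and ?z = "Z p"
  let ?k = "nem f3 ?q * ?w * ?w * ?w + 2 * (nem f2 ?q * ?w * ?z)"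
  have W_eq: "lin_sol (A p) 1 = W p" for p by (simp add: W_def)
  have k2: "K2 p 1 = nem f2 (M p) * W p * W p" for p by (simp add: K2_def W_def)
  have F2: "line_deriv (\<lambda>p. nem f2 (M p)) p 1 (nem f3 ?q * ?w)"
    using nem_curve[OF smooth_f(2) M_curve[OF line_curve[of p 1]]]
    by (simp add: f3_def W_def A_def)
  have Wl: "line_deriv W p 1 ?z" using W_line[of p 1] by (simp add: Z_def)
  note bl = bounded_bilinear.has_vector_derivative[OF bounded_bilinear_mult]
  have "line_deriv (\<lambda>p. nem f2 (M p) * W p * W p) p 1
      ((nem f2 ?q * ?w) * ?z + (nem f2 ?q * ?z + (nem f3 ?q * ?w) * ?w) * ?w)"
    using bl[OF bl[OF F2 Wl] Wl] by simp
  moreover have "(nem f2 ?q * ?w) * ?z + (nem f2 ?q * ?z + (nem f3 ?q * ?w) * ?w) * ?w = ?k"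
    by (simp add: algebra_simps)
  ultimately have K2l: "line_deriv (\<lambda>p. K2 p 1) p 1 ?k" by (simp add: k2)
  have Al: "line_deriv A p 1 (nem f2 ?q * ?w)" using A_line[of p 1] by (simp add: W_def)
  have "line_deriv Z p 1 (lin_sol (A p) (- prim ?k - prim ((nem f2 ?q * ?w) * ?z)))"
    using lin_sol_curve[OF Al has_vector_derivative_minus[OF prim_curve[OF K2l]]] by (simp add: Z_def)
  \<comment> \<open>Two copies of \<open>f''(u) W Z\<close> come from \<open>K2\<close>; the third
    one comes from differentiating the coefficient \<open>A p\<close> in
    \<open>lin_sol\<close>.\<close>
  moreover have "- prim ?k - prim ((nem f2 ?q * ?w) * ?z) = - prim (K3 p)"
  proof -
    have "?k + (nem f2 ?q * ?w) * ?z = K3 p" by (simp add: K3_def algebra_simps)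
    then have "prim (K3 p) = prim ?k + prim ((nem f2 ?q * ?w) * ?z)" by (metis prim_add)
    then show ?thesis by simp
  qed
  ultimately have Zl: "line_deriv Z p 1 (lin_sol (A p) (- prim (K3 p)))" by simp
  have "line_deriv (\<lambda>p. K2 p 1 + A p * Z p) p 1
      (?k + (A p * lin_sol (A p) (- prim (K3 p)) + (nem f2 ?q * ?w) * ?z))"
    using has_vector_derivative_add[OF K2l bl[OF Al Zl]] by simp
  moreover have "?k + (A p * lin_sol (A p) (- prim (K3 p)) + (nem f2 ?q * ?w) * ?z) =
      K3 p + A p * lin_sol (A p) (- prim (K3 p))"
    by (simp add: K3_def algebra_simps)
  ultimately have "line_deriv (\<lambda>p. K2 p 1 + A p * Z p) p 1 (K3 p + A p * lin_sol (A p) (- prim (K3 p)))" by simp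
  from mean_curve[OF this] show ?thesis by (simp add: val2_def val3_def)
qed

subsection \<open>Critical points\<close>

text \<open>Criticality says that \<open>A p * W p\<close> has mean zero, so the derivative of its
  \<open>prim\<close> is the product itself, with no mean subtracted.\<close>

lemma W_deriv:
  assumes "val1 p = 0"
  shows "(Rep_c0 (W p) has_real_derivative - (Rep_c0 (A p) t * Rep_c0 (W p) t)) (at t)"
proof -
  have "W p = 1 - prim (A p * W p)" using W[of p] by (simp add: eq_diff_eq)
  then have "Rep_c0 (W p) = (\<lambda>t. 1 - Rep_c0 (prim (A p * W p)) t)"
    by (metis minus_c0.rep_eq one_c0.rep_eq)
  moreover have "((\<lambda>t. 1 - Rep_c0 (prim (A p * W p)) t) has_real_derivative
      0 - (Rep_c0 (A p * W p) t - mean (A p * W p))) (at t)"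
    by (intro DERIV_diff DERIV_const prim_props)
  ultimately show ?thesis using assms by (simp add: val1_def c0_rep)
qed

lemma W_pos: "val1 p = 0 \<Longrightarrow> Rep_c0 (W p) t > 0"
  by (rule decay_pos[OF W_deriv]) (simp_all add: mean_W)

text \<open>The weight \<open>1 / W\<close> of the adjoint identity cancels the factor
  \<open>W p\<close> in \<open>K2 p g\<close>.\<close>

lemma dval1_crit:
  assumes "val1 p = 0"
  shows "dval1 p g * mean (recip (W p)) = mean (nem f2 (M p) * lin_sol (A p) g)"
proof -
  have "K2 p g * recip (W p) = nem f2 (M p) * lin_sol (A p) g"
    using mult_recip[OF W_pos[OF assms]] by (simp add: K2_def mult.assoc)
  then show ?thesis
    using adjoint_identity(2)[OF W_pos[OF assms] W_deriv[OF assms] refl, of "K2 p g"] by (simp add: dval1_def)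
qed

lemma val2_crit:
  assumes "val1 p = 0"
  shows "val2 p * mean (recip (W p)) = mean (nem f2 (M p) * W p)"
  using dval1_crit[OF assms, of 1] by (simp add: dval1_1 W_def)

text \<open>As \<open>val2 p = 0\<close>, the quotient \<zeta> of \<open>Z\<close> and
  \<open>W\<close> has derivative \<open>- f''(u) W\<close>. Hence \<open>f''(u) Z\<close> is the
  derivative of the periodic function \<open>- \<zeta>\<^sup>2 / 2\<close>, and the term of
  \<open>K3 p\<close> with \<open>Z p\<close> drops out.\<close>

lemma val3_crit:
  assumes "val1 p = 0" "val2 p = 0"
  shows "val3 p * mean (recip (W p)) = mean (nem f3 (M p) * W p * W p)"
proof -
  note pos = W_pos[OF assms(1)] and wd = W_deriv[OF assms(1)]
  define \<zeta> where "\<zeta> t = Rep_c0 (Z p) t / Rep_c0 (W p) t" for t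
  have k2: "K2 p 1 = nem f2 (M p) * W p * W p" by (simp add: K2_def W_def)
  have nz: "Rep_c0 (W p) t \<noteq> 0" for t using pos[of t] by simp
  have \<zeta>: "(\<zeta> has_real_derivative - (Rep_c0 (nem f2 (M p)) t * Rep_c0 (W p) t)) (at t)" for t
    using adjoint_identity(1)[OF pos wd Z_def, of t] assms(2) nz[of t]
    by (simp add: val2_def k2 c0_rep \<zeta>_def[abs_def])
  have "((\<lambda>t. - (\<zeta> t)\<^sup>2 / 2) has_real_derivative Rep_c0 (nem f2 (M p) * Z p) t) (at t)" for t
  proof -
    have "((\<lambda>t. - (\<zeta> t)\<^sup>2 / 2) has_real_derivative - (2 * \<zeta> t * - (Rep_c0 (nem f2 (M p)) t * Rep_c0 (W p) t)) / 2) (at t)"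
      by (auto intro!: derivative_eq_intros \<zeta>)
    then show ?thesis using nz[of t] by (simp add: c0_rep \<zeta>_def mult.commute)
  qed
  from mean_c0_diff[OF this, of 0] have 0: "mean (nem f2 (M p) * Z p) = 0"
    using c0_periodic[of "Z p" 0] c0_periodic[of "W p" 0] by (simp add: \<zeta>_def)
  have "K3 p * recip (W p) = nem f3 (M p) * W p * W p * (W p * recip (W p)) +
      3 * (nem f2 (M p) * Z p * (W p * recip (W p)))"
    by (simp add: K3_def algebra_simps)
  then have "K3 p * recip (W p) = nem f3 (M p) * W p * W p + 3 *\<^sub>R (nem f2 (M p) * Z p)"
    by (simp add: mult_recip[OF pos] scaleR_conv_of_real)
  then have "mean (K3 p * recip (W p)) = mean (nem f3 (M p) * W p * W p)"
    by (simp only: mean_add mean_scaleR 0)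
  then show ?thesis
    using adjoint_identity(2)[OF pos wd refl, of "K3 p"] by (simp add: val3_def)
qed

end

section \<open>Existence of cusps\<close>

lemma smooth_exp: "smooth (exp :: real \<Rightarrow> real)"
proof (rule smoothI)
  fix n
  show "Cn n (exp :: real \<Rightarrow> real)"
  proof (induction n)
    case 0
    show ?case by (rule Cn_0) (intro continuous_intros)
  next
    case (Suc n)
    show ?case
    proof (rule Cn_Suc[where F = "\<lambda>p. exp (fst p) * snd p"])
      fix x v :: real
      have "((\<lambda>s. exp (x + s * v)) has_real_derivative exp x * v) (at 0)"
        by (auto intro!: derivative_eq_intros)
      then show "line_deriv exp x v (exp (fst (x, v)) * snd (x, v))"
        by (simp add: has_real_derivative_iff_has_vector_derivative)
    qed (intro Cn_mult Cn_snd Cn_id Cn_compose[OF Suc Cn_fst[OF Cn_id]])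
  qed
qed

lemma c0_periodic_nat: "Rep_c0 u (t + real n) = Rep_c0 u t"
  by (induction n arbitrary: t) (simp_all add: add.assoc[symmetric] c0_periodic add.commute[of 1])

lemma c0_pos_lower:
  assumes "\<And>t. Rep_c0 u t > 0" shows "\<exists>\<delta>>0. \<forall>t. \<delta> \<le> Rep_c0 u t"
proof (intro exI conjI allI)
  have "recip u \<noteq> 0" using mult_recip[OF assms] by auto
  then show "inverse (norm (recip u)) > 0" by simp
  fix t
  have "inverse (Rep_c0 u t) \<le> norm (recip u)"
    using c0_abs_le_norm[of "recip u" t] assms[of t] by (simp add: Rep_recip[OF assms])
  from le_imp_inverse_le[OF this] show "inverse (norm (recip u)) \<le> Rep_c0 u t"
    using assms[of t] by simp
qed

text \<open>The inverse \<open>\<theta>\<close> of a primitive of the density \<open>\<rho>\<close> is a reparametrization of the circle under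
  which the time spent at each value of a profile is weighted by \<open>\<rho>\<close>; running through it \<open>n\<close> times as fast
  keeps the weights and divides primitives by \<open>n\<close>.\<close>

locale time_change =
  fixes \<rho> :: c0 and n :: nat
  assumes \<rho>_pos: "\<And>t. Rep_c0 \<rho> t > 0" and \<rho>_mean: "mean \<rho> = 1" and n_pos: "n > 0"
begin

definition \<tau> :: "real \<Rightarrow> real" where
  "\<tau> = (SOME T. (\<forall>t. (T has_real_derivative Rep_c0 \<rho> t) (at t)))"

lemma \<tau>_deriv: "(\<tau> has_real_derivative Rep_c0 \<rho> t) (at t)"
proof -
  have "\<forall>t. (\<tau> has_real_derivative Rep_c0 \<rho> t) (at t)"
    using someI_ex[OF c0_primitive[of \<rho>]] unfolding \<tau>_def .
  then show ?thesis by blast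
qed

lemma \<tau>_isCont: "isCont \<tau> t"
  using \<tau>_deriv by (rule DERIV_isCont)

lemma \<tau>_shift: "\<tau> (t + 1) = \<tau> t + 1"
  using mean_c0_diff[OF \<tau>_deriv, of t] \<rho>_mean by simp

lemma \<tau>_mono: "strict_mono \<tau>"
proof (rule strict_monoI)
  fix x y :: real assume "x < y"
  then show "\<tau> x < \<tau> y"
    by (rule DERIV_pos_imp_increasing) (use \<tau>_deriv \<rho>_pos in blast)
qed

text \<open>\<open>\<tau> t - t\<close> is periodic, hence bounded.\<close>

lemma \<tau>_surj: "\<exists>x. \<tau> x = y"
proof -
  have "periodic (\<lambda>t. \<tau> t - t)" by (simp add: periodic_def \<tau>_shift)
  moreover have "continuous_on UNIV (\<lambda>t. \<tau> t - t)"
    by (intro continuous_on_diff continuous_on_id continuous_at_imp_continuous_on ballI \<tau>_isCont)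
  ultimately have "bdd_above (range (\<lambda>t. \<bar>\<tau> t - t\<bar>))" by (rule periodic_bounded)
  then obtain C where C: "\<And>t. \<bar>\<tau> t - t\<bar> \<le> C" by (auto simp: bdd_above_def)
  have "\<tau> (y - C) \<le> y" "y \<le> \<tau> (y + C)" using C[of "y - C"] C[of "y + C"] by (auto simp: abs_le_iff)
  moreover have "0 \<le> C" using C[of 0] by linarith
  ultimately show ?thesis using IVT[of \<tau> "y - C" y "y + C"] \<tau>_isCont by auto
qed

definition \<theta> :: "real \<Rightarrow> real" where "\<theta> y = (THE x. \<tau> x = y)"

lemma \<tau>_\<theta>: "\<tau> (\<theta> y) = y"
proof -
  have "\<exists>!x. \<tau> x = y" using \<tau>_surj[of y] strict_mono_eq[OF \<tau>_mono] by auto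
  then show ?thesis unfolding \<theta>_def by (rule theI')
qed

lemma \<theta>_\<tau>: "\<theta> (\<tau> x) = x"
  using \<tau>_\<theta>[of "\<tau> x"] strict_mono_eq[OF \<tau>_mono] by simp

lemma \<theta>_shift: "\<theta> (y + real k) = \<theta> y + real k"
proof (induction k)
  case (Suc k)
  have "\<tau> (\<theta> (y + real k) + 1) = y + real k + 1" by (simp add: \<tau>_shift \<tau>_\<theta>)
  then have "\<theta> (y + real k + 1) = \<theta> (y + real k) + 1" using \<theta>_\<tau> by metis
  then show ?case using Suc by (simp add: algebra_simps)
qed simp

lemma \<theta>_deriv: "(\<theta> has_real_derivative inverse (Rep_c0 \<rho> (\<theta> y))) (at y)"
proof (rule DERIV_inverse_function[where f = \<tau> and a = "y - 1" and b = "y + 1"])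
  show "isCont \<theta> y"
    using isCont_inverse_function2[of "\<theta> y - 1" "\<theta> y" "\<theta> y + 1" \<theta> \<tau>] \<theta>_\<tau> \<tau>_isCont \<tau>_\<theta> by simp
  show "Rep_c0 \<rho> (\<theta> y) \<noteq> 0" using \<rho>_pos[of "\<theta> y"] by simp
qed (auto simp: \<tau>_deriv \<tau>_\<theta>)

lemma \<theta>_n_deriv: "((\<lambda>t. \<theta> (real n * t)) has_real_derivative real n * inverse (Rep_c0 \<rho> (\<theta> (real n * t)))) (at t)"
  using DERIV_chain2[OF \<theta>_deriv DERIV_cmult[OF DERIV_ident, of "real n"], of t] by (simp add: mult.commute)

definition pull :: "c0 \<Rightarrow> c0" where "pull u = Abs_c0 (\<lambda>t. Rep_c0 u (\<theta> (real n * t)))"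

lemma Rep_pull: "Rep_c0 (pull u) = (\<lambda>t. Rep_c0 u (\<theta> (real n * t)))"
  unfolding pull_def
proof (rule Rep_Abs_c0)
  have "continuous_on UNIV (\<lambda>t. \<theta> (real n * t))"
    by (intro continuous_at_imp_continuous_on ballI DERIV_isCont[OF \<theta>_n_deriv])
  then show "continuous_on UNIV (\<lambda>t. Rep_c0 u (\<theta> (real n * t)))"
    by (rule continuous_on_compose2[OF c0_continuous]) auto
  show "Rep_c0 u (\<theta> (real n * (t + 1))) = Rep_c0 u (\<theta> (real n * t))" for t
    using \<theta>_shift[of "real n * t" n] by (simp add: distrib_left c0_periodic_nat)
qed

lemma pull_mult: "pull (u * v) = pull u * pull v"
  by (rule c0_eqI) (simp add: Rep_pull c0_rep)

lemma pull_nem: "continuous_on UNIV f \<Longrightarrow> nem f (pull u) = pull (nem f u)"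
  by (rule c0_eqI) (simp add: Rep_pull Rep_nem)

lemma pull_eq_0: "pull u = 0 \<Longrightarrow> u = 0"
proof (rule c0_eqI)
  fix t assume "pull u = 0"
  then have "Rep_c0 u (\<theta> (real n * (\<tau> t / real n))) = 0"
    using fun_cong[OF Rep_pull[of u], of "\<tau> t / real n"] by (simp add: c0_rep)
  then show "Rep_c0 u t = Rep_c0 0 t" using n_pos by (simp add: \<theta>_\<tau> c0_rep)
qed

lemma pull_deriv:
  assumes "\<And>t. (Rep_c0 u has_real_derivative Rep_c0 u' t) (at t)"
  shows "(Rep_c0 (pull u) has_real_derivative Rep_c0 (real n *\<^sub>R pull (u' * recip \<rho>)) t) (at t)"
  using DERIV_chain2[OF assms \<theta>_n_deriv, of t]
  by (simp add: Rep_pull c0_rep Rep_recip[OF \<rho>_pos] mult_ac)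

text \<open>Substitution in terms of primitives: if \<open>K\<close> is a primitive of
  \<open>\<rho> * u\<close>, then \<open>K (\<theta> (n * t)) / n\<close> is one of the pulled back
  function, and in unit time \<open>\<theta> (n * t)\<close> runs through \<open>n\<close> periods
  of \<open>K'\<close>.\<close>

lemma mean_pull: "mean (pull u) = mean (\<rho> * u)"
proof -
  obtain K where K: "\<And>t. (K has_real_derivative Rep_c0 (\<rho> * u) t) (at t)" using c0_primitive[of "\<rho> * u"] by blast
  have shift: "K (s + real k) = K s + real k * mean (\<rho> * u)" for s and k :: nat
  proof (induction k)
    case (Suc k)
    then show ?case using mean_c0_diff[OF K, of "s + real k"] by (simp add: algebra_simps)
  qed simp
  have "((\<lambda>t. K (\<theta> (real n * t)) / real n) has_real_derivative Rep_c0 (pull u) t) (at t)" for t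
  proof -
    have "((\<lambda>t. K (\<theta> (real n * t)) / real n) has_real_derivative
        (Rep_c0 (\<rho> * u) (\<theta> (real n * t)) * (real n * inverse (Rep_c0 \<rho> (\<theta> (real n * t))))) / real n) (at t)"
      by (rule DERIV_cdivide) (rule DERIV_chain2[OF K \<theta>_n_deriv])
    then show ?thesis
      using \<rho>_pos[of "\<theta> (real n * t)"] n_pos by (simp add: Rep_pull c0_rep field_simps)
  qed
  from mean_c0_diff[OF this, of 0] show ?thesis
    using \<theta>_shift[of 0 n] shift[of "\<theta> 0" n] n_pos by (simp add: field_simps)
qed

end

context coercive begin

text \<open>A cusp, as seen on continuous functions: \<open>p\<close> and the direction \<open>g\<close> are continuously differentiable, so that
  they come from data in \<open>B\<^sup>1\<close>.\<close>

definition c0_cusp :: "c0 \<Rightarrow> bool" where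
  "c0_cusp p \<longleftrightarrow> val1 p = 0 \<and> val2 p = 0 \<and> val3 p \<noteq> 0 \<and> (\<exists>c r. dval1 p (const_fn c + prim r) \<noteq> 0)"

lemma c1_decompose:
  assumes "\<And>t. (Rep_c0 u has_real_derivative Rep_c0 u' t) (at t)"
  shows "u = const_fn (mean u) + prim u'"
  using prim_of_deriv(2)[OF assms] by simp

text \<open>Here \<open>v\<close> is the positive solution before normalization to mean 1.
  Surjectivity of the total derivative is tested in the direction whose linearized solution is
  \<open>f''(q)\<close>, where it gives a positive multiple of the mean of the square of
  \<open>f''(q)\<close>. Differentiability of \<open>q\<close> brings \<open>p\<close> and this
  direction into the form \<open>const_fn c + prim r\<close>.\<close>

lemma c0_cuspI:
  assumes q: "\<And>t. (Rep_c0 q has_real_derivative Rep_c0 q' t) (at t)"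
    and pos: "\<And>t. Rep_c0 v t > 0"
    and v: "\<And>t. (Rep_c0 v has_real_derivative Rep_c0 (- (nem f1 q * v)) t) (at t)"
    and crit: "mean (nem f2 q * v) = 0" "mean (nem f3 q * v * v) \<noteq> 0" and nz: "nem f2 q \<noteq> 0"
  shows "\<exists>c r. c0_cusp (const_fn c + prim r)"
proof -
  define p where "p = q + prim (nem f q)"
  have M: "M p = q" by (rule M_I) (simp add: p_def)
  have A: "A p = nem f1 q" by (simp add: A_def M)
  have p_eq: "p = const_fn (mean q) + prim (q' + nem f q)"
    using c1_decompose[OF q] by (simp add: p_def prim_add add.assoc[symmetric])
  have "v \<noteq> 0" using pos[of 0] by (auto simp: c0_rep)
  then have m: "mean v > 0" using pos by (intro mean_c0_pos) (auto intro: less_imp_le)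
  note pv = prim_of_deriv[OF v]
  have v_eq: "v + prim (nem f1 q * v) = const_fn (mean v)"
    using pv(2) by (simp add: prim_minus algebra_simps)
  define w where "w = v /\<^sub>R mean v"
  have "w + prim (A p * w) = (v + prim (nem f1 q * v)) /\<^sub>R mean v"
    by (simp add: w_def A prim_scaleR scaleR_add_right)
  then have "w + prim (A p * w) = 1" unfolding v_eq using m by (simp add: const_fn_c0_eq)
  then have W: "W p = w" unfolding W_def by (rule lin_solI)
  have v1: "val1 p = 0" using pv(1) by (simp add: val1_def W w_def A mean_scaleR)
  note rp = mean_recip_pos[OF W_pos[OF v1]]
  have v2: "val2 p = 0"
    using val2_crit[OF v1] rp crit(1) by (simp add: W w_def M mean_scaleR)
  have v3: "val3 p \<noteq> 0"
    using val3_crit[OF v1 v2] crit(2) m by (auto simp: W w_def M mean_scaleR)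
  define e where "e = nem f2 q"
  define g where "g = e + prim (nem f1 q * e)"
  have "lin_sol (A p) g = e" by (rule lin_solI) (simp add: A g_def)
  then have "dval1 p g * mean (recip (W p)) = mean (e * e)"
    using dval1_crit[OF v1, of g] by (simp add: M e_def)
  moreover have "mean (e * e) > 0"
  proof (rule mean_c0_pos)
    obtain t where "Rep_c0 e t \<noteq> 0" using nz unfolding e_def by (metis c0_eqI zero_c0.rep_eq)
    then have "Rep_c0 (e * e) t \<noteq> Rep_c0 0 t" by (simp add: c0_rep)
    then show "e * e \<noteq> 0" by metis
  qed (simp add: c0_rep)
  ultimately have d: "dval1 p g \<noteq> 0" by auto
  have "(Rep_c0 e has_real_derivative Rep_c0 (nem f3 q * q') t) (at t)" for t
    using DERIV_chain2[OF f_deriv(3) q, of t] by (simp add: e_def Rep_nem f_cont c0_rep)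
  from c1_decompose[OF this] have "g = const_fn (mean e) + prim (nem f3 q * q' + nem f1 q * e)"
    by (simp add: g_def prim_add add.assoc[symmetric])
  then have "\<exists>c r. dval1 p (const_fn c + prim r) \<noteq> 0" using d by metis
  then have "c0_cusp p" unfolding c0_cusp_def using v1 v2 v3 by blast
  then show ?thesis unfolding p_eq by blast
qed

text \<open>After the time change \<open>v' = - f'(q) v\<close> has an explicit solution: before
  pulling back it is the exponential of a multiple of \<open>prim (\<rho> * nem f1 g)\<close>, and
  hypothesis \<open>1\<close> says that the derivative of this \<open>prim\<close> carries no mean
  correction. So the cusp conditions turn into moments of the profile \<open>g\<close> against
  \<rho>, with an exponent that is small for large \<open>n\<close>.\<close>

lemma c0_cusp_profile:
  fixes n :: nat
  assumes g: "\<And>t. (Rep_c0 g has_real_derivative Rep_c0 g' t) (at t)"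
    and \<rho>: "\<And>t. Rep_c0 \<rho> t > 0" and n: "n > 0"
    and 1: "mean (\<rho> * nem f1 g) = 0"
    and 2: "mean (\<rho> * (nem f2 g * nem exp (- (1 / (real n * mean \<rho>)) *\<^sub>R prim (\<rho> * nem f1 g)))) = 0"
    and 3: "mean (\<rho> * (nem f3 g * nem exp (- (1 / (real n * mean \<rho>)) *\<^sub>R prim (\<rho> * nem f1 g))
        * nem exp (- (1 / (real n * mean \<rho>)) *\<^sub>R prim (\<rho> * nem f1 g)))) \<noteq> 0"
    and nz: "nem f2 g \<noteq> 0"
  shows "\<exists>c r. c0_cusp (const_fn c + prim r)"
proof -
  have "\<rho> \<noteq> 0" using \<rho>[of 0] by (auto simp: c0_rep)
  then have m: "mean \<rho> > 0" using \<rho> by (intro mean_c0_pos) (auto intro: less_imp_le)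
  define \<sigma> where "\<sigma> = \<rho> /\<^sub>R mean \<rho>"
  interpret time_change \<sigma> n
    by unfold_locales (use \<rho> m n in \<open>auto simp: \<sigma>_def c0_rep mean_scaleR\<close>)
  define B where "B = - (1 / (real n * mean \<rho>)) *\<^sub>R prim (\<rho> * nem f1 g)"
  define E where "E = nem exp B"
  have B: "(Rep_c0 B has_real_derivative - (1 / real n) * (Rep_c0 \<sigma> t * Rep_c0 (nem f1 g) t)) (at t)" for t
  proof -
    have "Rep_c0 B = (\<lambda>t. - (1 / (real n * mean \<rho>)) * Rep_c0 (prim (\<rho> * nem f1 g)) t)"
      unfolding B_def by (simp add: c0_rep fun_eq_iff)
    then show ?thesis
      using DERIV_cmult[OF prim_props(2)[of "\<rho> * nem f1 g" t], of "- (1 / (real n * mean \<rho>))"] 1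
      by (simp add: c0_rep \<sigma>_def divide_simps)
  qed
  have exp_cont: "continuous_on UNIV (exp :: real \<Rightarrow> real)" by (intro continuous_intros)
  have E: "(Rep_c0 E has_real_derivative Rep_c0 (- (1 / real n) *\<^sub>R (E * (\<sigma> * nem f1 g))) t) (at t)" for t
    using DERIV_chain2[OF DERIV_exp B, of t] by (simp add: E_def Rep_nem[OF exp_cont] c0_rep)
  have pos: "Rep_c0 (pull E) t > 0" for t by (simp add: Rep_pull E_def Rep_nem[OF exp_cont])
  show ?thesis
  proof (rule c0_cuspI[OF pull_deriv[OF g] pos])
    fix t
    have "\<sigma> * recip \<sigma> = 1" by (rule mult_recip) (rule \<rho>_pos)
    then have "- (1 / real n) *\<^sub>R (E * (\<sigma> * nem f1 g)) * recip \<sigma> = - (1 / real n) *\<^sub>R (nem f1 g * E)"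
      by (simp add: mult_ac) (metis mult.left_commute mult.right_neutral)
    then have "real n *\<^sub>R pull (- (1 / real n) *\<^sub>R (E * (\<sigma> * nem f1 g)) * recip \<sigma>) = - (nem f1 (pull g) * pull E)"
      using n by (intro c0_eqI) (simp add: Rep_pull c0_rep Rep_nem f_cont)
    then show "(Rep_c0 (pull E) has_real_derivative Rep_c0 (- (nem f1 (pull g) * pull E)) t) (at t)"
      using pull_deriv[OF E, of t] by simp
  next
    have "mean (nem f2 (pull g) * pull E) = mean (\<sigma> * (nem f2 g * E))"
      by (simp only: pull_nem[OF f_cont(3)] pull_mult[symmetric] mean_pull)
    then show "mean (nem f2 (pull g) * pull E) = 0"
      using 2 by (simp add: \<sigma>_def mean_scaleR E_def B_def)
    have "mean (nem f3 (pull g) * pull E * pull E) = mean (\<sigma> * (nem f3 g * E * E))"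
      by (simp only: pull_nem[OF f_cont(4)] pull_mult[symmetric] mean_pull)
    then show "mean (nem f3 (pull g) * pull E * pull E) \<noteq> 0"
      using 3 m by (simp add: \<sigma>_def mean_scaleR E_def B_def)
    show "nem f2 (pull g) \<noteq> 0" using nz pull_eq_0 by (metis pull_nem[OF f_cont(3)])
  qed
qed

text \<open>With a perturbation direction \<open>h\<close> that is orthogonal to \<open>f' \<circ> g\<close>, the first condition holds exactly and the
  second one is reached by the intermediate value theorem once \<open>n\<close> is large.\<close>

lemma c0_cusp_perturb:
  assumes g: "\<And>t. (Rep_c0 g has_real_derivative Rep_c0 g' t) (at t)"
    and \<rho>: "\<And>t. Rep_c0 \<rho> t > 0"
    and \<rho>1: "mean (\<rho> * nem f1 g) = 0" and \<rho>2: "mean (\<rho> * nem f2 g) = 0" and \<rho>3: "mean (\<rho> * nem f3 g) \<noteq> 0"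
    and h1: "mean (h * nem f1 g) = 0" and h2: "mean (h * nem f2 g) > 0"
    and nz: "nem f2 g \<noteq> 0"
  shows "\<exists>c r. c0_cusp (const_fn c + prim r)"
proof -
  define P where "P s = \<rho> + s *\<^sub>R h" for s
  \<comment> \<open>\<open>fst z\<close> stands for \<open>1 / (n * mean (P s))\<close>, now a real
    variable. At 0, the limit of infinitely many turns, \<open>E\<close> is 1 and the conditions are
    plain moments.\<close>
  define E where "E z = nem exp (- fst z *\<^sub>R prim (P (snd z) * nem f1 g))" for z :: "real \<times> real"
  define H where "H z = mean (P (snd z) * (nem f2 g * E z))" for z
  define J where "J z = mean (P (snd z) * (nem f3 g * E z * E z))" for z
  have P_cont: "continuous_on UNIV (\<lambda>z::real \<times> real. P (snd z))"
    unfolding P_def by (intro continuous_intros)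
  have E_cont: "continuous_on UNIV E"
    unfolding E_def
    by (intro continuous_on_compose2[OF nem_continuous[OF smooth_exp]] continuous_on_scaleR
        bounded_linear.continuous_on[OF bounded_linear_prim] continuous_on_mult P_cont continuous_intros subset_UNIV)
  have H_cont: "continuous_on UNIV H" and J_cont: "continuous_on UNIV J"
    unfolding H_def J_def
    by (intro bounded_linear.continuous_on[OF bounded_linear_mean_c0] continuous_on_mult P_cont E_cont continuous_on_const)+
  have E0: "E (0, s) = 1" for s
    by (rule c0_eqI) (simp add: E_def Rep_nem[OF smooth_continuous[OF smooth_exp]] c0_rep)
  have H0: "H (0, s) = s * mean (h * nem f2 g)" for s
    by (simp add: H_def E0 P_def distrib_right mean_add mean_scaleR \<rho>2)
  have J0: "J (0, 0) \<noteq> 0" using \<rho>3 by (simp add: J_def E0 P_def)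
  obtain \<delta> where \<delta>: "\<delta> > 0" "\<And>t. \<delta> \<le> Rep_c0 \<rho> t" using c0_pos_lower[OF \<rho>] by blast
  obtain e where e: "e > 0" "\<And>z. dist z (0, 0) < e \<Longrightarrow> J z \<noteq> 0"
  proof -
    have "isCont J (0, 0)" using J_cont by (simp add: continuous_on_eq_continuous_at)
    then obtain e where "e > 0" "\<And>z. dist z (0, 0) < e \<Longrightarrow> dist (J z) (J (0, 0)) < \<bar>J (0, 0)\<bar>"
      unfolding continuous_at_eps_delta using J0 by (metis zero_less_abs_iff)
    then show ?thesis using that by (metis abs_minus_commute diff_0_right dist_real_def less_irrefl minus_diff_eq abs_minus_cancel diff_zero)
  qed
  define N where "N = norm h + 1"
  have N: "N > 0" "norm h \<le> N" using norm_ge_zero[of h] unfolding N_def by linarith+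
  \<comment> \<open>The first bound on \<open>s\<close> serves to keep the third moment away from
    zero, the second one keeps the perturbed density above \<delta> / 2.\<close>
  define s0 where "s0 = min (e / 2) (\<delta> / (2 * N))"
  have s0: "s0 > 0" "s0 \<le> e / 2" using e(1) \<delta>(1) N by (simp_all add: s0_def)
  have "s0 * N \<le> \<delta> / (2 * N) * N" using N by (intro mult_right_mono) (simp_all add: s0_def)
  then have s0N: "s0 * N \<le> \<delta> / 2" using N by simp
  have P_lower: "Rep_c0 (P s) t \<ge> \<delta> / 2" if s: "\<bar>s\<bar> \<le> s0" for s t
  proof -
    have "\<bar>s * Rep_c0 h t\<bar> \<le> s0 * N"
      unfolding abs_mult using s c0_abs_le_norm[of h t] N s0 by (intro mult_mono) auto
    then have "\<bar>s * Rep_c0 h t\<bar> \<le> \<delta> / 2" using s0N by linarith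
    then show ?thesis using \<delta>(2)[of t] by (simp add: P_def c0_rep abs_le_iff)
  qed
  have mean_P: "mean (P s) \<ge> \<delta> / 2" if "\<bar>s\<bar> \<le> s0" for s
  proof -
    have "mean ((\<delta> / 2) *\<^sub>R (1 :: c0)) \<le> mean (P s)"
      by (rule mean_c0_mono) (use P_lower[OF that] in \<open>simp add: c0_rep\<close>)
    then show ?thesis by (simp add: mean_scaleR)
  qed
  define k where "k n s = 1 / (real n * mean (P s))" for n s
  have k_lim: "(\<lambda>n. k n s) \<longlonglongrightarrow> 0" for s
  proof -
    have "(\<lambda>n. inverse (real n) * inverse (mean (P s))) \<longlonglongrightarrow> 0 * inverse (mean (P s))"
      by (intro tendsto_mult tendsto_const lim_inverse_n)
    then show ?thesis by (simp add: k_def divide_inverse)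
  qed
  have H_lim: "(\<lambda>n. H (k n s, s)) \<longlonglongrightarrow> s * mean (h * nem f2 g)" for s
  proof -
    have "(\<lambda>n. H (k n s, s)) \<longlonglongrightarrow> H (0, s)"
      by (rule continuous_on_tendsto_compose[OF H_cont tendsto_Pair[OF k_lim tendsto_const]]) auto
    then show ?thesis by (simp add: H0)
  qed
  have "\<forall>\<^sub>F n in sequentially. H (k n s0, s0) > 0"
    by (rule order_tendstoD(1)[OF H_lim]) (use s0 h2 in simp)
  moreover have "\<forall>\<^sub>F n in sequentially. H (k n (- s0), - s0) < 0"
    by (rule order_tendstoD(2)[OF H_lim]) (use s0 h2 in simp)
  \<comment> \<open>Since \<open>mean (P s) \<ge> \<delta> / 2\<close>, this gives
    \<open>k n s < e / 2\<close>; with \<open>\<bar>s\<bar> \<le> e / 2\<close> it puts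
    \<open>(k n s, s)\<close> where \<open>J\<close> does not vanish.\<close>
  moreover have "\<forall>\<^sub>F n in sequentially. inverse (real n) < e * \<delta> / 4"
    by (rule order_tendstoD(2)[OF lim_inverse_n]) (use e \<delta> in simp)
  ultimately have "\<forall>\<^sub>F n in sequentially. H (k n s0, s0) > 0 \<and> H (k n (- s0), - s0) < 0 \<and>
      inverse (real n) < e * \<delta> / 4 \<and> n > 0"
    using eventually_gt_at_top[of 0] by eventually_elim simp
  then obtain n where n: "H (k n s0, s0) > 0" "H (k n (- s0), - s0) < 0" "inverse (real n) < e * \<delta> / 4" "n > 0"
    by (auto simp: eventually_sequentially)
  have "continuous_on {- s0..s0} (\<lambda>s. H (k n s, s))"
  proof (rule continuous_on_compose2[OF H_cont])
    have "continuous_on {- s0..s0} (\<lambda>s. mean (P s))"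
      unfolding P_def by (intro bounded_linear.continuous_on[OF bounded_linear_mean_c0] continuous_intros)
    moreover have "mean (P s) \<noteq> 0" if s: "s \<in> {- s0..s0}" for s
    proof -
      have "\<bar>s\<bar> \<le> s0" using s by auto
      from mean_P[OF this] show ?thesis using \<delta>(1) by linarith
    qed
    ultimately show "continuous_on {- s0..s0} (\<lambda>s. (k n s, s))"
      unfolding k_def using n(4) by (intro continuous_intros) auto
  qed auto
  then obtain s where s: "- s0 \<le> s" "s \<le> s0" "H (k n s, s) = 0"
    using IVT'[of "\<lambda>s. H (k n s, s)" "- s0" 0 s0] n s0 by auto
  then have sa: "\<bar>s\<bar> \<le> s0" by auto
  note mP = mean_P[OF sa]
  have kpos: "k n s \<ge> 0" using mP \<delta>(1) n(4) by (simp add: k_def)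
  have "inverse (mean (P s)) \<le> inverse (\<delta> / 2)" using mP \<delta>(1) by (intro le_imp_inverse_le) auto
  then have inv: "inverse (mean (P s)) \<le> 2 / \<delta>" by simp
  have "k n s = inverse (real n) * inverse (mean (P s))" by (simp add: k_def divide_inverse)
  also have "\<dots> \<le> inverse (real n) * (2 / \<delta>)" by (rule mult_left_mono[OF inv]) simp
  also have "\<dots> < (e * \<delta> / 4) * (2 / \<delta>)" using n(3) \<delta>(1) by (intro mult_strict_right_mono) auto
  also have "\<dots> = e / 2" using \<delta>(1) by simp
  finally have "\<bar>k n s\<bar> + \<bar>s\<bar> < e" using kpos sa s0 by linarith
  then have "dist (k n s, s) (0, 0) < e"
    using norm_Pair_le[of "k n s" s] by (simp add: dist_norm)
  from e(2)[OF this] have J: "J (k n s, s) \<noteq> 0" .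
  show ?thesis
  proof (rule c0_cusp_profile[OF g _ n(4), of "P s"])
    show "Rep_c0 (P s) t > 0" for t using P_lower[OF sa, of t] \<delta>(1) by linarith
    show "mean (P s * nem f1 g) = 0" by (simp add: P_def distrib_right mean_add mean_scaleR \<rho>1 h1)
  qed (use s(3) J nz in \<open>simp_all add: H_def J_def E_def k_def\<close>)
qed

section \<open>Choice of the profile and of the density\<close>

lemma sine_profile:
  assumes "R > (0::real)"
  obtains g g' where "\<And>t. (Rep_c0 g has_real_derivative Rep_c0 g' t) (at t)"
    "\<And>x. \<bar>x\<bar> \<le> R \<Longrightarrow> \<exists>t. Rep_c0 g t = x"
proof
  define g g' where "g = Abs_c0 (\<lambda>t. R * sin (2 * pi * t))" and "g' = Abs_c0 (\<lambda>t. 2 * pi * R * cos (2 * pi * t))"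
  have shift: "2 * pi * (t + 1) = 2 * pi * t + 2 * pi" for t by (simp add: algebra_simps)
  have g: "Rep_c0 g = (\<lambda>t. R * sin (2 * pi * t))" and g': "Rep_c0 g' = (\<lambda>t. 2 * pi * R * cos (2 * pi * t))"
    unfolding g_def g'_def by (rule Rep_Abs_c0; auto intro!: continuous_intros simp: shift)+
  show "(Rep_c0 g has_real_derivative Rep_c0 g' t) (at t)" for t
    unfolding g g' by (auto intro!: derivative_eq_intros)
  show "\<exists>t. Rep_c0 g t = x" if "\<bar>x\<bar> \<le> R" for x
  proof
    have "- 1 \<le> x / R" "x / R \<le> 1" using that assms by (auto simp: field_simps)
    then show "Rep_c0 g (arcsin (x / R) / (2 * pi)) = x" using assms by (simp add: g)
  qed
qed

text \<open>\<open>S\<close> collects the first two moments of positive densities. If 0 were outside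
  this convex set, a separating combination \<eta> of \<open>f1 \<circ> g\<close> and
  \<open>f2 \<circ> g\<close> would have nonnegative integral against every positive density,
  although it takes negative values. The hypothesis \<open>H3\<close> makes the three functions on
  the loop linearly independent, so Gram-Schmidt provides corrections that change one moment at a
  time.\<close>

lemma c0_cusp_exists:
  fixes R :: real
  assumes "R > 0"
    and H2: "\<And>a1 a2. a1 \<noteq> 0 \<or> a2 \<noteq> 0 \<Longrightarrow> \<exists>x. \<bar>x\<bar> \<le> R \<and> a1 * f1 x + a2 * f2 x < 0"
    and H3: "\<And>a1 a2 a3. a1 \<noteq> 0 \<or> a2 \<noteq> 0 \<or> a3 \<noteq> 0 \<Longrightarrow> \<exists>x. \<bar>x\<bar> \<le> R \<and> a1 * f1 x + a2 * f2 x + a3 * f3 x \<noteq> 0"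
  shows "\<exists>c r. c0_cusp (const_fn c + prim r)"
proof -
  obtain g g' where g: "\<And>t. (Rep_c0 g has_real_derivative Rep_c0 g' t) (at t)"
    and range: "\<And>x. \<bar>x\<bar> \<le> R \<Longrightarrow> \<exists>t. Rep_c0 g t = x" using sine_profile[OF assms(1)] by blast
  let ?\<gamma>1 = "nem f1 g" and ?\<gamma>2 = "nem f2 g" and ?\<gamma>3 = "nem f3 g"
  have \<gamma>: "Rep_c0 ?\<gamma>1 t = f1 (Rep_c0 g t)" "Rep_c0 ?\<gamma>2 t = f2 (Rep_c0 g t)" "Rep_c0 ?\<gamma>3 t = f3 (Rep_c0 g t)" for t
    by (simp_all add: Rep_nem f_cont)
  have indep: "a1 *\<^sub>R ?\<gamma>1 + a2 *\<^sub>R ?\<gamma>2 + a3 *\<^sub>R ?\<gamma>3 \<noteq> 0" if nz: "a1 \<noteq> 0 \<or> a2 \<noteq> 0 \<or> a3 \<noteq> 0" for a1 a2 a3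
  proof
    assume eq: "a1 *\<^sub>R ?\<gamma>1 + a2 *\<^sub>R ?\<gamma>2 + a3 *\<^sub>R ?\<gamma>3 = 0"
    obtain x where x: "\<bar>x\<bar> \<le> R" "a1 * f1 x + a2 * f2 x + a3 * f3 x \<noteq> 0" using H3[OF nz] by blast
    obtain t where "Rep_c0 g t = x" using range[OF x(1)] by blast
    then show False using x(2) arg_cong[OF eq, of "\<lambda>u. Rep_c0 u t"] by (simp add: c0_rep \<gamma>)
  qed
  have sq_pos: "mean (u * u) > 0" if nz: "u \<noteq> 0" for u :: c0
  proof (rule mean_c0_pos)
    obtain t where "Rep_c0 u t \<noteq> 0" using nz by (metis c0_eqI zero_c0.rep_eq)
    then have "Rep_c0 (u * u) t \<noteq> Rep_c0 0 t" by (simp add: c0_rep)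
    then show "u * u \<noteq> 0" by metis
  qed (simp add: c0_rep)
  define S where "S = {(mean (\<rho> * ?\<gamma>1), mean (\<rho> * ?\<gamma>2)) | \<rho>. \<forall>t. Rep_c0 \<rho> t > 0}"
  have "convex S"
  proof (rule convexI)
    fix x y and u v :: real assume xy: "x \<in> S" "y \<in> S" and uv: "0 \<le> u" "0 \<le> v" "u + v = 1"
    obtain \<rho>1 where \<rho>1: "x = (mean (\<rho>1 * ?\<gamma>1), mean (\<rho>1 * ?\<gamma>2))" "\<forall>t. Rep_c0 \<rho>1 t > 0" using xy(1) by (auto simp: S_def)
    obtain \<rho>2 where \<rho>2: "y = (mean (\<rho>2 * ?\<gamma>1), mean (\<rho>2 * ?\<gamma>2))" "\<forall>t. Rep_c0 \<rho>2 t > 0" using xy(2) by (auto simp: S_def)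
    have "Rep_c0 (u *\<^sub>R \<rho>1 + v *\<^sub>R \<rho>2) t > 0" for t
    proof (cases "u = 0")
      case False
      then have "u * Rep_c0 \<rho>1 t > 0" "v * Rep_c0 \<rho>2 t \<ge> 0" using uv \<rho>1(2) \<rho>2(2) by (auto simp: less_imp_le)
      then show ?thesis by (simp add: c0_rep)
    qed (use uv \<rho>2(2) in \<open>simp add: c0_rep\<close>)
    then show "u *\<^sub>R x + v *\<^sub>R y \<in> S"
      unfolding S_def \<rho>1(1) \<rho>2(1)
      by (intro CollectI exI[of _ "u *\<^sub>R \<rho>1 + v *\<^sub>R \<rho>2"]) (simp add: distrib_right mean_add mean_scaleR)
  qed
  have "0 \<in> S"
  proof (rule ccontr)
    assume "0 \<notin> S"
    from separating_hyperplane_set_0[OF \<open>convex S\<close> this]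
    obtain a where a: "a \<noteq> 0" "\<forall>x\<in>S. 0 \<le> inner a x" by blast
    obtain a1 a2 where a12: "a = (a1, a2)" by force
    define \<eta> where "\<eta> = a1 *\<^sub>R ?\<gamma>1 + a2 *\<^sub>R ?\<gamma>2"
    have sep: "0 \<le> mean (\<rho> * \<eta>)" if "\<forall>t. Rep_c0 \<rho> t > 0" for \<rho>
    proof -
      have "(mean (\<rho> * ?\<gamma>1), mean (\<rho> * ?\<gamma>2)) \<in> S" using that by (auto simp: S_def)
      then have "0 \<le> a1 * mean (\<rho> * ?\<gamma>1) + a2 * mean (\<rho> * ?\<gamma>2)" using a(2) by (auto simp: a12)
      then show ?thesis by (simp add: \<eta>_def distrib_left mean_add mean_scaleR)
    qed
    \<comment> \<open>The negative part of \<eta> serves as a density that sees only its negative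
      values; a small constant \<epsilon> added below makes it strictly positive.\<close>
    define \<nu> where "\<nu> = nem (\<lambda>x. max 0 (- x)) \<eta>"
    have \<nu>: "Rep_c0 \<nu> t = max 0 (- Rep_c0 \<eta> t)" for t
      unfolding \<nu>_def by (subst Rep_nem) (auto intro!: continuous_intros)
    have "\<nu> * \<eta> = - (\<nu> * \<nu>)" by (rule c0_eqI) (simp add: c0_rep \<nu> max_def)
    obtain x where x: "\<bar>x\<bar> \<le> R" "a1 * f1 x + a2 * f2 x < 0" using H2[of a1 a2] a(1) a12 by (auto simp: zero_prod_def)
    obtain t where "Rep_c0 g t = x" using range[OF x(1)] by blast
    then have "Rep_c0 \<nu> t \<noteq> 0" using x(2) by (simp add: \<nu> \<eta>_def c0_rep \<gamma>)
    then have "\<nu> \<noteq> 0" by (auto simp: c0_rep)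
    then have pos: "mean (\<nu> * \<nu>) > 0" by (rule sq_pos)
    define N where "N = \<bar>mean \<eta>\<bar> + 1"
    have N: "N > 0" "mean \<eta> \<le> N" unfolding N_def by linarith+
    define \<epsilon> where "\<epsilon> = mean (\<nu> * \<nu>) / (2 * N)"
    have \<epsilon>: "\<epsilon> > 0" using pos N by (simp add: \<epsilon>_def)
    have "0 \<le> mean ((\<epsilon> *\<^sub>R 1 + \<nu>) * \<eta>)"
      by (rule sep) (use \<epsilon> in \<open>simp add: c0_rep \<nu> add_pos_nonneg\<close>)
    moreover have "mean ((\<epsilon> *\<^sub>R 1 + \<nu>) * \<eta>) = \<epsilon> * mean \<eta> - mean (\<nu> * \<nu>)"
      by (simp add: distrib_right mean_add mean_diff mean_scaleR \<open>\<nu> * \<eta> = - (\<nu> * \<nu>)\<close>)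
    moreover have "\<epsilon> * mean \<eta> \<le> \<epsilon> * N" using \<epsilon> N by (intro mult_left_mono) auto
    moreover have "\<epsilon> * N = mean (\<nu> * \<nu>) / 2" using N by (simp add: \<epsilon>_def)
    ultimately show False using pos by linarith
  qed
  then obtain \<rho>0 where \<rho>0: "\<forall>t. Rep_c0 \<rho>0 t > 0" "mean (\<rho>0 * ?\<gamma>1) = 0" "mean (\<rho>0 * ?\<gamma>2) = 0"
    by (auto simp: S_def zero_prod_def)
  have \<gamma>1: "?\<gamma>1 \<noteq> 0" using indep[of 1 0 0] by simp
  \<comment> \<open>Gram-Schmidt for the mean of products: \<open>h2\<close> is orthogonal to
    \<open>?\<gamma>1\<close>, and \<open>h3\<close> below is orthogonal to
    \<open>?\<gamma>1\<close> and \<open>?\<gamma>2\<close>.\<close>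
  define c1 where "c1 = mean (?\<gamma>2 * ?\<gamma>1) / mean (?\<gamma>1 * ?\<gamma>1)"
  define h2 where "h2 = ?\<gamma>2 - c1 *\<^sub>R ?\<gamma>1"
  have h2_nz: "h2 \<noteq> 0" using indep[of "- c1" 1 0] by (simp add: h2_def)
  have h21: "mean (h2 * ?\<gamma>1) = 0"
    using sq_pos[OF \<gamma>1] by (simp add: h2_def left_diff_distrib mean_diff mean_scaleR c1_def)
  have "mean (h2 * h2) = mean (h2 * ?\<gamma>2) - c1 * mean (h2 * ?\<gamma>1)"
    by (subst (2) h2_def) (simp add: right_diff_distrib mean_diff mean_scaleR)
  then have h22: "mean (h2 * ?\<gamma>2) > 0" using h21 sq_pos[OF h2_nz] by simp
  define d1 where "d1 = mean (?\<gamma>3 * ?\<gamma>1) / mean (?\<gamma>1 * ?\<gamma>1)"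
  define d2 where "d2 = mean (?\<gamma>3 * h2) / mean (h2 * h2)"
  define h3 where "h3 = ?\<gamma>3 - d1 *\<^sub>R ?\<gamma>1 - d2 *\<^sub>R h2"
  have h31: "mean (h3 * ?\<gamma>1) = 0"
    using sq_pos[OF \<gamma>1] by (simp add: h3_def left_diff_distrib mean_diff mean_scaleR d1_def h21)
  have h3h2: "mean (h3 * h2) = 0"
    using sq_pos[OF h2_nz] h21 by (simp add: h3_def left_diff_distrib mean_diff mean_scaleR d2_def mult.commute[of ?\<gamma>1 h2])
  have \<gamma>2: "?\<gamma>2 = h2 + c1 *\<^sub>R ?\<gamma>1" by (simp add: h2_def)
  have h32: "mean (h3 * ?\<gamma>2) = 0"
    unfolding \<gamma>2 by (simp add: distrib_left mean_add mean_scaleR h3h2 h31)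
  have h3_nz: "h3 \<noteq> 0"
    using indep[of "d2 * c1 - d1" "- d2" 1] by (simp add: h3_def h2_def algebra_simps)
  have \<gamma>3: "?\<gamma>3 = h3 + d1 *\<^sub>R ?\<gamma>1 + d2 *\<^sub>R h2" by (simp add: h3_def)
  have "mean (h3 * ?\<gamma>3) = mean (h3 * h3)"
    unfolding \<gamma>3 by (simp add: distrib_left mean_add mean_scaleR h3h2 h31)
  then have h33: "mean (h3 * ?\<gamma>3) > 0" using sq_pos[OF h3_nz] by simp
  \<comment> \<open>Should \<rho>0 annihilate \<open>?\<gamma>3\<close> as well, a small multiple of
    \<open>h3\<close> changes this moment without affecting the first two.\<close>
  obtain \<rho> where \<rho>: "\<forall>t. Rep_c0 \<rho> t > 0" "mean (\<rho> * ?\<gamma>1) = 0" "mean (\<rho> * ?\<gamma>2) = 0" "mean (\<rho> * ?\<gamma>3) \<noteq> 0"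
  proof (cases "mean (\<rho>0 * ?\<gamma>3) = 0")
    case True
    obtain \<delta> where \<delta>: "\<delta> > 0" "\<And>t. \<delta> \<le> Rep_c0 \<rho>0 t" using c0_pos_lower[of \<rho>0] \<rho>0(1) by blast
    define N where "N = norm h3 + 1"
    have N: "N > 0" "norm h3 \<le> N" using norm_ge_zero[of h3] unfolding N_def by linarith+
    define \<epsilon> where "\<epsilon> = \<delta> / (2 * N)"
    have \<epsilon>: "\<epsilon> > 0" "\<epsilon> * N < \<delta>" using \<delta>(1) N by (simp_all add: \<epsilon>_def)
    have "Rep_c0 (\<rho>0 + \<epsilon> *\<^sub>R h3) t > 0" for t
    proof -
      have "\<bar>\<epsilon> * Rep_c0 h3 t\<bar> \<le> \<epsilon> * N"
        unfolding abs_mult using \<epsilon> c0_abs_le_norm[of h3 t] N by (intro mult_mono) auto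
      then have "\<bar>\<epsilon> * Rep_c0 h3 t\<bar> < \<delta>" using \<epsilon> by linarith
      then show ?thesis using \<delta>(2)[of t] by (simp add: c0_rep abs_less_iff)
    qed
    then show ?thesis
      using that[of "\<rho>0 + \<epsilon> *\<^sub>R h3"] \<rho>0 h31 h32 h33 True \<epsilon> by (simp add: distrib_right mean_add mean_scaleR)
  qed (use that \<rho>0 in blast)
  have \<gamma>2_nz: "?\<gamma>2 \<noteq> 0" using indep[of 0 1 0] by simp
  show ?thesis
    by (rule c0_cusp_perturb[OF g _ \<rho>(2,3,4) h21 h22 \<gamma>2_nz]) (use \<rho>(1) in blast)
qed

end

section \<open>The global fold\<close>

text \<open>Positive slope at every zero forbids a return to zero; the left half follows by
  reflecting both axes.\<close>

lemma simple_zero_signs: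
  fixes \<sigma> :: "real \<Rightarrow> real"
  assumes d: "\<And>t. (\<sigma> has_real_derivative d t) (at t)" and pos: "\<And>t. \<sigma> t = 0 \<Longrightarrow> d t > 0" and z: "\<sigma> z = 0"
  shows "s > z \<Longrightarrow> \<sigma> s > 0" and "s < z \<Longrightarrow> \<sigma> s < 0"
proof -
  have right: "g s > 0" if d: "\<And>t. (g has_real_derivative d t) (at t)" and pos: "\<And>t. g t = 0 \<Longrightarrow> d t > 0"
    and z: "g z = 0" and s: "s > z" for g d z s
  proof -
    obtain e where e: "e > 0" "\<And>h. 0 < h \<Longrightarrow> h < e \<Longrightarrow> g z < g (z + h)"
      using DERIV_pos_inc_right[OF d pos[OF z]] by blast
    define h where "h = min e (s - z) / 2"
    have "0 < h" "h < e" "z + h < s" using e(1) s by (auto simp: h_def min_def field_simps)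
    then show ?thesis using stays_positive[OF d pos, of "z + h" s] e(2)[of h] z by simp
  qed
  show "\<sigma> s > 0" if "s > z" using right[OF d pos z that] .
  have "((\<lambda>t. - \<sigma> (- t)) has_real_derivative d (- t)) (at t)" for t
    using DERIV_minus[OF DERIV_chain2[OF d DERIV_minus[OF DERIV_ident]], of t] by simp
  from right[OF this, of "- z" "- s"] show "\<sigma> s < 0" if "s < z" using that pos z by simp
qed

text \<open>For nearby parameters \<open>E\<close> keeps its signs slightly above and slightly below
  \<open>G a\<close>, which traps the sign change in between.\<close>

lemma continuous_of_signs:
  fixes G :: "'a::metric_space \<Rightarrow> real"
  assumes E: "continuous_on UNIV E"
    and "\<And>a s. s > G a \<Longrightarrow> E (a, s) > (0::real)" "\<And>a s. s < G a \<Longrightarrow> E (a, s) < 0"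
  shows "continuous_on UNIV G"
proof (rule continuous_at_imp_continuous_on, intro ballI)
  fix a
  have lim: "((\<lambda>b. E (b, s)) \<longlongrightarrow> E (a, s)) (at a)" for s
    by (rule continuous_on_tendsto_compose[OF E tendsto_Pair[OF tendsto_ident_at tendsto_const]]) auto
  show "isCont G a"
    unfolding continuous_at tendsto_iff
  proof (intro allI impI)
    fix e :: real assume e: "e > 0"
    have "\<forall>\<^sub>F b in at a. E (b, G a + e / 2) > 0"
      by (rule order_tendstoD(1)[OF lim]) (use assms(2) e in simp)
    moreover have "\<forall>\<^sub>F b in at a. E (b, G a - e / 2) < 0"
      by (rule order_tendstoD(2)[OF lim]) (use assms(3) e in simp)
    ultimately show "\<forall>\<^sub>F b in at a. dist (G b) (G a) < e"
    proof eventually_elim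
      case (elim b)
      have "\<not> G a + e / 2 < G b" using assms(3)[of "G a + e / 2" b] elim(1) by auto
      moreover have "\<not> G b < G a - e / 2" using assms(2)[of b "G a - e / 2"] elim(2) by auto
      ultimately show ?case using e by (simp add: dist_real_def abs_if)
    qed
  qed
qed

context coercive begin

section \<open>Existence of critical points on every fiber\<close>

abbreviation shift :: "c0 \<Rightarrow> real \<Rightarrow> c0" where "shift p s \<equiv> p + s *\<^sub>R 1"

lemma shift_shift: "shift (shift p s) r = shift p (s + r)"
  by (simp add: scaleR_add_left)

lemma fiber_deriv:
  assumes "\<And>p. line_deriv F p 1 (F' p)"
  shows "((\<lambda>s. F (shift p s)) has_real_derivative F' (shift p s)) (at s)"
  unfolding has_real_derivative_iff_has_vector_derivative by (rule line_deriv_at) (rule assms)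

lemma val1_line_1: "line_deriv val1 p 1 (val2 p)"
  using val1_line[of p 1] by (simp only: dval1_1)

lemmas val_fiber = fiber_deriv[OF val_line]
  and val1_fiber = fiber_deriv[OF val1_line_1]
  and val2_fiber = fiber_deriv[OF val2_line]

text \<open>If the mean were below \<open>K\<close>, the a priori estimate would keep the solution
  within \<open>K - m\<close> of \<open>p + s\<close>, where \<open>f\<close> is at least
  \<open>K\<close> for large \<open>\<bar>s\<bar>\<close>; but then the mean is at least
  \<open>K\<close>.\<close>

lemma val_coercive: "\<exists>b. \<forall>s. \<bar>s\<bar> \<ge> b \<longrightarrow> val (shift p s) \<ge> K"
proof -
  obtain m where m: "\<And>x. m \<le> f x" using f_lower by blast
  obtain b where b: "\<And>x. \<bar>x\<bar> \<ge> b \<Longrightarrow> f x \<ge> K" using f_large[of K] by blast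
  have "val (shift p s) \<ge> K" if s: "\<bar>s\<bar> \<ge> b + norm p + \<bar>K - m\<bar>" for s
  proof (rule ccontr)
    assume less: "\<not> ?thesis"
    obtain S where S: "\<And>x. \<bar>x\<bar> \<le> norm (shift p s) \<Longrightarrow> \<bar>f x\<bar> \<le> S"
      using bounded_on_interval[OF f_cont(1), of "norm (shift p s)"] by blast
    let ?q = "M (shift p s)"
    have "f (Rep_c0 ?q t) \<ge> K" for t
    proof (rule b)
      have "\<bar>Rep_c0 ?q t - Rep_c0 (shift p s) t\<bar> \<le> mean (nem f ?q) - m"
        by (rule apriori_bound(2)[OF f_cont(1) m M]) (use S abs_le_D1 in blast)
      then have "\<bar>Rep_c0 ?q t - (Rep_c0 p t + s)\<bar> \<le> K - m" using less by (simp add: val_def c0_rep)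
      then show "b \<le> \<bar>Rep_c0 ?q t\<bar>" using s c0_abs_le_norm[of p t] by linarith
    qed
    then have "mean (K *\<^sub>R (1 :: c0)) \<le> mean (nem f ?q)"
      by (intro mean_c0_mono) (simp add: c0_rep Rep_nem f_cont)
    then show False using less by (simp add: val_def mean_scaleR)
  qed
  then show ?thesis by blast
qed

lemma crit_exists: "\<exists>s. val1 (shift p s) = 0"
proof -
  obtain b where b: "\<And>s. \<bar>s\<bar> \<ge> b \<Longrightarrow> val (shift p s) \<ge> val (shift p 0) + 1" using val_coercive[of "val (shift p 0) + 1" p] by blast
  define B where "B = \<bar>b\<bar> + 1"
  have "\<exists>s0\<in>{-B..B}. \<forall>s\<in>{-B..B}. val (shift p s0) \<le> val (shift p s)"
    by (rule continuous_attains_inf)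
      (auto simp: B_def intro!: continuous_at_imp_continuous_on DERIV_isCont[OF val_fiber])
  then obtain s0 where s0': "\<forall>s\<in>{-B..B}. val (shift p s0) \<le> val (shift p s)" by blast
  have s0: "val (shift p s0) \<le> val (shift p s)" if "\<bar>s\<bar> \<le> B" for s
    using s0' that by (simp add: abs_le_iff)
  have "val (shift p s0) \<le> val (shift p s)" for s
  proof (cases "\<bar>s\<bar> \<le> B")
    case False
    then have "val (shift p 0) + 1 \<le> val (shift p s)" by (intro b) (simp add: B_def)
    moreover have "val (shift p s0) \<le> val (shift p 0)" by (rule s0) (simp add: B_def)
    ultimately show ?thesis by linarith
  qed (rule s0)
  then have "val1 (shift p s0) = 0"
    by (intro DERIV_local_min[OF val_fiber, of 1]) auto
  then show ?thesis by blast
qed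

end

text \<open>The first condition comes from a functional that supports the hull; the other two are
  what 2-goodness yields: \<open>f'' + c f'\<close> vanishes on no interval, and \<open>f'\<close>,
  \<open>f''\<close> have no common zero.\<close>

locale coercive_fold = coercive +
  fixes c :: real
  assumes \<kappa>_nonneg: "\<And>x. 0 \<le> f2 x + c * f1 x"
    and \<kappa>_nonzero: "\<And>a b. a < b \<Longrightarrow> \<exists>x. a < x \<and> x < b \<and> f2 x + c * f1 x \<noteq> 0"
    and nondegenerate: "\<And>x. f1 x \<noteq> 0 \<or> f2 x \<noteq> 0"
begin

text \<open>Since \<open>W' = - f'(u) W\<close> at a critical point, the term \<open>c f'\<close> integrates to zero against \<open>W\<close>.\<close>

lemma val2_pos:
  assumes "val1 p = 0" shows "val2 p > 0"
proof -
  note pos = W_pos[OF assms]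
  define \<kappa> where "\<kappa> = nem f2 (M p) + c *\<^sub>R A p"
  have \<kappa>: "Rep_c0 \<kappa> t = f2 (Rep_c0 (M p) t) + c * f1 (Rep_c0 (M p) t)" for t
    by (simp add: \<kappa>_def A_def c0_rep Rep_nem f_cont)
  \<comment> \<open>If \<kappa> vanished, a nonconstant solution would sweep an interval of zeros of
    \<open>f'' + c f'\<close>, while a constant one would have \<open>f' = 0\<close> by criticality
    and then also \<open>f'' = 0\<close>.\<close>
  have "\<kappa> \<noteq> 0"
  proof
    assume "\<kappa> = 0"
    then have z: "f2 (Rep_c0 (M p) t) + c * f1 (Rep_c0 (M p) t) = 0" for t using \<kappa>[of t] by (simp add: c0_rep)
    show False
    proof (cases "\<exists>t s. Rep_c0 (M p) t < Rep_c0 (M p) s")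
      case True
      then obtain t s where ts: "Rep_c0 (M p) t < Rep_c0 (M p) s" by blast
      obtain x where x: "Rep_c0 (M p) t < x" "x < Rep_c0 (M p) s" "f2 x + c * f1 x \<noteq> 0" using \<kappa>_nonzero[OF ts] by blast
      have "\<exists>r. Rep_c0 (M p) r = x"
      proof (cases "t \<le> s")
        case True
        then show ?thesis using IVT'[of "Rep_c0 (M p)" t x s] x c0_continuous by auto
      next
        case False
        then show ?thesis using IVT2'[of "Rep_c0 (M p)" t x s] x c0_continuous by auto
      qed
      then show False using z x(3) by blast
    next
      case False
      then have const: "Rep_c0 (M p) t = Rep_c0 (M p) 0" for t by (meson linorder_neqE)
      define x where "x = Rep_c0 (M p) 0"
      have "A p * W p = f1 x *\<^sub>R W p"
      proof (rule c0_eqI)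
        fix t show "Rep_c0 (A p * W p) t = Rep_c0 (f1 x *\<^sub>R W p) t"
          using const[of t] by (simp add: A_def c0_rep Rep_nem f_cont x_def)
      qed
      then have "f1 x = 0" using assms by (simp add: val1_def mean_scaleR mean_W)
      then show False using z[of 0] nondegenerate[of x] by (simp add: x_def)
    qed
  qed
  moreover have "\<kappa> * W p * recip (W p) = \<kappa>" using mult_recip[OF pos] by (simp add: mult.assoc)
  ultimately have "\<kappa> * W p \<noteq> 0" by auto
  then have "mean (\<kappa> * W p) > 0"
    using pos by (intro mean_c0_pos) (auto simp: c0_rep \<kappa> \<kappa>_nonneg less_imp_le)
  moreover have "mean (\<kappa> * W p) = mean (nem f2 (M p) * W p)"
    using assms by (simp add: \<kappa>_def distrib_right mean_add mean_scaleR val1_def)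
  ultimately have "val2 p * mean (recip (W p)) > 0" using val2_crit[OF assms] by simp
  then show ?thesis using mean_recip_pos[OF pos] by (simp add: zero_less_mult_iff)
qed

section \<open>The minimum of each fiber and a square root of the height above it\<close>

definition N :: "c0 \<Rightarrow> real" where "N p = (THE s. val1 (shift p s) = 0)"

lemma crit_signs:
  assumes "val1 (shift p z) = 0"
  shows "s > z \<Longrightarrow> val1 (shift p s) > 0" and "s < z \<Longrightarrow> val1 (shift p s) < 0"
  using simple_zero_signs[OF val1_fiber val2_pos assms] by blast+

lemma N_zero: "val1 (shift p (N p)) = 0"
proof -
  have "s = r" if "val1 (shift p s) = 0" "val1 (shift p r) = 0" for s r
    using crit_signs[OF that(1), of r] that(2) by (cases s r rule: linorder_cases) auto
  then show ?thesis unfolding N_def by (intro theI'[OF ex_ex1I[OF crit_exists]])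
qed

lemmas N_signs = crit_signs[OF N_zero]

lemma N_eqI: "val1 (shift p s) = 0 \<Longrightarrow> N p = s"
  using N_signs(1)[where p = p and s = s] N_signs(2)[where p = p and s = s] by (cases s "N p" rule: linorder_cases) auto

text \<open>\<open>N p\<close> is the displacement from \<open>p\<close> to the minimum of its
  fiber, not the position of the minimum.\<close>

lemma N_shift: "N (shift p s) = N p - s"
  by (rule N_eqI) (simp add: shift_shift N_zero)

lemma smooth_shift: "smooth (\<lambda>z. shift (fst z) (snd z))"
  by (rule smoothI) (intro Cn_add Cn_scaleR Cn_fst Cn_snd Cn_id Cn_const)

lemma smooth_shift_compose: "smooth u \<Longrightarrow> smooth s \<Longrightarrow> smooth (\<lambda>x. shift (u x) (s x))"
  by (rule smoothI) (intro Cn_add Cn_scaleR Cn_const smoothD)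

lemma smooth_N: "smooth N"
proof (rule smooth_implicit_real)
  let ?E = "\<lambda>z. val1 (shift (fst z) (snd z))"
  show E: "smooth ?E" by (rule smooth_compose[OF smooth_val1 smooth_shift])
  show "continuous_on UNIV N"
    by (rule continuous_of_signs[OF smooth_continuous[OF E]]) (simp_all add: N_signs)
  show "?E (p, N p) = 0" for p by (simp add: N_zero)
  show "dd ?E (p, N p) [(0, 1)] \<noteq> 0" for p
  proof -
    have "line_deriv ?E (p, N p) (0, 1) (val2 (shift p (N p)))"
      using val1_line_1[of "shift p (N p)"] by (simp add: scaleR_add_left add.assoc)
    from dd_1[OF this] show ?thesis using val2_pos[OF N_zero, of p] by simp
  qed
qed

lemma smooth_val2: "smooth val2"
proof -
  have "val2 = (\<lambda>p. dd val1 p [1])" using dd_1[OF val1_line_1] by auto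
  then show ?thesis using smooth_dd_const[OF smooth_val1] by simp
qed

text \<open>The height above the minimum divided by the square of the displacement, as an integral
  remainder in Taylor's formula; in this form it is smooth also where
  \<open>N p = 0\<close>.\<close>

definition H :: "c0 \<Rightarrow> real" where
  "H p = integral {0..1} (\<lambda>t. t * val2 (shift p (t * N p)))"

lemma smooth_H: "smooth H"
proof -
  have N: "smooth (\<lambda>z :: c0 \<times> real. snd z * N (fst z))"
    by (rule smoothI) (intro Cn_mult Cn_snd Cn_id Cn_compose[OF smoothD[OF smooth_N] Cn_fst[OF Cn_id]])
  have 2: "smooth (\<lambda>z :: c0 \<times> real. val2 (shift (fst z) (snd z * N (fst z))))"
    by (rule smooth_compose[OF smooth_val2 smooth_shift_compose[OF smooth_bounded_linear[OF bounded_linear_fst] N]])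
  have "smooth (\<lambda>z :: c0 \<times> real. snd z * val2 (shift (fst z) (snd z * N (fst z))))"
    by (rule smoothI) (rule Cn_mult[OF Cn_snd[OF Cn_id] smoothD[OF 2]])
  from smooth_integral[OF this] show ?thesis by (simp add: H_def[abs_def])
qed

text \<open>Taylor's formula at the minimum of the fiber, written from the other end point.\<close>

lemma H_taylor: "val p - val (shift p (N p)) = (N p)\<^sup>2 * H p"
proof -
  let ?n = "N p"
  have d: "((\<lambda>t. F (shift p (t * ?n))) has_real_derivative F' (shift p (t * ?n)) * ?n) (at t)"
    if "\<And>s. ((\<lambda>s. F (shift p s)) has_real_derivative F' (shift p s)) (at s)" for F F' :: "c0 \<Rightarrow> real" and t
    using DERIV_chain2[OF that DERIV_cmult_right[OF DERIV_ident, of ?n], of t] by simp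
  have "((\<lambda>t. ?n\<^sup>2 * (t * val2 (shift p (t * ?n)))) has_integral
      ((1 * (?n * val1 (shift p (1 * ?n))) - val (shift p (1 * ?n))) -
       (0 * (?n * val1 (shift p (0 * ?n))) - val (shift p (0 * ?n))))) {0..1}"
  proof (rule fundamental_theorem_of_calculus)
    fix t :: real
    have "((\<lambda>t. t * (?n * val1 (shift p (t * ?n))) - val (shift p (t * ?n))) has_real_derivative
        1 * (?n * val1 (shift p (t * ?n))) + ?n * (val2 (shift p (t * ?n)) * ?n) * t - val1 (shift p (t * ?n)) * ?n) (at t)"
      by (intro DERIV_diff DERIV_mult DERIV_ident DERIV_cmult d val1_fiber val_fiber)
    moreover have "1 * (?n * val1 (shift p (t * ?n))) + ?n * (val2 (shift p (t * ?n)) * ?n) * t - val1 (shift p (t * ?n)) * ?n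
        = ?n\<^sup>2 * (t * val2 (shift p (t * ?n)))"
      by (simp add: power2_eq_square)
    ultimately show "((\<lambda>t. t * (?n * val1 (shift p (t * ?n))) - val (shift p (t * ?n))) has_vector_derivative
        ?n\<^sup>2 * (t * val2 (shift p (t * ?n)))) (at t within {0..1})"
      by (simp only: has_real_derivative_iff_has_vector_derivative has_vector_derivative_at_within)
  qed simp
  from integral_unique[OF this] show ?thesis by (simp add: H_def N_zero)
qed

lemma val_min: "N p \<noteq> 0 \<Longrightarrow> val (shift p (N p)) < val p"
proof -
  assume "N p \<noteq> 0"
  then consider "0 < N p" | "N p < 0" by linarith
  then show ?thesis
  proof cases
    case 1
    obtain z where z: "0 < z" "z < N p" "val (shift p (N p)) - val (shift p 0) = (N p - 0) * val1 (shift p z)"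
      using MVT2[OF 1, of "\<lambda>s. val (shift p s)" "\<lambda>s. val1 (shift p s)", OF val_fiber] by blast
    have "(N p - 0) * val1 (shift p z) < 0" using N_signs(2)[OF z(2)] 1 by (simp add: mult_pos_neg)
    then show ?thesis using z(3) by simp
  next
    case 2
    obtain z where z: "N p < z" "z < 0" "val (shift p 0) - val (shift p (N p)) = (0 - N p) * val1 (shift p z)"
      using MVT2[OF 2, of "\<lambda>s. val (shift p s)" "\<lambda>s. val1 (shift p s)", OF val_fiber] by blast
    have "(0 - N p) * val1 (shift p z) > 0" using N_signs(1)[OF z(1)] 2 by (intro mult_pos_pos) auto
    then show ?thesis using z(3) by simp
  qed
qed

lemma H_pos: "H p > 0"
proof (cases "N p = 0")
  case True
  have "((\<lambda>t. t * val2 p) has_integral (1\<^sup>2 / 2 * val2 p - 0\<^sup>2 / 2 * val2 p)) {0..1}"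
    by (rule fundamental_theorem_of_calculus)
      (auto intro!: derivative_eq_intros simp: has_real_derivative_iff_has_vector_derivative[symmetric])
  then have "H p = val2 p / 2" using True by (simp add: H_def integral_unique)
  then show ?thesis using val2_pos[of p] N_zero[of p] True by simp
next
  case False
  then have "(N p)\<^sup>2 * H p > 0" using val_min[of p] H_taylor[of p] by simp
  then show ?thesis using False by (simp add: zero_less_mult_iff)
qed

text \<open>The Morse coordinate of the fiber: a square root of the height above the minimum that
  changes sign there. The minus sign makes it increase along the fiber.\<close>

definition X :: "c0 \<Rightarrow> real" where "X p = - N p * sqrt (H p)"

lemma smooth_X: "smooth X"
  unfolding X_def[abs_def]
  by (rule smoothI) (intro Cn_mult Cn_uminus smoothD smooth_N smooth_sqrt smooth_H H_pos)

lemma X_square: "(X p)\<^sup>2 = val p - val (shift p (N p))"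
  using H_taylor[of p] H_pos[of p] by (simp add: X_def power_mult_distrib)

lemma X_square_shift: "(X (shift p s))\<^sup>2 = val (shift p s) - val (shift p (N p))"
  using X_square[of "shift p s"] by (simp add: N_shift shift_shift)

definition X1 :: "c0 \<Rightarrow> real" where "X1 p = dd X p [1]"

lemma X_line: "line_deriv X p 1 (X1 p)"
  unfolding X1_def by (rule smooth_line[OF smooth_X])

text \<open>Away from the minimum, differentiating \<open>X\<^sup>2\<close> gives
  \<open>2 X X1 = val1\<close>, and both \<open>X\<close> and \<open>val1\<close> have the sign of
  \<open>- N p\<close>. At the minimum this degenerates to \<open>0 = 0\<close>, so there
  \<open>s * sqrt H\<close> is differentiated directly.\<close>

lemma X1_pos: "X1 p > 0"
proof (cases "N p = 0")
  case True
  have "((\<lambda>s. sqrt (H (p + s *\<^sub>R 1))) has_real_derivative dd (\<lambda>p. sqrt (H p)) p [1]) (at 0)"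
    using smooth_line[OF smooth_sqrt[OF smooth_H H_pos], of p 1]
    by (simp add: has_real_derivative_iff_has_vector_derivative)
  from DERIV_mult[OF DERIV_ident this]
  have "((\<lambda>s. s * sqrt (H (p + s *\<^sub>R 1))) has_real_derivative sqrt (H p)) (at 0)" by simp
  moreover have "(\<lambda>s. s * sqrt (H (p + s *\<^sub>R 1))) = (\<lambda>s. X (p + s *\<^sub>R 1))"
    using N_shift[of p] True by (simp add: X_def fun_eq_iff)
  ultimately have "line_deriv X p 1 (sqrt (H p))"
    by (simp add: has_real_derivative_iff_has_vector_derivative)
  from dd_1[OF this] show ?thesis using H_pos[of p] by (simp add: X1_def)
next
  case False
  have "((\<lambda>s. X (shift p s)) has_real_derivative X1 p) (at 0)"
    using fiber_deriv[OF X_line, of p 0] by simp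
  from DERIV_mult[OF this this]
  have "((\<lambda>s. X (shift p s) * X (shift p s)) has_real_derivative 2 * (X p * X1 p)) (at 0)" by simp
  moreover have "(\<lambda>s. X (shift p s) * X (shift p s)) = (\<lambda>s. val (shift p s) - val (shift p (N p)))"
    using X_square_shift[of p] by (simp add: power2_eq_square fun_eq_iff)
  ultimately have "((\<lambda>s. val (shift p s) - val (shift p (N p))) has_real_derivative 2 * (X p * X1 p)) (at 0)" by simp
  moreover have "((\<lambda>s. val (shift p s) - val (shift p (N p))) has_real_derivative val1 (shift p 0) - 0) (at 0)"
    by (intro DERIV_diff val_fiber DERIV_const)
  ultimately have "2 * (X p * X1 p) = val1 (shift p 0) - 0" by (rule DERIV_unique)
  then have eq: "X p * X1 p = val1 (shift p 0) / 2" by simp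
  have s: "sqrt (H p) > 0" using H_pos by simp
  show ?thesis
  proof (cases "N p > 0")
    case True
    then have "X p < 0" "X p * X1 p < 0" using s N_signs(2)[of 0 p] eq by (simp_all add: X_def mult_neg_pos)
    then show ?thesis by (simp add: mult_less_0_iff)
  next
    case F: False
    then have "N p < 0" using False by simp
    then have "X p > 0" "X p * X1 p > 0" using s N_signs(1)[of p 0] eq by (simp_all add: X_def mult_neg_pos)
    then show ?thesis by (simp add: zero_less_mult_iff)
  qed
qed

lemma X_mono: "s < r \<Longrightarrow> X (shift p s) < X (shift p r)"
  by (rule DERIV_pos_imp_increasing) (use fiber_deriv[OF X_line] X1_pos in blast)+

lemma X_surj: "\<exists>s. X (shift p s) = \<xi>"
proof -
  obtain b where b: "\<And>s. \<bar>s\<bar> \<ge> b \<Longrightarrow> val (shift p s) \<ge> \<xi>\<^sup>2 + val (shift p (N p))"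
    using val_coercive[of "\<xi>\<^sup>2 + val (shift p (N p))" p] by blast
  define s where "s = \<bar>b\<bar> + \<bar>N p\<bar> + 1"
  have "\<bar>\<xi>\<bar> \<le> \<bar>X (shift p r)\<bar>" if "\<bar>r\<bar> \<ge> b" for r
    using b[OF that] X_square_shift[of p r] by (simp add: abs_le_square_iff)
  from this[of s] this[of "- s"] have big: "\<bar>\<xi>\<bar> \<le> \<bar>X (shift p s)\<bar>" "\<bar>\<xi>\<bar> \<le> \<bar>X (shift p (- s))\<bar>"
    by (simp_all add: s_def)
  have "N (shift p s) < 0" "N (shift p (- s)) > 0" unfolding N_shift s_def by linarith+
  then have "X (shift p s) > 0" "X (shift p (- s)) < 0"
    unfolding X_def using H_pos by (simp_all add: mult_neg_pos)
  then have "X (shift p (- s)) \<le> \<xi>" "\<xi> \<le> X (shift p s)" using big by linarith+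
  moreover have "- s \<le> s" unfolding s_def by linarith
  ultimately show ?thesis
    using IVT[of "\<lambda>s. X (shift p s)" "- s" \<xi> s] DERIV_isCont[OF fiber_deriv[OF X_line]] by blast
qed

definition Y :: "c0 \<times> real \<Rightarrow> real" where "Y z = (THE s. X (shift (fst z) s) = snd z)"

lemma X_inj: "X (shift p s) = X (shift p r) \<Longrightarrow> s = r"
  using X_mono[of s r p] X_mono[of r s p] by (cases s r rule: linorder_cases) auto

lemma X_Y: "X (shift p (Y (p, \<xi>))) = \<xi>"
  unfolding Y_def fst_conv snd_conv by (intro theI'[OF ex_ex1I[OF X_surj]]) (rule X_inj[of p], simp)

lemma Y_X: "Y (p, X (shift p s)) = s"
  by (rule X_inj[of p]) (rule X_Y)

lemma smooth_Y: "smooth Y"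
proof (rule smooth_implicit_real)
  let ?E = "\<lambda>z. X (shift (fst (fst z)) (snd z)) - snd (fst z)"
  have 1: "smooth (\<lambda>z :: (c0 \<times> real) \<times> real. shift (fst (fst z)) (snd z))"
    by (rule smoothI) (intro Cn_add Cn_scaleR Cn_fst Cn_snd Cn_id Cn_const)
  show E: "smooth ?E"
    by (rule smoothI) (intro Cn_diff Cn_fst Cn_snd Cn_id Cn_compose[OF smoothD[OF smooth_X] smoothD[OF 1]])
  have signs: "X (shift (fst a) s) > snd a" if "s > Y a" for a s
    using X_mono[OF that, of "fst a"] X_Y[of "fst a" "snd a"] by simp
  have signs': "X (shift (fst a) s) < snd a" if "s < Y a" for a s
    using X_mono[OF that, of "fst a"] X_Y[of "fst a" "snd a"] by simp
  show "continuous_on UNIV Y"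
    by (rule continuous_of_signs[OF smooth_continuous[OF E]]) (simp_all add: signs signs')
  show "?E (a, Y a) = 0" for a using X_Y[of "fst a" "snd a"] by simp
  show "dd ?E (a, Y a) [(0, 1)] \<noteq> 0" for a
  proof -
    have "line_deriv X (shift (fst a) (Y a)) 1 (X1 (shift (fst a) (Y a)))" by (rule X_line)
    from has_vector_derivative_diff[OF this has_vector_derivative_const[of "snd a"]]
    have "line_deriv ?E (a, Y a) (0, 1) (X1 (shift (fst a) (Y a)))"
      by (simp add: scaleR_add_left add.assoc)
    from dd_1[OF this] show ?thesis using X1_pos[of "shift (fst a) (Y a)"] by simp
  qed
qed

definition val_floor :: "c0 \<Rightarrow> real" where "val_floor p = val (shift p (N p))"

lemma smooth_val_floor: "smooth val_floor"
  unfolding val_floor_def[abs_def]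
  by (rule smooth_compose[OF smooth_val smooth_shift_compose[OF smooth_bounded_linear[OF bounded_linear_ident] smooth_N]])

lemma val_floor_shift: "val_floor (shift p s) = val_floor p"
  by (simp add: val_floor_def N_shift shift_shift)

lemma val_eq: "val p = val_floor p + (X p)\<^sup>2"
  by (simp add: X_square val_floor_def)

end

section \<open>From continuous functions to the function spaces\<close>

text \<open>\<open>d\<close> is the derivative; \<open>j\<close> and \<open>k\<close> are the inclusions \<open>C\<^sup>0 \<subseteq> B\<^sup>0\<close> and
  \<open>B\<^sup>1 \<subseteq> C\<^sup>0\<close>.\<close>

locale circle_pair =
  fixes j :: "c0 \<Rightarrow> 'b0::circle_space" and k :: "'b1::circle_space \<Rightarrow> c0"
    and d :: "'b1 \<Rightarrow> 'b0" and C :: real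
  assumes lin: "bounded_linear j" "bounded_linear k" "bounded_linear d" "bounded_linear (mean :: 'b0 \<Rightarrow> real)"
    and mean_j: "\<And>q. mean (j q) = mean q" and mean_k: "\<And>u. mean (k u) = mean u"
    and mean_d: "\<And>u. mean (d u) = 0"
    and j_const: "\<And>c. j (const_fn c) = const_fn c" and k_const: "\<And>c. k (const_fn c) = const_fn c"
    and d_const: "\<And>c. d (const_fn c) = 0"
    and poincare: "\<And>u. mean u = 0 \<Longrightarrow> norm u \<le> C * norm (d u)"
    and primitive: "\<And>v. mean v = 0 \<Longrightarrow> \<exists>u. d u = v \<and> mean u = 0"
    and primitive_j: "\<And>q. \<exists>u. d u = j (q - const_fn (mean q)) \<and> k u = prim q"
begin

lemmas linear_jkd = lin(1-3)[THEN bounded_linear.linear]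
lemmas linear_jkd_simps = linear_jkd[THEN linear_add] linear_jkd[THEN linear_diff] linear_jkd[THEN linear_neg]
  linear_jkd[THEN linear_cmul] linear_jkd[THEN linear_0]

text \<open>The class \<open>circle_space\<close> does not state that constants are embedded
  linearly; here this is inherited from \<open>C^0\<close> through \<open>j\<close>.\<close>

lemma const_b0: "const_fn c = c *\<^sub>R (const_fn 1 :: 'b0)"
  using j_const[of c] j_const[of 1] by (simp add: const_fn_c0_eq linear_jkd_simps)

lemma bounded_linear_const_b0: "bounded_linear L \<Longrightarrow> bounded_linear (\<lambda>x. const_fn (L x) :: 'b0)"
  by (subst const_b0) (rule bounded_linear_compose[OF bounded_linear_scaleR_left])

lemma mean_free_part: "bounded_linear (\<lambda>w :: 'b0. w - const_fn (mean w))"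
  by (intro bounded_linear_sub bounded_linear_ident bounded_linear_const_b0 lin)

lemma d_inject: "d u = d w \<Longrightarrow> mean u = mean w \<Longrightarrow> u = w"
  using poincare[of "u - w"] by (simp add: mean_diff linear_jkd_simps)

text \<open>The counterpart of \<open>prim\<close> on the function spaces; it gains one
  derivative.\<close>

definition I :: "'b0 \<Rightarrow> 'b1" where "I v = (THE u. d u = v - const_fn (mean v) \<and> mean u = 0)"

lemma d_I: "d (I v) = v - const_fn (mean v)" and mean_I: "mean (I v) = 0"
proof -
  have "\<exists>!u. d u = v - const_fn (mean v) \<and> mean u = 0"
    using primitive[of "v - const_fn (mean v)"] d_inject
    by (intro ex_ex1I) (simp_all add: mean_diff mean_const_fn)
  from theI'[OF this] show "d (I v) = v - const_fn (mean v)" "mean (I v) = 0"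
    unfolding I_def[symmetric] by blast+
qed

lemma I_eqI: "d u = v - const_fn (mean v) \<Longrightarrow> mean u = 0 \<Longrightarrow> I v = u"
  by (rule d_inject) (simp_all add: d_I mean_I)

lemma bounded_linear_I: "bounded_linear I"
proof -
  interpret m: bounded_linear "\<lambda>w :: 'b0. w - const_fn (mean w)" by (rule mean_free_part)
  obtain K where K: "\<And>w :: 'b0. norm (w - const_fn (mean w)) \<le> norm w * K" using m.bounded by blast
  show ?thesis
  proof (rule bounded_linear_intro[where K = "\<bar>C\<bar> * K"])
    show "I (v + w) = I v + I w" for v w
      by (rule I_eqI) (simp add: linear_jkd_simps d_I m.add[symmetric], simp add: mean_add mean_I)
    show "I (c *\<^sub>R v) = c *\<^sub>R I v" for c v
      by (rule I_eqI) (simp add: linear_jkd_simps d_I m.scaleR[symmetric], simp add: mean_scaleR mean_I)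
    show "norm (I v) \<le> norm v * (\<bar>C\<bar> * K)" for v
    proof -
      have "norm (I v) \<le> C * norm (d (I v))" by (rule poincare[OF mean_I])
      also have "\<dots> \<le> \<bar>C\<bar> * norm (v - const_fn (mean v))"
        unfolding d_I by (rule mult_right_mono) simp_all
      also have "\<dots> \<le> \<bar>C\<bar> * (norm v * K)" by (rule mult_left_mono[OF K]) simp
      finally show ?thesis by (simp add: mult_ac)
    qed
  qed
qed

lemmas linear = linear_jkd bounded_linear_I[THEN bounded_linear.linear]
lemmas linear_simps = linear[THEN linear_add] linear[THEN linear_diff] linear[THEN linear_neg]
  linear[THEN linear_cmul] linear[THEN linear_0]

lemma I_d: "I (d u) = u - const_fn (mean u)"
  by (rule I_eqI) (simp_all add: linear_simps d_const mean_d mean_diff mean_const_fn const_b0[of 0])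

lemma I_const: "I (const_fn c) = 0"
  by (rule I_eqI) (simp_all add: linear_simps mean_const_fn)

lemma k_I_j: "k (I (j q)) = prim q"
proof -
  obtain u where u: "d u = j (q - const_fn (mean q))" "k u = prim q" using primitive_j by blast
  then have "I (j q) = u"
    by (intro I_eqI) (simp_all add: linear_simps j_const mean_j mean_k[symmetric] prim_props(1))
  then show ?thesis using u by simp
qed

lemma const_b1: "const_fn c = c *\<^sub>R (const_fn 1 :: 'b1)"
  using I_d[of "c *\<^sub>R (const_fn 1 :: 'b1)"] by (simp add: linear_simps d_const mean_scaleR mean_const_fn)

lemma bounded_linear_const_b1: "bounded_linear L \<Longrightarrow> bounded_linear (\<lambda>x. const_fn (L x) :: 'b1)"
  by (subst const_b1) (rule bounded_linear_compose[OF bounded_linear_scaleR_left])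

section \<open>The splitting into mean free part and mean\<close>

lemma Rep_zero_mean_part: "Rep_zero_mean (zero_mean_part w) = w - const_fn (mean w)" for w :: 'b0
  unfolding zero_mean_part_def by (rule Abs_zero_mean_inverse) (simp add: mean_diff mean_const_fn)

lemma mean_Rep: "mean (Rep_zero_mean v) = 0" for v :: "'b0 zero_mean"
  using Rep_zero_mean[of v] by simp

lemma zero_mean_part_unique: "w - const_fn (mean w) = Rep_zero_mean v \<Longrightarrow> zero_mean_part w = v" for w :: 'b0
  using Rep_zero_mean_part[of w] Rep_zero_mean_inject[of "zero_mean_part w" v] by simp

lemma bounded_linear_Rep: "bounded_linear (Rep_zero_mean :: 'b0 zero_mean \<Rightarrow> 'b0)"
  by (rule bounded_linear_intro[where K = 1])
    (simp_all add: plus_zero_mean.rep_eq scaleR_zero_mean.rep_eq norm_zero_mean.rep_eq)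

lemma bounded_linear_zero_mean_part: "bounded_linear (zero_mean_part :: 'b0 \<Rightarrow> 'b0 zero_mean)"
proof -
  interpret m: bounded_linear "\<lambda>w :: 'b0. w - const_fn (mean w)" by (rule mean_free_part)
  obtain K where K: "\<And>w :: 'b0. norm (w - const_fn (mean w)) \<le> norm w * K" using m.bounded by blast
  show ?thesis
  proof (rule bounded_linear_intro[where K = K])
    show "zero_mean_part (u + v) = zero_mean_part u + zero_mean_part v" for u v :: 'b0
      by (rule zero_mean_part_unique) (simp add: plus_zero_mean.rep_eq Rep_zero_mean_part m.add)
    show "zero_mean_part (c *\<^sub>R u) = c *\<^sub>R zero_mean_part u" for c and u :: 'b0
      by (rule zero_mean_part_unique) (simp add: scaleR_zero_mean.rep_eq Rep_zero_mean_part m.scaleR)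
    show "norm (zero_mean_part u) \<le> norm u * K" for u :: 'b0
      using K by (simp add: norm_zero_mean.rep_eq Rep_zero_mean_part)
  qed
qed

definition P :: "'b0 zero_mean \<Rightarrow> c0" where "P v = k (I (Rep_zero_mean v))"

lemma bounded_linear_P: "bounded_linear P"
  unfolding P_def
  by (rule bounded_linear_compose[OF lin(2) bounded_linear_compose[OF bounded_linear_I bounded_linear_Rep]])

lemma P_zero_mean_part: "P (zero_mean_part w) = k (I w)"
  by (simp add: P_def Rep_zero_mean_part linear_simps I_const)

text \<open>The right-hand side of the equation on \<open>C^0\<close>. Adding a constant to
  \<open>b\<close> moves it along 1, so the fibers over mean free functions become the lines on
  which \<open>val\<close> is studied.\<close>

definition base :: "'b0 \<Rightarrow> c0" where "base b = k (I b) + mean b *\<^sub>R 1"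

lemma bounded_linear_base: "bounded_linear base"
  unfolding base_def[abs_def]
  by (intro bounded_linear_add bounded_linear_compose[OF lin(2) bounded_linear_I]
      bounded_linear_compose[OF bounded_linear_scaleR_left lin(4)])

lemma base_split: "base (Rep_zero_mean v + const_fn x) = P v + x *\<^sub>R 1"
  by (simp add: base_def P_def linear_simps I_const mean_add mean_const_fn mean_Rep)

lemma split_b0: "Rep_zero_mean (zero_mean_part b) + const_fn (mean b) = b" for b :: 'b0
  by (simp add: Rep_zero_mean_part)

lemma mean_split: "mean (Rep_zero_mean v + const_fn x) = x" for v :: "'b0 zero_mean"
  by (simp add: mean_add mean_Rep mean_const_fn)

lemma zero_mean_part_split: "zero_mean_part (Rep_zero_mean v + const_fn x) = v" for v :: "'b0 zero_mean"
  by (rule zero_mean_part_unique) (simp only: mean_split add_diff_cancel_right')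

end

locale circle_operator = circle_pair + coercive
begin

definition F :: "'b \<Rightarrow> 'a" where "F u = d u + j (nem f (k u))"

text \<open>Applying \<open>I\<close> to \<open>Psi F u = b\<close> expresses \<open>u\<close>
  through \<open>b\<close> and \<open>f \<circ> u\<close>, and the latter is known from the equation
  on \<open>C^0\<close>, where \<open>k u = M (base b)\<close>.\<close>

definition G :: "'a \<Rightarrow> 'b" where
  "G b = const_fn (mean b) + I b - I (j (nem f (M (base b))))"

lemma k_G: "k (G b) = M (base b)"
proof -
  have "k (G b) = base b - prim (nem f (M (base b)))"
    by (simp add: G_def linear_simps k_const k_I_j base_def const_fn_c0_eq algebra_simps)
  also have "\<dots> = M (base b)" using M[of "base b"] by (simp add: diff_eq_eq)
  finally show ?thesis .
qed

lemma mean_G: "mean (G b) = mean b"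
  by (simp add: G_def mean_add mean_diff mean_const_fn mean_I)

lemma Psi_F: "Psi F u = d u + (j (nem f (k u)) - const_fn (mean (nem f (k u)))) + const_fn (mean u)"
  by (simp add: Psi_def F_def mean_add mean_d mean_j)

lemma Psi_G: "Psi F (G b) = b"
proof -
  have "d (G b) = (b - const_fn (mean b)) - (j (nem f (M (base b))) - const_fn (mean (nem f (M (base b)))))"
    by (simp add: G_def linear_simps d_const d_I mean_j)
  then show ?thesis by (simp add: Psi_F k_G mean_G)
qed

lemma G_Psi: "G (Psi F u) = u"
proof -
  let ?q = "nem f (k u)"
  have m: "mean (Psi F u) = mean u"
    by (simp add: Psi_F mean_add mean_diff mean_d mean_j mean_const_fn)
  have I: "I (Psi F u) = (u - const_fn (mean u)) + I (j ?q)"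
    by (simp add: Psi_F linear_simps I_d I_const)
  have "base (Psi F u) = k u + prim ?q"
    by (simp add: base_def m I linear_simps k_const k_I_j const_fn_c0_eq)
  then have "M (base (Psi F u)) = k u" by (intro M_I) simp
  then show ?thesis by (simp add: G_def m I)
qed

lemma inv_Psi: "inv (Psi F) = G"
  by (rule inv_equality) (simp_all add: Psi_G G_Psi)

lemma mean_F_G: "mean (F (G b)) = val (base b)"
  by (simp add: F_def mean_add mean_d mean_j k_G val_def)

lemma phi_F: "phi F v = (\<lambda>x. val (P v + x *\<^sub>R 1))"
  by (rule ext) (simp add: phi_def inv_Psi mean_F_G base_split)

lemma deriv_phi: "deriv (phi F v) = (\<lambda>x. val1 (P v + x *\<^sub>R 1))"
  unfolding phi_F by (rule ext) (rule DERIV_imp_deriv[OF val_fiber])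

lemma deriv2_phi: "(deriv ^^ 2) (phi F v) = (\<lambda>x. val2 (P v + x *\<^sub>R 1))"
  by (simp add: eval_nat_numeral deriv_phi) (rule ext, rule DERIV_imp_deriv[OF val1_fiber])

lemma deriv3_phi: "(deriv ^^ 3) (phi F v) = (\<lambda>x. val3 (P v + x *\<^sub>R 1))"
proof -
  have "(deriv ^^ 3) (phi F v) = deriv ((deriv ^^ 2) (phi F v))" by (simp add: eval_nat_numeral)
  then show ?thesis by (simp only: deriv2_phi) (rule ext, rule DERIV_imp_deriv[OF val2_fiber])
qed

text \<open>The derivative of \<open>phi F\<close> in the real variable is \<open>val1\<close>
  composed with a bounded linear map \<Lambda>. The range of \<Lambda> contains all
  \<open>const_fn c + prim r\<close>, so a nonzero value of \<open>dval1\<close> on such a direction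
  makes the real-valued total derivative surjective.\<close>

lemma is_cusp_G:
  assumes "c0_cusp (const_fn c + prim r)"
  shows "\<exists>u. is_cusp F u"
proof -
  define v where "v = zero_mean_part (j r)"
  define b where "b = Rep_zero_mean v + const_fn c"
  define p where "p = const_fn c + prim r"
  have P_j: "P (zero_mean_part (j s)) = prim s" for s by (simp add: P_zero_mean_part k_I_j)
  have p: "P v + c *\<^sub>R 1 = p" by (simp add: v_def P_j p_def const_fn_c0_eq)
  have zv: "zero_mean_part (Psi F (G b)) = v" and mb: "mean (Psi F (G b)) = c"
    by (simp_all only: Psi_G b_def zero_mean_part_split mean_split)
  obtain c' r' where nz: "dval1 p (const_fn c' + prim r') \<noteq> 0"
    using assms unfolding c0_cusp_def p_def by blast
  define \<Lambda> where "\<Lambda> z = P (fst z) + snd z *\<^sub>R 1" for z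
  have \<Lambda>: "bounded_linear \<Lambda>"
    unfolding \<Lambda>_def by (intro bounded_linear_add bounded_linear_compose[OF bounded_linear_P bounded_linear_fst]
        bounded_linear_compose[OF bounded_linear_scaleR_left bounded_linear_snd])
  define L where "L = (\<lambda>h. dd val1 p [\<Lambda> h])"
  have "(val1 has_derivative (\<lambda>h. dd val1 p [h])) (at (\<Lambda> (v, c)))"
    using smooth_has_derivative[OF smooth_val1, of p] p by (simp add: \<Lambda>_def)
  from has_derivative_compose[OF bounded_linear_imp_has_derivative[OF \<Lambda>] this]
  have L: "((\<lambda>z. val1 (\<Lambda> z)) has_derivative L) (at (v, c))" by (simp add: L_def)
  have "L (zero_mean_part (j r'), c') = dval1 p (const_fn c' + prim r')"
    unfolding L_def \<Lambda>_def fst_conv snd_conv P_j using dd_1[OF val1_line]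
    by (simp add: const_fn_c0_eq add.commute)
  then have L0: "L (zero_mean_part (j r'), c') \<noteq> 0" using nz by simp
  have "surj L"
  proof (rule surjI)
    fix y
    interpret bounded_linear L using L by (rule has_derivative_bounded_linear)
    show "L ((y / L (zero_mean_part (j r'), c')) *\<^sub>R (zero_mean_part (j r'), c')) = y"
      using L0 by (simp only: scaleR) simp
  qed
  moreover have "(\<lambda>(w, s). deriv (phi F w) s) = (\<lambda>z. val1 (\<Lambda> z))"
    by (simp add: deriv_phi \<Lambda>_def case_prod_beta')
  ultimately have "is_cusp F (G b)"
    unfolding is_cusp_def Let_def zv mb deriv2_phi deriv3_phi deriv_phi p
    using assms L by (auto simp: c0_cusp_def p_def deriv_phi)
  then show ?thesis by blast
qed

lemma smooth_G: "smooth G"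
proof -
  have "smooth (\<lambda>b. I (j (nem f (M (base b)))))"
    by (rule smooth_linear_compose[OF bounded_linear_compose[OF bounded_linear_I lin(1)]
        smooth_compose[OF smooth_nem[OF f] smooth_compose[OF smooth_M smooth_bounded_linear[OF bounded_linear_base]]]])
  then show ?thesis
    unfolding G_def[abs_def]
    by (intro smoothI Cn_diff Cn_add) (auto intro: smoothD Cn_bounded_linear bounded_linear_const_b1 bounded_linear_I lin)
qed

lemma smooth_Psi: "smooth (Psi F)"
proof -
  have n: "smooth (\<lambda>u. nem f (k u))"
    by (rule smooth_compose[OF smooth_nem[OF f] smooth_bounded_linear[OF lin(2)]])
  have m: "bounded_linear (\<lambda>u :: 'b. mean u)"
    using bounded_linear_compose[OF bounded_linear_mean_c0 lin(2)] by (simp add: mean_k)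
  have 1: "smooth (\<lambda>u. j (nem f (k u)) - const_fn (mean (nem f (k u))))"
    by (rule smooth_linear_compose[OF bounded_linear_sub[OF lin(1) bounded_linear_const_b0[OF bounded_linear_mean_c0]] n])
  have 2: "smooth (\<lambda>u. d u + const_fn (mean u))"
    by (rule smooth_bounded_linear[OF bounded_linear_add[OF lin(3) bounded_linear_const_b0[OF m]]])
  have "smooth (\<lambda>u. (d u + const_fn (mean u)) + (j (nem f (k u)) - const_fn (mean (nem f (k u)))))"
    by (rule smoothI) (rule Cn_add[OF smoothD[OF 2] smoothD[OF 1]])
  moreover have "Psi F = (\<lambda>u. (d u + const_fn (mean u)) + (j (nem f (k u)) - const_fn (mean (nem f (k u)))))"
    by (rule ext) (simp add: Psi_F algebra_simps)
  ultimately show ?thesis by simp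
qed

end

lemma diffeomorphismI:
  assumes "\<And>x. g (f x) = x" "\<And>y. f (g y) = y" "smooth f" "smooth g"
  shows "diffeomorphism f" "inv f = g"
proof -
  show i: "inv f = g" by (rule inv_equality) (simp_all add: assms)
  have "bij f" by (rule bijI') (metis assms)+
  then show "diffeomorphism f" unfolding diffeomorphism_def i using assms by simp
qed

lemma smooth_Pair: "smooth f \<Longrightarrow> smooth g \<Longrightarrow> smooth (\<lambda>x. (f x, g x))"
  by (rule smoothI) (rule Cn_Pair[OF smoothD smoothD])

locale circle_fold = circle_operator + coercive_fold
begin

text \<open>\<Xi>1 replaces the mean of \<open>Psi F u\<close> by the Morse coordinate on its fiber;
  \<Xi>0 subtracts from the mean the minimum over the fiber. Both keep the mean free part, which
  \<open>F\<close> and \<open>Psi F\<close> share, and \<open>val_eq\<close> gives the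
  square.\<close>

lemma global_fold_F: "global_fold F"
proof -
  define \<Xi>1 where "\<Xi>1 u = (X (base (Psi F u)), zero_mean_part (Psi F u))" for u
  define \<Xi>1' where "\<Xi>1' z = G (Rep_zero_mean (snd z) + const_fn (Y (P (snd z), fst z)))" for z
  define \<Xi>0 where "\<Xi>0 w = (mean w - val_floor (k (I w)), zero_mean_part w)" for w
  define \<Xi>0' where "\<Xi>0' z = Rep_zero_mean (snd z) + const_fn (fst z + val_floor (P (snd z)))" for z :: "real \<times> 'a zero_mean"
  have sP: "smooth P" and sb: "smooth base" and sz: "smooth (zero_mean_part :: 'a \<Rightarrow> 'a zero_mean)"
    and sR: "smooth (\<lambda>z :: real \<times> 'a zero_mean. Rep_zero_mean (snd z))"
    by (intro smooth_bounded_linear bounded_linear_P bounded_linear_base bounded_linear_zero_mean_part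
        bounded_linear_compose[OF bounded_linear_Rep bounded_linear_snd])+
  have sPs: "smooth (\<lambda>z :: real \<times> 'a zero_mean. P (snd z))"
    by (rule smooth_compose[OF sP smooth_bounded_linear[OF bounded_linear_snd]])
  have sc: "smooth (\<lambda>z. const_fn (h z) :: 'a)" if "smooth h" for h :: "real \<times> 'a zero_mean \<Rightarrow> real"
    by (rule smooth_linear_compose[OF bounded_linear_const_b0[OF bounded_linear_ident] that])
  have fst: "smooth (fst :: real \<times> 'a zero_mean \<Rightarrow> real)" by (rule smooth_bounded_linear[OF bounded_linear_fst])
  have s1: "smooth \<Xi>1" unfolding \<Xi>1_def[abs_def]
    by (rule smooth_Pair[OF smooth_compose[OF smooth_X smooth_compose[OF sb smooth_Psi]] smooth_compose[OF sz smooth_Psi]])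
  have "smooth (\<lambda>z. Rep_zero_mean (snd z) + const_fn (Y (P (snd z), fst z)))"
    by (rule smoothI) (rule Cn_add[OF smoothD[OF sR] smoothD[OF sc[OF smooth_compose[OF smooth_Y smooth_Pair[OF sPs fst]]]]])
  then have s1': "smooth \<Xi>1'" unfolding \<Xi>1'_def[abs_def] by (rule smooth_compose[OF smooth_G])
  have "smooth (\<lambda>w. mean w - val_floor (k (I w)))"
    by (rule smoothI) (rule Cn_diff[OF Cn_bounded_linear[OF lin(4)] smoothD[OF smooth_compose[OF smooth_val_floor
          smooth_bounded_linear[OF bounded_linear_compose[OF lin(2) bounded_linear_I]]]]])
  then have s0: "smooth \<Xi>0" unfolding \<Xi>0_def[abs_def] by (rule smooth_Pair[OF _ sz])
  have "smooth (\<lambda>z :: real \<times> 'a zero_mean. fst z + val_floor (P (snd z)))"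
    by (rule smoothI) (rule Cn_add[OF smoothD[OF fst] smoothD[OF smooth_compose[OF smooth_val_floor sPs]]])
  from sc[OF this] have s0': "smooth \<Xi>0'" unfolding \<Xi>0'_def[abs_def]
    by (intro smoothI Cn_add smoothD[OF sR]) (rule smoothD)
  have base_b: "base b = shift (P (zero_mean_part b)) (mean b)" for b
    by (simp add: base_def P_zero_mean_part)
  have inv1: "\<Xi>1' (\<Xi>1 u) = u" for u
    unfolding \<Xi>1'_def \<Xi>1_def fst_conv snd_conv by (simp only: base_b Y_X split_b0 G_Psi)
  have inv1': "\<Xi>1 (\<Xi>1' z) = z" for z
    unfolding \<Xi>1'_def \<Xi>1_def by (simp only: Psi_G base_split X_Y zero_mean_part_split prod.collapse)
  have kI: "k (I (Rep_zero_mean v + const_fn x)) = P v" for v x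
    by (simp add: P_def linear_simps I_const)
  have inv0: "\<Xi>0' (\<Xi>0 w) = w" for w
    unfolding \<Xi>0'_def \<Xi>0_def by (simp add: P_zero_mean_part split_b0)
  have inv0': "\<Xi>0 (\<Xi>0' z) = z" for z
    unfolding \<Xi>0'_def \<Xi>0_def by (simp only: kI mean_split zero_mean_part_split) simp
  have "(\<Xi>0 \<circ> F \<circ> inv \<Xi>1) (x, v) = (x\<^sup>2, v)" for x v
  proof -
    define s where "s = Y (P v, x)"
    define b where "b = Rep_zero_mean v + const_fn s"
    have base: "base b = shift (P v) s" by (simp add: b_def base_split)
    have "F (G b) = Psi F (G b) + const_fn (mean (F (G b))) - const_fn (mean (G b))"
      by (simp add: Psi_def)
    also have "\<dots> = Rep_zero_mean v + const_fn (val (base b))"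
      unfolding Psi_G mean_F_G mean_G by (simp add: b_def mean_split)
    finally have FG: "F (G b) = Rep_zero_mean v + const_fn (val (base b))" .
    have "X (base b) = x" by (simp add: base s_def X_Y)
    then have "val (base b) = val_floor (P v) + x\<^sup>2"
      using val_eq[of "base b"] by (simp add: base val_floor_shift)
    then have "\<Xi>0 (F (G b)) = (x\<^sup>2, v)"
      unfolding FG \<Xi>0_def kI mean_split zero_mean_part_split by simp
    then show ?thesis
      unfolding diffeomorphismI(2)[OF inv1 inv1' s1 s1'] by (simp add: \<Xi>1'_def b_def s_def)
  qed
  then show ?thesis
    unfolding global_fold_def
    using diffeomorphismI(1)[OF inv1 inv1' s1 s1'] diffeomorphismI(1)[OF inv0 inv0' s0 s0'] by blast
qed

end

section \<open>The two pairs of function spaces\<close>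

lemma c0_of_c1_linear: "c0_of_c1 (u + v) = c0_of_c1 u + c0_of_c1 v" "c0_of_c1 (a *\<^sub>R u) = a *\<^sub>R c0_of_c1 u"
  by (transfer; simp)+

lemma deriv_c1_linear: "deriv_c1 (u + v) = deriv_c1 u + deriv_c1 v" "deriv_c1 (a *\<^sub>R u) = a *\<^sub>R deriv_c1 u"
  by (transfer; intro ext DERIV_imp_deriv DERIV_add DERIV_cmult; simp add: differentiable_real_deriv)+

lemma c1_has_deriv: "(Rep_c0 (c0_of_c1 u) has_real_derivative Rep_c0 (deriv_c1 u) t) (at t)"
  by transfer (simp add: differentiable_real_deriv)

lemma c1_exists:
  assumes "\<And>t. (Rep_c0 y has_real_derivative Rep_c0 q t) (at t)"
  shows "\<exists>u. c0_of_c1 u = y \<and> deriv_c1 u = q"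
proof -
  have d: "deriv (Rep_c0 y) = Rep_c0 q" by (intro ext DERIV_imp_deriv assms)
  have c1: "Rep_c0 y \<in> {u. (\<forall>t. u differentiable (at t)) \<and> continuous_on UNIV (deriv u) \<and> periodic u}"
    using Rep_c0[of q] Rep_c0[of y] assms by (auto simp: d real_differentiable_def)
  have "c0_of_c1 (Abs_c1 (Rep_c0 y)) = y" "deriv_c1 (Abs_c1 (Rep_c0 y)) = q"
    by (rule c0_eqI, simp add: c0_of_c1.rep_eq deriv_c1.rep_eq Abs_c1_inverse[OF c1] d)+
  then show ?thesis by blast
qed

lemma prim_deriv_c1: "mean (deriv_c1 u) = 0" "prim (deriv_c1 u) = c0_of_c1 u - const_fn (mean u)"
  using prim_of_deriv[OF c1_has_deriv[of u]] by (simp_all add: mean_c1_def)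

lemma prim_c1:
  obtains u where "deriv_c1 u = q - const_fn (mean q)" "c0_of_c1 u = prim q"
  using c1_exists[of "prim q" "q - const_fn (mean q)"] prim_props(2)[of q] by (auto simp: c0_rep)

text \<open>The constant 3 adds the bound 2 of \<open>norm_prim_le\<close> for the function and 1
  for its derivative in the \<open>C^1\<close> norm.\<close>

interpretation c1: circle_pair "\<lambda>q. q" c0_of_c1 deriv_c1 3
proof (rule circle_pair.intro)
  fix u :: c1 and c :: real and v q :: c0
  show "bounded_linear (\<lambda>q :: c0. q)" by (rule bounded_linear_ident)
  show "bounded_linear c0_of_c1" "bounded_linear deriv_c1"
    by (rule bounded_linear_intro[where K = 1], simp_all add: c0_of_c1_linear deriv_c1_linear norm_c1_def)+
  show "bounded_linear (mean :: c0 \<Rightarrow> real)" by (rule bounded_linear_mean_c0)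
  show "mean (c0_of_c1 u) = mean u" by (simp add: mean_c1_def)
  show "mean (deriv_c1 u) = 0" by (rule prim_deriv_c1)
  show "c0_of_c1 (const_fn c) = const_fn c" by transfer simp
  show "deriv_c1 (const_fn c) = 0" by transfer (intro ext DERIV_imp_deriv DERIV_const)
  show "norm u \<le> 3 * norm (deriv_c1 u)" if "mean u = 0"
    using norm_prim_le[of "deriv_c1 u"] that by (simp add: prim_deriv_c1 norm_c1_def const_fn_c0_eq)
  show "\<exists>u. deriv_c1 u = v \<and> mean u = 0" if "mean v = 0"
  proof -
    obtain u where "deriv_c1 u = v - const_fn (mean v)" "c0_of_c1 u = prim v" by (rule prim_c1)
    then show ?thesis using that prim_props(1)[of v] by (auto simp: mean_c1_def const_fn_c0_eq)
  qed
  show "\<exists>u. deriv_c1 u = q - const_fn (mean q) \<and> c0_of_c1 u = prim q" using prim_c1[of q] by blast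
qed simp_all

lemma op_C_eq:
  assumes "continuous_on UNIV f"
  shows "op_C f u = deriv_c1 u + nem f (c0_of_c1 u)"
proof (rule c0_eqI)
  have "Rep_c0 (Abs_c0 (Rep_c0 (deriv_c1 u + nem f (c0_of_c1 u)))) = Rep_c0 (deriv_c1 u + nem f (c0_of_c1 u))"
    by (simp add: Rep_c0_inverse)
  then show "Rep_c0 (op_C f u) t = Rep_c0 (deriv_c1 u + nem f (c0_of_c1 u)) t" for t
    by (simp add: op_C_def c0_rep Rep_nem[OF assms] deriv_c1.rep_eq c0_of_c1.rep_eq)
qed

subsection \<open>The Sobolev space\<close>

lemma abs_l2_add: "square_int f \<Longrightarrow> square_int g \<Longrightarrow> abs_l2 f + abs_l2 g = abs_l2 (\<lambda>t. f t + g t)"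
  by (intro plus_l2.abs_eq) (auto simp: l2_rel_def)

lemma abs_l2_scaleR: "square_int f \<Longrightarrow> a *\<^sub>R abs_l2 f = abs_l2 (\<lambda>t. a * f t)"
  by (intro scaleR_l2.abs_eq) (auto simp: l2_rel_def)

lemma abs_l2_const: "const_fn c = abs_l2 (\<lambda>_. c)"
  by (simp add: const_fn_l2.abs_eq)

lemma inner_abs_l2: "square_int f \<Longrightarrow> square_int g \<Longrightarrow> inner (abs_l2 f) (abs_l2 g) = (LINT t|circle. f t * g t)"
  by (intro inner_l2.abs_eq) (auto simp: l2_rel_def)

lemma mean_abs_l2: "square_int f \<Longrightarrow> mean (abs_l2 f) = (LINT t|circle. f t)"
  by (intro mean_l2.abs_eq) (auto simp: l2_rel_def)

lemma abs_l2_cases: obtains g where "square_int g" "v = abs_l2 g"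
proof -
  have "l2_rel (rep_l2 v) (rep_l2 v)" "abs_l2 (rep_l2 v) = v"
    by (rule Quotient_rep_reflp[OF Quotient_l2]) (rule Quotient_abs_rep[OF Quotient_l2])
  then show ?thesis using that by (simp add: l2_rel_def)
qed

lemma mean_l2_inner: "mean v = inner v (const_fn 1)" for v :: l2
  by (cases v rule: abs_l2_cases) (simp add: abs_l2_const mean_abs_l2 inner_abs_l2 square_int_const)

lemma norm_const_l2: "norm (const_fn c :: l2) = \<bar>c\<bar>"
  by (simp add: norm_l2_def abs_l2_const inner_abs_l2 square_int_const measure_circle)

lemma abs_mean_l2: "\<bar>mean v\<bar> \<le> norm v" for v :: l2
  using Cauchy_Schwarz_ineq2[of v "const_fn 1"] by (simp add: mean_l2_inner norm_const_l2)

lemma l2_bound: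
  assumes "square_int g" "\<And>t. t \<in> {0..1} \<Longrightarrow> \<bar>g t\<bar> \<le> B"
  shows "norm (abs_l2 g) \<le> B"
proof -
  have B: "B \<ge> 0" using assms(2)[of 0] by simp
  have "(LINT t|circle. g t * g t) \<le> (LINT t|circle. B * B)"
  proof (rule integral_mono)
    show "integrable circle (\<lambda>t. g t * g t)" by (intro square_int_mult assms)
    show "integrable circle (\<lambda>t. B * B)" by (rule square_int_mult[OF square_int_const square_int_const])
    show "g t * g t \<le> B * B" if "t \<in> space circle" for t
      using abs_le_square_iff[of "g t" B] assms(2)[of t] that B by (simp add: power2_eq_square)
  qed
  also have "\<dots> = B\<^sup>2" by (simp add: measure_circle power2_eq_square)
  finally show ?thesis
    using B by (simp add: norm_l2_def inner_abs_l2 assms real_le_lsqrt)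
qed

lemma circle_integral: "(LINT t|circle. g t) = (LBINT t:{0..1}. g t)" for g :: "real \<Rightarrow> real"
  unfolding circle_def set_lebesgue_integral_def by (rule integral_restrict_space) simp

lemma square_int_abs: "square_int g \<Longrightarrow> square_int (\<lambda>t. \<bar>g t\<bar>)"
  by (auto simp: square_int_def)

text \<open>On a space of total mass one the \<open>L^1\<close> norm is at most the
  \<open>L^2\<close> norm, by Cauchy-Schwarz against the constant 1.\<close>

lemma abs_integral_le_norm_l2:
  assumes "square_int g" "0 \<le> s" "s \<le> t" "t \<le> 1"
  shows "\<bar>LBINT r:{s..t}. g r\<bar> \<le> norm (abs_l2 g)"
proof -
  have int: "set_integrable lborel {a..b} h" if "square_int h" "0 \<le> a" "b \<le> 1" for h :: "real \<Rightarrow> real" and a b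
    by (rule set_integrable_subset[OF square_int_set_integrable[OF that(1) order_refl]]) (use that in auto)
  have "\<bar>LBINT r:{s..t}. g r\<bar> \<le> (LBINT r:{s..t}. \<bar>g r\<bar>)"
    using set_integral_norm_bound[OF int[OF assms(1,2,4)]] by simp
  also have "\<dots> \<le> (LBINT r:{0..1}. \<bar>g r\<bar>)"
    using int[OF square_int_abs[OF assms(1)], of s t] int[OF square_int_abs[OF assms(1)], of 0 1] assms
    unfolding set_lebesgue_integral_def set_integrable_def
    by (intro integral_mono) (auto simp: indicator_def)
  also have "\<dots> = mean (abs_l2 (\<lambda>r. \<bar>g r\<bar>))"
    by (simp add: mean_abs_l2 square_int_abs assms circle_integral)
  also have "\<dots> \<le> norm (abs_l2 (\<lambda>r. \<bar>g r\<bar>))" using abs_mean_l2[of "abs_l2 (\<lambda>r. \<bar>g r\<bar>)"] by linarith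
  also have "\<dots> = norm (abs_l2 g)"
    by (simp add: norm_l2_def inner_abs_l2 square_int_abs assms)
  finally show ?thesis .
qed

definition c0_of_h1 :: "h1 \<Rightarrow> c0" where "c0_of_h1 u = Abs_c0 (Rep_h1 u)"

lemma periodic_h1: "Rep_h1 u (t + 1) = Rep_h1 u t"
  using Rep_h1[of u] by (simp add: periodic_def)

lemma periodic_continuous:
  fixes u :: "real \<Rightarrow> real"
  assumes "periodic u" "continuous_on {0..1} u"
  shows "continuous_on UNIV u"
proof -
  have shift: "continuous_on {a..a + 1} u" if "a \<in> \<int>" for a
  proof -
    have "u (t - a) = u t" for t
      using periodic_frac[OF assms(1), of t] periodic_frac[OF assms(1), of "t - a"] that
      by (auto simp: frac_def elim!: Ints_cases)
    moreover have "continuous_on {a..a + 1} (\<lambda>t. u (t - a))"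
      by (rule continuous_on_compose2[OF assms(2)]) (auto intro: continuous_intros)
    ultimately show ?thesis by simp
  qed
  have "isCont u t" for t
  proof -
    \<comment> \<open>One less than the floor, so that \<open>t\<close> is interior to
      \<open>{a..a + 2}\<close> even if it is an integer.\<close>
    define a where "a = of_int \<lfloor>t\<rfloor> - (1 :: real)"
    have "continuous_on ({a..a + 1} \<union> {a + 1..a + 1 + 1} ) u"
      by (intro continuous_on_closed_Un shift) (auto simp: a_def)
    moreover have "{a..a + 1} \<union> {a + 1..a + 1 + 1} = {a..a + 2}" by auto
    moreover have "t \<in> interior {a..a + 2}" unfolding a_def by (simp add: interior_atLeastAtMost_real) linarith
    ultimately show ?thesis by (metis continuous_on_interior)
  qed
  then show ?thesis by (simp add: continuous_on_eq_continuous_at)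
qed

lemma Rep_c0_of_h1: "Rep_c0 (c0_of_h1 u) = Rep_h1 u"
proof -
  obtain g where "is_weak_deriv (Rep_h1 u) g" using weak_deriv_ex by blast
  then show ?thesis unfolding c0_of_h1_def
    using Rep_h1[of u] periodic_continuous[OF _ is_weak_deriv_continuous]
    by (intro Rep_Abs_c0 periodic_h1) auto
qed

lemma mean_c0_of_h1: "mean (c0_of_h1 u) = mean u"
  by (simp add: mean_c0.rep_eq Rep_c0_of_h1 mean_h1_def l2_of_h1_eq mean_abs_l2 square_int_h1)

lemma c0_of_h1_linear: "c0_of_h1 (u + v) = c0_of_h1 u + c0_of_h1 v" "c0_of_h1 (a *\<^sub>R u) = a *\<^sub>R c0_of_h1 u"
  by (rule c0_eqI, simp add: c0_rep Rep_c0_of_h1 plus_h1.rep_eq scaleR_h1.rep_eq)+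

lemma norm_h1_bounds:
  "norm (l2_of_h1 u) \<le> norm u" "norm (weak_deriv u) \<le> norm u"
  "norm u \<le> norm (l2_of_h1 u) + norm (weak_deriv u)"
proof -
  have "norm u = sqrt ((norm (l2_of_h1 u))\<^sup>2 + (norm (weak_deriv u))\<^sup>2)"
    by (simp add: norm_h1_def inner_h1_def power2_norm_eq_inner)
  then show "norm (l2_of_h1 u) \<le> norm u" "norm (weak_deriv u) \<le> norm u"
    "norm u \<le> norm (l2_of_h1 u) + norm (weak_deriv u)"
    by (simp_all add: real_le_rsqrt sqrt_sum_squares_le_sum)
qed

lemma h1_oscillation: "\<bar>Rep_h1 u t - Rep_h1 u s\<bar> \<le> norm (weak_deriv u)"
proof -
  obtain g where g: "is_weak_deriv (Rep_h1 u) g" using weak_deriv_ex by blast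
  note g1 = is_weak_derivD(1)[OF g]
  have *: "\<bar>Rep_h1 u t - Rep_h1 u s\<bar> \<le> norm (weak_deriv u)" if "0 \<le> s" "s \<le> t" "t \<le> 1" for s t
  proof -
    have "Rep_h1 u t - Rep_h1 u s = integral {0..t} g - integral {0..s} g"
      using is_weak_derivD(2)[OF g, of t] is_weak_derivD(2)[OF g, of s] that
        set_borel_integral_eq_integral(2)[OF square_int_set_integrable[OF g1, of t]]
        set_borel_integral_eq_integral(2)[OF square_int_set_integrable[OF g1, of s]] by simp
    also have "\<dots> = integral {s..t} g"
      using Henstock_Kurzweil_Integration.integral_combine[OF that(1,2)
          set_borel_integral_eq_integral(1)[OF square_int_set_integrable[OF g1 that(3)]]] by simp
    also have "\<dots> = (LBINT r:{s..t}. g r)"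
      by (rule set_borel_integral_eq_integral(2)[symmetric],
        rule set_integrable_subset[OF square_int_set_integrable[OF g1 order_refl]]) (use that in auto)
    finally show ?thesis using abs_integral_le_norm_l2[OF g1 that] by (simp add: weak_deriv_eq[OF g])
  qed
  have "\<bar>Rep_h1 u (frac t) - Rep_h1 u (frac s)\<bar> \<le> norm (weak_deriv u)"
    using *[of "frac s" "frac t"] *[of "frac t" "frac s"] frac_ge_0[of s] frac_ge_0[of t]
      frac_lt_1[of s] frac_lt_1[of t] by (cases "frac s \<le> frac t") (auto simp: abs_minus_commute)
  then show ?thesis using periodic_frac[of "Rep_h1 u"] Rep_h1[of u] by simp
qed

text \<open>The one-dimensional Sobolev embedding: the function attains its mean somewhere, and its
  oscillation is at most the \<open>L^2\<close> norm of the derivative.\<close>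

lemma norm_c0_of_h1: "norm (c0_of_h1 u) \<le> \<bar>mean u\<bar> + norm (weak_deriv u)"
proof (rule c0_norm_le)
  fix t
  obtain s where "Rep_c0 (c0_of_h1 u - const_fn (mean u)) s = 0"
    using c0_zero[of "c0_of_h1 u - const_fn (mean u)"] by (auto simp: mean_diff mean_const_fn mean_c0_of_h1)
  then have "Rep_h1 u s = mean u" by (simp add: c0_rep Rep_c0_of_h1)
  then show "\<bar>Rep_c0 (c0_of_h1 u) t\<bar> \<le> \<bar>mean u\<bar> + norm (weak_deriv u)"
    using h1_oscillation[of u t s] by (simp add: Rep_c0_of_h1)
qed

lemma h1_exists:
  assumes "is_weak_deriv u g" "periodic u"
  shows "\<exists>w. Rep_h1 w = u \<and> weak_deriv w = abs_l2 g"
proof -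
  have "Rep_h1 (Abs_h1 u) = u" using assms by (auto intro: Abs_h1_inverse)
  then show ?thesis using weak_deriv_eq[of "Abs_h1 u" g] assms by auto
qed

lemma weak_deriv_const: "weak_deriv (const_fn c) = 0"
  using weak_deriv_eq[of "const_fn c" "\<lambda>_. 0"] by (simp add: const_fn_h1.rep_eq is_weak_deriv_const zero_l2.abs_eq)

lemma h1_primitive:
  assumes "mean v = 0"
  shows "\<exists>u. weak_deriv u = v \<and> mean u = 0"
proof -
  obtain g where g: "square_int g" "v = abs_l2 g" by (rule abs_l2_cases)
  have zero: "(LBINT s:{0..1}. g s) = 0" using assms g by (simp add: mean_abs_l2 circle_integral)
  define u where "u t = (LBINT s:{0..frac t}. g s)" for t :: real
  have "u t = u 0 + (LBINT s:{0..t}. g s)" if "t \<in> {0..1}" for t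
  \<comment> \<open>\<open>frac\<close> vanishes at the right end point; there the formula holds
    because \<open>g\<close> has integral zero.\<close>
  proof (cases "t = 1")
    case True
    then show ?thesis using zero by (simp add: u_def frac_def)
  next
    case False
    then have "frac t = t" using that by (simp add: frac_eq)
    moreover have "(LBINT s:{0..0}. g s) = 0"
      using set_borel_integral_eq_integral(2)[OF square_int_set_integrable[OF g(1), of 0]] by simp
    ultimately show ?thesis by (simp add: u_def)
  qed
  then have "is_weak_deriv u g" unfolding is_weak_deriv_def using g(1) by blast
  then obtain w where w: "weak_deriv w = v"
    using h1_exists[of u g] g by (auto simp: periodic_def u_def frac_1_eq)
  have "weak_deriv (w + (-1) *\<^sub>R const_fn (mean w)) = v"
    unfolding weak_deriv_add weak_deriv_scaleR w weak_deriv_const by simp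
  moreover have "mean (w + (-1) *\<^sub>R const_fn (mean w)) = 0"
    unfolding mean_add mean_scaleR mean_const_fn by simp
  ultimately show ?thesis by blast
qed

lemma h1_primitive_c0:
  "\<exists>u. weak_deriv u = abs_l2 (Rep_c0 (q - const_fn (mean q))) \<and> c0_of_h1 u = prim q"
proof -
  let ?g = "Rep_c0 (q - const_fn (mean q))"
  have d: "(Rep_c0 (prim q) has_real_derivative ?g t) (at t)" for t
    using prim_props(2)[of q t] by (simp add: c0_rep)
  have "is_weak_deriv (Rep_c0 (prim q)) ?g"
    unfolding is_weak_deriv_def
  proof (intro conjI ballI)
    show sq: "square_int ?g" by (rule square_int_continuous[OF c0_continuous])
    fix t :: real assume t: "t \<in> {0..1}"
    have "(?g has_integral (Rep_c0 (prim q) t - Rep_c0 (prim q) 0)) {0..t}"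
      using t d by (intro fundamental_theorem_of_calculus)
        (auto simp flip: has_real_derivative_iff_has_vector_derivative intro: has_field_derivative_at_within)
    then show "Rep_c0 (prim q) t = Rep_c0 (prim q) 0 + (LBINT s:{0..t}. ?g s)"
      using set_borel_integral_eq_integral(2)[OF square_int_set_integrable[OF sq, of t]] t
      by (simp add: integral_unique)
  qed
  from h1_exists[OF this] obtain w where "Rep_h1 w = Rep_c0 (prim q)" "weak_deriv w = abs_l2 ?g"
    using Rep_c0[of "prim q"] by auto
  then show ?thesis using Rep_c0_of_h1[of w] Rep_c0_inject by auto
qed

lemma abs_l2_c0: "norm (abs_l2 (Rep_c0 q)) \<le> norm q"
  by (rule l2_bound) (simp_all add: square_int_continuous c0_continuous c0_abs_le_norm)

lemma mean_weak_deriv: "mean (weak_deriv u) = 0"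
proof -
  obtain g where g: "is_weak_deriv (Rep_h1 u) g" using weak_deriv_ex by blast
  show ?thesis
    using is_weak_derivD(2)[OF g, of 1] periodic_h1[of u 0] is_weak_derivD(1)[OF g]
    by (simp add: weak_deriv_eq[OF g] mean_abs_l2 circle_integral)
qed

text \<open>The constant 2: for mean zero, the \<open>L^2\<close> norm is at most the sup norm,
  which the norm of the derivative bounds; the derivative itself contributes another 1.\<close>

interpretation h1: circle_pair "\<lambda>q. abs_l2 (Rep_c0 q)" c0_of_h1 weak_deriv 2
proof (rule circle_pair.intro)
  fix u :: h1 and c :: real and v :: l2 and q :: c0
  note sq = square_int_continuous[OF c0_continuous]
  show "bounded_linear (\<lambda>q. abs_l2 (Rep_c0 q))"
    by (rule bounded_linear_intro[where K = 1]) (simp_all add: abs_l2_c0 c0_rep abs_l2_add abs_l2_scaleR sq)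
  show "bounded_linear c0_of_h1"
  proof (rule bounded_linear_intro[where K = 2])
    show "norm (c0_of_h1 x) \<le> norm x * 2" for x
      using norm_c0_of_h1[of x] norm_h1_bounds[of x] abs_mean_l2[of "l2_of_h1 x"] by (simp add: mean_h1_def)
  qed (rule c0_of_h1_linear)+
  show "bounded_linear weak_deriv"
    by (rule bounded_linear_intro[where K = 1]) (simp_all add: weak_deriv_add weak_deriv_scaleR norm_h1_bounds)
  show "bounded_linear (mean :: l2 \<Rightarrow> real)"
    by (rule bounded_linear_intro[where K = 1]) (simp_all add: mean_add mean_scaleR abs_mean_l2)
  show "mean (abs_l2 (Rep_c0 q)) = mean q" by (simp add: mean_abs_l2 sq mean_c0.rep_eq)
  show "abs_l2 (Rep_c0 (const_fn c)) = const_fn c" by (simp add: const_fn_c0.rep_eq abs_l2_const)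
  show "c0_of_h1 (const_fn c) = const_fn c"
    by (rule c0_eqI) (simp add: Rep_c0_of_h1 const_fn_h1.rep_eq const_fn_c0.rep_eq)
  show "norm u \<le> 2 * norm (weak_deriv u)" if "mean u = 0"
    using norm_h1_bounds(3)[of u] norm_c0_of_h1[of u] abs_l2_c0[of "c0_of_h1 u"] that
    by (simp add: l2_of_h1_eq Rep_c0_of_h1)
  show "\<exists>u. weak_deriv u = v \<and> mean u = 0" if "mean v = 0" by (rule h1_primitive[OF that])
  show "\<exists>u. weak_deriv u = abs_l2 (Rep_c0 (q - const_fn (mean q))) \<and> c0_of_h1 u = prim q" by (rule h1_primitive_c0)
qed (simp_all add: mean_c0_of_h1 mean_weak_deriv weak_deriv_const)

lemma op_H_eq:
  assumes "continuous_on UNIV f"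
  shows "op_H f u = weak_deriv u + abs_l2 (Rep_c0 (nem f (c0_of_h1 u)))"
  by (simp add: op_H_def Rep_nem[OF assms] Rep_c0_of_h1)

section \<open>The dichotomy\<close>

text \<open>Otherwise the hull would lie in a closed half space with 0 on its boundary.\<close>

lemma negative_direction:
  fixes \<gamma> :: "real \<Rightarrow> 'n::euclidean_space"
  assumes "0 \<in> interior (convex hull (range \<gamma>))" "a \<noteq> 0"
  shows "\<exists>x. a \<bullet> \<gamma> x < 0"
proof (rule ccontr)
  assume "\<not> (\<exists>x. a \<bullet> \<gamma> x < 0)"
  then have "convex hull (range \<gamma>) \<subseteq> {y. a \<bullet> y \<ge> 0}"
    by (intro hull_minimal convex_halfspace_ge) (auto simp: not_less)
  then have "0 \<in> interior {y. a \<bullet> y \<ge> 0}" using assms(1) interior_mono by blast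
  then show False using assms(2) by simp
qed

text \<open>Compactness of the unit sphere makes finitely many points suffice. A bounded range
  matters because a profile on the circle covers a compact interval only.\<close>

lemma negative_direction_uniform:
  fixes \<gamma> :: "real \<Rightarrow> 'n::euclidean_space"
  assumes neg: "\<And>a. a \<noteq> 0 \<Longrightarrow> \<exists>x. a \<bullet> \<gamma> x < 0"
  shows "\<exists>R>0. \<forall>a. a \<noteq> 0 \<longrightarrow> (\<exists>x. \<bar>x\<bar> \<le> R \<and> a \<bullet> \<gamma> x < 0)"
proof -
  have op: "open {a. a \<bullet> \<gamma> x < 0}" for x
    by (intro open_Collect_less continuous_intros)
  have "sphere 0 1 \<subseteq> (\<Union>x. {a. a \<bullet> \<gamma> x < 0})"
  proof
    fix a :: 'n assume "a \<in> sphere 0 1"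
    then have "a \<noteq> 0" by auto
    from neg[OF this] show "a \<in> (\<Union>x. {a. a \<bullet> \<gamma> x < 0})" by simp
  qed
  then obtain T where T: "finite T" "sphere 0 1 \<subseteq> (\<Union>x\<in>T. {a. a \<bullet> \<gamma> x < 0})"
    by (rule compactE_image[OF compact_sphere op])
  define R where "R = Max (insert 1 (abs ` T))"
  have R: "R \<ge> 1" "\<And>x. x \<in> T \<Longrightarrow> \<bar>x\<bar> \<le> R"
    unfolding R_def using T(1) by (auto intro: Max_ge)
  have "\<exists>x. \<bar>x\<bar> \<le> R \<and> a \<bullet> \<gamma> x < 0" if "a \<noteq> 0" for a
  proof -
    have "a /\<^sub>R norm a \<in> sphere 0 1" using that by simp
    then obtain x where "x \<in> T" "(a /\<^sub>R norm a) \<bullet> \<gamma> x < 0" using T(2) by blast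
    then have "\<bar>x\<bar> \<le> R" "a \<bullet> \<gamma> x < 0" using R(2) that by (simp_all add: mult_less_0_iff)
    then show ?thesis by blast
  qed
  moreover have "R > 0" using R(1) by linarith
  ultimately show ?thesis by blast
qed

text \<open>Separation is applied to the interior of the hull and extended to its closure. With
  empty interior the hull lies in a hyperplane, and its normal is oriented by the sign of
  \<open>b\<close>.\<close>

lemma supporting_direction:
  fixes S :: "'n::euclidean_space set"
  assumes "0 \<notin> interior (convex hull S)"
  shows "\<exists>a. a \<noteq> 0 \<and> (\<forall>y\<in>S. 0 \<le> a \<bullet> y)"
proof (cases "interior (convex hull S) = {}")
  case True
  then obtain a b where ab: "a \<noteq> 0" "convex hull S \<subseteq> {y. a \<bullet> y = b}"
    using empty_interior_subset_hyperplane[OF convex_convex_hull] by blast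
  have S: "a \<bullet> y = b" if "y \<in> S" for y using ab(2) hull_subset[of S convex] that by blast
  show ?thesis
  proof (cases "b \<ge> 0")
    case True
    then show ?thesis using ab(1) S by (intro exI[of _ a]) simp
  next
    case False
    then show ?thesis using ab(1) S by (intro exI[of _ "- a"]) simp
  qed
next
  case False
  obtain a where a: "a \<noteq> 0" "\<forall>y\<in>interior (convex hull S). 0 \<le> a \<bullet> y"
    using separating_hyperplane_set_0[OF convex_interior[OF convex_convex_hull] assms] by blast
  have "closure (interior (convex hull S)) \<subseteq> {y. a \<bullet> y \<ge> 0}"
    by (rule closure_minimal) (use a(2) in \<open>auto simp: closed_halfspace_ge\<close>)
  then have "convex hull S \<subseteq> {y. a \<bullet> y \<ge> 0}"
    using convex_closure_interior[OF convex_convex_hull False] closure_subset by blast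
  then show ?thesis using a(1) hull_subset[of S convex] by blast
qed

lemma inner_hat_gamma_2: "a \<bullet> (hat_gamma f x :: real ^ 2) = a $ 1 * deriv f x + a $ 2 * deriv (deriv f) x"
  by (simp add: hat_gamma_2 inner_vec_def sum_2 eval_nat_numeral)

lemma inner_hat_gamma_3: "a \<bullet> (hat_gamma f x :: real ^ 3) =
    a $ 1 * deriv f x + a $ 2 * deriv (deriv f) x + a $ 3 * deriv (deriv (deriv f)) x"
  by (simp add: hat_gamma_3 inner_vec_def sum_3 eval_nat_numeral)

lemma k_goodD:
  fixes T :: "'k::{finite, zero, one, plus} itself" and c :: "real ^ 'k::{finite, zero, one, plus}"
  assumes "k_good T f" "a < b" "c \<noteq> 0"
  shows "\<exists>x. a < x \<and> x < b \<and> c \<bullet> hat_gamma f x \<noteq> 0"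
proof -
  have "open {a<..<b}" "is_interval {a<..<b}" "{a<..<b} \<noteq> {}" using assms(2) by (auto simp: is_interval_convex_1)
  then have "\<not> (hat_gamma f ` {a<..<b} \<subseteq> {y. c \<bullet> y = 0})"
    using assms(1,3) unfolding k_good_def by blast
  then show ?thesis by auto
qed

section \<open>The two alternatives for the operators\<close>

context coercive
begin

lemma cusp_operators:
  assumes "k_good TYPE(3) f" and hull: "0 \<in> interior (convex hull (range (hat_gamma f :: real \<Rightarrow> real ^ 2)))"
  shows "(\<exists>u. is_cusp (op_H f) u) \<and> (\<exists>u. is_cusp (op_C f) u)"
proof -
  interpret h: circle_operator "\<lambda>q. abs_l2 (Rep_c0 q)" c0_of_h1 weak_deriv 2 f
    by (intro circle_operator.intro h1.circle_pair_axioms coercive_axioms)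
  interpret c: circle_operator "\<lambda>q. q" c0_of_c1 deriv_c1 3 f
    by (intro circle_operator.intro c1.circle_pair_axioms coercive_axioms)
  obtain R where R: "R > 0" and neg: "\<And>a :: real ^ 2. a \<noteq> 0 \<Longrightarrow> \<exists>x. \<bar>x\<bar> \<le> R \<and> a \<bullet> hat_gamma f x < 0"
    using negative_direction_uniform[of "hat_gamma f :: real \<Rightarrow> real ^ 2", OF negative_direction[OF hull]] by blast
  have "\<exists>c r. c0_cusp (const_fn c + prim r)"
  proof (rule c0_cusp_exists[OF R])
    fix a1 a2 :: real assume nz: "a1 \<noteq> 0 \<or> a2 \<noteq> 0"
    define a :: "real ^ 2" where "a = vector [a1, a2]"
    have a: "a $ 1 = a1" "a $ 2 = a2" by (simp_all add: a_def)
    then have "a \<noteq> 0" using nz by auto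
    from neg[OF this] show "\<exists>x. \<bar>x\<bar> \<le> R \<and> a1 * f1 x + a2 * f2 x < 0"
      by (simp add: inner_hat_gamma_2 f1_def f2_def a)
  next
    fix a1 a2 a3 :: real assume nz: "a1 \<noteq> 0 \<or> a2 \<noteq> 0 \<or> a3 \<noteq> 0"
    define a :: "real ^ 3" where "a = vector [a1, a2, a3]"
    have a: "a $ 1 = a1" "a $ 2 = a2" "a $ 3 = a3" by (simp_all add: a_def)
    then have "a \<noteq> 0" using nz by auto
    from k_goodD[OF assms(1) _ this, of "- R" R]
    obtain x where "- R < x" "x < R" "a \<bullet> hat_gamma f x \<noteq> 0" using R by auto
    then show "\<exists>x. \<bar>x\<bar> \<le> R \<and> a1 * f1 x + a2 * f2 x + a3 * f3 x \<noteq> 0"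
      by (intro exI[of _ x]) (simp add: inner_hat_gamma_3 f1_def f2_def f3_def a)
  qed
  then obtain c r where cusp: "c0_cusp (const_fn c + prim r)" by blast
  have "op_H f = h.F" "op_C f = c.F"
    by (rule ext, simp add: h.F_def c.F_def op_H_eq op_C_eq f_cont)+
  then show ?thesis using h.is_cusp_G[OF cusp] c.is_cusp_G[OF cusp] by simp
qed

text \<open>A supporting functional \<open>a\<^sub>1 f' + a\<^sub>2 f'' \<ge> 0\<close> has \<open>a\<^sub>2 > 0\<close>: for \<open>a\<^sub>2 < 0\<close> the function
  \<open>exp (c x) f' x\<close>, \<open>c = a\<^sub>1 / a\<^sub>2\<close>, would be nonincreasing, whereas it is negative far to the left
  and positive far to the right.\<close>

lemma fold_condition:
  assumes good: "k_good TYPE(2) f" and hull: "0 \<notin> interior (convex hull (range (hat_gamma f :: real \<Rightarrow> real ^ 2)))"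
  shows "\<exists>c. coercive_fold f c"
proof -
  obtain a :: "real ^ 2" where a: "a \<noteq> 0" "\<And>x. 0 \<le> a \<bullet> hat_gamma f x"
    using supporting_direction[OF hull] by blast
  have nn: "0 \<le> a $ 1 * f1 x + a $ 2 * f2 x" for x
    using a(2)[of x] by (simp add: inner_hat_gamma_2 f1_def f2_def)
  obtain l where l: "f1 l < 0" using f1_signs(2)[of 0] by blast
  obtain r where r: "l \<le> r" "f1 r > 0" using f1_signs(1)[of l] by blast
  \<comment> \<open>\<open>f'\<close> takes both signs, so a supporting functional has to involve
    \<open>f''\<close>.\<close>
  have "a $ 2 \<noteq> 0"
  proof
    assume a2: "a $ 2 = 0"
    then have "a $ 1 = 0" using nn[of l] nn[of r] l r by (simp add: zero_le_mult_iff)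
    then show False using a(1) a2 by (simp add: vec_eq_iff forall_2)
  qed
  moreover have "\<not> a $ 2 < 0"
  proof
    assume neg: "a $ 2 < 0"
    define c where "c = a $ 1 / a $ 2"
    have np: "f2 x + c * f1 x \<le> 0" for x
    proof -
      have "a $ 1 * f1 x + a $ 2 * f2 x = a $ 2 * (f2 x + c * f1 x)"
        using neg by (simp add: c_def field_simps)
      then show ?thesis using nn[of x] neg by (simp add: zero_le_mult_iff)
    qed
    have "exp (c * r) * f1 r \<le> exp (c * l) * f1 l"
    proof (rule DERIV_nonpos_imp_nonincreasing[OF r(1)])
      fix x
      have "((\<lambda>x. exp (c * x) * f1 x) has_real_derivative exp (c * x) * (f2 x + c * f1 x)) (at x)"
        by (auto intro!: derivative_eq_intros f_deriv simp: algebra_simps)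
      then show "\<exists>y. ((\<lambda>x. exp (c * x) * f1 x) has_real_derivative y) (at x) \<and> y \<le> 0"
        using np[of x] by (intro exI conjI) (assumption, simp add: mult_nonneg_nonpos)
    qed
    moreover have "exp (c * r) * f1 r > 0" "exp (c * l) * f1 l < 0"
      using l r by (simp_all add: mult_pos_neg)
    ultimately show False by linarith
  qed
  ultimately have pos: "a $ 2 > 0" by simp
  define c where "c = a $ 1 / a $ 2"
  have eq: "f2 x + c * f1 x = (a \<bullet> hat_gamma f x) / a $ 2" for x
    using pos by (simp add: c_def inner_hat_gamma_2 f1_def f2_def field_simps)
  have "coercive_fold f c"
  proof (unfold_locales)
    show "0 \<le> f2 x + c * f1 x" for x using a(2)[of x] pos by (simp add: eq)
    show "\<exists>x. s < x \<and> x < t \<and> f2 x + c * f1 x \<noteq> 0" if "s < t" for s t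
      using k_goodD[OF good that a(1)] pos by (simp add: eq)
    show "f1 x \<noteq> 0 \<or> f2 x \<noteq> 0" for x
    proof -
      have "(hat_gamma f x :: real ^ 2) \<noteq> 0" using good by (simp add: k_good_def)
      then show ?thesis by (auto simp: hat_gamma_2 f1_def f2_def vec_eq_iff forall_2 eval_nat_numeral)
    qed
  qed
  then show ?thesis ..
qed

end

context coercive_fold
begin

lemma global_fold_operators: "global_fold (op_H f) \<and> global_fold (op_C f)"
proof -
  interpret h: circle_fold "\<lambda>q. abs_l2 (Rep_c0 q)" c0_of_h1 weak_deriv 2 f c
    by (intro circle_fold.intro circle_operator.intro h1.circle_pair_axioms coercive_axioms coercive_fold_axioms)
  interpret c: circle_fold "\<lambda>q. q" c0_of_c1 deriv_c1 3 f c
    by (intro circle_fold.intro circle_operator.intro c1.circle_pair_axioms coercive_axioms coercive_fold_axioms)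
  have "op_H f = h.F" "op_C f = c.F"
    by (rule ext, simp add: h.F_def c.F_def op_H_eq op_C_eq f_cont)+
  then show ?thesis using h.global_fold_F c.global_fold_F by simp
qed

end

theorem theorem4p3:
  fixes f :: "real \<Rightarrow> real"
  assumes "smooth f"
    and "k_good TYPE(2) f" and "k_good TYPE(3) f"
    and "filterlim f at_top at_top" and "filterlim f at_top at_bot"
  shows "(0 \<in> interior (convex hull (range (hat_gamma f :: real \<Rightarrow> real ^ 2))) \<longrightarrow>
            (\<exists>u. is_cusp (op_H f) u) \<and> (\<exists>u. is_cusp (op_C f) u)) \<and>
         (0 \<notin> interior (convex hull (range (hat_gamma f :: real \<Rightarrow> real ^ 2))) \<longrightarrow>
            global_fold (op_H f) \<and> global_fold (op_C f))"
  proof -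
  interpret coercive f by (rule coercive.intro) (rule assms)+
  have "global_fold (op_H f) \<and> global_fold (op_C f)"
    if hull: "0 \<notin> interior (convex hull (range (hat_gamma f :: real \<Rightarrow> real ^ 2)))"
  proof -
    obtain c where "coercive_fold f c" using fold_condition[OF assms(2) hull] ..
    then show ?thesis by (rule coercive_fold.global_fold_operators)
  qed
  then show ?thesis using cusp_operators[OF assms(3)] by blast
qed

end
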